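(* For every integer $n\ge3$ and for $\bullet\in\{A,B\}$, the differential at the origin $D_0\beta^\bullet_n$ of the higher Bers map $\beta^\bullet_n:\mathcal T_B(\mathbb 1)\to B_{n-1}(\mathbb D)$ is a surjective operator onto $B_{n-1}(\mathbb D)$ (equivalently, the differential at the origin $D_0\tilde\beta_n^\bullet:L^\infty(\mathbb D^c)\to B_{n-1}(\mathbb D)$ of the lift $\tilde\beta^\bullet_n$ is surjective).
   Context: $\mathbb D$ is the unit disc, $\mathbb D^c$ the interior of its complement in the Riemann sphere $\hat{\mathbb C}$. $B_q(\mathbb D)$ is the complex Banach space of holomorphic $f$ on $\mathbb D$ with $\|f\|_{B_q(\mathbb D)}=\sup_{z\in\mathbb D}|f(z)|(1-|z|^2)^{q}<\infty$. Higher Schwarzians, for locally injective $f$ and integers $n\ge3$: with $S_f=(f''/f')'-\tfrac12(f''/f')^2$, $$\sigma^A_3[f]=S_f,\quad \sigma^A_{n+1}[f]=\sigma^A_n[f]'-(n-1)\frac{f''}{f'}\sigma^A_n[f],\qquad \sigma^B_n[f]=-2(f')^{\frac n2-1}\frac{d^{n-1}}{dz^{n-1}}\Big((f')^{1-\frac n2}\Big),$$ with the same branch of the square root used in both places when $n$ is odd. $\mathrm{Belt}(\mathbb D^c)$ is the open unit ball of $L^\infty(\mathbb D^c)$. For $\mu\in\mathrm{Belt}(\mathbb D^c)$, extended by $0$ to $\mathbb D$, $w^\mu$ is the quasiconformal homeomorphism of $\hat{\mathbb C}$ with $\bar\partial w=\mu\,\partial w$, normalized by $w^\mu(0)=0$,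 $(w^\mu)'(0)=1$, $(w^\mu)''(0)=0$. The universal Teichmüller space $\mathcal T_B(\mathbb 1)$ is $\mathrm{Belt}(\mathbb D^c)/\!\sim$, where $\mu\sim\nu$ iff $w^\mu|_{\partial\mathbb D}=w^\nu|_{\partial\mathbb D}$, with the induced complex structure and quotient map $\pi_T$. The higher Bers maps are $\beta^\bullet_n([\mu])=\sigma^\bullet_n[w^\mu|_{\mathbb D}]$, with lift $\tilde\beta^\bullet_n=\beta^\bullet_n\circ\pi_T$. *)

theory Defs
  imports
    "HOL-Probability.Essential_Supremum"
    "HOL-Complex_Analysis.Complex_Analysis"
    "HOL-Library.Function_Algebras"
begin

section \<open>The spaces \<open>B\<^sub>q\<close> and \<open>L\<^sup>\<infinity>\<close>\<close>

text \<open>Functions on the open unit disc are represented by their extension by \<open>0\<close> to the whole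
  plane, so that equality in \<open>bers_space q\<close> is equality of functions, and vector
  space operations are pointwise.\<close>

abbreviation unit_disc :: "complex set" where
  "unit_disc \<equiv> ball 0 1"

definition bers_space :: "nat \<Rightarrow> (complex \<Rightarrow> complex) set" where
  "bers_space q = {f. f holomorphic_on unit_disc \<and> (\<forall>z. z \<notin> unit_disc \<longrightarrow> f z = 0) \<and>
     bdd_above ((\<lambda>z. cmod (f z) * (1 - (cmod z)\<^sup>2) ^ q) ` unit_disc)}"

definition bers_norm :: "nat \<Rightarrow> (complex \<Rightarrow> complex) \<Rightarrow> real" where
  "bers_norm q f = (SUP z\<in>unit_disc. cmod (f z) * (1 - (cmod z)\<^sup>2) ^ q)"

text \<open>\<open>L\<^sup>\<infinity>\<close> of the exterior of the closed disc (the point at infinity is a null set): its elements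
  are represented by Borel functions vanishing on the closed disc. Functions that agree
  almost everywhere are not identified; they are at distance \<open>0\<close> for the essential supremum
  seminorm, and so have the same image under every bounded linear operator.\<close>

definition linf_norm :: "(complex \<Rightarrow> complex) \<Rightarrow> real" where
  "linf_norm \<mu> = real_of_ereal (esssup lborel (\<lambda>z. ereal (cmod (\<mu> z))))"

definition linf_ext :: "(complex \<Rightarrow> complex) set" where
  "linf_ext = {\<mu>. \<mu> \<in> borel_measurable lborel \<and> (\<forall>z\<in>cball 0 1. \<mu> z = 0) \<and>
     esssup lborel (\<lambda>z. ereal (cmod (\<mu> z))) < \<infinity>}"

definition Belt :: "(complex \<Rightarrow> complex) set" where
  "Belt = {\<mu> \<in> linf_ext. linf_norm \<mu> < 1}"


section \<open>Quasiconformal homeomorphisms of the Riemann sphere\<close>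

text \<open>The Riemann sphere is the one-point compactification of the plane: \<open>None\<close> is infinity.\<close>

definition riemann_sphere :: "complex option topology" where
  "riemann_sphere = Alexandroff_compactification euclidean"

definition sphere_inversion :: "complex option \<Rightarrow> complex option" where
  "sphere_inversion x =
     (case x of None \<Rightarrow> Some 0 | Some z \<Rightarrow> if z = 0 then None else Some (inverse z))"

definition finite_part :: "(complex option \<Rightarrow> complex option) \<Rightarrow> complex \<Rightarrow> complex" where
  "finite_part g z = the (g (Some z))"

text \<open>A \<open>C\<^sup>1\<close> test function with compact support in \<open>\<Omega>\<close> and its Wirtinger derivatives:
  \<open>p\<close> is \<open>\<partial>\<phi>\<close> and \<open>q\<close> is the d-bar derivative of \<open>\<phi>\<close>.\<close>

definition test_function ::
  "complex set \<Rightarrow> (complex \<Rightarrow> complex) \<Rightarrow> (complex \<Rightarrow> complex) \<Rightarrow> (complex \<Rightarrow> complex) \<Rightarrow> bool"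
where
  "test_function \<Omega> \<phi> p q \<longleftrightarrow>
     (\<exists>K. compact K \<and> K \<subseteq> \<Omega> \<and> (\<forall>z. z \<notin> K \<longrightarrow> \<phi> z = 0)) \<and>
     continuous_on UNIV p \<and> continuous_on UNIV q \<and>
     (\<forall>z. (\<phi> has_derivative (\<lambda>h. p z * h + q z * cnj h)) (at z))"

definition locally_L2 :: "complex set \<Rightarrow> (complex \<Rightarrow> complex) \<Rightarrow> bool" where
  "locally_L2 \<Omega> g \<longleftrightarrow> set_borel_measurable lborel \<Omega> g \<and>
     (\<forall>K. compact K \<longrightarrow> K \<subseteq> \<Omega> \<longrightarrow> set_integrable lborel K (\<lambda>z. (cmod (g z))\<^sup>2))"

text \<open>\<open>f\<close> is a continuous \<open>W\<^sup>1\<^sup>,\<^sup>2\<close>-loc solution of the Beltrami equation in \<open>\<Omega>\<close>;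
  \<open>g\<close> and \<open>h\<close> are its weak \<open>\<partial>\<close>- and d-bar derivatives.\<close>

definition beltrami_solution_on ::
  "complex set \<Rightarrow> (complex \<Rightarrow> complex) \<Rightarrow> (complex \<Rightarrow> complex) \<Rightarrow> bool"
where
  "beltrami_solution_on \<Omega> \<mu> f \<longleftrightarrow> open \<Omega> \<and> continuous_on \<Omega> f \<and>
     (\<exists>g h. locally_L2 \<Omega> g \<and> locally_L2 \<Omega> h \<and>
        (\<forall>\<phi> p q. test_function \<Omega> \<phi> p q \<longrightarrow>
           (LINT z:\<Omega>|lborel. f z * p z) = - (LINT z:\<Omega>|lborel. g z * \<phi> z) \<and>
           (LINT z:\<Omega>|lborel. f z * q z) = - (LINT z:\<Omega>|lborel. h z * \<phi> z)) \<and>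
        (AE z in lborel. z \<in> \<Omega> \<longrightarrow> h z = \<mu> z * g z))"

text \<open>A homeomorphism of the sphere satisfying the Beltrami equation in the charts \<open>z\<close> and
  \<open>1/z\<close> at source and target. The second coefficient is the pull-back of \<open>\<mu>\<close>, as a
  \<open>(-1,1)\<close>-form, under \<open>a(z) = 1/z\<close>, that is \<open>\<mu>(a z) * cnj (a' z) / a' z\<close>. A Sobolev
  homeomorphism with dilatation bounded by \<open>k < 1\<close> preserves orientation automatically.\<close>

definition qc_homeomorphism :: "(complex \<Rightarrow> complex) \<Rightarrow> (complex option \<Rightarrow> complex option) \<Rightarrow> bool"
where
  "qc_homeomorphism \<mu> w \<longleftrightarrow>
     linf_norm \<mu> < 1 \<and> homeomorphic_map riemann_sphere riemann_sphere w \<and>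
     (\<forall>(a, \<nu>) \<in> {(id, \<mu>), (sphere_inversion, \<lambda>z. \<mu> (inverse z) * (z\<^sup>2 / (cnj z)\<^sup>2))}.
      \<forall>b \<in> {id, sphere_inversion}.
        beltrami_solution_on {z. (b \<circ> w \<circ> a) (Some z) \<noteq> None} \<nu> (finite_part (b \<circ> w \<circ> a)))"

definition normalized_qc_solution ::
  "(complex \<Rightarrow> complex) \<Rightarrow> (complex option \<Rightarrow> complex option) \<Rightarrow> bool"
where
  "normalized_qc_solution \<mu> w \<longleftrightarrow> qc_homeomorphism \<mu> w \<and>
     w (Some 0) = Some 0 \<and> deriv (finite_part w) 0 = 1 \<and> (deriv ^^ 2) (finite_part w) 0 = 0"


section \<open>Higher Schwarzians\<close>

definition schwarzian :: "(complex \<Rightarrow> complex) \<Rightarrow> complex \<Rightarrow> complex" where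
  "schwarzian f z = deriv (\<lambda>u. deriv (deriv f) u / deriv f u) z
     - 1 / 2 * (deriv (deriv f) z / deriv f z)\<^sup>2"

text \<open>Both families are meaningful for \<open>n \<ge> 3\<close> only.\<close>

primrec sigma_A :: "nat \<Rightarrow> (complex \<Rightarrow> complex) \<Rightarrow> complex \<Rightarrow> complex" where
  "sigma_A 0 f = schwarzian f"
| "sigma_A (Suc n) f =
     (if n < 3 then schwarzian f
      else (\<lambda>z. deriv (sigma_A n f) z
              - (of_nat n - 1) * (deriv (deriv f) z / deriv f z) * sigma_A n f z))"

text \<open>With a holomorphic square root \<open>s\<close> of \<open>f'\<close> on the disc, \<open>(f')\<close> to the power \<open>n/2 - 1\<close> is
  \<open>s ^ (n - 2)\<close>; the same \<open>s\<close> is used in both places, so the value does not depend on the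
  choice of \<open>s\<close>.\<close>

definition sqrt_deriv :: "(complex \<Rightarrow> complex) \<Rightarrow> complex \<Rightarrow> complex" where
  "sqrt_deriv f = (SOME s. s holomorphic_on unit_disc \<and> (\<forall>z\<in>unit_disc. (s z)\<^sup>2 = deriv f z))"

definition sigma_B :: "nat \<Rightarrow> (complex \<Rightarrow> complex) \<Rightarrow> complex \<Rightarrow> complex" where
  "sigma_B n f z = - 2 * sqrt_deriv f z ^ (n - 2)
     * (deriv ^^ (n - 1)) (\<lambda>u. inverse (sqrt_deriv f u ^ (n - 2))) z"

datatype schwarzian_kind = KindA | KindB

definition higher_schwarzian ::
  "schwarzian_kind \<Rightarrow> nat \<Rightarrow> (complex \<Rightarrow> complex) \<Rightarrow> complex \<Rightarrow> complex"
where
  "higher_schwarzian \<kappa> n f z =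
     (if z \<in> unit_disc then (case \<kappa> of KindA \<Rightarrow> sigma_A n f z | KindB \<Rightarrow> sigma_B n f z) else 0)"


section \<open>The universal Teichmueller space and the higher Bers maps\<close>

text \<open>Throughout, \<open>w \<mu>\<close> is the normalized solution for the Beltrami coefficient \<open>\<mu>\<close>.\<close>

type_synonym solution_family = "(complex \<Rightarrow> complex) \<Rightarrow> complex option \<Rightarrow> complex option"

definition teich_rel :: "solution_family \<Rightarrow> (complex \<Rightarrow> complex) rel" where
  "teich_rel w = {(\<mu>, \<nu>). \<mu> \<in> Belt \<and> \<nu> \<in> Belt \<and> (\<forall>z\<in>sphere 0 1. w \<mu> (Some z) = w \<nu> (Some z))}"

definition teich_space :: "solution_family \<Rightarrow> (complex \<Rightarrow> complex) set set" where
  "teich_space w = Belt // teich_rel w"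

definition teich_proj :: "solution_family \<Rightarrow> (complex \<Rightarrow> complex) \<Rightarrow> (complex \<Rightarrow> complex) set" where
  "teich_proj w \<mu> = teich_rel w `` {\<mu>}"

definition bers_map ::
  "solution_family \<Rightarrow> schwarzian_kind \<Rightarrow> nat \<Rightarrow> (complex \<Rightarrow> complex) set \<Rightarrow> complex \<Rightarrow> complex"
where
  "bers_map w \<kappa> n X = the_elem ((\<lambda>\<mu>. higher_schwarzian \<kappa> n (finite_part (w \<mu>))) ` X)"

definition lifted_bers_map ::
  "solution_family \<Rightarrow> schwarzian_kind \<Rightarrow> nat \<Rightarrow> (complex \<Rightarrow> complex) \<Rightarrow> complex \<Rightarrow> complex"
where
  "lifted_bers_map w \<kappa> n = bers_map w \<kappa> n \<circ> teich_proj w"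


section \<open>Differentials at the origin\<close>

text \<open>\<open>L\<close> is the complex Frechet differential at \<open>0\<close> of the map \<open>F\<close>, defined on \<open>Belt\<close>, with values
  in the complex normed space with carrier \<open>Y\<close>, norm \<open>N\<close> and scalar multiplication \<open>smul\<close>.
  As only the germ of \<open>F\<close> at the origin matters, \<open>F\<close> need only be \<open>Y\<close>-valued near \<open>0\<close>.\<close>

definition has_differential_at_0 ::
  "(complex \<Rightarrow> 'b \<Rightarrow> 'b) \<Rightarrow> 'b set \<Rightarrow> ('b \<Rightarrow> real) \<Rightarrow>
   ((complex \<Rightarrow> complex) \<Rightarrow> 'b::ab_group_add) \<Rightarrow> ((complex \<Rightarrow> complex) \<Rightarrow> 'b) \<Rightarrow> bool"
where
  "has_differential_at_0 smul Y N F L \<longleftrightarrow>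
     (\<forall>\<mu>\<in>linf_ext. L \<mu> \<in> Y) \<and>
     (\<forall>\<mu>\<in>linf_ext. \<forall>\<nu>\<in>linf_ext. L (\<lambda>z. \<mu> z + \<nu> z) = L \<mu> + L \<nu>) \<and>
     (\<forall>c. \<forall>\<mu>\<in>linf_ext. L (\<lambda>z. c * \<mu> z) = smul c (L \<mu>)) \<and>
     (\<exists>C. \<forall>\<mu>\<in>linf_ext. N (L \<mu>) \<le> C * linf_norm \<mu>) \<and>
     (\<forall>\<epsilon>>0. \<exists>\<delta>>0. \<forall>\<mu>\<in>Belt. linf_norm \<mu> < \<delta> \<longrightarrow>
        F \<mu> \<in> Y \<and> N (F \<mu> - F (\<lambda>z. 0) - L \<mu>) \<le> \<epsilon> * linf_norm \<mu>)"

text \<open>The complex structure on Teichmueller space is the one induced by \<open>teich_proj\<close>: a map \<open>G\<close> on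
  Teichmueller space is differentiable iff \<open>G \<circ> teich_proj\<close> is. Accordingly, the kernel
  of the differential of \<open>teich_proj\<close> at \<open>0\<close> consists of the directions in which all
  scalar functions differentiable at the origin of Teichmueller space have derivative \<open>0\<close>,
  and the tangent space at the origin is the quotient of \<open>linf_ext\<close> by this kernel.\<close>

definition teich_proj_kernel :: "solution_family \<Rightarrow> (complex \<Rightarrow> complex) set" where
  "teich_proj_kernel w = {\<mu> \<in> linf_ext.
     \<forall>(G :: (complex \<Rightarrow> complex) set \<Rightarrow> complex) l.
       has_differential_at_0 (*) UNIV cmod (G \<circ> teich_proj w) l \<longrightarrow> l \<mu> = 0}"

definition teich_tangent_rel :: "solution_family \<Rightarrow> (complex \<Rightarrow> complex) rel" where
  "teich_tangent_rel w =
     {(\<mu>, \<nu>). \<mu> \<in> linf_ext \<and> \<nu> \<in> linf_ext \<and> (\<lambda>z. \<nu> z - \<mu> z) \<in> teich_proj_kernel w}"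

definition teich_tangent_space :: "solution_family \<Rightarrow> (complex \<Rightarrow> complex) set set" where
  "teich_tangent_space w = linf_ext // teich_tangent_rel w"

definition teich_proj_differential ::
  "solution_family \<Rightarrow> (complex \<Rightarrow> complex) \<Rightarrow> (complex \<Rightarrow> complex) set"
where
  "teich_proj_differential w \<mu> = teich_tangent_rel w `` {\<mu>}"

text \<open>\<open>D\<close> is the differential at the origin of a map \<open>F\<close> on Teichmueller space (chain rule).\<close>

definition has_teich_differential ::
  "solution_family \<Rightarrow> (complex \<Rightarrow> 'b \<Rightarrow> 'b) \<Rightarrow> 'b set \<Rightarrow> ('b \<Rightarrow> real) \<Rightarrow>
   ((complex \<Rightarrow> complex) set \<Rightarrow> 'b::ab_group_add) \<Rightarrow> ((complex \<Rightarrow> complex) set \<Rightarrow> 'b) \<Rightarrow> bool"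
where
  "has_teich_differential w smul Y N F D \<longleftrightarrow>
     has_differential_at_0 smul Y N (F \<circ> teich_proj w) (D \<circ> teich_proj_differential w)"

definition scale_fun :: "complex \<Rightarrow> (complex \<Rightarrow> complex) \<Rightarrow> complex \<Rightarrow> complex" where
  "scale_fun c f = (\<lambda>z. c * f z)"

end

theory Submission
  imports Defs "HOL-Real_Asymp.Real_Asymp"
begin

text \<open>For small \<open>k = \<parallel>\<mu>\<parallel>\<close>, a mollified energy identity for \<open>1 / (w - w(a))\<close> shows that the Schwarzian
of \<open>w\<close> at \<open>a\<close> in the disc is \<open>c \<integral> \<mu>(\<zeta>) / (\<zeta> - a)\<^sup>4\<close> up to an error \<open>O(k\<^sup>2)\<close>, weighted by the squared distance to the circle.
A Riccati argument, started at the normalization \<open>w''(0) = 0\<close>, then bounds \<open>w'' / w'\<close> by \<open>O(k)\<close>, so that in the recursions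
for the higher Schwarzians every nonlinear term is \<open>O(k\<^sup>2)\<close>. The differential at the origin is therefore a nonzero
multiple of the \<open>(n - 3)\<close>-rd derivative of that integral operator. The operator is onto the functions of order two by the Ahlfors--Weill
reproducing formula, and the derivative is onto since a function of order \<open>q + 1 \<ge> 2\<close> has a primitive of order \<open>q\<close>.\<close>

section \<open>Wirtinger derivatives\<close>

text \<open>The solution \<open>w\<close> is only a continuous weak solution and may be infinite
  somewhere, even inside the disc, so nothing about \<open>w\<close> can be bounded at the outset.
  The function U = w'(a) / (w - w(a)) - 1/(z - a) avoids this: it is finite at the pole of
  \<open>w\<close>, has a limit at infinity, is regular at a, and U'(a) = -S/6. It solves dbar U =
  \<mu> (dU - E), where E is 1/(z - a)^2 cut off near a, where \<mu> = 0. Integration by parts gives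
  equal L^2 norms of dU and dbar U, so dU is O(k) times the norm of E, and the error is the one term
  \<mu> dU E; the weight is the squared norm of E. The estimate thus holds wherever \<open>w\<close>
  is finite. The Riccati argument is run up to a hypothetical first pole, where it bounds
  \<open>w\<close> by 2 and so excludes the pole. All integration by parts reduces to translation
  invariance of Lebesgue measure. The constants \<open>kernel_mass\<close> and
  \<open>slope_mass\<close> both equal \<pi> but stay symbolic, since only their signs enter. A
  Teichmueller class of a small coefficient may contain large ones; that \<open>bers_map\<close> has
  a single value there rests on the maximum principle.\<close>

definition wirtinger :: "(complex \<Rightarrow> complex) \<Rightarrow> complex \<Rightarrow> complex \<Rightarrow> complex \<Rightarrow> bool" where
 "wirtinger f p q z \<longleftrightarrow> (f has_derivative (\<lambda>h. p * h + q * cnj h)) (at z)"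

text \<open>Evaluating the real-linear map at 1 and at \<open>\<i>\<close> recovers p + q and p -
  q.\<close>

lemma wirtinger_unique:
 assumes "wirtinger f p q z" "wirtinger f p' q' z"
 shows "p = p'" "q = q'"
proof -
 have eq: "(\<lambda>h. p * h + q * cnj h) = (\<lambda>h. p' * h + q' * cnj h)"
  using assms unfolding wirtinger_def by (rule has_derivative_unique)
 from fun_cong[OF eq, of 1] have 1: "p + q = p' + q'" by simp
 have "(p - q) * \<i> = (p' - q') * \<i>"
  using fun_cong[OF eq, of \<i>] by (simp add: algebra_simps)
 hence 2: "p - q = p' - q'" by simp
 have "2 * p = 2 * p'" "2 * q = 2 * q'"
  using arg_cong2[OF 1 2, of "(+)"] arg_cong2[OF 1 2, of "(-)"] by simp_all
 thus "p = p'" "q = q'" by simp_all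
qed

lemma wirtinger_continuous: "wirtinger f p q z \<Longrightarrow> isCont f z"
 unfolding wirtinger_def by (rule has_derivative_continuous)

lemma wirtinger_field_derivative:
 "(f has_field_derivative d) (at z) \<Longrightarrow> wirtinger f d 0 z"
 by (simp add: wirtinger_def has_field_derivative_def)

lemma wirtinger_imp_field_derivative:
 "wirtinger f d 0 z \<Longrightarrow> (f has_field_derivative d) (at z)"
 by (simp add: wirtinger_def has_field_derivative_def)

lemma wirtinger_const: "wirtinger (\<lambda>z. c) 0 0 z"
 by (simp add: wirtinger_def)

lemma wirtinger_cnj_ident: "wirtinger cnj 0 1 z"
 by (simp add: wirtinger_def bounded_linear_cnj bounded_linear_imp_has_derivative)

lemma wirtinger_diff:
 "wirtinger f p q z \<Longrightarrow> wirtinger g p' q' z \<Longrightarrow> wirtinger (\<lambda>z. f z - g z) (p - p') (q - q') z"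
 unfolding wirtinger_def
 by (drule (1) has_derivative_diff) (simp add: algebra_simps)

lemma wirtinger_mult:
 "wirtinger f p q z \<Longrightarrow> wirtinger g p' q' z \<Longrightarrow>
  wirtinger (\<lambda>z. f z * g z) (p * g z + f z * p') (q * g z + f z * q') z"
 unfolding wirtinger_def
 by (drule (1) has_derivative_mult) (simp add: algebra_simps)

lemma wirtinger_cmult: "wirtinger f p q z \<Longrightarrow> wirtinger (\<lambda>z. c * f z) (c * p) (c * q) z"
 using wirtinger_mult[OF wirtinger_const[of c z]] by fastforce

lemma wirtinger_cnj: "wirtinger f p q z \<Longrightarrow> wirtinger (\<lambda>z. cnj (f z)) (cnj q) (cnj p) z"
 unfolding wirtinger_def
 by (drule has_derivative_cnj) (simp add: algebra_simps)

lemma wirtinger_comp_field: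
 assumes "wirtinger f p q z" "(F has_field_derivative d) (at (f z))"
 shows "wirtinger (\<lambda>z. F (f z)) (d * p) (d * q) z"
proof -
 have "((\<lambda>z. F (f z)) has_derivative (\<lambda>h. d * (p * h + q * cnj h))) (at z)"
  using has_derivative_compose[of f _ z UNIV F "(*) d"] assms
  by (simp add: wirtinger_def has_field_derivative_def)
 thus ?thesis by (simp add: wirtinger_def algebra_simps)
qed

lemma wirtinger_comp_affine:
 assumes "wirtinger f p q (a + b * z)"
 shows "wirtinger (\<lambda>z. f (a + b * z)) (p * b) (q * cnj b) z"
proof -
 have "((\<lambda>z. f (a + b * z)) has_derivative (\<lambda>h. p * (b * h) + q * cnj (b * h))) (at z)"
  by (rule has_derivative_compose[of "\<lambda>z. a + b * z" _ z UNIV f])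
   (use assms in \<open>auto simp: wirtinger_def intro!: derivative_eq_intros\<close>)
 thus ?thesis by (simp add: wirtinger_def algebra_simps)
qed

lemma wirtinger_reflect:
 assumes "wirtinger f p q (a - z)"
 shows "wirtinger (\<lambda>z. f (a - z)) (- p) (- q) z"
 using wirtinger_comp_affine[of f p q a "-1" z] assms by simp

lemma wirtinger_transform:
 assumes "wirtinger f p q z" "open S" "z \<in> S" "\<And>x. x \<in> S \<Longrightarrow> f x = g x"
 shows "wirtinger g p q z"
 using assms unfolding wirtinger_def
 by (rule has_derivative_transform_within_open)

text \<open>Bumps and cutoffs below are functions of the squared modulus, which is smooth at the
  centre too and has the Wirtinger derivatives \<open>cnj (z - a)\<close> and
  \<open>z - a\<close>.\<close>

lemma wirtinger_radial:
 assumes "(\<psi> has_real_derivative d) (at ((cmod (z - a))^2))"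
 shows "wirtinger (\<lambda>z. of_real (\<psi> ((cmod (z - a))^2))) (of_real d * cnj (z - a)) (of_real d * (z - a)) z"
proof -
 have eq: "(cmod (z - a))\<^sup>2 = (z - a) \<bullet> (z - a)" for z
  by (simp add: dot_square_norm)
 have 1: "((\<lambda>z. (cmod (z - a))\<^sup>2) has_derivative (\<lambda>h. 2 * ((z - a) \<bullet> h))) (at z)"
  unfolding eq by (auto intro!: derivative_eq_intros simp: inner_commute algebra_simps)
 have "((\<lambda>z. \<psi> ((cmod (z - a))^2)) has_derivative (\<lambda>h. d * (2 * ((z - a) \<bullet> h)))) (at z)"
  using has_derivative_compose[OF 1, of \<psi> "(*) d"] assms
  by (simp add: has_field_derivative_def)
 hence "((\<lambda>z. complex_of_real (\<psi> ((cmod (z - a))^2))) has_derivative (\<lambda>h. of_real (d * (2 * ((z - a) \<bullet> h))))) (at z)"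
  by (rule has_derivative_of_real)
 moreover have "complex_of_real (d * (2 * ((z - a) \<bullet> h))) = of_real d * cnj (z - a) * h + of_real d * (z - a) * cnj h" for h
  by (simp add: complex_eq_iff inner_complex_def algebra_simps)
 ultimately show ?thesis by (simp add: wirtinger_def)
qed

lemma wirtinger_zero_off:
 assumes "wirtinger f p q z" "closed K" "z \<notin> K" "\<And>z. z \<notin> K \<Longrightarrow> f z = 0"
 shows "p = 0" "q = 0"
proof -
 have "wirtinger f 0 0 z"
  by (rule wirtinger_transform[OF wirtinger_const[of 0], where S="-K"]) (use assms in auto)
 from wirtinger_unique[OF assms(1) this] show "p = 0" "q = 0" by auto
qed

text \<open>Mean value inequality on the convex plane; each of the two parts of the differential has
  norm at most B, whence the factor 2.\<close>

lemma wirtinger_lipschitz: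
 assumes "\<And>z. wirtinger f (p z) (q z) z" "\<And>z. cmod (p z) \<le> B" "\<And>z. cmod (q z) \<le> B"
 shows "cmod (f x - f y) \<le> 2 * B * cmod (x - y)"
proof (rule differentiable_bound[of UNIV f "\<lambda>z h. p z * h + q z * cnj h"])
 fix z
 show "(f has_derivative (\<lambda>h. p z * h + q z * cnj h)) (at z within UNIV)"
  using assms(1) by (simp add: wirtinger_def)
 show "onorm (\<lambda>h. p z * h + q z * cnj h) \<le> 2 * B"
 proof (rule onorm_le)
  fix h
  have "cmod (p z * h + q z * cnj h) \<le> cmod (p z) * cmod h + cmod (q z) * cmod h"
   by (metis complex_mod_cnj norm_mult norm_triangle_ineq)
  also have "\<dots> \<le> B * cmod h + B * cmod h"
   by (intro add_mono mult_right_mono assms) auto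
  finally show "cmod (p z * h + q z * cnj h) \<le> 2 * B * cmod h" by simp
 qed
qed auto

section \<open>Integration over the plane\<close>

lemma integrable_bounded_support:
 fixes f :: "'a::euclidean_space \<Rightarrow> 'b::{banach, second_countable_topology}"
 assumes "f \<in> borel_measurable lborel" "\<And>z. norm (f z) \<le> B" "\<And>z. z \<notin> cball a R \<Longrightarrow> f z = 0"
 shows "integrable lborel f"
proof (rule Bochner_Integration.integrable_bound[of _ "\<lambda>z. indicator (cball a R) z * B"])
 show "integrable lborel (\<lambda>z. indicator (cball a R) z * B :: real)"
  by (intro integrable_mult_left integrable_real_indicator) (use emeasure_lborel_cball_finite in auto)
 show "AE x in lborel. norm (f x) \<le> norm (indicator (cball a R) x * B :: real)"
  using assms(2,3) by (intro always_eventually allI) (metis abs_ge_self assms(3) indicator_simps mult_1 norm_ge_zero norm_zero order.trans real_norm_def)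
qed fact

lemma integral_translate:
 fixes f :: "complex \<Rightarrow> complex"
 shows "integral\<^sup>L lborel (\<lambda>z. f (c + z)) = integral\<^sup>L lborel f"
proof (cases "f \<in> borel_measurable borel")
 case True
 have "integral\<^sup>L (distr lborel borel ((+) c)) f = integral\<^sup>L lborel (\<lambda>z. f (c + z))"
  by (rule integral_distr) (use True in auto)
 thus ?thesis by (simp add: lborel_distr_plus)
next
 \<comment> \<open>If f is not measurable, neither is its translate, and both integrals have the
   default value 0.\<close>
 case False
 have "(\<lambda>z. f (c + z)) \<notin> borel_measurable borel"
 proof
  assume "(\<lambda>z. f (c + z)) \<in> borel_measurable borel"
  then have "(\<lambda>z. f (c + (z - c))) \<in> borel_measurable borel" by measurable
  with False show False by simp
 qed
 with False have "\<not> integrable lborel (\<lambda>z. f (c + z))" "\<not> integrable lborel f"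
  by (auto dest: borel_measurable_integrable)
 thus ?thesis by (simp add: not_integrable_integral_eq)
qed

lemma integrable_translate:
 fixes f :: "complex \<Rightarrow> 'b::{banach, second_countable_topology}"
 assumes "integrable lborel f"
 shows "integrable lborel (\<lambda>z. f (c + z))"
proof -
 have "integrable (distr lborel borel ((+) c)) f" using assms by (simp add: lborel_distr_plus)
 thus ?thesis by (subst (asm) integrable_distr_eq) (use assms in \<open>auto simp: borel_measurable_integrable\<close>)
qed

text \<open>Stokes without boundary: difference quotients of X in a fixed direction integrate to 0
  by translation invariance, and dominated convergence passes to the directional derivative. The
  derivatives are only asked to be bounded and measurable, because continuity at the unit circle
  will not be available for functions extended by 0 across it.\<close>

lemma integral_wirtinger_eq_0:
 assumes der: "\<And>z. wirtinger X (p z) (q z) z"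
  and meas: "p \<in> borel_measurable borel" "q \<in> borel_measurable borel"
  and bnd: "\<And>z. cmod (p z) \<le> B" "\<And>z. cmod (q z) \<le> B"
  and supp: "\<And>z. z \<notin> cball 0 R \<Longrightarrow> X z = 0"
 shows "integral\<^sup>L lborel p = 0" "integral\<^sup>L lborel q = 0"
proof -
 have B: "B \<ge> 0" using bnd(1)[of 0] norm_ge_zero[of "p 0"] by linarith
 have contX: "continuous_on UNIV X"
  using der by (intro continuous_at_imp_continuous_on ballI wirtinger_continuous)
 then have measX[measurable]: "X \<in> borel_measurable borel"
  by (rule borel_measurable_continuous_onI)
 note lip = wirtinger_lipschitz[OF der bnd]
 obtain M where M: "\<And>z. cmod (X z) \<le> M"
 proof -
  have "compact (X ` cball 0 R)"
   by (intro compact_continuous_image continuous_on_subset[OF contX]) auto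
  then obtain M where "\<And>z. z \<in> cball 0 R \<Longrightarrow> cmod (X z) \<le> M" "M > 0"
   using compact_imp_bounded bounded_pos by (metis image_eqI)
  then show ?thesis using that[of M] supp by (metis norm_zero less_imp_le)
 qed
 have intX: "integrable lborel X"
  by (rule integrable_bounded_support[of _ M 0 R]) (use M supp in auto)
 have zero: "p z = 0" "q z = 0" if "z \<notin> cball 0 R" for z
  using wirtinger_zero_off[OF der, of "cball 0 R"] supp that by auto
 have intp: "integrable lborel p" "integrable lborel q"
  by (rule integrable_bounded_support[of _ B 0 R]; use meas bnd zero in auto)+
 have main: "integral\<^sup>L lborel (\<lambda>z. p z * v + q z * cnj v) = 0" if v: "cmod v = 1" for v
 proof -
  define t where "t = (\<lambda>j::nat. 1 / (real j + 1))"
  have t: "t j > 0" "t j \<le> 1" for j by (auto simp: t_def)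
  have tlim: "t \<longlonglongrightarrow> 0" unfolding t_def by real_asymp
  define s where "s = (\<lambda>j z. (X (of_real (t j) * v + z) - X z) / of_real (t j))"
  have int0: "integral\<^sup>L lborel (s j) = 0" for j
   unfolding s_def using intX
   by (simp add: integral_translate integrable_translate Bochner_Integration.integral_diff)
  have lim: "(\<lambda>j. s j z) \<longlonglongrightarrow> p z * v + q z * cnj v" for z
  proof -
   have "((\<lambda>h. cmod (X (z + h) - X z - (p z * h + q z * cnj h)) / cmod h) \<longlongrightarrow> 0) (at 0)"
    using der[of z] by (simp add: wirtinger_def has_derivative_at)
   moreover have "filterlim (\<lambda>j. of_real (t j) * v) (at 0) sequentially"
   proof (rule filterlim_atI)
    have "(\<lambda>j. of_real (t j) * v) \<longlonglongrightarrow> of_real 0 * v" by (intro tendsto_intros tlim)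
    thus "(\<lambda>j. of_real (t j) * v) \<longlonglongrightarrow> 0" by simp
    have "of_real (t j) * v \<noteq> 0" for j using t(1)[of j] v by auto
    thus "\<forall>\<^sub>F j in sequentially. of_real (t j) * v \<noteq> 0" by simp
   qed
   ultimately have "(\<lambda>j. cmod (X (z + of_real (t j) * v) - X z - (p z * (of_real (t j) * v) + q z * cnj (of_real (t j) * v))) / cmod (of_real (t j) * v)) \<longlonglongrightarrow> 0"
    by (rule filterlim_compose)
   also have "(\<lambda>j. cmod (X (z + of_real (t j) * v) - X z - (p z * (of_real (t j) * v) + q z * cnj (of_real (t j) * v))) / cmod (of_real (t j) * v))
    = (\<lambda>j. cmod (s j z - (p z * v + q z * cnj v)))"
   proof
    fix j
    have "s j z - (p z * v + q z * cnj v) = (X (z + of_real (t j) * v) - X z - (p z * (of_real (t j) * v) + q z * cnj (of_real (t j) * v))) / of_real (t j)"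
     using t(1)[of j] by (simp add: s_def field_simps)
    thus "cmod (X (z + of_real (t j) * v) - X z - (p z * (of_real (t j) * v) + q z * cnj (of_real (t j) * v))) / cmod (of_real (t j) * v) = cmod (s j z - (p z * v + q z * cnj v))"
     using v t(1)[of j] by (simp add: norm_divide norm_mult)
   qed
   finally show ?thesis by (simp add: tendsto_norm_zero_iff LIM_zero_iff)
  qed
  have "(\<lambda>j. integral\<^sup>L lborel (s j)) \<longlonglongrightarrow> integral\<^sup>L lborel (\<lambda>z. p z * v + q z * cnj v)"
  \<comment> \<open>As \<open>t j \<le> 1\<close>, the quotients are supported in the ball enlarged
    by 1, and the Lipschitz constant 2B bounds them there.\<close>
  proof (rule integral_dominated_convergence[where w="\<lambda>z. indicator (cball 0 (R+1)) z * (2 * B)"])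
   show "integrable lborel (\<lambda>z. indicator (cball 0 (R+1)) z * (2 * B) :: real)"
    by (intro integrable_mult_left integrable_real_indicator) (use emeasure_lborel_cball_finite in auto)
   show "AE x in lborel. cmod (s j x) \<le> indicator (cball 0 (R + 1)) x * (2 * B)" for j
   proof (intro always_eventually allI)
    fix x
    show "cmod (s j x) \<le> indicator (cball 0 (R + 1)) x * (2 * B)"
    proof (cases "x \<in> cball 0 (R+1)")
     case True
     have "cmod (X (of_real (t j) * v + x) - X x) \<le> 2 * B * t j"
      using lip[of "of_real (t j) * v + x" x] t[of j] v by (simp add: norm_mult)
     thus ?thesis using True t[of j] by (simp add: s_def norm_divide divide_simps)
    next
     case False
     have "cmod x \<le> cmod (of_real (t j) * v + x) + cmod (of_real (t j) * v)"
      by (metis add.commute add_diff_cancel norm_triangle_sub norm_minus_commute)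
     then have "X (of_real (t j) * v + x) = 0" "X x = 0"
      using False t[of j] v by (auto intro!: supp simp: norm_mult)
     thus ?thesis using False by (simp add: s_def)
    qed
   qed
   show "s j \<in> borel_measurable lborel" for j unfolding s_def by measurable
   show "AE x in lborel. (\<lambda>j. s j x) \<longlonglongrightarrow> p x * v + q x * cnj v" using lim by auto
   show "(\<lambda>z. p z * v + q z * cnj v) \<in> borel_measurable lborel" using meas by measurable
  qed
  then show ?thesis using int0 by (simp add: LIMSEQ_const_iff)
 qed
 \<comment> \<open>The directions 1 and \<open>\<i>\<close> give the integrals of p + q and of
   \<open>\<i>\<close> (p - q).\<close>
 have 1: "integral\<^sup>L lborel p + integral\<^sup>L lborel q = 0"
  using main[of 1] intp by simp
 have 2: "integral\<^sup>L lborel p * \<i> - integral\<^sup>L lborel q * \<i> = 0"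
  using main[of \<i>] intp by simp
 from 2 have "integral\<^sup>L lborel p = integral\<^sup>L lborel q" by simp
 with 1 show "integral\<^sup>L lborel p = 0" "integral\<^sup>L lborel q = 0" by auto
qed

section \<open>Mollification\<close>

definition convolution :: "(complex \<Rightarrow> complex) \<Rightarrow> (complex \<Rightarrow> complex) \<Rightarrow> complex \<Rightarrow> complex" where
 "convolution f k z = (LINT t|lborel. f t * k (z - t))"

lemma integrable_mult_bounded:
 fixes f g :: "'a \<Rightarrow> complex"
 assumes "integrable M f" "g \<in> borel_measurable M" "\<And>x. cmod (g x) \<le> B"
 shows "integrable M (\<lambda>x. f x * g x)"
proof (rule Bochner_Integration.integrable_bound[of _ "\<lambda>x. B * cmod (f x)"])
 show "integrable M (\<lambda>x. B * cmod (f x))" using assms by simp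
 show "(\<lambda>x. f x * g x) \<in> borel_measurable M" using assms by measurable
 show "AE x in M. cmod (f x * g x) \<le> norm (B * cmod (f x))"
 proof (intro always_eventually allI)
  fix x
  have "cmod (f x) * cmod (g x) \<le> cmod (f x) * B" using assms(3) by (intro mult_left_mono) auto
  also have "\<dots> \<le> norm (B * cmod (f x))" by (simp add: mult.commute)
  finally show "cmod (f x * g x) \<le> norm (B * cmod (f x))" by (simp add: norm_mult)
 qed
qed

lemma convolution_integrand:
 assumes "integrable lborel f" "k \<in> borel_measurable borel" "\<And>z. cmod (k z) \<le> B"
 shows "integrable lborel (\<lambda>t. f t * k (z - t))"
 using assms by (intro integrable_mult_bounded[where B=B]) auto

text \<open>All regularity is put on the kernel: its first-order remainder \<open>r\<close> is at
  most 4B |y - z| uniformly in t, so an integrable f dominates the difference quotients under the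
  integral.\<close>

lemma wirtinger_convolution:
 assumes f: "integrable lborel f"
  and der: "\<And>z. wirtinger k (p z) (q z) z"
  and meas: "p \<in> borel_measurable borel" "q \<in> borel_measurable borel"
  and bnd: "\<And>z. cmod (k z) \<le> B" "\<And>z. cmod (p z) \<le> B" "\<And>z. cmod (q z) \<le> B"
 shows "wirtinger (convolution f k) (convolution f p z) (convolution f q z) z"
proof -
 have contk: "continuous_on UNIV k"
  using der by (intro continuous_at_imp_continuous_on ballI wirtinger_continuous)
 then have meask: "k \<in> borel_measurable borel" by (rule borel_measurable_continuous_onI)
 note [measurable] = meask meas borel_measurable_integrable[OF f]
 have B: "B \<ge> 0" using bnd(1)[of 0] norm_ge_zero[of "k 0"] by linarith
 note lip = wirtinger_lipschitz[OF der bnd(2,3)]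
 note ints = convolution_integrand[OF f meask bnd(1)] convolution_integrand[OF f meas(1) bnd(2)]
  convolution_integrand[OF f meas(2) bnd(3)]
 define r where "r y t = k (y - t) - k (z - t) - (p (z - t) * (y - z) + q (z - t) * cnj (y - z))" for y t
 have rbound: "cmod (r y t) \<le> 4 * B * cmod (y - z)" for y t
 proof -
  have "cmod (r y t) \<le> cmod (k (y - t) - k (z - t)) + (cmod (p (z - t)) * cmod (y - z) + cmod (q (z - t)) * cmod (y - z))"
   unfolding r_def by (metis (no_types, lifting) add_left_mono complex_mod_cnj norm_mult norm_triangle_ineq norm_triangle_ineq4 order_trans)
  also have "\<dots> \<le> 2 * B * cmod (y - z) + (B * cmod (y - z) + B * cmod (y - z))"
   using lip[of "y - t" "z - t"] by (intro add_mono mult_right_mono bnd) auto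
  finally show ?thesis by (simp add: algebra_simps)
 qed
 have eq: "convolution f k y - convolution f k z - (convolution f p z * (y - z) + convolution f q z * cnj (y - z))
   = (LINT t|lborel. f t * r y t)" for y
 proof -
  have "(\<lambda>t. f t * r y t) = (\<lambda>t. f t * k (y - t) - f t * k (z - t) - (f t * p (z - t) * (y - z) + f t * q (z - t) * cnj (y - z)))"
   by (auto simp: r_def algebra_simps)
  then show ?thesis
   using ints by (simp add: convolution_def)
 qed
 have "((\<lambda>y. cmod (convolution f k y - convolution f k z - (convolution f p z * (y - z) + convolution f q z * cnj (y - z))) / cmod (y - z)) \<longlongrightarrow> 0) (at z)"
  unfolding tendsto_at_iff_sequentially
 proof (intro allI impI)
  fix X :: "nat \<Rightarrow> complex" assume X: "\<forall>i. X i \<in> UNIV - {z}" "X \<longlonglongrightarrow> z"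
  have lim: "(\<lambda>i. cmod (f t * r (X i) t) / cmod (X i - z)) \<longlonglongrightarrow> 0" for t
  proof -
   have "((\<lambda>h. cmod (k (z - t + h) - k (z - t) - (p (z - t) * h + q (z - t) * cnj h)) / cmod h) \<longlongrightarrow> 0) (at 0)"
    using der[of "z - t"] by (simp add: wirtinger_def has_derivative_at)
   moreover have "filterlim (\<lambda>i. X i - z) (at 0) sequentially"
    by (rule filterlim_atI) (use X in \<open>auto simp: LIM_zero_iff\<close>)
   ultimately have "(\<lambda>i. cmod (k (z - t + (X i - z)) - k (z - t) - (p (z - t) * (X i - z) + q (z - t) * cnj (X i - z))) / cmod (X i - z)) \<longlonglongrightarrow> 0"
    by (rule filterlim_compose)
   then have "(\<lambda>i. cmod (f t) * (cmod (r (X i) t) / cmod (X i - z))) \<longlonglongrightarrow> cmod (f t) * 0"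
    by (intro tendsto_intros) (simp add: r_def algebra_simps)
   then show ?thesis by (simp add: norm_mult)
  qed
  have "(\<lambda>i. LINT t|lborel. cmod (f t * r (X i) t) / cmod (X i - z)) \<longlonglongrightarrow> integral\<^sup>L lborel (\<lambda>t::complex. 0 :: real)"
  proof (rule integral_dominated_convergence[where w="\<lambda>t. 4 * B * cmod (f t)"])
   show "integrable lborel (\<lambda>t. 4 * B * cmod (f t))" using f by simp
   show "(\<lambda>t. cmod (f t * r (X i) t) / cmod (X i - z)) \<in> borel_measurable lborel" for i
    unfolding r_def by measurable
   show "AE t in lborel. (\<lambda>i. cmod (f t * r (X i) t) / cmod (X i - z)) \<longlonglongrightarrow> 0" using lim by auto
   show "AE t in lborel. norm (cmod (f t * r (X i) t) / cmod (X i - z)) \<le> 4 * B * cmod (f t)" for i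
   proof (intro always_eventually allI)
    fix t
    have "X i \<noteq> z" using X by auto
    then have "cmod (r (X i) t) / cmod (X i - z) \<le> 4 * B"
     using rbound[of "X i" t] by (simp add: divide_simps)
    then have "cmod (f t) * (cmod (r (X i) t) / cmod (X i - z)) \<le> cmod (f t) * (4 * B)"
     by (intro mult_left_mono) auto
    then show "norm (cmod (f t * r (X i) t) / cmod (X i - z)) \<le> 4 * B * cmod (f t)"
     by (simp add: norm_mult algebra_simps)
   qed
  qed auto
  then have lim0: "(\<lambda>i. LINT t|lborel. cmod (f t * r (X i) t) / cmod (X i - z)) \<longlonglongrightarrow> 0" by simp
  show "((\<lambda>y. cmod (convolution f k y - convolution f k z - (convolution f p z * (y - z) + convolution f q z * cnj (y - z))) / cmod (y - z)) \<circ> X) \<longlonglongrightarrow> 0"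
  proof (rule Lim_null_comparison[OF always_eventually lim0], rule allI)
   fix i
   have "cmod (LINT t|lborel. f t * r (X i) t) \<le> (LINT t|lborel. cmod (f t * r (X i) t))"
    by (rule integral_norm_bound)
   then show "norm (((\<lambda>y. cmod (convolution f k y - convolution f k z - (convolution f p z * (y - z) + convolution f q z * cnj (y - z))) / cmod (y - z)) \<circ> X) i)
    \<le> (LINT t|lborel. cmod (f t * r (X i) t) / cmod (X i - z))"
    unfolding o_def eq by (simp add: divide_right_mono)
  qed
 qed
 moreover have "bounded_linear (\<lambda>h. convolution f p z * h + convolution f q z * cnj h)"
  by (intro bounded_linear_add bounded_linear_mult_right bounded_linear_compose[OF bounded_linear_mult_right bounded_linear_cnj])
 ultimately show ?thesis
  unfolding wirtinger_def has_derivative_iff_norm by simp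
qed

section \<open>Explicit bumps and mollifiers of finite smoothness\<close>

lemma has_real_derivative_max_power:
 assumes "n \<ge> 2"
 shows "((\<lambda>s::real. max 0 s ^ n) has_real_derivative (of_nat n * max 0 s ^ (n - 1))) (at s)"
proof -
 consider "s < 0" | "s > 0" | "s = 0" by linarith
 then show ?thesis
 proof cases
  case 1
  have "((\<lambda>s::real. 0) has_real_derivative 0) (at s)" by simp
  then have "((\<lambda>s::real. max 0 s ^ n) has_real_derivative 0) (at s)"
   by (rule DERIV_cong_ev[OF refl _ refl, THEN iffD1, rotated])
    (use 1 assms in \<open>auto intro!: eventually_mono[OF eventually_nhds_in_open[of "{..<0}" s]] simp: max_def\<close>)
  then show ?thesis using 1 assms by (simp add: max_absorb1 zero_power)
 next
  case 2
  have "((\<lambda>s::real. s ^ n) has_real_derivative of_nat n * s ^ (n - 1)) (at s)" by (auto intro!: derivative_eq_intros)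
  then have "((\<lambda>s::real. max 0 s ^ n) has_real_derivative of_nat n * s ^ (n - 1)) (at s)"
   by (rule DERIV_cong_ev[OF refl _ refl, THEN iffD1, rotated])
    (use 2 assms in \<open>auto intro!: eventually_mono[OF eventually_nhds_in_open[of "{0<..}" s]] simp: max_def\<close>)
  then show ?thesis using 2 by (simp add: max_absorb2)
 next
  case 3
  have "((\<lambda>h::real. max 0 h ^ n / h) \<longlongrightarrow> 0) (at 0)"
  proof (rule Lim_null_comparison)
   show "\<forall>\<^sub>F h in at (0::real). norm (max 0 h ^ n / h) \<le> norm h ^ (n - 1)"
   proof (intro always_eventually allI)
    fix h :: real
    show "norm (max 0 h ^ n / h) \<le> norm h ^ (n - 1)"
     using assms by (cases n) (auto simp: max_def)
   qed
   show "((\<lambda>h::real. norm h ^ (n - 1)) \<longlongrightarrow> 0) (at 0)"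
    using assms by (auto intro!: tendsto_eq_intros simp: zero_power)
  qed
  then show ?thesis using 3 assms by (simp add: DERIV_def zero_power)
 qed
qed

lemma wirtinger_bump:
 assumes "n \<ge> 2" "e \<noteq> 0"
 shows "wirtinger (\<lambda>z. of_real (max 0 (1 - (cmod (z - a))\<^sup>2 / e^2) ^ n))
  (- of_real (n / e^2 * max 0 (1 - (cmod (z - a))\<^sup>2 / e^2) ^ (n - 1)) * cnj (z - a))
  (- of_real (n / e^2 * max 0 (1 - (cmod (z - a))\<^sup>2 / e^2) ^ (n - 1)) * (z - a)) z"
proof -
 have "((\<lambda>s::real. max 0 (1 - s / e^2) ^ n) has_real_derivative
   (of_nat n * max 0 (1 - (cmod (z - a))\<^sup>2 / e^2) ^ (n - 1)) * (- (1 / e^2))) (at ((cmod (z - a))^2))"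
  by (rule DERIV_chain2[OF has_real_derivative_max_power[OF assms(1)]]) (use assms in \<open>auto intro!: derivative_eq_intros simp: power2_eq_square\<close>)
 from wirtinger_radial[OF this] show ?thesis by (simp add: mult_ac)
qed

text \<open>The exponent 3 leaves second derivatives that are still continuous, and the double
  integration by parts in \<open>weak_wirtinger_energy\<close> uses exactly two. A truncated
  polynomial keeps every derivative explicit.\<close>

definition bump :: "real \<Rightarrow> complex \<Rightarrow> real" where
 "bump e z = max 0 (1 - (cmod z)\<^sup>2 / e^2) ^ 3"

definition mollifier :: "real \<Rightarrow> complex \<Rightarrow> real" where
 "mollifier e z = bump e z / integral\<^sup>L lborel (bump e)"

lemma continuous_on_bump [continuous_intros]: "continuous_on S (bump e)"
 unfolding bump_def divide_inverse by (intro continuous_intros)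

lemma bump_measurable [measurable]: "bump e \<in> borel_measurable borel"
 by (intro borel_measurable_continuous_onI continuous_intros)

lemma bump_nonneg: "bump e z \<ge> 0"
 by (simp add: bump_def)

lemma bump_le_1: "bump e z \<le> 1"
 unfolding bump_def by (intro power_le_one) auto

lemma bump_eq_0: "e > 0 \<Longrightarrow> cmod z \<ge> e \<Longrightarrow> bump e z = 0"
 by (simp add: bump_def max_def zero_power power_mono)

lemma integrable_bump: "e > 0 \<Longrightarrow> integrable lborel (bump e)"
 by (rule integrable_bounded_support[of _ 1 0 e]) (auto simp: bump_nonneg bump_le_1 intro!: bump_eq_0)

lemma integral_bump_pos:
 assumes "e > 0"
 shows "integral\<^sup>L lborel (bump e) > 0"
proof -
 have "0 < measure lborel (ball (0::complex) (e / 2)) * (1/4)"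
  using content_ball_pos[of "e / 2" "0::complex"] assms by simp
 also have "\<dots> = (LINT z|lborel. indicator (ball (0::complex) (e / 2)) z * (1/4))" by simp
 also have "\<dots> \<le> integral\<^sup>L lborel (bump e)"
 proof (rule integral_mono)
  show "integrable lborel (\<lambda>z. indicator (ball (0::complex) (e / 2)) z * (1/4::real))"
   by (intro integrable_mult_left integrable_real_indicator) (use emeasure_lborel_ball_finite in auto)
  show "indicator (ball 0 (e / 2)) z * (1/4) \<le> bump e z" for z
  proof (cases "z \<in> ball 0 (e / 2)")
   case True
   then have "(cmod z)\<^sup>2 \<le> (e / 2)^2" by (intro power_mono) auto
   then have "(cmod z)\<^sup>2 / e^2 \<le> 1/4"
    using assms by (simp add: field_simps)
   then have "3/4 \<le> max 0 (1 - (cmod z)\<^sup>2 / e^2)" by linarith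
   \<comment> \<open>(3/4)^3 = 27/64 exceeds the 1/4 claimed on the ball of half the radius.\<close>
   then have "(3/4) ^ 3 \<le> bump e z" unfolding bump_def by (rule power_mono) simp
   then show ?thesis using True by (simp add: eval_nat_numeral)
  qed (simp add: bump_nonneg)
 qed (use assms integrable_bump in auto)
 finally show ?thesis .
qed

lemma mollifier_measurable [measurable]: "mollifier e \<in> borel_measurable borel"
 unfolding mollifier_def by measurable

lemma mollifier_nonneg: "mollifier e z \<ge> 0"
 by (simp add: mollifier_def bump_nonneg)

lemma mollifier_eq_0: "e > 0 \<Longrightarrow> cmod z \<ge> e \<Longrightarrow> mollifier e z = 0"
 by (simp add: mollifier_def bump_eq_0)

lemma mollifier_le: "mollifier e z \<le> 1 / integral\<^sup>L lborel (bump e)"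
 unfolding mollifier_def by (intro divide_right_mono bump_le_1 integral_nonneg) (auto simp: bump_nonneg)

lemma mollifier_minus: "mollifier e (- z) = mollifier e z"
 by (simp add: mollifier_def bump_def)

lemma integral_mollifier:
 assumes "e > 0"
 shows "integrable lborel (mollifier e)" "integral\<^sup>L lborel (mollifier e) = 1"
 using integral_bump_pos[OF assms] integrable_bump[OF assms] unfolding mollifier_def by auto

lemma nn_integral_translate:
 fixes f :: "complex \<Rightarrow> ennreal"
 assumes [measurable]: "f \<in> borel_measurable borel"
 shows "(\<integral>\<^sup>+z. f (c + z) \<partial>lborel) = (\<integral>\<^sup>+z. f z \<partial>lborel)"
proof -
 have "(\<integral>\<^sup>+z. f z \<partial>lborel) = (\<integral>\<^sup>+z. f z \<partial>distr lborel borel ((+) c))" by (simp add: lborel_distr_plus)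
 also have "\<dots> = (\<integral>\<^sup>+z. f (c + z) \<partial>lborel)" by (rule nn_integral_distr) auto
 finally show ?thesis by simp
qed

lemma nn_integral_mollifier:
 assumes "e > 0"
 shows "(\<integral>\<^sup>+z. ennreal (mollifier e (z - t)) \<partial>lborel) = 1"
proof -
 have "(\<integral>\<^sup>+z. ennreal (mollifier e (- t + z)) \<partial>lborel) = (\<integral>\<^sup>+z. ennreal (mollifier e z) \<partial>lborel)"
  by (rule nn_integral_translate) auto
 also have "\<dots> = 1"
  using integral_mollifier[OF assms] by (subst nn_integral_eq_integral) (auto simp: mollifier_nonneg)
 finally show ?thesis by simp
qed

lemma integral_mollifier_reflect:
 assumes "e > 0"
 shows "integrable lborel (\<lambda>t. mollifier e (z - t))" "(LINT t|lborel. mollifier e (z - t)) = 1"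
proof -
 have eq: "mollifier e (z - t) = mollifier e (t - z)" for t
  using mollifier_minus[of e "z - t"] by simp
 have *: "(\<integral>\<^sup>+t. ennreal (mollifier e (z - t)) \<partial>lborel) = 1"
  using nn_integral_mollifier[OF assms, of z] by (simp add: eq)
 show "integrable lborel (\<lambda>t. mollifier e (z - t))"
  by (rule integrableI_nonneg) (use * in \<open>auto simp: mollifier_nonneg\<close>)
 show "(LINT t|lborel. mollifier e (z - t)) = 1"
  by (subst integral_eq_nn_integral) (use * in \<open>auto simp: mollifier_nonneg\<close>)
qed

abbreviation mollify :: "real \<Rightarrow> (complex \<Rightarrow> complex) \<Rightarrow> complex \<Rightarrow> complex" where
 "mollify e f \<equiv> convolution f (\<lambda>z. of_real (mollifier e z))"

lemma mollify_integrand: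
 fixes f :: "complex \<Rightarrow> complex"
 assumes "integrable lborel f" "e > 0"
 shows "integrable lborel (\<lambda>t. f t * of_real (mollifier e (z - t)))"
proof (rule integrable_mult_bounded[where B="1 / integral\<^sup>L lborel (bump e)"])
 show "cmod (complex_of_real (mollifier e (z - x))) \<le> 1 / integral\<^sup>L lborel (bump e)" for x
  using mollifier_le[of e "z - x"] mollifier_nonneg[of e "z - x"] by simp
qed (use assms in auto)

definition bump_power :: "real \<Rightarrow> nat \<Rightarrow> complex \<Rightarrow> complex" where
 "bump_power e n z = of_real (max 0 (1 - (cmod z)\<^sup>2 / e^2) ^ n)"

text \<open>The factor produced by differentiating (1 - s / e^2)^3 in s, divided by the normalizing
  integral. In the names that follow, p stands for a derivative d and q for a derivative
  dbar.\<close>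

definition mollifier_scale :: "real \<Rightarrow> complex" where
 "mollifier_scale e = of_real (- 3 / (e^2 * integral\<^sup>L lborel (bump e)))"

definition mollifier_p :: "real \<Rightarrow> complex \<Rightarrow> complex" where
 "mollifier_p e z = mollifier_scale e * (bump_power e 2 z * cnj z)"

definition mollifier_q :: "real \<Rightarrow> complex \<Rightarrow> complex" where
 "mollifier_q e z = mollifier_scale e * (bump_power e 2 z * z)"

definition mollifier_pp :: "real \<Rightarrow> complex \<Rightarrow> complex" where
 "mollifier_pp e z = mollifier_scale e * (of_real (- 2 / e^2) * bump_power e 1 z * cnj z * cnj z)"

text \<open>One function serves for both mixed derivatives, so their equality is built in; the
  energy identity depends on it.\<close>

definition mollifier_pq :: "real \<Rightarrow> complex \<Rightarrow> complex" where
 "mollifier_pq e z = mollifier_scale e * (of_real (- 2 / e^2) * bump_power e 1 z * z * cnj z + bump_power e 2 z)"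

definition mollifier_qq :: "real \<Rightarrow> complex \<Rightarrow> complex" where
 "mollifier_qq e z = mollifier_scale e * (of_real (- 2 / e^2) * bump_power e 1 z * z * z)"

lemma wirtinger_bump_power:
 assumes "n \<ge> 2" "e > 0"
 shows "wirtinger (bump_power e n) (of_real (- n / e^2) * bump_power e (n - 1) z * cnj z)
  (of_real (- n / e^2) * bump_power e (n - 1) z * z) z"
 using wirtinger_bump[of n e 0 z] assms unfolding bump_power_def[abs_def] by (simp add: mult_ac)

lemma mollifier_eq_bump_power:
 "(\<lambda>z. complex_of_real (mollifier e z)) = (\<lambda>z. of_real (1 / integral\<^sup>L lborel (bump e)) * bump_power e 3 z)"
 by (auto simp: mollifier_def bump_power_def bump_def)

lemma wirtinger_mollifier:
 assumes "e > 0"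
 shows "wirtinger (\<lambda>z. of_real (mollifier e z)) (mollifier_p e z) (mollifier_q e z) z"
  "wirtinger (mollifier_p e) (mollifier_pp e z) (mollifier_pq e z) z"
  "wirtinger (mollifier_q e) (mollifier_pq e z) (mollifier_qq e z) z"
proof -
 note d3 = wirtinger_bump_power[of 3 e z] and d2 = wirtinger_bump_power[of 2 e z]
 show "wirtinger (\<lambda>z. of_real (mollifier e z)) (mollifier_p e z) (mollifier_q e z) z"
  unfolding mollifier_eq_bump_power
  using wirtinger_cmult[OF d3, of "of_real (1 / integral\<^sup>L lborel (bump e))"] assms
  by (simp add: mollifier_p_def mollifier_q_def mollifier_scale_def mult_ac)
 show "wirtinger (mollifier_p e) (mollifier_pp e z) (mollifier_pq e z) z"
  using wirtinger_cmult[OF wirtinger_mult[OF d2 wirtinger_cnj_ident], of "mollifier_scale e"] assms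
  unfolding mollifier_p_def[abs_def] mollifier_pp_def mollifier_pq_def by simp
 have "wirtinger (\<lambda>z. z) 1 0 z" by (simp add: wirtinger_def)
 from wirtinger_cmult[OF wirtinger_mult[OF d2 this], of "mollifier_scale e"]
 show "wirtinger (mollifier_q e) (mollifier_pq e z) (mollifier_qq e z) z"
  using assms unfolding mollifier_q_def[abs_def] mollifier_qq_def mollifier_pq_def by (simp add: mult_ac)
qed

lemma continuous_on_bump_power [continuous_intros]: "continuous_on S (bump_power e n)"
 unfolding bump_power_def divide_inverse by (intro continuous_intros)

lemma continuous_on_mollifier_derivatives [continuous_intros]:
 "continuous_on S (\<lambda>z. complex_of_real (mollifier e z))" "continuous_on S (mollifier_p e)"
 "continuous_on S (mollifier_q e)" "continuous_on S (mollifier_pp e)"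
 "continuous_on S (mollifier_pq e)" "continuous_on S (mollifier_qq e)"
 unfolding mollifier_eq_bump_power mollifier_p_def mollifier_q_def mollifier_pp_def mollifier_pq_def mollifier_qq_def
 by (intro continuous_intros)+

lemma mollifier_derivatives_measurable [measurable]:
 "mollifier_p e \<in> borel_measurable borel" "mollifier_q e \<in> borel_measurable borel"
 "mollifier_pp e \<in> borel_measurable borel" "mollifier_pq e \<in> borel_measurable borel"
 "mollifier_qq e \<in> borel_measurable borel"
 by (intro borel_measurable_continuous_onI continuous_intros)+

lemma mollifier_derivatives_eq_0:
 assumes "e > 0" "cmod z \<ge> e"
 shows "mollifier_p e z = 0" "mollifier_q e z = 0" "mollifier_pp e z = 0"
  "mollifier_pq e z = 0" "mollifier_qq e z = 0"
proof -
 have "bump_power e n z = 0" if "n \<ge> 1" for n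
  using that assms by (simp add: bump_power_def max_def zero_power power_mono)
 then show "mollifier_p e z = 0" "mollifier_q e z = 0" "mollifier_pp e z = 0"
  "mollifier_pq e z = 0" "mollifier_qq e z = 0"
  by (auto simp: mollifier_p_def mollifier_q_def mollifier_pp_def mollifier_pq_def mollifier_qq_def)
qed

lemma continuous_bounded_support:
 fixes h :: "complex \<Rightarrow> complex"
 assumes "continuous_on UNIV h" "\<And>z. cmod z \<ge> e \<Longrightarrow> h z = 0"
 shows "\<exists>B. \<forall>z. cmod (h z) \<le> B"
proof -
 have "compact (h ` cball 0 e)"
  by (intro compact_continuous_image continuous_on_subset[OF assms(1)]) auto
 then obtain B where B: "\<And>z. z \<in> cball 0 e \<Longrightarrow> cmod (h z) \<le> B" "B > 0"
  using compact_imp_bounded bounded_pos by (metis image_eqI)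
 have "cmod (h z) \<le> B" for z
  by (cases "z \<in> cball 0 e") (use B assms(2)[of z] in auto)
 then show ?thesis by auto
qed

lemma mollifier_derivatives_bounded:
 assumes "e > 0"
 obtains B where "\<And>z. cmod (of_real (mollifier e z)) \<le> B"
  "\<And>z. cmod (mollifier_p e z) \<le> B" "\<And>z. cmod (mollifier_q e z) \<le> B"
  "\<And>z. cmod (mollifier_pp e z) \<le> B" "\<And>z. cmod (mollifier_pq e z) \<le> B" "\<And>z. cmod (mollifier_qq e z) \<le> B"
proof -
 define p0 where "p0 = (\<lambda>z. complex_of_real (mollifier e z))"
 note zero = mollifier_derivatives_eq_0[OF assms]
 have p0: "continuous_on UNIV p0" "\<And>z. cmod z \<ge> e \<Longrightarrow> p0 z = 0"
  unfolding p0_def using mollifier_eq_0[OF assms]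
  by (auto simp only: mollifier_eq_0 of_real_0 intro!: continuous_on_mollifier_derivatives(1))
 obtain b where b: "\<forall>z. cmod (p0 z) \<le> b 0" "\<forall>z. cmod (mollifier_p e z) \<le> b 1" "\<forall>z. cmod (mollifier_q e z) \<le> b 2"
  "\<forall>z. cmod (mollifier_pp e z) \<le> b 3" "\<forall>z. cmod (mollifier_pq e z) \<le> b 4" "\<forall>z. cmod (mollifier_qq e z) \<le> b (5::nat)"
 proof -
  obtain b0 b1 b2 b3 b4 b5 where "\<forall>z. cmod (p0 z) \<le> b0" "\<forall>z. cmod (mollifier_p e z) \<le> b1" "\<forall>z. cmod (mollifier_q e z) \<le> b2"
   "\<forall>z. cmod (mollifier_pp e z) \<le> b3" "\<forall>z. cmod (mollifier_pq e z) \<le> b4" "\<forall>z. cmod (mollifier_qq e z) \<le> b5"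
   using continuous_bounded_support[where e=e, OF p0] continuous_bounded_support[where e=e, OF continuous_on_mollifier_derivatives(2) zero(1)]
    continuous_bounded_support[where e=e, OF continuous_on_mollifier_derivatives(3) zero(2)]
    continuous_bounded_support[where e=e, OF continuous_on_mollifier_derivatives(4) zero(3)]
    continuous_bounded_support[where e=e, OF continuous_on_mollifier_derivatives(5) zero(4)]
    continuous_bounded_support[where e=e, OF continuous_on_mollifier_derivatives(6) zero(5)] by blast
  then show thesis
   by (intro that[of "\<lambda>n. [b0, b1, b2, b3, b4, b5] ! n"]) (simp_all add: eval_nat_numeral)
 qed
 have le: "b n \<le> Max (b ` {..5})" if "n \<le> 5" for n using that by (intro Max_ge) auto
 show thesis
  by (rule that[of "Max (b ` {..5})"]; rule order_trans[OF _ le])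
   (use b in \<open>auto simp: p0_def\<close>)
qed

text \<open>Truncation makes g bounded at a small L^1 cost; a bounded measurable function is an
  almost everywhere limit of continuous ones, and once these share a bound and a compact support,
  dominated convergence gives L^1 convergence.\<close>

lemma continuous_L1_approximation:
 fixes g :: "complex \<Rightarrow> complex"
 assumes g: "integrable lborel g" and supp: "\<And>z. z \<notin> cball 0 R \<Longrightarrow> g z = 0" and e: "e > 0"
 obtains h where "continuous_on UNIV h" "\<And>z. z \<notin> cball 0 (R + 1) \<Longrightarrow> h z = 0"
  "integrable lborel h" "(LINT z|lborel. cmod (g z - h z)) < e"
proof -
 have [measurable]: "g \<in> borel_measurable borel" using g by (auto dest: borel_measurable_integrable)
 define tr where "tr M z = (if cmod (g z) \<le> M then g z else 0)" for M z
 have [measurable]: "tr M \<in> borel_measurable borel" for M unfolding tr_def by measurable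
 have "(\<lambda>n. LINT z|lborel. cmod (g z - tr (real n) z)) \<longlonglongrightarrow> (LINT (z::complex)|lborel. (0::real))"
 proof (rule integral_dominated_convergence[where w="\<lambda>z. cmod (g z)"])
  show "AE z in lborel. (\<lambda>n. cmod (g z - tr (real n) z)) \<longlonglongrightarrow> 0"
  proof (intro always_eventually allI)
   fix z
   have "eventually (\<lambda>n. cmod (g z - tr (real n) z) = 0) sequentially"
    using eventually_ge_at_top[of "nat \<lceil>cmod (g z)\<rceil>"]
    by eventually_elim (auto simp: tr_def nat_le_iff ceiling_le_iff le_of_int_ceiling)
   then show "(\<lambda>n. cmod (g z - tr (real n) z)) \<longlonglongrightarrow> 0"
    by (rule tendsto_eventually)
  qed
  show "AE z in lborel. norm (cmod (g z - tr (real n) z)) \<le> cmod (g z)" for n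
   by (auto simp: tr_def)
 qed (use g in auto)
 then have "(\<lambda>n. LINT z|lborel. cmod (g z - tr (real n) z)) \<longlonglongrightarrow> 0" by simp
 from order_tendstoD(2)[OF this, of "e/2"] obtain n where n: "(LINT z|lborel. cmod (g z - tr (real n) z)) < e / 2"
  using e by (auto simp: eventually_sequentially)
 define f where "f = tr (real n)"
 have f[measurable]: "f \<in> borel_measurable borel" by (simp add: f_def)
 have fb: "cmod (f z) \<le> real n" and fs: "z \<notin> cball 0 R \<Longrightarrow> f z = 0" for z
  using supp by (auto simp: f_def tr_def)
 have fint: "integrable lborel f" by (rule integrable_bounded_support[of _ "real n" 0 R]) (use f fb fs in auto)
 have "f \<in> borel_measurable lebesgue"
  using f by (simp add: measurable_completion)
 then have "f measurable_on UNIV"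
  using lebesgue_measurable_imp_measurable_on by fastforce
 then obtain N F where N: "negligible N" and F: "\<And>j. continuous_on UNIV (F j)"
  and lim: "\<And>x. x \<notin> N \<Longrightarrow> (\<lambda>j. F j x) \<longlonglongrightarrow> f x"
  unfolding measurable_on_def by auto
 \<comment> \<open>The approximants \<open>F j\<close> need be neither bounded nor compactly
   supported. Projection onto the disc of radius n and multiplication by the plateau
   \<open>\<theta>\<close> repair this without moving the limit.\<close>
 define c where "c = closest_point (cball (0::complex) (real n))"
 define \<theta> where "\<theta> z = max 0 (1 - max 0 (cmod z - R))" for z :: complex
 define H where "H j z = of_real (\<theta> z) * c (F j z)" for j z
 have c: "continuous_on UNIV c" "\<And>z. cmod (c z) \<le> real n" "\<And>z. cmod z \<le> real n \<Longrightarrow> c z = z"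
 proof -
  show "continuous_on UNIV c" unfolding c_def by (rule continuous_on_closest_point) auto
  show "cmod (c z) \<le> real n" for z
   using closest_point_in_set[of "cball (0::complex) (real n)" z] unfolding c_def by (auto simp del: closest_point_in_set)
  show "\<And>z. cmod z \<le> real n \<Longrightarrow> c z = z" unfolding c_def by (rule closest_point_self) auto
 qed
 have \<theta>: "0 \<le> \<theta> z" "\<theta> z \<le> 1" "z \<in> cball 0 R \<Longrightarrow> \<theta> z = 1" "z \<notin> cball 0 (R+1) \<Longrightarrow> \<theta> z = 0" for z
  by (auto simp: \<theta>_def max_def)
 have Hcont: "continuous_on UNIV (H j)" for j
  unfolding H_def \<theta>_def by (intro continuous_intros continuous_on_compose2[OF c(1) F]) auto
 have [measurable]: "H j \<in> borel_measurable borel" for j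
  by (rule borel_measurable_continuous_onI) (rule Hcont)
 have Hb: "cmod (H j z) \<le> real n" and Hs: "z \<notin> cball 0 (R+1) \<Longrightarrow> H j z = 0" for j z
 proof -
  show "cmod (H j z) \<le> real n"
   using mult_mono[OF \<theta>(2) c(2)[of "F j z"]] \<theta>(1)[of z] by (auto simp: H_def norm_mult)
  show "z \<notin> cball 0 (R+1) \<Longrightarrow> H j z = 0" using \<theta>(4)[of z] by (simp add: H_def)
 qed
 have Hint: "integrable lborel (H j)" for j
  by (rule integrable_bounded_support[of _ "real n" 0 "R+1"]) (use Hb Hs in auto)
 have "(\<lambda>j. LINT z|lborel. cmod (f z - H j z)) \<longlonglongrightarrow> (LINT (z::complex)|lborel. (0::real))"
 proof (rule integral_dominated_convergence[where w="\<lambda>z. indicator (cball 0 (R+1)) z * (2 * real n)"])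
  show "integrable lborel (\<lambda>z. indicator (cball (0::complex) (R + 1)) z * (2 * real n))"
   by (intro integrable_mult_left integrable_real_indicator) (use emeasure_lborel_cball_finite in auto)
  have "AE z in lborel. z \<notin> N"
   using N by (auto simp: negligible_iff_null_sets null_sets_completion_iff2 eventually_ae_filter)
  then show "AE z in lborel. (\<lambda>j. cmod (f z - H j z)) \<longlonglongrightarrow> 0"
  proof eventually_elim
   case (elim z)
   have "(\<lambda>j. of_real (\<theta> z) * c (F j z)) \<longlonglongrightarrow> of_real (\<theta> z) * c (f z)"
    using c(1) lim[OF elim] by (intro tendsto_intros continuous_on_tendsto_compose[OF c(1)]) auto
   also have "of_real (\<theta> z) * c (f z) = f z"
    using c(3)[OF fb[of z]] \<theta>(3)[of z] fs[of z] by (cases "z \<in> cball 0 R") auto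
   finally have "(\<lambda>j. f z - H j z) \<longlonglongrightarrow> f z - f z" unfolding H_def by (intro tendsto_intros)
   then show ?case by (simp add: tendsto_norm_zero_iff)
  qed
  show "AE z in lborel. norm (cmod (f z - H j z)) \<le> indicator (cball 0 (R + 1)) z * (2 * real n)" for j
  proof (intro always_eventually allI)
   fix z
   show "norm (cmod (f z - H j z)) \<le> indicator (cball 0 (R + 1)) z * (2 * real n)"
    using norm_triangle_ineq4[of "f z" "H j z"] fb[of z] Hb[of j z] Hs[of z j] fs[of z]
    by (cases "z \<in> cball 0 (R+1)") auto
  qed
 qed auto
 then have "(\<lambda>j. LINT z|lborel. cmod (f z - H j z)) \<longlonglongrightarrow> 0" by simp
 from order_tendstoD(2)[OF this, of "e/2"] obtain j where j: "(LINT z|lborel. cmod (f z - H j z)) < e / 2"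
  using e by (auto simp: eventually_sequentially)
 have "(LINT z|lborel. cmod (g z - H j z)) \<le> (LINT z|lborel. cmod (g z - f z) + cmod (f z - H j z))"
 proof (rule integral_mono)
  show "cmod (g z - H j z) \<le> cmod (g z - f z) + cmod (f z - H j z)" for z
   using norm_triangle_ineq[of "g z - f z" "f z - H j z"] by simp
 qed (use g fint Hint in auto)
 also have "\<dots> = (LINT z|lborel. cmod (g z - f z)) + (LINT z|lborel. cmod (f z - H j z))"
  using g fint Hint by (intro Bochner_Integration.integral_add) auto
 also have "\<dots> < e" using n j by (simp add: f_def)
 finally show thesis using that[OF Hcont Hs Hint] by auto
qed

text \<open>A mollification is an average with total weight 1 over the disc of radius e. With w = f
  z this yields uniform convergence, with w = 0 it locates the support.\<close>

lemma mollify_diff_le: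
 assumes f: "integrable lborel f" and e: "e > 0"
  and le: "\<And>t. cmod (t - z) \<le> e \<Longrightarrow> cmod (f t - w) \<le> \<eta>"
 shows "cmod (mollify e f z - w) \<le> \<eta>"
proof -
 note m = integral_mollifier_reflect[OF e, of z]
 have m': "integrable lborel (\<lambda>t. complex_of_real (mollifier e (z - t)))"
  "(LINT t|lborel. complex_of_real (mollifier e (z - t))) = 1" using m by auto
 have mw: "integrable lborel (\<lambda>t. w * complex_of_real (mollifier e (z - t)))"
  by (rule integrable_mult_right) (rule m')
 have "mollify e f z - w = (LINT t|lborel. f t * of_real (mollifier e (z - t))) - (LINT t|lborel. w * of_real (mollifier e (z - t)))"
  using m' by (simp add: convolution_def)
 also have "\<dots> = (LINT t|lborel. f t * of_real (mollifier e (z - t)) - w * of_real (mollifier e (z - t)))"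
  by (intro Bochner_Integration.integral_diff[symmetric] mollify_integrand f e mw)
 also have "cmod \<dots> \<le> (LINT t|lborel. \<eta> * mollifier e (z - t))"
 proof (rule Bochner_Integration.integral_norm_bound_integral)
  show "integrable lborel (\<lambda>t. f t * of_real (mollifier e (z - t)) - w * of_real (mollifier e (z - t)))"
   by (intro Bochner_Integration.integrable_diff mollify_integrand f e mw)
  show "integrable lborel (\<lambda>t. \<eta> * mollifier e (z - t))" using m by auto
  show "cmod (f t * of_real (mollifier e (z - t)) - w * of_real (mollifier e (z - t))) \<le> \<eta> * mollifier e (z - t)" for t
  proof (cases "cmod (t - z) \<le> e")
   case True
   have "cmod (f t * of_real (mollifier e (z - t)) - w * of_real (mollifier e (z - t))) = cmod (f t - w) * mollifier e (z - t)"
    by (metis left_diff_distrib mollifier_nonneg norm_mult norm_of_real abs_of_nonneg)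
   also have "\<dots> \<le> \<eta> * mollifier e (z - t)" by (intro mult_right_mono le True mollifier_nonneg)
   finally show ?thesis .
  next
   case False
   then have "mollifier e (z - t) = 0" by (intro mollifier_eq_0 e) (simp add: norm_minus_commute)
   then show ?thesis by simp
  qed
 qed
 also have "\<dots> = \<eta>" using m by simp
 finally show ?thesis .
qed

lemma wirtinger_mollify:
 assumes f: "integrable lborel f" and e: "e > 0"
 shows "wirtinger (mollify e f) (convolution f (mollifier_p e) z) (convolution f (mollifier_q e) z) z"
  "wirtinger (convolution f (mollifier_p e)) (convolution f (mollifier_pp e) z) (convolution f (mollifier_pq e) z) z"
  "wirtinger (convolution f (mollifier_q e)) (convolution f (mollifier_pq e) z) (convolution f (mollifier_qq e) z) z"
proof -
 obtain B where B: "\<And>z. cmod (of_real (mollifier e z)) \<le> B"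
  "\<And>z. cmod (mollifier_p e z) \<le> B" "\<And>z. cmod (mollifier_q e z) \<le> B"
  "\<And>z. cmod (mollifier_pp e z) \<le> B" "\<And>z. cmod (mollifier_pq e z) \<le> B" "\<And>z. cmod (mollifier_qq e z) \<le> B"
  using mollifier_derivatives_bounded[OF e] by metis
 show "wirtinger (mollify e f) (convolution f (mollifier_p e) z) (convolution f (mollifier_q e) z) z"
  by (rule wirtinger_convolution[OF f wirtinger_mollifier(1)[OF e] _ _ B(1,2,3)]) measurable
 show "wirtinger (convolution f (mollifier_p e)) (convolution f (mollifier_pp e) z) (convolution f (mollifier_pq e) z) z"
  by (rule wirtinger_convolution[OF f wirtinger_mollifier(2)[OF e] _ _ B(2,4,5)]) measurable
 show "wirtinger (convolution f (mollifier_q e)) (convolution f (mollifier_pq e) z) (convolution f (mollifier_qq e) z) z"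
  by (rule wirtinger_convolution[OF f wirtinger_mollifier(3)[OF e] _ _ B(3,5,6)]) measurable
qed

lemma mollify_continuous:
 assumes f: "integrable lborel f" and e: "e > 0"
 shows "continuous_on S (mollify e f)" "continuous_on S (convolution f (mollifier_p e))"
  "continuous_on S (convolution f (mollifier_q e))"
 by (intro continuous_at_imp_continuous_on ballI wirtinger_continuous[OF wirtinger_mollify(1)[OF f e]]
   wirtinger_continuous[OF wirtinger_mollify(2)[OF f e]] wirtinger_continuous[OF wirtinger_mollify(3)[OF f e]])+

lemma nn_integral_convolution_mollifier:
 assumes [measurable]: "\<phi> \<in> borel_measurable borel" and e: "e > 0"
 shows "(\<integral>\<^sup>+z. (\<integral>\<^sup>+t. \<phi> t * ennreal (mollifier e (z - t)) \<partial>lborel) \<partial>lborel) = (\<integral>\<^sup>+t. \<phi> t \<partial>lborel)"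
proof -
 have "(\<integral>\<^sup>+z. (\<integral>\<^sup>+t. \<phi> t * ennreal (mollifier e (z - t)) \<partial>lborel) \<partial>lborel)
   = (\<integral>\<^sup>+t. (\<integral>\<^sup>+z. \<phi> t * ennreal (mollifier e (z - t)) \<partial>lborel) \<partial>lborel)"
  by (rule lborel_pair.Fubini') (simp, measurable)
 also have "\<dots> = (\<integral>\<^sup>+t. \<phi> t * 1 \<partial>lborel)"
  by (intro nn_integral_cong, subst nn_integral_cmult) (auto simp: nn_integral_mollifier[OF e])
 finally show ?thesis by simp
qed

lemma nn_integral_mollify_le:
 assumes f: "integrable lborel f" and e: "e > 0"
 shows "(\<integral>\<^sup>+z. ennreal (cmod (mollify e f z)) \<partial>lborel) \<le> (\<integral>\<^sup>+z. ennreal (cmod (f z)) \<partial>lborel)"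
proof -
 have [measurable]: "f \<in> borel_measurable borel" using f by (auto dest: borel_measurable_integrable)
 have "ennreal (cmod (mollify e f z)) \<le> (\<integral>\<^sup>+t. ennreal (cmod (f t)) * ennreal (mollifier e (z - t)) \<partial>lborel)" for z
 proof -
  have "ennreal (cmod (mollify e f z)) \<le> (\<integral>\<^sup>+t. ennreal (cmod (f t * of_real (mollifier e (z - t)))) \<partial>lborel)"
   unfolding convolution_def by (intro integral_norm_bound_ennreal mollify_integrand f e)
  also have "\<dots> = (\<integral>\<^sup>+t. ennreal (cmod (f t)) * ennreal (mollifier e (z - t)) \<partial>lborel)"
   by (intro nn_integral_cong) (simp add: norm_mult ennreal_mult mollifier_nonneg)
  finally show ?thesis .
 qed
 then have "(\<integral>\<^sup>+z. ennreal (cmod (mollify e f z)) \<partial>lborel) \<le> (\<integral>\<^sup>+z. (\<integral>\<^sup>+t. ennreal (cmod (f t)) * ennreal (mollifier e (z - t)) \<partial>lborel) \<partial>lborel)"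
  by (intro nn_integral_mono)
 also have "\<dots> = (\<integral>\<^sup>+z. ennreal (cmod (f z)) \<partial>lborel)"
  by (rule nn_integral_convolution_mollifier) (use e in auto)
 finally show ?thesis .
qed

lemma mollify_integrable:
 assumes f: "integrable lborel f" and e: "e > 0"
 shows "integrable lborel (mollify e f)"
  "(LINT z|lborel. cmod (mollify e f z)) \<le> (LINT z|lborel. cmod (f z))"
proof -
 note le = nn_integral_mollify_le[OF f e]
 have fin: "(\<integral>\<^sup>+z. ennreal (cmod (f z)) \<partial>lborel) = ennreal (LINT z|lborel. cmod (f z))"
  using f by (intro nn_integral_eq_integral) auto
 show *: "integrable lborel (mollify e f)"
  by (rule integrableI_bounded) (use borel_measurable_continuous_onI[OF mollify_continuous(1)[OF f e]] le fin in \<open>auto simp: le_less_trans\<close>)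
 have "ennreal (LINT z|lborel. cmod (mollify e f z)) \<le> ennreal (LINT z|lborel. cmod (f z))"
  using le fin * by (subst nn_integral_eq_integral[symmetric]) auto
 then show "(LINT z|lborel. cmod (mollify e f z)) \<le> (LINT z|lborel. cmod (f z))"
  by (subst (asm) ennreal_le_iff) auto
qed

text \<open>Jensen's inequality for the probability density \<open>mollifier e (z - \<cdot>)\<close>, from
 \<open>0 \<le> \<integral> \<bar>f - c\<bar>\<^sup>2 mollifier\<close> with \<open>c\<close> the mean.\<close>

lemma norm_mollify_power2_le:
 assumes f: "integrable lborel f" and f2: "integrable lborel (\<lambda>z. (cmod (f z))\<^sup>2)" and e: "e > 0"
 shows "(cmod (mollify e f z))\<^sup>2 \<le> (LINT t|lborel. (cmod (f t))\<^sup>2 * mollifier e (z - t))"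
proof -
 define c where "c = mollify e f z"
 note m = integral_mollifier_reflect[OF e, of z]
 note i1 = mollify_integrand[OF f e, of z]
 have i2: "integrable lborel (\<lambda>t. (cmod (f t))\<^sup>2 * mollifier e (z - t))"
 proof (rule Bochner_Integration.integrable_bound[of _ "\<lambda>t. (cmod (f t))\<^sup>2 * (1 / integral\<^sup>L lborel (bump e))"])
  show "integrable lborel (\<lambda>t. (cmod (f t))\<^sup>2 * (1 / integral\<^sup>L lborel (bump e)))" using f2 by (rule integrable_mult_left)
  have [measurable]: "f \<in> borel_measurable borel" using f by (auto dest: borel_measurable_integrable)
  show "(\<lambda>t. (cmod (f t))\<^sup>2 * mollifier e (z - t)) \<in> borel_measurable lborel" by measurable
  show "AE x in lborel. norm ((cmod (f x))^2 * mollifier e (z - x)) \<le> norm ((cmod (f x))^2 * (1 / integral\<^sup>L lborel (bump e)))"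
  proof (intro always_eventually allI)
   fix x
   have "(cmod (f x))\<^sup>2 * mollifier e (z - x) \<le> (cmod (f x))^2 * (1 / integral\<^sup>L lborel (bump e))"
    by (intro mult_left_mono mollifier_le) auto
   moreover have "(cmod (f x))\<^sup>2 * mollifier e (z - x) \<ge> 0" by (simp add: mollifier_nonneg)
   ultimately show "norm ((cmod (f x))^2 * mollifier e (z - x)) \<le> norm ((cmod (f x))^2 * (1 / integral\<^sup>L lborel (bump e)))"
    unfolding real_norm_def by linarith
  qed
 qed
 define r where "r t = Re (cnj c * (f t * of_real (mollifier e (z - t))))" for t
 have i3: "integrable lborel r"
  unfolding r_def by (intro integrable_Re integrable_mult_right i1)
 have "0 \<le> (LINT t|lborel. (cmod (f t - c))\<^sup>2 * mollifier e (z - t))"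
  by (intro integral_nonneg_AE) (auto simp: mollifier_nonneg)
 also have "(\<lambda>t. (cmod (f t - c))\<^sup>2 * mollifier e (z - t)) =
  (\<lambda>t. (cmod (f t))\<^sup>2 * mollifier e (z - t) - 2 * r t + (cmod c)^2 * mollifier e (z - t))"
  unfolding cmod_power2 r_def by (rule ext) (simp add: power2_eq_square algebra_simps)
 also have "(LINT t|lborel. (cmod (f t))\<^sup>2 * mollifier e (z - t) - 2 * r t + (cmod c)^2 * mollifier e (z - t))
  = (LINT t|lborel. (cmod (f t))\<^sup>2 * mollifier e (z - t)) - 2 * (LINT t|lborel. r t) + (cmod c)^2"
  using i2 i3 m by simp
 also have "(LINT t|lborel. r t) = Re (cnj c * c)"
 proof -
  have "(LINT t|lborel. r t) = Re (LINT t|lborel. cnj c * (f t * of_real (mollifier e (z - t))))"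
   unfolding r_def by (intro integral_Re integrable_mult_right i1)
  also have "\<dots> = Re (cnj c * c)" unfolding c_def convolution_def by simp
  finally show ?thesis .
 qed
 also have "Re (cnj c * c) = (cmod c)^2"
  unfolding cmod_power2 by (simp add: power2_eq_square)
 finally show ?thesis by (simp add: c_def)
qed

lemma nn_integral_mollify_power2_le:
 assumes f: "integrable lborel f" and f2: "integrable lborel (\<lambda>z. (cmod (f z))\<^sup>2)" and e: "e > 0"
 shows "(\<integral>\<^sup>+z. ennreal ((cmod (mollify e f z))^2) \<partial>lborel) \<le> (\<integral>\<^sup>+z. ennreal ((cmod (f z))^2) \<partial>lborel)"
proof -
 have [measurable]: "f \<in> borel_measurable borel" using f by (auto dest: borel_measurable_integrable)
 have "ennreal ((cmod (mollify e f z))^2) \<le> (\<integral>\<^sup>+t. ennreal ((cmod (f t))^2) * ennreal (mollifier e (z - t)) \<partial>lborel)" for z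
 proof -
  have "ennreal ((cmod (mollify e f z))^2) \<le> ennreal (LINT t|lborel. (cmod (f t))\<^sup>2 * mollifier e (z - t))"
   by (intro ennreal_leI norm_mollify_power2_le assms)
  also have "\<dots> \<le> (\<integral>\<^sup>+t. ennreal ((cmod (f t))^2 * mollifier e (z - t)) \<partial>lborel)"
   by (subst integral_eq_nn_integral) (auto simp: mollifier_nonneg ennreal_enn2real_if)
  finally show ?thesis by (simp add: ennreal_mult mollifier_nonneg)
 qed
 then have "(\<integral>\<^sup>+z. ennreal ((cmod (mollify e f z))^2) \<partial>lborel) \<le> (\<integral>\<^sup>+z. (\<integral>\<^sup>+t. ennreal ((cmod (f t))^2) * ennreal (mollifier e (z - t)) \<partial>lborel) \<partial>lborel)"
  by (intro nn_integral_mono)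
 also have "\<dots> = (\<integral>\<^sup>+z. ennreal ((cmod (f z))^2) \<partial>lborel)"
  by (rule nn_integral_convolution_mollifier) (use e in auto)
 finally show ?thesis .
qed

text \<open>Mollification does not increase the L^1 norm, so it suffices to treat a continuous h
  close to g, where uniform continuity applies.\<close>

lemma mollify_L1_tendsto:
 fixes \<epsilon> :: "nat \<Rightarrow> real"
 assumes g: "integrable lborel g" and supp: "\<And>z. z \<notin> cball 0 R \<Longrightarrow> g z = 0"
  and \<epsilon>: "\<And>j. \<epsilon> j > 0" "\<epsilon> \<longlonglongrightarrow> 0"
 shows "(\<lambda>j. LINT z|lborel. cmod (mollify (\<epsilon> j) g z - g z)) \<longlonglongrightarrow> 0"
proof (rule LIMSEQ_I)
 fix r :: real assume r: "r > 0"
 obtain h where h: "continuous_on UNIV h" "\<And>z. z \<notin> cball 0 (R + 1) \<Longrightarrow> h z = 0"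
  "integrable lborel h" "(LINT z|lborel. cmod (g z - h z)) < r / 3"
  using continuous_L1_approximation[OF g, of R "r/3"] supp r by auto
 define A where "A = measure lborel (cball (0::complex) (R + 2))"
 \<comment> \<open>Chosen so that A times \<open>\<eta>\<close> stays below r/3, with A the area of
   a disc that contains the supports of h and of its mollifications.\<close>
 define \<eta> where "\<eta> = r / (3 * (A + 1))"
 have A: "A \<ge> 0" by (simp add: A_def)
 have \<eta>: "\<eta> > 0" using r A by (simp add: \<eta>_def)
 have "uniformly_continuous_on (cball 0 (R + 3)) h"
  by (intro compact_uniformly_continuous continuous_on_subset[OF h(1)]) auto
 then obtain d where d: "d > 0" "\<And>x y. x \<in> cball 0 (R+3) \<Longrightarrow> y \<in> cball 0 (R+3) \<Longrightarrow> dist x y < d \<Longrightarrow> dist (h x) (h y) < \<eta>"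
  unfolding uniformly_continuous_on_def using \<eta> by metis
 have "eventually (\<lambda>j. \<epsilon> j < min d 1) sequentially"
  using d(1) order_tendstoD(2)[OF \<epsilon>(2), of "min d 1"] by simp
 then obtain J where J: "\<And>j. j \<ge> J \<Longrightarrow> \<epsilon> j < min d 1" by (auto simp: eventually_sequentially)
 show "\<exists>no. \<forall>n\<ge>no. norm ((LINT z|lborel. cmod (mollify (\<epsilon> n) g z - g z)) - 0) < r"
 proof (intro exI allI impI)
  fix n assume n: "n \<ge> J"
  note e = \<epsilon>(1)[of n]
  have en: "\<epsilon> n < d" "\<epsilon> n < 1" using J[OF n] by auto
  have gh: "integrable lborel (\<lambda>z. g z - h z)" using g h by auto
  have moll_h: "cmod (mollify (\<epsilon> n) h z - h z) \<le> indicator (cball 0 (R + 2)) z * \<eta>" for z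
  proof (cases "z \<in> cball 0 (R+2)")
   case True
   have "cmod (h t - h z) \<le> \<eta>" if "cmod (t - z) \<le> \<epsilon> n" for t
   proof -
    have "cmod t \<le> cmod z + cmod (t - z)" by (metis norm_triangle_sub)
    then have "t \<in> cball 0 (R+3)" "z \<in> cball 0 (R+3)" using that True en by auto
    from d(2)[OF this] that en show ?thesis by (simp add: dist_norm)
   qed
   from mollify_diff_le[OF h(3) e this] True show ?thesis by simp
  next
   case False
   have "cmod (h t - 0) \<le> 0" if "cmod (t - z) \<le> \<epsilon> n" for t
   proof -
    have "cmod z \<le> cmod t + cmod (t - z)" by (metis norm_minus_commute norm_triangle_sub)
    then show ?thesis using h(2)[of t] that False en by auto
   qed
   from mollify_diff_le[OF h(3) e this] have "mollify (\<epsilon> n) h z = 0" by simp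
   moreover have "h z = 0" using False by (intro h(2)) auto
   ultimately show ?thesis using \<eta> by simp
  qed
  have eq: "mollify (\<epsilon> n) (\<lambda>z. g z - h z) z = mollify (\<epsilon> n) g z - mollify (\<epsilon> n) h z" for z
   unfolding convolution_def left_diff_distrib
   by (intro Bochner_Integration.integral_diff mollify_integrand g h e)
  note mi = mollify_integrable[OF g e] mollify_integrable[OF h(3) e] mollify_integrable[OF gh e]
  have iind: "integrable lborel (\<lambda>z. indicator (cball (0::complex) (R + 2)) z * \<eta>)"
   by (intro integrable_mult_left integrable_real_indicator) (use emeasure_lborel_cball_finite in auto)
  have "(LINT z|lborel. cmod (mollify (\<epsilon> n) g z - g z))
   \<le> (LINT z|lborel. cmod (mollify (\<epsilon> n) (\<lambda>z. g z - h z) z) + indicator (cball 0 (R + 2)) z * \<eta> + cmod (g z - h z))"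
  proof (rule integral_mono)
   show "integrable lborel (\<lambda>z. cmod (mollify (\<epsilon> n) g z - g z))" using mi g by auto
   show "integrable lborel (\<lambda>z. cmod (mollify (\<epsilon> n) (\<lambda>z. g z - h z) z) + indicator (cball 0 (R + 2)) z * \<eta> + cmod (g z - h z))"
    using mi(5) gh iind by (intro Bochner_Integration.integrable_add integrable_norm)
   fix z
   have "mollify (\<epsilon> n) g z - g z = mollify (\<epsilon> n) (\<lambda>z. g z - h z) z + (mollify (\<epsilon> n) h z - h z) - (g z - h z)"
    unfolding eq by simp
   then have "cmod (mollify (\<epsilon> n) g z - g z) \<le> cmod (mollify (\<epsilon> n) (\<lambda>z. g z - h z) z) + cmod (mollify (\<epsilon> n) h z - h z) + cmod (g z - h z)"
    by (metis add_mono_thms_linordered_semiring(3) norm_triangle_ineq norm_triangle_ineq4 order_trans)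
   then show "cmod (mollify (\<epsilon> n) g z - g z) \<le> cmod (mollify (\<epsilon> n) (\<lambda>z. g z - h z) z) + indicator (cball 0 (R + 2)) z * \<eta> + cmod (g z - h z)"
    using moll_h[of z] by linarith
  qed
  also have "\<dots> = (LINT z|lborel. cmod (mollify (\<epsilon> n) (\<lambda>z. g z - h z) z)) + A * \<eta> + (LINT z|lborel. cmod (g z - h z))"
   using mi(5) gh iind by (simp add: A_def)
  also have "\<dots> \<le> (LINT z|lborel. cmod (g z - h z)) + A * \<eta> + (LINT z|lborel. cmod (g z - h z))"
   using mi(6) by simp
  also have "\<dots> < r"
  proof -
   have "A * \<eta> < r / 3" using r A by (simp add: \<eta>_def field_simps)
   then show ?thesis using h(4) by simp
  qed
  finally show "norm ((LINT z|lborel. cmod (mollify (\<epsilon> n) g z - g z)) - 0) < r"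
   by (simp add: integral_nonneg)
 qed
qed

section \<open>Weak derivatives\<close>

text \<open>The regularity part of \<open>beltrami_solution_on\<close> with the weak derivatives as
  explicit arguments and without the equation, so that calculus rules can be stated for
  them.\<close>

definition weak_wirtinger ::
 "complex set \<Rightarrow> (complex \<Rightarrow> complex) \<Rightarrow> (complex \<Rightarrow> complex) \<Rightarrow> (complex \<Rightarrow> complex) \<Rightarrow> bool"
where
 "weak_wirtinger Y f g h \<longleftrightarrow> open Y \<and> continuous_on Y f \<and> locally_L2 Y g \<and> locally_L2 Y h \<and>
  (\<forall>\<phi> p q. test_function Y \<phi> p q \<longrightarrow>
    (LINT z:Y|lborel. f z * p z) = - (LINT z:Y|lborel. g z * \<phi> z) \<and>
    (LINT z:Y|lborel. f z * q z) = - (LINT z:Y|lborel. h z * \<phi> z))"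

lemma test_function_wirtinger: "test_function Y \<phi> p q \<Longrightarrow> wirtinger \<phi> (p z) (q z) z"
 unfolding test_function_def wirtinger_def by blast

lemma test_function_continuous:
 assumes "test_function Y \<phi> p q"
 shows "continuous_on UNIV p" "continuous_on UNIV q" "continuous_on UNIV \<phi>"
 using assms wirtinger_continuous[OF test_function_wirtinger[OF assms]]
 by (auto simp: test_function_def intro!: continuous_at_imp_continuous_on)

lemma test_function_support:
 assumes "test_function Y \<phi> p q"
 obtains K where "compact K" "K \<subseteq> Y" "\<forall>z. z \<notin> K \<longrightarrow> \<phi> z = 0 \<and> p z = 0 \<and> q z = 0"
proof -
 obtain K where K: "compact K" "K \<subseteq> Y" "\<forall>z. z \<notin> K \<longrightarrow> \<phi> z = 0"
  using assms unfolding test_function_def by blast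
 have "p z = 0" "q z = 0" if "z \<notin> K" for z
  using wirtinger_zero_off[OF test_function_wirtinger[OF assms] compact_imp_closed[OF K(1)] that] K(3) by auto
 with K that show thesis by blast
qed

lemma test_functionI:
 assumes "compact K" "K \<subseteq> Y" "\<And>z. z \<notin> K \<Longrightarrow> \<phi> z = 0" "\<And>z. wirtinger \<phi> (p z) (q z) z"
  "continuous_on UNIV p" "continuous_on UNIV q"
 shows "test_function Y \<phi> p q"
 using assms unfolding test_function_def wirtinger_def by blast

lemma compact_bound:
 fixes f :: "'a::metric_space \<Rightarrow> 'b::real_normed_vector"
 assumes "compact K" "continuous_on K f"
 obtains B where "B > 0" "\<And>z. z \<in> K \<Longrightarrow> norm (f z) \<le> B"
proof -
 have "bounded (f ` K)" by (intro compact_imp_bounded compact_continuous_image assms)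
 then show thesis using that unfolding bounded_pos by blast
qed

lemma locally_L2_restrict:
 assumes "locally_L2 Y g" "compact L" "L \<subseteq> Y"
 shows "(\<lambda>z. indicator L z *\<^sub>R g z) \<in> borel_measurable borel"
  "integrable lborel (\<lambda>z. indicator L z *\<^sub>R g z)"
  "integrable lborel (\<lambda>z. (cmod (indicator L z *\<^sub>R g z))\<^sup>2)"
proof -
 have "(\<lambda>z. indicator Y z *\<^sub>R g z) \<in> borel_measurable borel"
  using assms(1) by (simp add: locally_L2_def set_borel_measurable_def)
 moreover have "L \<in> sets borel" using assms(2) by (simp add: borel_compact)
 ultimately have "(\<lambda>z. indicator L z *\<^sub>R (indicator Y z *\<^sub>R g z)) \<in> borel_measurable borel"
  by measurable
 also have "(\<lambda>z. indicator L z *\<^sub>R (indicator Y z *\<^sub>R g z)) = (\<lambda>z. indicator L z *\<^sub>R g z)"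
  using assms(3) by (auto simp: fun_eq_iff indicator_def)
 finally show m: "(\<lambda>z. indicator L z *\<^sub>R g z) \<in> borel_measurable borel" .
 have "set_integrable lborel L (\<lambda>z. (cmod (g z))\<^sup>2)"
  using assms by (simp add: locally_L2_def)
 also have "(\<lambda>z. indicator L z *\<^sub>R ((cmod (g z))^2)) = (\<lambda>z. (cmod (indicator L z *\<^sub>R g z))\<^sup>2)"
  by (auto simp: fun_eq_iff indicator_def)
 ultimately show i2: "integrable lborel (\<lambda>z. (cmod (indicator L z *\<^sub>R g z))\<^sup>2)"
  by (simp add: set_integrable_def)
 have iL: "integrable lborel (indicator L :: complex \<Rightarrow> real)"
  using borel_integrable_compact[OF assms(2), of "\<lambda>_. 1::real"] by simp
 show "integrable lborel (\<lambda>z. indicator L z *\<^sub>R g z)"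
 proof (rule Bochner_Integration.integrable_bound[of _ "\<lambda>z. indicator L z + (cmod (indicator L z *\<^sub>R g z))^2"])
  show "integrable lborel (\<lambda>z. indicator L z + (cmod (indicator L z *\<^sub>R g z))^2)"
   using iL i2 by (rule Bochner_Integration.integrable_add)
  show "AE x in lborel. cmod (indicator L x *\<^sub>R g x) \<le> norm (indicator L x + (cmod (indicator L x *\<^sub>R g x))^2)"
  proof (intro always_eventually allI)
   fix x
   \<comment> \<open>Source of |g| \<le> 1 + |g|^2, by which L^2 on a compact set implies L^1
     there.\<close>
   have "0 \<le> (cmod (g x) - 1)^2" by simp
   then have "2 * cmod (g x) \<le> 1 + (cmod (g x))^2" by (simp add: power2_diff)
   with norm_ge_zero[of "g x"] have "cmod (g x) \<le> 1 + (cmod (g x))^2" by linarith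
   then show "cmod (indicator L x *\<^sub>R g x) \<le> norm (indicator L x + (cmod (indicator L x *\<^sub>R g x))^2)"
    by (auto simp: indicator_def)
  qed
 qed (use m in simp)
qed

lemma set_borel_measurable_mult:
 fixes f g :: "complex \<Rightarrow> complex"
 assumes "set_borel_measurable lborel Y f" "set_borel_measurable lborel Y g"
 shows "set_borel_measurable lborel Y (\<lambda>z. f z * g z)"
proof -
 have "(\<lambda>z. (indicator Y z *\<^sub>R f z) * (indicator Y z *\<^sub>R g z)) \<in> borel_measurable borel"
  using assms unfolding set_borel_measurable_def by measurable
 also have "(\<lambda>z. (indicator Y z *\<^sub>R f z) * (indicator Y z *\<^sub>R g z)) = (\<lambda>z. indicator Y z *\<^sub>R (f z * g z))"
  by (auto simp: indicator_def)
 finally show ?thesis by (simp add: set_borel_measurable_def)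
qed

lemma set_borel_measurable_continuous:
 fixes f :: "complex \<Rightarrow> complex"
 assumes "open Y" "continuous_on Y f"
 shows "set_borel_measurable lborel Y f"
 unfolding set_borel_measurable_def
 using borel_measurable_continuous_on_indicator[of Y f] assms by (simp add: borel_open)

lemma locally_L2_mult:
 assumes "open Y" "continuous_on Y b" "locally_L2 Y g"
 shows "locally_L2 Y (\<lambda>z. b z * g z)"
 unfolding locally_L2_def
proof (intro conjI allI impI)
 show m: "set_borel_measurable lborel Y (\<lambda>z. b z * g z)"
  using assms(3) by (intro set_borel_measurable_mult[OF set_borel_measurable_continuous[OF assms(1,2)]]) (auto simp: locally_L2_def)
 fix K assume K: "compact K" "K \<subseteq> Y"
 then obtain B where B: "B > 0" "\<And>z. z \<in> K \<Longrightarrow> norm (b z) \<le> B"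
  using compact_bound continuous_on_subset[OF assms(2)] by metis
 note r = locally_L2_restrict[OF assms(3) K]
 have bm: "(\<lambda>z. indicator K z *\<^sub>R b z) \<in> borel_measurable borel"
  using borel_measurable_continuous_on_indicator[of K b] K continuous_on_subset[OF assms(2)] by (simp add: borel_compact)
 show "set_integrable lborel K (\<lambda>z. (cmod (b z * g z))\<^sup>2)"
  unfolding set_integrable_def
 proof (rule Bochner_Integration.integrable_bound[of _ "\<lambda>z. B\<^sup>2 * (cmod (indicator K z *\<^sub>R g z))^2"])
  show "integrable lborel (\<lambda>z. B\<^sup>2 * (cmod (indicator K z *\<^sub>R g z))^2)" using r by simp
  have "(\<lambda>z. (cmod ((indicator K z *\<^sub>R b z) * (indicator K z *\<^sub>R g z)))\<^sup>2) \<in> borel_measurable borel"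
   using bm r(1) by measurable
  also have "(\<lambda>z. (cmod ((indicator K z *\<^sub>R b z) * (indicator K z *\<^sub>R g z)))\<^sup>2) = (\<lambda>z. indicator K z *\<^sub>R ((cmod (b z * g z))^2))"
   by (auto simp: indicator_def)
  finally show "(\<lambda>z. indicator K z *\<^sub>R ((cmod (b z * g z))^2)) \<in> borel_measurable lborel" by simp
  show "AE x in lborel. norm (indicator K x *\<^sub>R ((cmod (b x * g x))^2)) \<le> norm (B^2 * (cmod (indicator K x *\<^sub>R g x))^2)"
  proof (intro always_eventually allI)
   fix x
   have "(cmod (b x * g x))\<^sup>2 \<le> (B * cmod (g x))^2" if "x \<in> K"
    unfolding norm_mult using B that by (intro power_mono mult_right_mono) auto
   then show "norm (indicator K x *\<^sub>R ((cmod (b x * g x))^2)) \<le> norm (B^2 * (cmod (indicator K x *\<^sub>R g x))^2)"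
    by (auto simp: indicator_def power_mult_distrib)
  qed
 qed
qed

lemma locally_L2_continuous:
 assumes "open Y" "continuous_on Y g"
 shows "locally_L2 Y g"
 unfolding locally_L2_def
proof (intro conjI allI impI)
 show "set_borel_measurable lborel Y g" by (rule set_borel_measurable_continuous[OF assms])
 fix K assume K: "compact K" "K \<subseteq> Y"
 have c: "continuous_on K (\<lambda>z. (cmod (g z))\<^sup>2)"
  using continuous_on_subset[OF assms(2) K(2)] by (intro continuous_intros)
 show "set_integrable lborel K (\<lambda>z. (cmod (g z))\<^sup>2)"
  by (rule borel_integrable_compact[OF K(1) c, folded set_integrable_def, simplified])
qed

lemma locally_L2_add:
 assumes "locally_L2 Y g" "locally_L2 Y h"
 shows "locally_L2 Y (\<lambda>z. g z + h z)"
 unfolding locally_L2_def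
proof (intro conjI allI impI)
 have "(\<lambda>z. indicator Y z *\<^sub>R g z + indicator Y z *\<^sub>R h z) \<in> borel_measurable borel"
  using assms unfolding locally_L2_def set_borel_measurable_def by (auto intro: borel_measurable_add)
 then show "set_borel_measurable lborel Y (\<lambda>z. g z + h z)"
  by (simp add: set_borel_measurable_def scaleR_add_right)
 fix K assume K: "compact K" "K \<subseteq> Y"
 note r = locally_L2_restrict[OF assms(1) K] locally_L2_restrict[OF assms(2) K]
 show "set_integrable lborel K (\<lambda>z. (cmod (g z + h z))\<^sup>2)"
  unfolding set_integrable_def
 proof (rule Bochner_Integration.integrable_bound[of _ "\<lambda>z. 2 * (cmod (indicator K z *\<^sub>R g z))^2 + 2 * (cmod (indicator K z *\<^sub>R h z))^2"])
  show "integrable lborel (\<lambda>z. 2 * (cmod (indicator K z *\<^sub>R g z))^2 + 2 * (cmod (indicator K z *\<^sub>R h z))^2)" using r by simp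
  have "(\<lambda>z. (cmod ((indicator K z *\<^sub>R g z) + (indicator K z *\<^sub>R h z)))\<^sup>2) \<in> borel_measurable borel"
   using r(1,4) by measurable
  also have "(\<lambda>z. (cmod ((indicator K z *\<^sub>R g z) + (indicator K z *\<^sub>R h z)))\<^sup>2) = (\<lambda>z. indicator K z *\<^sub>R ((cmod (g z + h z))^2))"
   by (auto simp: indicator_def)
  finally show "(\<lambda>z. indicator K z *\<^sub>R ((cmod (g z + h z))^2)) \<in> borel_measurable lborel" by simp
  show "AE x in lborel. norm (indicator K x *\<^sub>R ((cmod (g x + h x))^2)) \<le> norm (2 * (cmod (indicator K x *\<^sub>R g x))^2 + 2 * (cmod (indicator K x *\<^sub>R h x))^2)"
  proof (intro always_eventually allI)
   fix x
   have "(cmod (g x + h x))\<^sup>2 \<le> (cmod (g x) + cmod (h x))^2"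
    by (intro power_mono norm_triangle_ineq) auto
   also have "\<dots> \<le> 2 * (cmod (g x))^2 + 2 * (cmod (h x))^2"
    using sum_squares_bound[of "cmod (g x)" "cmod (h x)"] by (simp add: power2_sum)
   finally show "norm (indicator K x *\<^sub>R ((cmod (g x + h x))^2)) \<le> norm (2 * (cmod (indicator K x *\<^sub>R g x))^2 + 2 * (cmod (indicator K x *\<^sub>R h x))^2)"
    by (auto simp: indicator_def)
  qed
 qed
qed

lemma locally_L2_subset: "locally_L2 Y g \<Longrightarrow> open Y' \<Longrightarrow> Y' \<subseteq> Y \<Longrightarrow> locally_L2 Y' g"
proof -
 assume a: "locally_L2 Y g" "open Y'" "Y' \<subseteq> Y"
 have "(\<lambda>z. indicator Y' z *\<^sub>R (indicator Y z *\<^sub>R g z)) \<in> borel_measurable borel"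
 proof (rule borel_measurable_scaleR)
  show "indicat_real Y' \<in> borel_measurable borel" using a(2) by (simp add: borel_open)
 qed (use a(1) in \<open>simp add: locally_L2_def set_borel_measurable_def\<close>)
 also have "(\<lambda>z. indicator Y' z *\<^sub>R (indicator Y z *\<^sub>R g z)) = (\<lambda>z. indicator Y' z *\<^sub>R g z)"
  using a(3) by (auto simp: fun_eq_iff indicator_def)
 finally show ?thesis using a unfolding locally_L2_def set_borel_measurable_def by auto
qed

text \<open>The reflected and shifted mollifier t -> \<open>mollifier e (z - t)\<close> is itself an
  admissible test function; testing with it moves the derivative from the kernel onto f.\<close>

lemma mollify_weak_derivative:
 assumes weak: "weak_wirtinger Y f g h" and L: "compact L" "L \<subseteq> Y" and z: "cball z e \<subseteq> L" and e: "e > 0"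
 shows "convolution (\<lambda>z. indicator L z *\<^sub>R f z) (mollifier_p e) z = mollify e (\<lambda>z. indicator L z *\<^sub>R g z) z"
  "convolution (\<lambda>z. indicator L z *\<^sub>R f z) (mollifier_q e) z = mollify e (\<lambda>z. indicator L z *\<^sub>R h z) z"
proof -
 define \<phi> where "\<phi> t = complex_of_real (mollifier e (z - t))" for t
 have \<phi>0: "\<phi> t = 0" if "t \<notin> cball z e" for t
  unfolding \<phi>_def using that by (simp add: dist_norm mollifier_eq_0 e)
 have "test_function Y \<phi> (\<lambda>t. - mollifier_p e (z - t)) (\<lambda>t. - mollifier_q e (z - t))"
 proof (rule test_functionI[of "cball z e"])
  show "wirtinger \<phi> (- mollifier_p e (z - t)) (- mollifier_q e (z - t)) t" for t
   unfolding \<phi>_def by (rule wirtinger_reflect) (rule wirtinger_mollifier[OF e])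
  show "continuous_on UNIV (\<lambda>t. - mollifier_p e (z - t))"
   by (intro continuous_intros continuous_on_compose2[OF continuous_on_mollifier_derivatives(2)[of UNIV]]) auto
  show "continuous_on UNIV (\<lambda>t. - mollifier_q e (z - t))"
   by (intro continuous_intros continuous_on_compose2[OF continuous_on_mollifier_derivatives(3)[of UNIV]]) auto
 qed (use \<phi>0 z L in auto)
 then have 1: "(LINT t:Y|lborel. f t * - mollifier_p e (z - t)) = - (LINT t:Y|lborel. g t * \<phi> t)"
  and 2: "(LINT t:Y|lborel. f t * - mollifier_q e (z - t)) = - (LINT t:Y|lborel. h t * \<phi> t)"
  using weak unfolding weak_wirtinger_def by blast+
 have eq: "(\<lambda>t. indicator Y t *\<^sub>R (f t * b t)) = (\<lambda>t. (indicator L t *\<^sub>R f t) * b t)"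
  if "\<And>t. t \<notin> cball z e \<Longrightarrow> b t = 0" for b f :: "complex \<Rightarrow> complex"
 proof
  fix t show "indicator Y t *\<^sub>R (f t * b t) = (indicator L t *\<^sub>R f t) * b t"
   using that[of t] L(2) z by (cases "t \<in> cball z e") (auto simp: indicator_def)
 qed
 have eq': "(LINT t:Y|lborel. F t * b t) = (LINT t|lborel. (indicator L t *\<^sub>R F t) * b t)"
  if "\<And>t. t \<notin> cball z e \<Longrightarrow> b t = 0" for b F :: "complex \<Rightarrow> complex"
  unfolding set_lebesgue_integral_def by (rule arg_cong[OF eq[OF that]])
 have z0: "- mollifier_p e (z - t) = 0" "- mollifier_q e (z - t) = 0" if "t \<notin> cball z e" for t
  using that mollifier_derivatives_eq_0[OF e, of "z - t"] by (auto simp: dist_norm)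
 show "convolution (\<lambda>z. indicator L z *\<^sub>R f z) (mollifier_p e) z = mollify e (\<lambda>z. indicator L z *\<^sub>R g z) z"
  using 1 eq'[where b="\<lambda>t. - mollifier_p e (z - t)" and F=f, OF z0(1)] eq'[where b=\<phi> and F=g, OF \<phi>0] by (simp add: convolution_def \<phi>_def)
 show "convolution (\<lambda>z. indicator L z *\<^sub>R f z) (mollifier_q e) z = mollify e (\<lambda>z. indicator L z *\<^sub>R h z) z"
  using 2 eq'[where b="\<lambda>t. - mollifier_q e (z - t)" and F=f, OF z0(2)] eq'[where b=\<phi> and F=h, OF \<phi>0] by (simp add: convolution_def \<phi>_def)
qed

text \<open>A bundle of approximations of f near K: F tends to f uniformly, the derivatives P and Q
  tend to g and h only in L^1. The last clause records that Q vanishes identically near K once h = 0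
  almost everywhere.\<close>

definition mollified where
 "mollified Y K f g h W L F P Q \<longleftrightarrow> open W \<and> K \<subseteq> W \<and> W \<subseteq> L \<and> compact L \<and> L \<subseteq> Y \<and>
  (\<forall>j z. wirtinger (F j) (P j z) (Q j z) z) \<and>
  (\<forall>j. continuous_on UNIV (P j)) \<and> (\<forall>j. continuous_on UNIV (Q j)) \<and>
  uniform_limit W F f sequentially \<and>
  (\<lambda>j::nat. LINT z|lborel. indicator W z * cmod (P j z - g z)) \<longlonglongrightarrow> 0 \<and>
  (\<lambda>j::nat. LINT z|lborel. indicator W z * cmod (Q j z - h z)) \<longlonglongrightarrow> 0 \<and>
  ((AE z in lborel. z \<in> Y \<longrightarrow> h z = 0) \<longrightarrow> (\<forall>j z. z \<in> W \<longrightarrow> Q j z = 0))"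

lemma weak_wirtinger_mollify:
 assumes weak: "weak_wirtinger Y f g h" and K: "compact K" "K \<subseteq> Y" "K \<noteq> {}"
 shows "\<exists>W L F P Q. mollified Y K f g h W L F P Q"
proof -
 have op: "open Y" and cf: "continuous_on Y f" and L2: "locally_L2 Y g" "locally_L2 Y h"
  using weak by (auto simp: weak_wirtinger_def)
 obtain \<delta> where \<delta>: "\<delta> > 0" "(\<Union>x\<in>K. cball x \<delta>) \<subseteq> Y"
  using compact_subset_open_imp_cball_epsilon_subset[OF K(1) op K(2)] by blast
 \<comment> \<open>Two neighbourhoods of K: mollifying at radius at most \<open>\<delta>\<close> / 2
   at a point of W sees only values on L. K must be nonempty here, since
   \<open>infdist z {} = 0\<close>.\<close>
 define L where "L = {z. infdist z K \<le> \<delta>}"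
 define W where "W = {z. infdist z K < \<delta> / 2}"
 have W: "open W" unfolding W_def by (intro open_Collect_less continuous_intros)
 have KW: "K \<subseteq> W" using \<delta> by (auto simp: W_def)
 have WL: "W \<subseteq> L" using \<delta> by (auto simp: W_def L_def)
 have L: "compact L" unfolding L_def using K by (intro compact_infdist_le \<delta>) auto
 have LY: "L \<subseteq> Y"
 proof
  fix z assume z: "z \<in> L"
  obtain x where "x \<in> K" "infdist z K = dist z x" using infdist_attains_inf[of K z] K compact_imp_closed by metis
  then have "z \<in> (\<Union>x\<in>K. cball x \<delta>)" using z by (auto simp: L_def dist_commute)
  then show "z \<in> Y" using \<delta> by blast
 qed
 define \<epsilon> where "\<epsilon> j = \<delta> / (2 * (real j + 1))" for j :: nat
 have \<epsilon>: "\<epsilon> j > 0" "\<epsilon> j \<le> \<delta> / 2" for j using \<delta> by (auto simp: \<epsilon>_def field_simps)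
 have \<epsilon>lim: "\<epsilon> \<longlonglongrightarrow> 0" unfolding \<epsilon>_def by real_asymp
 have ball: "cball z (\<epsilon> j) \<subseteq> L" if "z \<in> W" for z j
 proof
  fix y assume "y \<in> cball z (\<epsilon> j)"
  then have "infdist y K \<le> infdist z K + \<epsilon> j" using infdist_triangle[of y K z] by (auto simp: dist_commute)
  then show "y \<in> L" using that \<epsilon>(2)[of j] by (auto simp: W_def L_def)
 qed
 define f' where "f' z = indicator L z *\<^sub>R f z" for z
 define g' where "g' z = indicator L z *\<^sub>R g z" for z
 define h' where "h' z = indicator L z *\<^sub>R h z" for z
 have f'i: "integrable lborel f'"
  using borel_integrable_compact[OF L continuous_on_subset[OF cf LY]] by (simp add: f'_def[abs_def])
 have g'i: "integrable lborel g'" and h'i: "integrable lborel h'"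
  using locally_L2_restrict(2)[OF L2(1) L LY] locally_L2_restrict(2)[OF L2(2) L LY]
  by (simp_all add: g'_def[abs_def] h'_def[abs_def])
 define p where "p j = mollifier_p (\<epsilon> j)" for j
 define q where "q j = mollifier_q (\<epsilon> j)" for j
 have pq: "\<And>j z. wirtinger (mollify (\<epsilon> j) f') (convolution f' (p j) z) (convolution f' (q j) z) z"
  "\<And>j. continuous_on UNIV (convolution f' (p j))" "\<And>j. continuous_on UNIV (convolution f' (q j))"
  unfolding p_def q_def by (intro wirtinger_mollify mollify_continuous f'i \<epsilon>)+
 have pqW: "convolution f' (p j) z = mollify (\<epsilon> j) g' z" "convolution f' (q j) z = mollify (\<epsilon> j) h' z" if "z \<in> W" for j z
  using mollify_weak_derivative[OF weak L LY ball[OF that] \<epsilon>(1)]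
  by (simp_all add: f'_def[abs_def] g'_def[abs_def] h'_def[abs_def] p_def q_def)
 obtain R where R: "L \<subseteq> cball 0 R"
  using compact_imp_bounded[OF L] by (auto simp: bounded_iff subset_eq)
 have L1: "(\<lambda>j::nat. LINT z|lborel. indicator W z * cmod (convolution f' (p j) z - g z)) \<longlonglongrightarrow> 0"
  if i: "integrable lborel g'" and e: "\<And>j z. z \<in> W \<Longrightarrow> convolution f' (p j) z = mollify (\<epsilon> j) g' z"
   and g': "g' = (\<lambda>z. indicator L z *\<^sub>R g z)" for g g' p
 proof (rule Lim_null_comparison)
  show "(\<lambda>j. LINT z|lborel. cmod (mollify (\<epsilon> j) g' z - g' z)) \<longlonglongrightarrow> 0"
   by (rule mollify_L1_tendsto[OF i _ \<epsilon>(1) \<epsilon>lim, of R]) (use R in \<open>auto simp: g' indicator_def subset_eq\<close>)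
  show "\<forall>\<^sub>F j in sequentially. norm (LINT z|lborel. indicator W z * cmod (convolution f' (p j) z - g z)) \<le> (LINT z|lborel. cmod (mollify (\<epsilon> j) g' z - g' z))"
  proof (intro always_eventually allI)
   fix j
   have ptw: "indicator W z * cmod (convolution f' (p j) z - g z) = indicator W z * cmod (mollify (\<epsilon> j) g' z - g' z)" for z
    using e[of z j] WL by (auto simp: indicator_def g')
   have i3: "integrable lborel (\<lambda>z. cmod (mollify (\<epsilon> j) g' z - g' z))"
    using mollify_integrable(1)[OF i \<epsilon>(1)] i by auto
   have i4: "integrable lborel (\<lambda>z. indicator W z * cmod (mollify (\<epsilon> j) g' z - g' z))"
    using integrable_mult_indicator[OF _ i3, of W] W by (simp add: borel_open)
   have "(LINT z|lborel. indicator W z * cmod (mollify (\<epsilon> j) g' z - g' z)) \<le> (LINT z|lborel. cmod (mollify (\<epsilon> j) g' z - g' z))"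
    by (rule integral_mono[OF i4 i3]) (auto simp: indicator_def)
   moreover have "0 \<le> (LINT z|lborel. indicator W z * cmod (mollify (\<epsilon> j) g' z - g' z))"
    by (rule integral_nonneg_AE) auto
   ultimately show "norm (LINT z|lborel. indicator W z * cmod (convolution f' (p j) z - g z)) \<le> (LINT z|lborel. cmod (mollify (\<epsilon> j) g' z - g' z))"
    unfolding ptw by simp
  qed
 qed
 have unif: "uniform_limit W (\<lambda>j. mollify (\<epsilon> j) f') f sequentially"
  unfolding uniform_limit_sequentially_iff
 proof (intro allI impI)
  fix r :: real assume r: "r > 0"
  have "uniformly_continuous_on L f"
   by (intro compact_uniformly_continuous L continuous_on_subset[OF cf LY])
  then obtain d where d: "d > 0" "\<And>x y. x \<in> L \<Longrightarrow> y \<in> L \<Longrightarrow> dist x y < d \<Longrightarrow> dist (f x) (f y) < r/2"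
   unfolding uniformly_continuous_on_def using r half_gt_zero by metis
  have "eventually (\<lambda>j. \<epsilon> j < d) sequentially"
   using order_tendstoD(2)[OF \<epsilon>lim, of d] d(1) by simp
  then obtain N where N: "\<And>j. j \<ge> N \<Longrightarrow> \<epsilon> j < d" by (auto simp: eventually_sequentially)
  have "dist (mollify (\<epsilon> n) f' x) (f x) < r" if n: "n \<ge> N" and x: "x \<in> W" for n x
  proof -
   have tt: "cmod (f' t - f x) \<le> r / 2" if t: "cmod (t - x) \<le> \<epsilon> n" for t
   proof -
    have "t \<in> L" "x \<in> L" using ball[OF x, of n] x WL t by (auto simp: dist_norm norm_minus_commute)
    with d(2)[of t x] N[OF n] t show ?thesis by (simp add: dist_norm f'_def)
   qed
   have "cmod (mollify (\<epsilon> n) f' x - f x) \<le> r / 2"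
    by (rule mollify_diff_le[OF f'i \<epsilon>(1) tt])
   then show ?thesis using r by (simp add: dist_norm)
  qed
  then show "\<exists>N. \<forall>n\<ge>N. \<forall>x\<in>W. dist (mollify (\<epsilon> n) f' x) (f x) < r" by blast
 qed
 have van: "convolution f' (q j) z = 0" if ae: "AE z in lborel. z \<in> Y \<longrightarrow> h z = 0" and z: "z \<in> W" for j z
 proof -
  have "mollify (\<epsilon> j) h' z = integral\<^sup>L lborel (\<lambda>t::complex. 0)"
   unfolding convolution_def
  proof (rule integral_cong_AE)
   show "(\<lambda>t. h' t * complex_of_real (mollifier (\<epsilon> j) (z - t))) \<in> borel_measurable lborel"
    using h'i by (auto dest: borel_measurable_integrable)
   show "AE t in lborel. h' t * complex_of_real (mollifier (\<epsilon> j) (z - t)) = 0"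
    using ae by eventually_elim (use LY in \<open>auto simp: h'_def indicator_def\<close>)
  qed simp
  then show ?thesis using pqW(2)[OF z] by simp
 qed
 have "mollified Y K f g h W L (\<lambda>j. mollify (\<epsilon> j) f') (\<lambda>j. convolution f' (p j)) (\<lambda>j. convolution f' (q j))"
  unfolding mollified_def
  using W KW WL L LY pq unif L1[OF g'i pqW(1)] L1[OF h'i pqW(2)] van
  by (simp add: g'_def[abs_def] h'_def[abs_def])
 then show ?thesis by blast
qed

section \<open>Calculus rules for weak derivatives\<close>

lemma weak_wirtingerD:
 assumes "weak_wirtinger Y f g h" "test_function Y \<phi> p q"
 shows "(LINT z|lborel. indicator Y z *\<^sub>R (f z * p z)) = - (LINT z|lborel. indicator Y z *\<^sub>R (g z * \<phi> z))"
  "(LINT z|lborel. indicator Y z *\<^sub>R (f z * q z)) = - (LINT z|lborel. indicator Y z *\<^sub>R (h z * \<phi> z))"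
 using assms unfolding weak_wirtinger_def set_lebesgue_integral_def by blast+

lemma weak_wirtingerI:
 assumes "open Y" "continuous_on Y f" "locally_L2 Y g" "locally_L2 Y h"
  "\<And>\<phi> p q. test_function Y \<phi> p q \<Longrightarrow>
   (LINT z|lborel. indicator Y z *\<^sub>R (f z * p z)) = - (LINT z|lborel. indicator Y z *\<^sub>R (g z * \<phi> z))"
  "\<And>\<phi> p q. test_function Y \<phi> p q \<Longrightarrow>
   (LINT z|lborel. indicator Y z *\<^sub>R (f z * q z)) = - (LINT z|lborel. indicator Y z *\<^sub>R (h z * \<phi> z))"
 shows "weak_wirtinger Y f g h"
 using assms unfolding weak_wirtinger_def set_lebesgue_integral_def by blast

text \<open>Weyl's lemma: the mollifications have dbar derivative 0 near each closed disc, hence are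
  holomorphic, and they converge uniformly.\<close>

lemma weak_wirtinger_holomorphic:
 assumes weak: "weak_wirtinger Y f g h" and ae: "AE z in lborel. z \<in> Y \<longrightarrow> h z = 0"
 shows "f holomorphic_on Y"
proof -
 have op: "open Y" using weak by (simp add: weak_wirtinger_def)
 have "\<exists>r>0. f holomorphic_on ball z r" if z: "z \<in> Y" for z
 proof -
  obtain r where r: "r > 0" "cball z r \<subseteq> Y" using op z open_contains_cball by blast
  obtain W L F P Q where m: "mollified Y (cball z r) f g h W L F P Q"
   using weak_wirtinger_mollify[OF weak, of "cball z r"] r by auto
  have W: "open W" "cball z r \<subseteq> W" and dF: "\<And>j z. wirtinger (F j) (P j z) (Q j z) z"
   and unif: "uniform_limit W F f sequentially" and Q0: "\<And>j z. z \<in> W \<Longrightarrow> Q j z = 0"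
   using m ae unfolding mollified_def by blast+
  have "F j field_differentiable at x" if "x \<in> W" for j x
   using dF[of j x] Q0[OF that, of j]
   unfolding field_differentiable_def by (auto intro: wirtinger_imp_field_derivative)
  then have hol: "F j holomorphic_on W" for j
   by (auto simp: holomorphic_on_def field_differentiable_at_within)
  have "continuous_on (cball z r) f \<and> f holomorphic_on ball z r"
  proof (rule holomorphic_uniform_limit[of z r F sequentially f])
   show "\<forall>\<^sub>F n in sequentially. continuous_on (cball z r) (F n) \<and> F n holomorphic_on ball z r"
    using hol W(2) by (intro always_eventually allI conjI)
     (meson holomorphic_on_imp_continuous_on holomorphic_on_subset ball_subset_cball order_trans)+
   show "uniform_limit (cball z r) F f sequentially" by (rule uniform_limit_on_subset[OF unif W(2)])
  qed auto
  then show ?thesis using r by blast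
 qed
 then show ?thesis
  by (metis analytic_on_def analytic_imp_holomorphic)
qed

lemma indicator_support_eq:
 fixes F :: "complex \<Rightarrow> complex"
 assumes "K \<subseteq> Y" "\<And>z. z \<notin> K \<Longrightarrow> F z = 0"
 shows "(\<lambda>z. indicator Y z *\<^sub>R F z) = (\<lambda>z. indicator K z *\<^sub>R F z)"
proof
 fix z show "indicator Y z *\<^sub>R F z = indicator K z *\<^sub>R F z"
  using assms by (cases "z \<in> K") (auto simp: indicator_def)
qed

lemma test_function_empty:
 assumes "test_function Y \<phi> p q" "\<And>z. \<phi> z = 0"
 shows "p = (\<lambda>z. 0)" "q = (\<lambda>z. 0)"
proof -
 have "wirtinger \<phi> (p z) (q z) z" for z using assms(1) by (auto simp: test_function_def wirtinger_def)
 moreover have "\<phi> = (\<lambda>z. 0)" using assms(2) by auto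
 ultimately have "wirtinger (\<lambda>z. 0) (p z) (q z) z" for z by simp
 from wirtinger_unique[OF this wirtinger_const] show "p = (\<lambda>z. 0)" "q = (\<lambda>z. 0)" by auto
qed

text \<open>Chain rule by approximation: for the smooth approximants A the product F(A) \<phi> is
  differentiable with compact support, so its derivatives integrate to 0, and this identity survives
  the limit.\<close>

lemma weak_wirtinger_compose:
 assumes weak: "weak_wirtinger Y f g h" and F: "F holomorphic_on V" "open V" "f ` Y \<subseteq> V"
 shows "weak_wirtinger Y (\<lambda>z. F (f z)) (\<lambda>z. deriv F (f z) * g z) (\<lambda>z. deriv F (f z) * h z)"
proof -
 have op: "open Y" and cf: "continuous_on Y f" and L2: "locally_L2 Y g" "locally_L2 Y h"
  using weak by (auto simp: weak_wirtinger_def)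
 have cF: "continuous_on V F" and cdF: "continuous_on V (deriv F)"
  using F by (auto intro!: holomorphic_on_imp_continuous_on holomorphic_deriv)
 have dF: "(F has_field_derivative deriv F y) (at y)" if "y \<in> V" for y
  using F that by (meson holomorphic_derivI)
 have main: "(LINT z|lborel. indicator Y z *\<^sub>R (F (f z) * p z)) = - (LINT z|lborel. indicator Y z *\<^sub>R (deriv F (f z) * g z * \<phi> z)) \<and>
  (LINT z|lborel. indicator Y z *\<^sub>R (F (f z) * q z)) = - (LINT z|lborel. indicator Y z *\<^sub>R (deriv F (f z) * h z * \<phi> z))"
  if test: "test_function Y \<phi> p q" for \<phi> p q
 proof -
  obtain K where K0: "compact K" "K \<subseteq> Y" "\<forall>z. z \<notin> K \<longrightarrow> \<phi> z = 0 \<and> p z = 0 \<and> q z = 0"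
   using test_function_support[OF test] by blast
  then have K: "compact K" "K \<subseteq> Y" "\<And>z. z \<notin> K \<Longrightarrow> \<phi> z = 0" "\<And>z. z \<notin> K \<Longrightarrow> p z = 0" "\<And>z. z \<notin> K \<Longrightarrow> q z = 0"
   by auto
  note d\<phi> = test_function_wirtinger[OF test] and cont = test_function_continuous[OF test]
  show ?thesis
  proof (cases "K = {}")
   case True
   then have "\<phi> z = 0" for z using K(3) by auto
   then show ?thesis using test_function_empty[OF test] by simp
  next
   case False
   obtain W L A P Q where m: "mollified Y K f g h W L A P Q"
    using weak_wirtinger_mollify[OF weak K(1,2) False] by blast
   have W: "open W" "K \<subseteq> W" "W \<subseteq> L" "compact L" "L \<subseteq> Y"
    and dA: "\<And>j z. wirtinger (A j) (P j z) (Q j z) z"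
    and cPQ: "\<And>j. continuous_on UNIV (P j)" "\<And>j. continuous_on UNIV (Q j)"
    and unif: "uniform_limit W A f sequentially"
    and L1: "(\<lambda>j::nat. LINT z|lborel. indicator W z * cmod (P j z - g z)) \<longlonglongrightarrow> 0"
     "(\<lambda>j::nat. LINT z|lborel. indicator W z * cmod (Q j z - h z)) \<longlonglongrightarrow> 0"
    using m unfolding mollified_def by blast+
   have cA: "continuous_on UNIV (A j)" for j
    by (intro continuous_at_imp_continuous_on ballI) (rule wirtinger_continuous[OF dA])
   have cfL: "continuous_on L f" by (rule continuous_on_subset[OF cf W(5)])
   have "compact (f ` L)" "f ` L \<subseteq> V" using W(4,5) F(3) cfL by (auto intro: compact_continuous_image)
   then obtain e where e: "e > 0" "(\<Union>x\<in>f ` L. cball x e) \<subseteq> V"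
    using compact_subset_open_imp_cball_epsilon_subset[of "f ` L" V] F(2) by blast
   \<comment> \<open>A compact neighbourhood of f(L) inside V. It contains all values of f and of
     the late approximants, so F and F' are bounded along the whole sequence.\<close>
   define T where "T = {y. infdist y (f ` L) \<le> e}"
   have Lne: "L \<noteq> {}" using False W by auto
   have T: "compact T" unfolding T_def using \<open>compact (f ` L)\<close> Lne e by (intro compact_infdist_le) auto
   have TV: "T \<subseteq> V"
   proof
    fix y assume y: "y \<in> T"
    obtain x where "x \<in> f ` L" "infdist y (f ` L) = dist y x"
     using infdist_attains_inf[of "f ` L" y] \<open>compact (f ` L)\<close> Lne compact_imp_closed by (metis image_is_empty)
    then have "y \<in> (\<Union>x\<in>f ` L. cball x e)" using y by (auto simp: T_def dist_commute)
    then show "y \<in> V" using e by blast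
   qed
   have fT: "f z \<in> T" if "z \<in> L" for z using that e by (auto simp: T_def)
   obtain N where N: "\<And>j z. j \<ge> N \<Longrightarrow> z \<in> W \<Longrightarrow> dist (A j z) (f z) < e"
    using unif e(1) unfolding uniform_limit_sequentially_iff by blast
   have AT: "A j z \<in> T" if "j \<ge> N" "z \<in> W" for j z
   proof -
    have "infdist (A j z) (f ` L) \<le> dist (A j z) (f z)" using that W by (intro infdist_le) auto
    then show ?thesis using N[OF that] by (auto simp: T_def)
   qed
   obtain B1 where B1: "B1 > 0" "\<And>y. y \<in> T \<Longrightarrow> norm (F y) \<le> B1"
    using compact_bound[OF T continuous_on_subset[OF cF TV]] by metis
   obtain B2 where B2: "B2 > 0" "\<And>y. y \<in> T \<Longrightarrow> norm (deriv F y) \<le> B2"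
    using compact_bound[OF T continuous_on_subset[OF cdF TV]] by metis
   obtain B3 where B3: "B3 > 0" "\<And>y. y \<in> K \<Longrightarrow> norm (\<phi> y) \<le> B3"
    using compact_bound[OF K(1) continuous_on_subset[OF cont(3) subset_UNIV]] by metis
   have Alim: "(\<lambda>j. A j z) \<longlonglongrightarrow> f z" if "z \<in> W" for z
    using tendsto_uniform_limitI[OF unif that] .
   have KL: "K \<subseteq> L" using W by auto
   have Kb: "K \<in> sets borel" using K(1) by (simp add: borel_compact)
   have iK: "integrable lborel (\<lambda>z. indicator K z :: real)"
    using borel_integrable_compact[OF K(1), of "\<lambda>_. 1::real"] by simp
   have cAK: "continuous_on K (\<lambda>z. F (A j z))" "continuous_on K (\<lambda>z. deriv F (A j z))" if "j \<ge> N" for j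
    using AT[OF that] TV W by (intro continuous_on_compose2[OF cF] continuous_on_compose2[OF cdF] continuous_on_subset[OF cA]; force)+
   have cfK: "continuous_on K (\<lambda>z. F (f z))" "continuous_on K (\<lambda>z. deriv F (f z))"
    using fT KL TV by (intro continuous_on_compose2[OF cF] continuous_on_compose2[OF cdF] continuous_on_subset[OF cfL]; force)+
   have zero: "(LINT z|lborel. indicator K z *\<^sub>R (deriv F (A j z) * P j z * \<phi> z + F (A j z) * p z)) = 0 \<and>
     (LINT z|lborel. indicator K z *\<^sub>R (deriv F (A j z) * Q j z * \<phi> z + F (A j z) * q z)) = 0" if j: "j \<ge> N" for j
   proof -
    define pX where "pX z = indicator K z *\<^sub>R (deriv F (A j z) * P j z * \<phi> z + F (A j z) * p z)" for z
    define qX where "qX z = indicator K z *\<^sub>R (deriv F (A j z) * Q j z * \<phi> z + F (A j z) * q z)" for z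
    have c: "continuous_on K (\<lambda>z. deriv F (A j z) * P j z * \<phi> z + F (A j z) * p z)"
     "continuous_on K (\<lambda>z. deriv F (A j z) * Q j z * \<phi> z + F (A j z) * q z)"
     by (intro continuous_intros cAK[OF j] continuous_on_subset[OF cPQ(1)] continuous_on_subset[OF cPQ(2)]
       continuous_on_subset[OF cont(1)] continuous_on_subset[OF cont(2)] continuous_on_subset[OF cont(3)]; simp)+
    have der: "wirtinger (\<lambda>z. F (A j z) * \<phi> z) (pX z) (qX z) z" for z
    proof (cases "z \<in> K")
     case True
     then have "A j z \<in> V" using AT[OF j] W TV by blast
     from wirtinger_mult[OF wirtinger_comp_field[OF dA dF[OF this]] d\<phi>] True
     show ?thesis by (simp add: pX_def qX_def)
    next
     case False
     have "wirtinger (\<lambda>z. F (A j z) * \<phi> z) 0 0 z"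
      by (rule wirtinger_transform[OF wirtinger_const[of 0], of "-K"])
       (use False K(3) compact_imp_closed[OF K(1)] in auto)
     then show ?thesis using False by (simp add: pX_def qX_def)
    qed
    obtain Bp where Bp: "Bp > 0" "\<And>z. z \<in> K \<Longrightarrow> cmod (deriv F (A j z) * P j z * \<phi> z + F (A j z) * p z) \<le> Bp"
     using compact_bound[OF K(1) c(1)] by metis
    obtain Bq where Bq: "Bq > 0" "\<And>z. z \<in> K \<Longrightarrow> cmod (deriv F (A j z) * Q j z * \<phi> z + F (A j z) * q z) \<le> Bq"
     using compact_bound[OF K(1) c(2)] by metis
    have m: "pX \<in> borel_measurable borel" "qX \<in> borel_measurable borel"
     unfolding pX_def[abs_def] qX_def[abs_def]
     by (intro borel_measurable_continuous_on_indicator Kb c)+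
    have b: "cmod (pX z) \<le> max Bp Bq" "cmod (qX z) \<le> max Bp Bq" for z
     using Bp Bq by (cases "z \<in> K"; force simp: pX_def qX_def)+
    obtain R where R: "K \<subseteq> cball 0 R"
     using compact_imp_bounded[OF K(1)] by (auto simp: bounded_iff subset_eq)
    have "F (A j z) * \<phi> z = 0" if "z \<notin> cball 0 R" for z
     using that R K(3)[of z] by (auto simp: subset_eq)
    from integral_wirtinger_eq_0[OF der m b this] show ?thesis by (simp add: pX_def qX_def)
   qed
   have lim: "(\<lambda>j. LINT z|lborel. indicator K z *\<^sub>R (deriv F (A j z) * P j z * \<phi> z + F (A j z) * p z)) \<longlonglongrightarrow>
     (LINT z|lborel. indicator K z *\<^sub>R (deriv F (f z) * g z * \<phi> z)) + (LINT z|lborel. indicator K z *\<^sub>R (F (f z) * p z))"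
    if L2g: "locally_L2 Y g" and L1g: "(\<lambda>j::nat. LINT z|lborel. indicator W z * cmod (P j z - g z)) \<longlonglongrightarrow> 0"
     and cP: "\<And>j. continuous_on UNIV (P j)" and cp: "continuous_on UNIV p" for P :: "nat \<Rightarrow> complex \<Rightarrow> complex" and g p
   proof -
    note gL = locally_L2_restrict[OF L2g W(4,5)]
    have WL: "W \<in> sets lborel" using W(1) by (simp add: borel_open)
    have Pi: "integrable lborel (\<lambda>z. indicator W z * cmod (P j z - g z))" for j
    proof -
     have "integrable lborel (\<lambda>z. indicator L z *\<^sub>R P j z)"
      using borel_integrable_compact[OF W(4) continuous_on_subset[OF cP subset_UNIV]] .
     with gL(2) have "integrable lborel (\<lambda>z. cmod (indicator L z *\<^sub>R P j z - indicator L z *\<^sub>R g z))" by auto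
     from integrable_mult_indicator[OF WL this]
     have "integrable lborel (\<lambda>x. indicat_real W x *\<^sub>R cmod (indicat_real L x *\<^sub>R P j x - indicat_real L x *\<^sub>R g x))" .
     also have "(\<lambda>x. indicat_real W x *\<^sub>R cmod (indicat_real L x *\<^sub>R P j x - indicat_real L x *\<^sub>R g x)) = (\<lambda>z. indicator W z * cmod (P j z - g z))"
      using W(3) by (auto simp: fun_eq_iff indicator_def)
     finally show ?thesis .
    qed
    have gK: "(\<lambda>z. indicator K z *\<^sub>R g z) \<in> borel_measurable borel" "integrable lborel (\<lambda>z. indicator K z *\<^sub>R g z)"
     using locally_L2_restrict[OF L2g K(1,2)] by auto
    have mK: "(\<lambda>z. indicator K z *\<^sub>R G z) \<in> borel_measurable borel" if "continuous_on K G" for G :: "complex \<Rightarrow> complex"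
     by (rule borel_measurable_continuous_on_indicator[OF Kb that])
    have cK: "continuous_on K (P j)" "continuous_on K p" "continuous_on K \<phi>" for j
     by (rule continuous_on_subset[OF cP] continuous_on_subset[OF cp] continuous_on_subset[OF cont(3)], simp)+
    \<comment> \<open>The part \<open>a\<close> carries the difference P - g and is small by L^1
      convergence with bounded factors; \<open>b\<close> and \<open>c\<close> converge pointwise
      under a fixed integrable bound.\<close>
    define a where "a j z = indicator K z *\<^sub>R (deriv F (A j z) * (P j z - g z) * \<phi> z)" for j z
    define b where "b j z = indicator K z *\<^sub>R (deriv F (A j z) * g z * \<phi> z)" for j z
    define c where "c j z = indicator K z *\<^sub>R (F (A j z) * p z)" for j z
    have meas_b: "b j \<in> borel_measurable borel" if "j \<ge> N" for j
    proof -
     have "b j = (\<lambda>z. (indicator K z *\<^sub>R (deriv F (A j z) * \<phi> z)) * (indicator K z *\<^sub>R g z))"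
      by (auto simp: b_def fun_eq_iff indicator_def)
     moreover have "(\<lambda>z. indicator K z *\<^sub>R (deriv F (A j z) * \<phi> z)) \<in> borel_measurable borel"
      by (intro mK continuous_intros cAK that cK)
     ultimately show ?thesis by (simp only: borel_measurable_times[OF _ gK(1)])
    qed
    have meas_bl: "(\<lambda>z. indicator K z *\<^sub>R (deriv F (f z) * g z * \<phi> z)) \<in> borel_measurable borel"
    proof -
     have "(\<lambda>z. indicator K z *\<^sub>R (deriv F (f z) * g z * \<phi> z)) = (\<lambda>z. (indicator K z *\<^sub>R (deriv F (f z) * \<phi> z)) * (indicator K z *\<^sub>R g z))"
      by (auto simp: b_def fun_eq_iff indicator_def)
     moreover have "(\<lambda>z. indicator K z *\<^sub>R (deriv F (f z) * \<phi> z)) \<in> borel_measurable borel"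
      by (intro mK continuous_intros cfK cK)
     ultimately show ?thesis by (simp only: borel_measurable_times[OF _ gK(1)])
    qed
    have meas_a: "a j \<in> borel_measurable borel" if "j \<ge> N" for j
    proof -
     have "a j = (\<lambda>z. indicator K z *\<^sub>R (deriv F (A j z) * P j z * \<phi> z) - b j z)"
      by (auto simp: a_def b_def fun_eq_iff indicator_def algebra_simps)
     moreover have "(\<lambda>z. indicator K z *\<^sub>R (deriv F (A j z) * P j z * \<phi> z)) \<in> borel_measurable borel"
      by (intro mK continuous_intros cAK that cK)
     ultimately show ?thesis using meas_b[OF that] by simp
    qed
    have ba: "cmod (a j z) \<le> B2 * B3 * (indicator W z * cmod (P j z - g z))" if "j \<ge> N" for j z
    proof (cases "z \<in> K")
     case True
     then have "cmod (deriv F (A j z)) * cmod (P j z - g z) * cmod (\<phi> z) \<le> B2 * cmod (P j z - g z) * B3"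
      using B2(2)[OF AT[OF that, of z]] B3(2)[of z] W(2) B2(1) by (intro mult_mono) auto
     then show ?thesis using True W(2) by (auto simp: a_def norm_mult mult_ac)
    qed (use B2 B3 in \<open>auto simp: a_def\<close>)
    have bb: "cmod (indicator K z *\<^sub>R (deriv F y * g z * \<phi> z)) \<le> B2 * B3 * cmod (indicator K z *\<^sub>R g z)" if "y \<in> T" for y z
    proof (cases "z \<in> K")
     case True
     then have "cmod (deriv F y) * cmod (g z) * cmod (\<phi> z) \<le> B2 * cmod (g z) * B3"
      using B2(2)[OF that] B3(2)[of z] B2(1) by (intro mult_mono) auto
     then show ?thesis using True by (auto simp: norm_mult mult_ac)
    qed auto
    obtain Bp where Bp: "Bp > 0" "\<And>z. z \<in> K \<Longrightarrow> cmod (p z) \<le> Bp"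
     using compact_bound[OF K(1) cK(2)] by metis
    have bc: "cmod (indicator K z *\<^sub>R (F y * p z)) \<le> B1 * Bp * indicator K z" if "y \<in> T" for y z
     using mult_mono[OF B1(2)[OF that] Bp(2)[of z]] B1(1) by (auto simp: norm_mult indicator_def)
    have ia: "integrable lborel (a j)" if "j \<ge> N" for j
     by (rule Bochner_Integration.integrable_bound[OF integrable_mult_right[OF Pi, of "B2 * B3"]])
      (use meas_a[OF that] ba[OF that] B2 B3 in auto)
    have bnz: "cmod (b j z) \<le> B2 * B3 * cmod (indicator K z *\<^sub>R g z)" if "j \<ge> N" for j z
     using bb[OF AT[OF that, of z], of z] W(2) by (cases "z \<in> K") (auto simp: b_def)
    have cnz: "cmod (c j z) \<le> B1 * Bp * indicator K z" if "j \<ge> N" for j z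
     using bc[OF AT[OF that, of z], of z] W(2) by (cases "z \<in> K") (auto simp: c_def)
    have ib: "integrable lborel (b j)" if "j \<ge> N" for j
     by (rule Bochner_Integration.integrable_bound[OF integrable_mult_right[OF integrable_norm[OF gK(2)], of "B2 * B3"]])
      (use meas_b[OF that] bnz[OF that] B2 B3 in auto)
    have mc: "c j \<in> borel_measurable borel" if "j \<ge> N" for j
     unfolding c_def by (intro mK continuous_intros cAK that cK)
    have ic: "integrable lborel (c j)" if "j \<ge> N" for j
     by (rule Bochner_Integration.integrable_bound[OF integrable_mult_right[OF iK, of "B1 * Bp"]])
      (use mc[OF that] cnz[OF that] B1 Bp in auto)
    have lima: "(\<lambda>j. integral\<^sup>L lborel (a (j + N))) \<longlonglongrightarrow> 0"
    proof (rule Lim_null_comparison)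
     show "(\<lambda>j. B2 * B3 * (LINT z|lborel. indicator W z * cmod (P (j + N) z - g z))) \<longlonglongrightarrow> 0"
      using tendsto_mult_left[OF LIMSEQ_ignore_initial_segment[OF L1g, of N], of "B2 * B3"] by simp
     show "\<forall>\<^sub>F j in sequentially. cmod (integral\<^sup>L lborel (a (j + N))) \<le> B2 * B3 * (LINT z|lborel. indicator W z * cmod (P (j + N) z - g z))"
     proof (intro always_eventually allI)
      fix j
      have "cmod (integral\<^sup>L lborel (a (j + N))) \<le> (LINT z|lborel. B2 * B3 * (indicator W z * cmod (P (j + N) z - g z)))"
       by (rule Bochner_Integration.integral_norm_bound_integral[OF ia integrable_mult_right[OF Pi] ba]) auto
      then show "cmod (integral\<^sup>L lborel (a (j + N))) \<le> B2 * B3 * (LINT z|lborel. indicator W z * cmod (P (j + N) z - g z))" by simp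
     qed
    qed
    have limb: "(\<lambda>j. integral\<^sup>L lborel (b (j + N))) \<longlonglongrightarrow> (LINT z|lborel. indicator K z *\<^sub>R (deriv F (f z) * g z * \<phi> z))"
    proof (rule integral_dominated_convergence[where w="\<lambda>z. B2 * B3 * cmod (indicator K z *\<^sub>R g z)"])
     show "integrable lborel (\<lambda>z. B2 * B3 * cmod (indicator K z *\<^sub>R g z))"
      by (intro integrable_mult_right integrable_norm gK(2))
     show "AE z in lborel. (\<lambda>j. b (j + N) z) \<longlonglongrightarrow> indicator K z *\<^sub>R (deriv F (f z) * g z * \<phi> z)"
     proof (intro always_eventually allI)
      fix z
      show "(\<lambda>j. b (j + N) z) \<longlonglongrightarrow> indicator K z *\<^sub>R (deriv F (f z) * g z * \<phi> z)"
      proof (cases "z \<in> K")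
       case True
       then have "isCont (deriv F) (f z)" using fT KL TV F(2) cdF continuous_on_eq_continuous_at by blast
       then have "(\<lambda>j. deriv F (A (j + N) z)) \<longlonglongrightarrow> deriv F (f z)"
        by (rule isCont_tendsto_compose[OF _ LIMSEQ_ignore_initial_segment[OF Alim]]) (use True W(2) in blast)
       then show ?thesis unfolding b_def by (intro tendsto_intros)
      qed (simp add: b_def)
     qed
    qed (use meas_bl meas_b bnz in auto)
    have limc: "(\<lambda>j. integral\<^sup>L lborel (c (j + N))) \<longlonglongrightarrow> (LINT z|lborel. indicator K z *\<^sub>R (F (f z) * p z))"
    proof (rule integral_dominated_convergence[where w="\<lambda>z. B1 * Bp * indicator K z"])
     show "integrable lborel (\<lambda>z. B1 * Bp * indicator K z)" using iK by auto
     show "AE z in lborel. (\<lambda>j. c (j + N) z) \<longlonglongrightarrow> indicator K z *\<^sub>R (F (f z) * p z)"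
     proof (intro always_eventually allI)
      fix z
      show "(\<lambda>j. c (j + N) z) \<longlonglongrightarrow> indicator K z *\<^sub>R (F (f z) * p z)"
      proof (cases "z \<in> K")
       case True
       then have "isCont F (f z)" using fT KL TV F(2) cF continuous_on_eq_continuous_at by blast
       then have "(\<lambda>j. F (A (j + N) z)) \<longlonglongrightarrow> F (f z)"
        by (rule isCont_tendsto_compose[OF _ LIMSEQ_ignore_initial_segment[OF Alim]]) (use True W(2) in blast)
       then show ?thesis unfolding c_def by (intro tendsto_intros)
      qed (simp add: c_def)
     qed
     show "(\<lambda>z. indicator K z *\<^sub>R (F (f z) * p z)) \<in> borel_measurable lborel"
      using mK[OF continuous_on_mult[OF cfK(1) cK(2)]] by simp
    qed (use mc cnz in auto)
    have eq: "(LINT z|lborel. indicator K z *\<^sub>R (deriv F (A (j + N) z) * P (j + N) z * \<phi> z + F (A (j + N) z) * p z))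
     = integral\<^sup>L lborel (a (j + N)) + integral\<^sup>L lborel (b (j + N)) + integral\<^sup>L lborel (c (j + N))" for j
    proof -
     have "(\<lambda>z. indicator K z *\<^sub>R (deriv F (A (j + N) z) * P (j + N) z * \<phi> z + F (A (j + N) z) * p z)) = (\<lambda>z. a (j + N) z + b (j + N) z + c (j + N) z)"
      by (auto simp: a_def b_def c_def fun_eq_iff indicator_def algebra_simps)
     then show ?thesis using ia ib ic by simp
    qed
    show ?thesis
     \<comment> \<open>The first N approximants may leave the domain of F, so limits are taken along
       the shifted sequence.\<close>
     by (rule LIMSEQ_offset[where k=N]) (unfold eq, use tendsto_add[OF tendsto_add[OF lima limb] limc] in simp)
   qed
   have lim0: "(\<lambda>j::nat. X j) \<longlonglongrightarrow> (0::complex)" if "\<And>j. j \<ge> N \<Longrightarrow> X j = 0" for X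
    by (rule tendsto_eventually) (use that in \<open>auto simp: eventually_sequentially\<close>)
   have "(LINT z|lborel. indicator K z *\<^sub>R (deriv F (f z) * g z * \<phi> z)) + (LINT z|lborel. indicator K z *\<^sub>R (F (f z) * p z)) = 0"
    by (rule LIMSEQ_unique[OF lim[OF L2(1) L1(1) cPQ(1) cont(1)] lim0]) (use zero in blast)
   moreover have "(LINT z|lborel. indicator K z *\<^sub>R (deriv F (f z) * h z * \<phi> z)) + (LINT z|lborel. indicator K z *\<^sub>R (F (f z) * q z)) = 0"
    by (rule LIMSEQ_unique[OF lim[OF L2(2) L1(2) cPQ(2) cont(2)] lim0]) (use zero in blast)
   moreover have "(\<lambda>z. indicator Y z *\<^sub>R (F (f z) * p z)) = (\<lambda>z. indicator K z *\<^sub>R (F (f z) * p z))"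
    "(\<lambda>z. indicator Y z *\<^sub>R (F (f z) * q z)) = (\<lambda>z. indicator K z *\<^sub>R (F (f z) * q z))"
    "(\<lambda>z. indicator Y z *\<^sub>R (deriv F (f z) * g z * \<phi> z)) = (\<lambda>z. indicator K z *\<^sub>R (deriv F (f z) * g z * \<phi> z))"
    "(\<lambda>z. indicator Y z *\<^sub>R (deriv F (f z) * h z * \<phi> z)) = (\<lambda>z. indicator K z *\<^sub>R (deriv F (f z) * h z * \<phi> z))"
    using K by (auto intro!: indicator_support_eq)
   ultimately show ?thesis by (simp add: add_eq_0_iff)
  qed
 qed
 show ?thesis
 proof (rule weak_wirtingerI[OF op])
  have "continuous_on Y (\<lambda>z. deriv F (f z))" using F(3) by (intro continuous_on_compose2[OF cdF cf]) auto
  then show "locally_L2 Y (\<lambda>z. deriv F (f z) * g z)" "locally_L2 Y (\<lambda>z. deriv F (f z) * h z)"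
   using L2 op by (auto intro: locally_L2_mult)
  show "continuous_on Y (\<lambda>z. F (f z))" using F(3) by (intro continuous_on_compose2[OF cF cf]) auto
 qed (use main in blast)+
qed

lemma locally_L2_test_integrable:
 assumes "locally_L2 Y g" "test_function Y \<phi> p q"
 shows "integrable lborel (\<lambda>z. indicator Y z *\<^sub>R (g z * \<phi> z))"
proof -
 obtain K where K: "compact K" "K \<subseteq> Y" "\<forall>z. z \<notin> K \<longrightarrow> \<phi> z = 0 \<and> p z = 0 \<and> q z = 0"
  using test_function_support[OF assms(2)] by blast
 note c = test_function_continuous[OF assms(2)]
 obtain B where B: "B > 0" "\<And>z. z \<in> K \<Longrightarrow> cmod (\<phi> z) \<le> B"
  using compact_bound[OF K(1) continuous_on_subset[OF c(3) subset_UNIV]] by metis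
 have "integrable lborel (\<lambda>z. (indicator K z *\<^sub>R g z) * \<phi> z)"
 proof (rule integrable_mult_bounded[OF locally_L2_restrict(2)[OF assms(1) K(1,2)]])
  show "cmod (\<phi> z) \<le> B" for z using B K by (cases "z \<in> K") auto
  show "\<phi> \<in> borel_measurable lborel" using borel_measurable_continuous_onI[OF c(3)] by simp
 qed
 also have "(\<lambda>z. (indicator K z *\<^sub>R g z) * \<phi> z) = (\<lambda>z. indicator Y z *\<^sub>R (g z * \<phi> z))"
  using K by (subst indicator_support_eq[of K]) (auto simp: fun_eq_iff indicator_def)
 finally show ?thesis .
qed

lemma continuous_test_integrable:
 assumes "continuous_on Y f" "test_function Y \<phi> p q"
 shows "integrable lborel (\<lambda>z. indicator Y z *\<^sub>R (f z * p z))"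
  "integrable lborel (\<lambda>z. indicator Y z *\<^sub>R (f z * q z))"
  "integrable lborel (\<lambda>z. indicator Y z *\<^sub>R (f z * \<phi> z))"
proof -
 obtain K where K: "compact K" "K \<subseteq> Y" "\<forall>z. z \<notin> K \<longrightarrow> \<phi> z = 0 \<and> p z = 0 \<and> q z = 0"
  using test_function_support[OF assms(2)] by blast
 note c = test_function_continuous[OF assms(2)]
 have *: "integrable lborel (\<lambda>z. indicator Y z *\<^sub>R (f z * b z))" if "continuous_on UNIV b" "\<And>z. z \<notin> K \<Longrightarrow> b z = 0" for b
 proof -
  have "continuous_on K (\<lambda>z. f z * b z)"
   by (intro continuous_intros continuous_on_subset[OF assms(1) K(2)] continuous_on_subset[OF that(1)]) auto
  from borel_integrable_compact[OF K(1) this] show ?thesis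
   by (subst indicator_support_eq[of K]) (use K that in auto)
 qed
 show "integrable lborel (\<lambda>z. indicator Y z *\<^sub>R (f z * p z))"
  "integrable lborel (\<lambda>z. indicator Y z *\<^sub>R (f z * q z))"
  "integrable lborel (\<lambda>z. indicator Y z *\<^sub>R (f z * \<phi> z))"
  using K by (auto intro!: * c)
qed

lemma weak_wirtinger_add:
 assumes "weak_wirtinger Y f g h" "weak_wirtinger Y f' g' h'"
 shows "weak_wirtinger Y (\<lambda>z. f z + f' z) (\<lambda>z. g z + g' z) (\<lambda>z. h z + h' z)"
proof (rule weak_wirtingerI)
 have a: "open Y" "continuous_on Y f" "locally_L2 Y g" "locally_L2 Y h"
  "continuous_on Y f'" "locally_L2 Y g'" "locally_L2 Y h'"
  using assms by (auto simp: weak_wirtinger_def)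
 then show "open Y" "continuous_on Y (\<lambda>z. f z + f' z)" "locally_L2 Y (\<lambda>z. g z + g' z)" "locally_L2 Y (\<lambda>z. h z + h' z)"
  by (auto intro: continuous_on_add locally_L2_add)
 fix \<phi> p q assume t: "test_function Y \<phi> p q"
 note i = continuous_test_integrable(1,2)[OF a(2) t] continuous_test_integrable(1,2)[OF a(5) t]
  locally_L2_test_integrable[OF a(3) t] locally_L2_test_integrable[OF a(4) t]
  locally_L2_test_integrable[OF a(6) t] locally_L2_test_integrable[OF a(7) t]
 note w = weak_wirtingerD[OF assms(1) t] weak_wirtingerD[OF assms(2) t]
 show "(LINT z|lborel. indicator Y z *\<^sub>R ((f z + f' z) * p z)) = - (LINT z|lborel. indicator Y z *\<^sub>R ((g z + g' z) * \<phi> z))"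
  using i w by (simp add: distrib_right scaleR_add_right Bochner_Integration.integral_add)
 show "(LINT z|lborel. indicator Y z *\<^sub>R ((f z + f' z) * q z)) = - (LINT z|lborel. indicator Y z *\<^sub>R ((h z + h' z) * \<phi> z))"
  using i w by (simp add: distrib_right scaleR_add_right Bochner_Integration.integral_add)
qed

lemma weak_wirtinger_cmult:
 assumes "weak_wirtinger Y f g h"
 shows "weak_wirtinger Y (\<lambda>z. c * f z) (\<lambda>z. c * g z) (\<lambda>z. c * h z)"
proof (rule weak_wirtingerI)
 have a: "open Y" "continuous_on Y f" "locally_L2 Y g" "locally_L2 Y h"
  using assms by (auto simp: weak_wirtinger_def)
 then show "open Y" "continuous_on Y (\<lambda>z. c * f z)" "locally_L2 Y (\<lambda>z. c * g z)" "locally_L2 Y (\<lambda>z. c * h z)"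
  by (auto intro!: continuous_on_mult locally_L2_mult continuous_on_const)
 fix \<phi> p q assume t: "test_function Y \<phi> p q"
 have eq: "(LINT z|lborel. indicator Y z *\<^sub>R (c * u z * v z)) = c * (LINT z|lborel. indicator Y z *\<^sub>R (u z * v z))" for u v :: "complex \<Rightarrow> complex"
  by (subst integral_mult_right_zero[symmetric]) (simp add: mult_ac)
 show "(LINT z|lborel. indicator Y z *\<^sub>R (c * f z * p z)) = - (LINT z|lborel. indicator Y z *\<^sub>R (c * g z * \<phi> z))"
  "(LINT z|lborel. indicator Y z *\<^sub>R (c * f z * q z)) = - (LINT z|lborel. indicator Y z *\<^sub>R (c * h z * \<phi> z))"
  unfolding eq using weak_wirtingerD[OF assms(1) t] by simp_all
qed

lemma test_function_mono: "test_function Y' \<phi> p q \<Longrightarrow> Y' \<subseteq> Y \<Longrightarrow> test_function Y \<phi> p q"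
 unfolding test_function_def by blast

lemma weak_wirtinger_subset:
 assumes "weak_wirtinger Y f g h" "open Y'" "Y' \<subseteq> Y"
 shows "weak_wirtinger Y' f g h"
proof (rule weak_wirtingerI)
 show "open Y'" "continuous_on Y' f" "locally_L2 Y' g" "locally_L2 Y' h"
  using assms by (auto simp: weak_wirtinger_def intro: continuous_on_subset locally_L2_subset)
 fix \<phi> p q assume t: "test_function Y' \<phi> p q"
 obtain K where K: "compact K" "K \<subseteq> Y'" "\<forall>z. z \<notin> K \<longrightarrow> \<phi> z = 0 \<and> p z = 0 \<and> q z = 0"
  using test_function_support[OF t] by blast
 have e: "(\<lambda>z. indicator Y' z *\<^sub>R (u z * v z)) = (\<lambda>z. indicator Y z *\<^sub>R (u z * v z))"
  if "\<And>z. z \<notin> K \<Longrightarrow> v z = 0" for u v :: "complex \<Rightarrow> complex"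
  using that K(2) assms(3) by (subst (1 2) indicator_support_eq[of K]) auto
 show "(LINT z|lborel. indicator Y' z *\<^sub>R (f z * p z)) = - (LINT z|lborel. indicator Y' z *\<^sub>R (g z * \<phi> z))"
  "(LINT z|lborel. indicator Y' z *\<^sub>R (f z * q z)) = - (LINT z|lborel. indicator Y' z *\<^sub>R (h z * \<phi> z))"
  using weak_wirtingerD[OF assms(1) test_function_mono[OF t assms(3)]] K(3) by (simp_all add: e)
qed

text \<open>The product f \<phi>, extended by 0 outside Y, is differentiable on the whole plane with
  bounded derivatives, so the Stokes-type lemma applies to it.\<close>

lemma weak_wirtinger_classical:
 assumes op: "open Y" and der: "\<And>z. z \<in> Y \<Longrightarrow> wirtinger f (g z) (h z) z"
  and cont: "continuous_on Y g" "continuous_on Y h"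
 shows "weak_wirtinger Y f g h"
proof (rule weak_wirtingerI)
 show cf: "continuous_on Y f"
  by (intro continuous_at_imp_continuous_on ballI) (rule wirtinger_continuous[OF der])
 show "open Y" "locally_L2 Y g" "locally_L2 Y h" by (intro op locally_L2_continuous cont)+
 fix \<phi> p q assume t: "test_function Y \<phi> p q"
 obtain K where K: "compact K" "K \<subseteq> Y" "\<forall>z. z \<notin> K \<longrightarrow> \<phi> z = 0 \<and> p z = 0 \<and> q z = 0"
  using test_function_support[OF t] by blast
 note c = test_function_continuous[OF t]
 define pX where "pX z = indicator Y z *\<^sub>R (g z * \<phi> z) + indicator Y z *\<^sub>R (f z * p z)" for z
 define qX where "qX z = indicator Y z *\<^sub>R (h z * \<phi> z) + indicator Y z *\<^sub>R (f z * q z)" for z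
 have der': "wirtinger (\<lambda>z. indicator Y z *\<^sub>R (f z * \<phi> z)) (pX z) (qX z) z" for z
 proof (cases "z \<in> Y")
  case True
  have "wirtinger (\<lambda>z. f z * \<phi> z) (pX z) (qX z) z"
   using wirtinger_mult[OF der[OF True] test_function_wirtinger[OF t]] True by (simp add: pX_def qX_def)
  then show ?thesis by (rule wirtinger_transform[OF _ op True]) simp
 next
  case False
  have "wirtinger (\<lambda>z. indicator Y z *\<^sub>R (f z * \<phi> z)) 0 0 z"
   by (rule wirtinger_transform[OF wirtinger_const[of 0], of "-K"])
    (use False K compact_imp_closed[OF K(1)] in auto)
  then show ?thesis using False by (simp add: pX_def qX_def)
 qed
 have i: "integrable lborel (\<lambda>z. indicator Y z *\<^sub>R (g z * \<phi> z))" "integrable lborel (\<lambda>z. indicator Y z *\<^sub>R (f z * p z))"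
  "integrable lborel (\<lambda>z. indicator Y z *\<^sub>R (h z * \<phi> z))" "integrable lborel (\<lambda>z. indicator Y z *\<^sub>R (f z * q z))"
  using continuous_test_integrable[OF cf t] continuous_test_integrable(3)[OF cont(1) t] continuous_test_integrable(3)[OF cont(2) t]
  by auto
 have m: "pX \<in> borel_measurable borel" "qX \<in> borel_measurable borel"
  using i[THEN borel_measurable_integrable] unfolding pX_def[abs_def] qX_def[abs_def] by (auto intro!: borel_measurable_add)
 have cK: "continuous_on K (\<lambda>z. g z * \<phi> z + f z * p z)" "continuous_on K (\<lambda>z. h z * \<phi> z + f z * q z)"
  using K(2) by (intro continuous_intros continuous_on_subset[OF cf] continuous_on_subset[OF cont(1)] continuous_on_subset[OF cont(2)] continuous_on_subset[OF c(1)]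
    continuous_on_subset[OF c(2)] continuous_on_subset[OF c(3)]; simp)+
 obtain B1 where B1: "B1 > 0" "\<And>z. z \<in> K \<Longrightarrow> cmod (g z * \<phi> z + f z * p z) \<le> B1"
  using compact_bound[OF K(1) cK(1)] by metis
 obtain B2 where B2: "B2 > 0" "\<And>z. z \<in> K \<Longrightarrow> cmod (h z * \<phi> z + f z * q z) \<le> B2"
  using compact_bound[OF K(1) cK(2)] by metis
 have b: "cmod (pX z) \<le> max B1 B2" "cmod (qX z) \<le> max B1 B2" for z
  using B1(1) B1(2)[of z] B2(1) B2(2)[of z] K by (cases "z \<in> K"; force simp: pX_def qX_def)+
 obtain R where R: "K \<subseteq> cball 0 R"
  using compact_imp_bounded[OF K(1)] by (auto simp: bounded_iff subset_eq)
 have "indicator Y z *\<^sub>R (f z * \<phi> z) = 0" if "z \<notin> cball 0 R" for z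
  using that R K(3) by (auto simp: subset_eq)
 from integral_wirtinger_eq_0[OF der' m b this]
 have "integral\<^sup>L lborel pX = 0" "integral\<^sup>L lborel qX = 0" by auto
 then show "(LINT z|lborel. indicator Y z *\<^sub>R (f z * p z)) = - (LINT z|lborel. indicator Y z *\<^sub>R (g z * \<phi> z))"
  "(LINT z|lborel. indicator Y z *\<^sub>R (f z * q z)) = - (LINT z|lborel. indicator Y z *\<^sub>R (h z * \<phi> z))"
  unfolding pX_def qX_def using i by (simp_all add: add_eq_0_iff Bochner_Integration.integral_add)
qed

text \<open>If \<phi> is a test function, so is b \<phi>; testing f against it is the product
  rule.\<close>

lemma weak_wirtinger_mult:
 assumes weak: "weak_wirtinger UNIV f g h"
  and der: "\<And>z. wirtinger b (p z) (q z) z" and cont: "continuous_on UNIV p" "continuous_on UNIV q"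
 shows "weak_wirtinger UNIV (\<lambda>z. b z * f z) (\<lambda>z. b z * g z + p z * f z) (\<lambda>z. b z * h z + q z * f z)"
proof (rule weak_wirtingerI)
 have a: "continuous_on UNIV f" "locally_L2 UNIV g" "locally_L2 UNIV h"
  using weak by (auto simp: weak_wirtinger_def)
 have cb: "continuous_on UNIV b"
  by (intro continuous_at_imp_continuous_on ballI) (rule wirtinger_continuous[OF der])
 have l2: "locally_L2 UNIV (\<lambda>z. b z * g z)" "locally_L2 UNIV (\<lambda>z. b z * h z)"
  "locally_L2 UNIV (\<lambda>z. p z * f z)" "locally_L2 UNIV (\<lambda>z. q z * f z)"
  by (intro locally_L2_mult locally_L2_continuous continuous_intros cb a cont open_UNIV)+
 show "open (UNIV :: complex set)" "continuous_on UNIV (\<lambda>z. b z * f z)" by (auto intro: continuous_intros cb a)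
 show "locally_L2 UNIV (\<lambda>z. b z * g z + p z * f z)" "locally_L2 UNIV (\<lambda>z. b z * h z + q z * f z)"
  by (intro locally_L2_add l2)+
 fix \<phi> p' q' assume t: "test_function UNIV \<phi> p' q'"
 obtain K where K: "compact K" "K \<subseteq> UNIV" "\<forall>z. z \<notin> K \<longrightarrow> \<phi> z = 0 \<and> p' z = 0 \<and> q' z = 0"
  using test_function_support[OF t] by blast
 have t': "test_function UNIV (\<lambda>z. b z * \<phi> z) (\<lambda>z. p z * \<phi> z + b z * p' z) (\<lambda>z. q z * \<phi> z + b z * q' z)"
  using K by (intro test_functionI[of K] wirtinger_mult der test_function_wirtinger[OF t] continuous_intros cont cb test_function_continuous[OF t]) auto
 note i = continuous_test_integrable[OF continuous_on_mult[OF cb a(1)] t]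
  locally_L2_test_integrable[OF l2(1) t] locally_L2_test_integrable[OF l2(2) t]
  locally_L2_test_integrable[OF l2(3) t] locally_L2_test_integrable[OF l2(4) t]
 note w = weak_wirtingerD[OF weak t']
 have hlp: "y = - (c + x)" if "x + y = - c" for x y c :: complex using that by algebra
 have e1: "(LINT z|lborel. indicator UNIV z *\<^sub>R (f z * (p z * \<phi> z + b z * p' z))) = (LINT z|lborel. p z * f z * \<phi> z) + (LINT z|lborel. b z * f z * p' z)"
  by (subst Bochner_Integration.integral_add[symmetric]) (use i in \<open>auto simp: algebra_simps\<close>)
 have e2: "(LINT z|lborel. b z * g z * \<phi> z + p z * f z * \<phi> z) = (LINT z|lborel. b z * g z * \<phi> z) + (LINT z|lborel. p z * f z * \<phi> z)"
  by (rule Bochner_Integration.integral_add) (use i in auto)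
 have "(LINT z|lborel. p z * f z * \<phi> z) + (LINT z|lborel. b z * f z * p' z) = - (LINT z|lborel. b z * g z * \<phi> z)"
  using w(1) e1 by (simp add: mult_ac)
 moreover have "(LINT z|lborel. indicator UNIV z *\<^sub>R ((b z * g z + p z * f z) * \<phi> z)) = (LINT z|lborel. b z * g z * \<phi> z) + (LINT z|lborel. p z * f z * \<phi> z)"
  using e2 by (simp add: distrib_right)
 ultimately show "(LINT z|lborel. indicator UNIV z *\<^sub>R (b z * f z * p' z)) = - (LINT z|lborel. indicator UNIV z *\<^sub>R ((b z * g z + p z * f z) * \<phi> z))"
  using hlp by simp
 have e1: "(LINT z|lborel. indicator UNIV z *\<^sub>R (f z * (q z * \<phi> z + b z * q' z))) = (LINT z|lborel. q z * f z * \<phi> z) + (LINT z|lborel. b z * f z * q' z)"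
  by (subst Bochner_Integration.integral_add[symmetric]) (use i in \<open>auto simp: algebra_simps\<close>)
 have e2: "(LINT z|lborel. b z * h z * \<phi> z + q z * f z * \<phi> z) = (LINT z|lborel. b z * h z * \<phi> z) + (LINT z|lborel. q z * f z * \<phi> z)"
  by (rule Bochner_Integration.integral_add) (use i in auto)
 have "(LINT z|lborel. q z * f z * \<phi> z) + (LINT z|lborel. b z * f z * q' z) = - (LINT z|lborel. b z * h z * \<phi> z)"
  using w(2) e1 by (simp add: mult_ac)
 moreover have "(LINT z|lborel. indicator UNIV z *\<^sub>R ((b z * h z + q z * f z) * \<phi> z)) = (LINT z|lborel. b z * h z * \<phi> z) + (LINT z|lborel. q z * f z * \<phi> z)"
  using e2 by (simp add: distrib_right)
 ultimately show "(LINT z|lborel. indicator UNIV z *\<^sub>R (b z * f z * q' z)) = - (LINT z|lborel. indicator UNIV z *\<^sub>R ((b z * h z + q z * f z) * \<phi> z))"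
  using hlp by simp
qed

text \<open>A C^1 plateau function: 1 up to radius r, 0 from radius 2r on, written in terms of |z -
  a|^2. \<open>cutoff_slope\<close> is its derivative with respect to that squared modulus, so the
  Wirtinger derivatives are the slope times \<open>cnj (z - a)\<close> and times
  \<open>z - a\<close>.\<close>

definition cutoff :: "complex \<Rightarrow> real \<Rightarrow> complex \<Rightarrow> real" where
 "cutoff a r z = max 0 (1 - max 0 ((cmod (z - a))^2 / r^2 - 1) ^ 2) ^ 2"

definition cutoff_slope :: "complex \<Rightarrow> real \<Rightarrow> complex \<Rightarrow> real" where
 "cutoff_slope a r z = - 4 / r^2 * max 0 (1 - max 0 ((cmod (z - a))^2 / r^2 - 1) ^ 2) * max 0 ((cmod (z - a))^2 / r^2 - 1)"

lemma wirtinger_cutoff: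
 assumes "r > 0"
 shows "wirtinger (\<lambda>z. of_real (cutoff a r z)) (of_real (cutoff_slope a r z) * cnj (z - a))
  (of_real (cutoff_slope a r z) * (z - a)) z"
proof -
 let ?s = "(cmod (z - a))\<^sup>2"
 have "((\<lambda>s::real. s / r^2 - 1) has_real_derivative 1 / r^2) (at ?s)"
  using assms by (auto intro!: derivative_eq_intros simp: power2_eq_square)
 from DERIV_chain2[OF has_real_derivative_max_power[of 2] this]
 have "((\<lambda>s. 1 - max 0 (s / r^2 - 1) ^ 2) has_real_derivative - (2 * max 0 (?s / r^2 - 1) * (1 / r^2))) (at ?s)"
  using DERIV_diff[OF DERIV_const[of 1]] by fastforce
 from DERIV_chain2[OF has_real_derivative_max_power[of 2] this]
 have "((\<lambda>s. max 0 (1 - max 0 (s / r^2 - 1) ^ 2) ^ 2) has_real_derivative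
   cutoff_slope a r z) (at ?s)"
  by (simp add: cutoff_slope_def mult_ac)
 from wirtinger_radial[OF this] show ?thesis by (simp add: cutoff_def)
qed

lemma continuous_on_cutoff [continuous_intros]: "continuous_on S (cutoff a r)" "continuous_on S (cutoff_slope a r)"
 unfolding cutoff_def[abs_def] cutoff_slope_def[abs_def] divide_inverse by (intro continuous_intros)+

lemma cutoff_bounds: "0 \<le> cutoff a r z" "cutoff a r z \<le> 1"
 by (auto simp: cutoff_def intro!: power_le_one)

lemma cutoff_inner:
 assumes "r > 0" "cmod (z - a) \<le> r"
 shows "cutoff a r z = 1" "cutoff_slope a r z = 0"
proof -
 have "(cmod (z - a))\<^sup>2 \<le> r^2" using assms by (intro power_mono) auto
 then have "max 0 ((cmod (z - a))^2 / r^2 - 1) = 0" using assms by (simp add: max_def field_simps)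
 then show "cutoff a r z = 1" "cutoff_slope a r z = 0" by (auto simp: cutoff_def cutoff_slope_def)
qed

lemma cutoff_outer:
 assumes "r > 0" "cmod (z - a) \<ge> 2 * r"
 shows "cutoff a r z = 0" "cutoff_slope a r z = 0"
proof -
 have "(2 * r)\<^sup>2 \<le> (cmod (z - a))^2" using assms by (intro power_mono) auto
 then have "4 * r^2 \<le> (cmod (z - a))^2" by (simp add: power_mult_distrib)
 then have "2 * r^2 \<le> (cmod (z - a))^2" using zero_le_power2[of r] by linarith
 then have "2 \<le> (cmod (z - a))^2 / r^2" using assms by (simp add: le_divide_eq)
 then have "1 \<le> max 0 ((cmod (z - a))^2 / r^2 - 1)" by simp
 then have "1 \<le> max 0 ((cmod (z - a))^2 / r^2 - 1) ^ 2" by (rule one_le_power)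
 then have "max 0 (1 - max 0 ((cmod (z - a))^2 / r^2 - 1) ^ 2) = 0" by simp
 then show "cutoff a r z = 0" "cutoff_slope a r z = 0" by (auto simp: cutoff_def cutoff_slope_def)
qed

text \<open>The slope is at most 4 / r^2 and lives where |z - a| < 2r. The resulting order 1/r is
  what makes cutoff errors scale invariant in the energy estimate.\<close>

lemma cutoff_slope_bound:
 assumes "r > 0"
 shows "cmod (of_real (cutoff_slope a r z) * (z - a)) \<le> 8 / r"
proof (cases "cmod (z - a) \<ge> 2 * r")
 case False
 define m where "m = max 0 ((cmod (z - a))^2 / r^2 - 1)"
 have m: "0 \<le> m" by (simp add: m_def)
 have "max 0 (1 - m ^ 2) * m \<le> 1"
 proof (cases "m \<le> 1")
  case True
  then show ?thesis using m by (intro mult_le_one) auto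
 next
  case False
  then have "1 \<le> m^2" by (intro one_le_power) auto
  then show ?thesis by (simp add: max_def)
 qed
 then have "\<bar>cutoff_slope a r z\<bar> \<le> 4 / r^2"
  using m assms unfolding cutoff_slope_def m_def[symmetric]
  by (simp add: abs_mult mult.assoc divide_simps)
 then have "\<bar>cutoff_slope a r z\<bar> * cmod (z - a) \<le> 4 / r^2 * (2 * r)"
  using False assms by (intro mult_mono) auto
 then show ?thesis using assms by (simp add: norm_mult power2_eq_square)
qed (use cutoff_outer[of r z a] assms in simp)

text \<open>Being a weak derivative is a local property: a cutoff splits each test function into one
  supported near a and one supported away from a. The two pairs of derivatives need not agree
  pointwise on the overlap, so they are blended with the same cutoff.\<close>

lemma weak_wirtinger_glue:
 assumes op: "open Y" and w1: "weak_wirtinger (Y - {a}) f g1 h1"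
  and w2: "weak_wirtinger (ball a r) f g2 h2" and r: "r > 0" "ball a r \<subseteq> Y"
 defines "b \<equiv> \<lambda>z. complex_of_real (cutoff a (r / 3) z)"
 shows "weak_wirtinger Y f (\<lambda>z. b z * g2 z + (1 - b z) * g1 z) (\<lambda>z. b z * h2 z + (1 - b z) * h1 z)"
proof (rule weak_wirtingerI[OF op])
 define d where "d z = complex_of_real (cutoff_slope a (r / 3) z)" for z
 have r3: "r / 3 > 0" using r by simp
 have db: "wirtinger b (d z * cnj (z - a)) (d z * (z - a)) z" for z
  unfolding b_def d_def by (rule wirtinger_cutoff[OF r3])
 have cb: "continuous_on S b" "continuous_on S d" for S
  unfolding b_def d_def by (intro continuous_intros)+
 have out: "b z = 0" "d z = 0" if "cmod (z - a) \<ge> 2 * (r / 3)" for z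
  using cutoff_outer[OF r3 that] by (auto simp: b_def d_def)
 have inn: "b z = 1" "d z = 0" if "cmod (z - a) \<le> r / 3" for z
  using cutoff_inner[OF r3 that] by (auto simp: b_def d_def)
 have c1: "continuous_on (Y - {a}) f" and c2: "continuous_on (ball a r) f"
  and l: "locally_L2 (Y - {a}) g1" "locally_L2 (Y - {a}) h1" "locally_L2 (ball a r) g2" "locally_L2 (ball a r) h2"
  using w1 w2 by (auto simp: weak_wirtinger_def)
 have op1: "open (Y - {a})" using op by auto
 have Yeq: "Y = (Y - {a}) \<union> ball a r" using r by auto
 show "continuous_on Y f"
  by (subst Yeq, rule continuous_on_open_Un[OF op1 _ c1 c2]) auto
 have L2: "locally_L2 Y (\<lambda>z. b z * v z + (1 - b z) * u z)"
  if u: "locally_L2 (Y - {a}) u" and v: "locally_L2 (ball a r) v" for u v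
 proof (rule locally_L2_add)
  have bv: "locally_L2 (ball a r) (\<lambda>z. b z * v z)" by (rule locally_L2_mult[OF open_ball cb(1) v])
  have bu: "locally_L2 (Y - {a}) (\<lambda>z. (1 - b z) * u z)"
   by (rule locally_L2_mult[OF op1 _ u]) (intro continuous_intros cb)
  show "locally_L2 Y (\<lambda>z. b z * v z)"
   unfolding locally_L2_def
  proof (intro conjI allI impI)
   have "(\<lambda>z. indicator (ball a r) z *\<^sub>R (b z * v z)) = (\<lambda>z. indicator Y z *\<^sub>R (b z * v z))"
    using r out by (subst (1 2) indicator_support_eq[of "ball a r"]) (auto simp: dist_norm norm_minus_commute)
   then show "set_borel_measurable lborel Y (\<lambda>z. b z * v z)"
    using bv by (simp add: locally_L2_def set_borel_measurable_def)
   fix K assume K: "compact K" "K \<subseteq> Y"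
   have "cball a (2 * (r / 3)) \<subseteq> ball a r" using r by auto
   then have "set_integrable lborel (K \<inter> cball a (2 * (r / 3))) (\<lambda>z. (cmod (b z * v z))\<^sup>2)"
    using bv K by (auto simp: locally_L2_def)
   also have "(\<lambda>z. indicator (K \<inter> cball a (2 * (r / 3))) z *\<^sub>R ((cmod (b z * v z))^2)) = (\<lambda>z. indicator K z *\<^sub>R ((cmod (b z * v z))^2))"
    using out by (auto simp: fun_eq_iff indicator_def dist_norm norm_minus_commute)
   ultimately show "set_integrable lborel K (\<lambda>z. (cmod (b z * v z))\<^sup>2)" by (simp add: set_integrable_def)
  qed
  show "locally_L2 Y (\<lambda>z. (1 - b z) * u z)"
   unfolding locally_L2_def
  proof (intro conjI allI impI)
   have "(\<lambda>z. indicator (Y - {a}) z *\<^sub>R ((1 - b z) * u z)) = (\<lambda>z. indicator Y z *\<^sub>R ((1 - b z) * u z))"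
    using r inn(1)[of a] by (auto simp: fun_eq_iff indicator_def)
   then show "set_borel_measurable lborel Y (\<lambda>z. (1 - b z) * u z)"
    using bu by (simp add: locally_L2_def set_borel_measurable_def)
   fix K assume K: "compact K" "K \<subseteq> Y"
   have "compact (K - ball a (r / 3))" "K - ball a (r / 3) \<subseteq> Y - {a}" using K r by (auto intro: compact_diff)
   then have "set_integrable lborel (K - ball a (r / 3)) (\<lambda>z. (cmod ((1 - b z) * u z))\<^sup>2)"
    using bu by (auto simp: locally_L2_def)
   also have "(\<lambda>z. indicator (K - ball a (r / 3)) z *\<^sub>R ((cmod ((1 - b z) * u z))^2)) = (\<lambda>z. indicator K z *\<^sub>R ((cmod ((1 - b z) * u z))^2))"
    using inn by (auto simp: fun_eq_iff indicator_def dist_norm norm_minus_commute)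
   ultimately show "set_integrable lborel K (\<lambda>z. (cmod ((1 - b z) * u z))\<^sup>2)" by (simp add: set_integrable_def)
  qed
 qed
 show "locally_L2 Y (\<lambda>z. b z * g2 z + (1 - b z) * g1 z)" "locally_L2 Y (\<lambda>z. b z * h2 z + (1 - b z) * h1 z)"
  by (intro L2 l)+
 fix \<phi> p q assume t: "test_function Y \<phi> p q"
 obtain K where K: "compact K" "K \<subseteq> Y" "\<forall>z. z \<notin> K \<longrightarrow> \<phi> z = 0 \<and> p z = 0 \<and> q z = 0"
  using test_function_support[OF t] by blast
 note c = test_function_continuous[OF t]
 \<comment> \<open>Derivatives of the two pieces (1 - b) \<phi> and b \<phi>. The radius r/3 of the
   cutoff keeps the second piece compactly supported in \<open>ball a r\<close> and the first away
   from a.\<close>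
 define p1 where "p1 z = (0 - d z * cnj (z - a)) * \<phi> z + (1 - b z) * p z" for z
 define q1 where "q1 z = (0 - d z * (z - a)) * \<phi> z + (1 - b z) * q z" for z
 define p2 where "p2 z = d z * cnj (z - a) * \<phi> z + b z * p z" for z
 define q2 where "q2 z = d z * (z - a) * \<phi> z + b z * q z" for z
 have cc: "continuous_on UNIV p1" "continuous_on UNIV q1" "continuous_on UNIV p2" "continuous_on UNIV q2"
  unfolding p1_def q1_def p2_def q2_def by (intro continuous_intros cb c)+
 have t1: "test_function (Y - {a}) (\<lambda>z. (1 - b z) * \<phi> z) p1 q1"
 proof (rule test_functionI[of "K - ball a (r / 3)"])
  show "compact (K - ball a (r / 3))" "K - ball a (r / 3) \<subseteq> Y - {a}" using K r by (auto intro: compact_diff)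
  show "wirtinger (\<lambda>z. (1 - b z) * \<phi> z) (p1 z) (q1 z) z" for z
   unfolding p1_def q1_def by (intro wirtinger_mult wirtinger_diff wirtinger_const db test_function_wirtinger[OF t])
  show "(1 - b z) * \<phi> z = 0" if "z \<notin> K - ball a (r / 3)" for z
   using that K(3) inn by (auto simp: dist_norm norm_minus_commute)
 qed (rule cc)+
 have t2: "test_function (ball a r) (\<lambda>z. b z * \<phi> z) p2 q2"
 proof (rule test_functionI[of "K \<inter> cball a (2 * (r / 3))"])
  show "compact (K \<inter> cball a (2 * (r / 3)))" "K \<inter> cball a (2 * (r / 3)) \<subseteq> ball a r" using K r by auto
  show "wirtinger (\<lambda>z. b z * \<phi> z) (p2 z) (q2 z) z" for z
   unfolding p2_def q2_def by (intro wirtinger_mult db test_function_wirtinger[OF t])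
  show "b z * \<phi> z = 0" if "z \<notin> K \<inter> cball a (2 * (r / 3))" for z
   using that K(3) out by (auto simp: dist_norm norm_minus_commute)
 qed (rule cc)+
 have sp: "indicator Y z *\<^sub>R (f z * p z) = indicator (Y - {a}) z *\<^sub>R (f z * p1 z) + indicator (ball a r) z *\<^sub>R (f z * p2 z)"
  "indicator Y z *\<^sub>R (f z * q z) = indicator (Y - {a}) z *\<^sub>R (f z * q1 z) + indicator (ball a r) z *\<^sub>R (f z * q2 z)" for z
 proof -
  have "p1 z + p2 z = p z" "q1 z + q2 z = q z" by (auto simp: p1_def p2_def q1_def q2_def algebra_simps)
  moreover have "p1 z = 0" "q1 z = 0" if "z = a" using that inn[of a] r by (auto simp: p1_def q1_def)
  moreover have "p2 z = 0" "q2 z = 0" if "z \<notin> ball a r"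
   using that out[of z] r by (auto simp: p2_def q2_def dist_norm norm_minus_commute)
  ultimately show "indicator Y z *\<^sub>R (f z * p z) = indicator (Y - {a}) z *\<^sub>R (f z * p1 z) + indicator (ball a r) z *\<^sub>R (f z * p2 z)"
  "indicator Y z *\<^sub>R (f z * q z) = indicator (Y - {a}) z *\<^sub>R (f z * q1 z) + indicator (ball a r) z *\<^sub>R (f z * q2 z)"
   using r by (cases "z = a"; cases "z \<in> ball a r"; cases "z \<in> Y"; force simp flip: distrib_left)+
 qed
 have sg: "indicator Y z *\<^sub>R ((b z * v z + (1 - b z) * u z) * \<phi> z)
  = indicator (Y - {a}) z *\<^sub>R (u z * ((1 - b z) * \<phi> z)) + indicator (ball a r) z *\<^sub>R (v z * (b z * \<phi> z))" for u v z
  using r inn(1)[of a] out(1)[of z] by (cases "z = a"; cases "z \<in> ball a r"; cases "z \<in> Y"; force simp: algebra_simps dist_norm norm_minus_commute)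
 note i = continuous_test_integrable(1,2)[OF c1 t1] continuous_test_integrable(1,2)[OF c2 t2]
  locally_L2_test_integrable[OF l(1) t1] locally_L2_test_integrable[OF l(2) t1]
  locally_L2_test_integrable[OF l(3) t2] locally_L2_test_integrable[OF l(4) t2]
 note w = weak_wirtingerD[OF w1 t1] weak_wirtingerD[OF w2 t2]
 show "(LINT z|lborel. indicator Y z *\<^sub>R (f z * p z)) = - (LINT z|lborel. indicator Y z *\<^sub>R ((b z * g2 z + (1 - b z) * g1 z) * \<phi> z))"
  unfolding sp sg using i w by (simp only: Bochner_Integration.integral_add) simp
 show "(LINT z|lborel. indicator Y z *\<^sub>R (f z * q z)) = - (LINT z|lborel. indicator Y z *\<^sub>R ((b z * h2 z + (1 - b z) * h1 z) * \<phi> z))"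
  unfolding sp sg using i w by (simp only: Bochner_Integration.integral_add) simp
qed

section \<open>The energy identity for compactly supported functions\<close>

lemma borel_measurable_cnj [measurable (raw)]:
 assumes "f \<in> borel_measurable M"
 shows "(\<lambda>z. cnj (f z)) \<in> borel_measurable M"
 using measurable_compose[OF assms borel_measurable_continuous_onI[OF continuous_on_cnj[OF continuous_on_id]]] by simp

lemma norm_convolution_le:
 assumes f: "integrable lborel f" and k: "k \<in> borel_measurable borel" "\<And>z. cmod (k z) \<le> B"
 shows "cmod (convolution f k z) \<le> B * (LINT t|lborel. cmod (f t))"
proof -
 have "cmod (convolution f k z) \<le> (LINT t|lborel. B * cmod (f t))"
  unfolding convolution_def
 proof (rule Bochner_Integration.integral_norm_bound_integral[OF convolution_integrand[OF f k]])
  show "integrable lborel (\<lambda>t. B * cmod (f t))" using f by auto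
  show "cmod (f t * k (z - t)) \<le> B * cmod (f t)" for t
   using mult_left_mono[OF k(2)[of "z - t"] norm_ge_zero[of "f t"]] by (simp add: norm_mult mult.commute)
 qed
 then show ?thesis by simp
qed

lemma convolution_measurable [measurable]:
 assumes [measurable]: "f \<in> borel_measurable borel" "k \<in> borel_measurable borel"
 shows "convolution f k \<in> borel_measurable borel"
 unfolding convolution_def by measurable

text \<open>The Beurling transform is an isometry of \<open>L\<^sup>2\<close>.\<close>

lemma weak_wirtinger_energy:
 assumes weak: "weak_wirtinger UNIV V a h"
  and supp: "\<And>z. z \<notin> cball 0 R \<Longrightarrow> V z = 0" "\<And>z. z \<notin> cball 0 R \<Longrightarrow> a z = 0" "\<And>z. z \<notin> cball 0 R \<Longrightarrow> h z = 0"
 shows "(\<integral>\<^sup>+z. ennreal ((cmod (a z))^2) \<partial>lborel) \<le> (\<integral>\<^sup>+z. ennreal ((cmod (h z))^2) \<partial>lborel)"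
proof -
 have cV: "continuous_on UNIV V" and L2: "locally_L2 UNIV a" "locally_L2 UNIV h"
  using weak by (auto simp: weak_wirtinger_def)
 have ind: "(\<lambda>z. indicator L z *\<^sub>R u z) = u" if "cball 0 R \<subseteq> L" "\<And>z. z \<notin> cball 0 R \<Longrightarrow> u z = 0" for L and u :: "complex \<Rightarrow> complex"
  using that by (auto simp: fun_eq_iff indicator_def subset_eq)
 have "integrable lborel (\<lambda>z. indicator (cball 0 R) z *\<^sub>R V z)"
  by (rule borel_integrable_compact) (auto intro: continuous_on_subset[OF cV])
 then have iV: "integrable lborel V" using ind[of "cball 0 R" V] supp by simp
 have ra: "indicator (cball 0 R) z *\<^sub>R a z = a z" "indicator (cball 0 R) z *\<^sub>R h z = h z" for z
  using supp by (auto simp: indicator_def)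
 have ia: "integrable lborel a" and ia2: "integrable lborel (\<lambda>z. (cmod (a z))\<^sup>2)"
  using locally_L2_restrict(2,3)[OF L2(1) compact_cball[of 0 R] subset_UNIV] unfolding ra by simp_all
 have ih: "integrable lborel h" and ih2: "integrable lborel (\<lambda>z. (cmod (h z))\<^sup>2)"
  using locally_L2_restrict(2,3)[OF L2(2) compact_cball[of 0 R] subset_UNIV] unfolding ra by simp_all
 have [measurable]: "V \<in> borel_measurable borel" "a \<in> borel_measurable borel" "h \<in> borel_measurable borel"
  using iV ia ih by (auto dest: borel_measurable_integrable)
 have eq: "convolution V (mollifier_p e) z = mollify e a z" "convolution V (mollifier_q e) z = mollify e h z" if e: "e > 0" for e z
 proof -
  \<comment> \<open>A disc that contains both the support and the window of the mollifier at z, so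
    that restriction to L changes nothing.\<close>
  define L where "L = cball (0::complex) (max R (cmod z + e))"
  have L: "compact L" "cball 0 R \<subseteq> L" "cball z e \<subseteq> L"
   unfolding L_def by (auto simp: subset_eq dist_norm) (metis norm_triangle_sub norm_minus_commute add_left_mono max.coboundedI2 order_trans add.commute)
  from mollify_weak_derivative[OF weak L(1) subset_UNIV L(3) e]
  show "convolution V (mollifier_p e) z = mollify e a z" "convolution V (mollifier_q e) z = mollify e h z"
   using ind[OF L(2) supp(1)] ind[OF L(2) supp(2)] ind[OF L(2) supp(3)] by simp_all
 qed
 have equal: "(\<integral>\<^sup>+z. ennreal ((cmod (mollify e a z))^2) \<partial>lborel) = (\<integral>\<^sup>+z. ennreal ((cmod (mollify e h z))^2) \<partial>lborel)"
  if e: "e > 0" for e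
 proof -
  define F where "F = mollify e V"
  define P where "P = convolution V (mollifier_p e)"
  define Q where "Q = convolution V (mollifier_q e)"
  define PP where "PP = convolution V (mollifier_pp e)"
  define PQ where "PQ = convolution V (mollifier_pq e)"
  define QQ where "QQ = convolution V (mollifier_qq e)"
  have d: "wirtinger F (P z) (Q z) z" "wirtinger P (PP z) (PQ z) z" "wirtinger Q (PQ z) (QQ z) z" for z
   unfolding F_def P_def Q_def PP_def PQ_def QQ_def by (rule wirtinger_mollify[OF iV e])+
  have [measurable]: "F \<in> borel_measurable borel" "P \<in> borel_measurable borel" "Q \<in> borel_measurable borel"
   "PP \<in> borel_measurable borel" "PQ \<in> borel_measurable borel" "QQ \<in> borel_measurable borel"
   unfolding F_def P_def Q_def PP_def PQ_def QQ_def by measurable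
  obtain B where B: "\<And>z. cmod (of_real (mollifier e z)) \<le> B"
   "\<And>z. cmod (mollifier_p e z) \<le> B" "\<And>z. cmod (mollifier_q e z) \<le> B"
   "\<And>z. cmod (mollifier_pp e z) \<le> B" "\<And>z. cmod (mollifier_pq e z) \<le> B" "\<And>z. cmod (mollifier_qq e z) \<le> B"
   using mollifier_derivatives_bounded[OF e] by metis
  define C where "C = B * (LINT t|lborel. cmod (V t))"
  have C: "cmod (F z) \<le> C" "cmod (P z) \<le> C" "cmod (Q z) \<le> C" "cmod (PP z) \<le> C" "cmod (PQ z) \<le> C" "cmod (QQ z) \<le> C" for z
   unfolding F_def P_def Q_def PP_def PQ_def QQ_def C_def
   by (intro norm_convolution_le[OF iV] B; measurable)+
  have C0: "C \<ge> 0" using order_trans[OF norm_ge_zero C(1)] .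
  have F0: "F z = 0" if z: "z \<notin> cball 0 (R + e)" for z
  proof -
   have "cmod (V t - 0) \<le> 0" if "cmod (t - z) \<le> e" for t
   proof -
    have "cmod z \<le> cmod t + cmod (t - z)" by (metis norm_minus_commute norm_triangle_sub)
    then show ?thesis using supp(1)[of t] that z by auto
   qed
   from mollify_diff_le[OF iV e this] show ?thesis by (simp add: F_def)
  qed
  have PQ0: "P z = 0" "Q z = 0" if "z \<notin> cball 0 (R + e)" for z
   using wirtinger_zero_off[OF d(1) closed_cball that F0] by auto
  have mul: "cmod (x * y) \<le> C * C" if "cmod x \<le> C" "cmod y \<le> C" for x y
   unfolding norm_mult using that C0 by (intro mult_mono) auto
  have sm: "cmod (x * y + x' * y') \<le> C * C + C * C" if "cmod x \<le> C" "cmod y \<le> C" "cmod x' \<le> C" "cmod y' \<le> C" for x y x' y'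
   using norm_triangle_le[OF add_mono[OF mul mul]] that by blast
  \<comment> \<open>With P and Q the d and dbar derivatives of F, the exact derivatives d(F cnj P)
    and dbar(F cnj Q) equal |P|^2 and |Q|^2 plus the same term F cnj(PQ). Both integrate to 0, hence
    P and Q have equal energy.\<close>
  have X1: "integral\<^sup>L lborel (\<lambda>z. P z * cnj (P z) + F z * cnj (PQ z)) = 0"
  proof (rule integral_wirtinger_eq_0(1)[of "\<lambda>z. F z * cnj (P z)" _ "\<lambda>z. Q z * cnj (P z) + F z * cnj (PP z)" "C * C + C * C" "R + e"])
   show "wirtinger (\<lambda>z. F z * cnj (P z)) (P z * cnj (P z) + F z * cnj (PQ z)) (Q z * cnj (P z) + F z * cnj (PP z)) z" for z
    by (intro wirtinger_mult wirtinger_cnj d)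
   show "(\<lambda>z. P z * cnj (P z) + F z * cnj (PQ z)) \<in> borel_measurable borel"
    "(\<lambda>z. Q z * cnj (P z) + F z * cnj (PP z)) \<in> borel_measurable borel" by measurable
   show "cmod (P z * cnj (P z) + F z * cnj (PQ z)) \<le> C * C + C * C"
    "cmod (Q z * cnj (P z) + F z * cnj (PP z)) \<le> C * C + C * C" for z
    by (intro sm; simp add: C)+
  qed (use F0 in auto)
  have X2: "integral\<^sup>L lborel (\<lambda>z. Q z * cnj (Q z) + F z * cnj (PQ z)) = 0"
  proof (rule integral_wirtinger_eq_0(2)[of "\<lambda>z. F z * cnj (Q z)" "\<lambda>z. P z * cnj (Q z) + F z * cnj (QQ z)" _ "C * C + C * C" "R + e"])
   show "wirtinger (\<lambda>z. F z * cnj (Q z)) (P z * cnj (Q z) + F z * cnj (QQ z)) (Q z * cnj (Q z) + F z * cnj (PQ z)) z" for z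
    by (intro wirtinger_mult wirtinger_cnj d)
   show "(\<lambda>z. P z * cnj (Q z) + F z * cnj (QQ z)) \<in> borel_measurable borel"
    "(\<lambda>z. Q z * cnj (Q z) + F z * cnj (PQ z)) \<in> borel_measurable borel" by measurable
   show "cmod (P z * cnj (Q z) + F z * cnj (QQ z)) \<le> C * C + C * C"
    "cmod (Q z * cnj (Q z) + F z * cnj (PQ z)) \<le> C * C + C * C" for z
    by (intro sm; simp add: C)+
  qed (use F0 in auto)
  have ib: "integrable lborel (\<lambda>z. x z * cnj (y z))"
   if "x \<in> borel_measurable borel" "y \<in> borel_measurable borel" "\<And>z. cmod (x z) \<le> C" "\<And>z. cmod (y z) \<le> C"
    "\<And>z. z \<notin> cball 0 (R + e) \<Longrightarrow> x z = 0" for x y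
  proof (rule integrable_bounded_support[of _ "C * C" 0 "R + e"])
   show "(\<lambda>z. x z * cnj (y z)) \<in> borel_measurable lborel" using that(1,2) by simp
  qed (use that mul in auto)
  have i: "integrable lborel (\<lambda>z. P z * cnj (P z))" "integrable lborel (\<lambda>z. Q z * cnj (Q z))" "integrable lborel (\<lambda>z. F z * cnj (PQ z))"
   by (rule ib; use C F0 PQ0 in simp)+
  have "integral\<^sup>L lborel (\<lambda>z. P z * cnj (P z)) = integral\<^sup>L lborel (\<lambda>z. Q z * cnj (Q z))"
   using X1 X2 i by (simp add: Bochner_Integration.integral_add add_eq_0_iff2)
  then have "complex_of_real (LINT z|lborel. (cmod (P z))\<^sup>2) = complex_of_real (LINT z|lborel. (cmod (Q z))\<^sup>2)"
   by (simp only: complex_norm_square[symmetric] integral_complex_of_real)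
  then have e1: "(LINT z|lborel. (cmod (P z))\<^sup>2) = (LINT z|lborel. (cmod (Q z))\<^sup>2)" by (simp only: of_real_eq_iff)
  have "integrable lborel (\<lambda>z. complex_of_real ((cmod (P z))^2))" "integrable lborel (\<lambda>z. complex_of_real ((cmod (Q z))^2))"
   using i by (simp_all only: complex_norm_square)
  then have i': "integrable lborel (\<lambda>z. (cmod (P z))\<^sup>2)" "integrable lborel (\<lambda>z. (cmod (Q z))\<^sup>2)"
   by (simp_all only: complex_of_real_integrable_eq)
  have "(\<integral>\<^sup>+z. ennreal ((cmod (P z))^2) \<partial>lborel) = (\<integral>\<^sup>+z. ennreal ((cmod (Q z))^2) \<partial>lborel)"
   using e1 i' by (simp add: nn_integral_eq_integral)
  then show ?thesis unfolding P_def Q_def eq[OF e] .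
 qed
 \<comment> \<open>The smoothing is removed by Fatou along an almost everywhere convergent
   subsequence for a, and by Jensen for h. This yields the inequality, which is all that is
   claimed.\<close>
 define \<epsilon> where "\<epsilon> j = 1 / (real j + 1)" for j :: nat
 have \<epsilon>: "\<epsilon> j > 0" for j by (simp add: \<epsilon>_def)
 have \<epsilon>lim: "\<epsilon> \<longlonglongrightarrow> 0" unfolding \<epsilon>_def by real_asymp
 have "(\<lambda>j. LINT z|lborel. cmod (mollify (\<epsilon> j) a z - a z)) \<longlonglongrightarrow> 0"
  by (rule mollify_L1_tendsto[OF ia supp(2) \<epsilon> \<epsilon>lim])
 moreover have "integrable lborel (\<lambda>z. mollify (\<epsilon> j) a z - a z)" for j
  using mollify_integrable(1)[OF ia \<epsilon>] ia by auto
 ultimately obtain r where r: "strict_mono r" "AE z in lborel. (\<lambda>j. mollify (\<epsilon> (r j)) a z - a z) \<longlonglongrightarrow> 0"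
  using tendsto_L1_AE_subseq[of lborel "\<lambda>j z. mollify (\<epsilon> j) a z - a z"] by auto
 have "(\<integral>\<^sup>+z. ennreal ((cmod (a z))^2) \<partial>lborel) = (\<integral>\<^sup>+z. liminf (\<lambda>j. ennreal ((cmod (mollify (\<epsilon> (r j)) a z))^2)) \<partial>lborel)"
 proof (rule nn_integral_cong_AE)
  show "AE z in lborel. ennreal ((cmod (a z))^2) = liminf (\<lambda>j. ennreal ((cmod (mollify (\<epsilon> (r j)) a z))^2))"
   using r(2)
  proof eventually_elim
   case (elim z)
   then have "(\<lambda>j. mollify (\<epsilon> (r j)) a z) \<longlonglongrightarrow> a z" by (simp add: LIM_zero_iff)
   then have "(\<lambda>j. ennreal ((cmod (mollify (\<epsilon> (r j)) a z))^2)) \<longlonglongrightarrow> ennreal ((cmod (a z))^2)"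
    by (intro tendsto_ennrealI tendsto_intros)
   then show ?case by (rule lim_imp_Liminf[OF sequentially_bot, symmetric])
  qed
 qed
 also have "\<dots> \<le> liminf (\<lambda>j. \<integral>\<^sup>+z. ennreal ((cmod (mollify (\<epsilon> (r j)) a z))^2) \<partial>lborel)"
  by (rule nn_integral_liminf) measurable
 also have "\<dots> \<le> (\<integral>\<^sup>+z. ennreal ((cmod (h z))^2) \<partial>lborel)"
  by (rule Liminf_le) (use nn_integral_mollify_power2_le[OF ih ih2 \<epsilon>] in \<open>auto simp: equal[OF \<epsilon>]\<close>)
 finally show ?thesis .
qed

section \<open>The Dirichlet estimate\<close>

lemma integral_affine:
 fixes f :: "complex \<Rightarrow> 'b::{banach, second_countable_topology}"
 assumes [measurable]: "f \<in> borel_measurable borel" and c: "c \<noteq> 0"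
 shows "integral\<^sup>L lborel f = c^2 *\<^sub>R (LINT x|lborel. f (t + c *\<^sub>R x))"
  "integrable lborel f \<longleftrightarrow> integrable lborel (\<lambda>x. f (t + c *\<^sub>R x))"
proof -
 have eq: "lborel = density (distr lborel borel (\<lambda>x. t + c *\<^sub>R x)) (\<lambda>_::complex. ennreal (c^2))"
  using lborel_affine[OF c, of t] c by (simp add: DIM_complex ennreal_power)
 have "integral\<^sup>L lborel f = integral\<^sup>L (density (distr lborel borel (\<lambda>x. t + c *\<^sub>R x)) (\<lambda>_. ennreal (c^2))) f"
  by (subst eq) simp
 also have "\<dots> = (LINT x|distr lborel borel (\<lambda>x. t + c *\<^sub>R x). c\<^sup>2 *\<^sub>R f x)"
  by (rule integral_density) auto
 also have "\<dots> = c^2 *\<^sub>R (LINT x|lborel. f (t + c *\<^sub>R x))"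
  by (subst integral_distr) auto
 finally show "integral\<^sup>L lborel f = c^2 *\<^sub>R (LINT x|lborel. f (t + c *\<^sub>R x))" .
 have "integrable lborel f \<longleftrightarrow> integrable (density (distr lborel borel (\<lambda>x. t + c *\<^sub>R x)) (\<lambda>_. ennreal (c^2))) f"
  by (subst eq) simp
 also have "\<dots> \<longleftrightarrow> integrable (distr lborel borel (\<lambda>x. t + c *\<^sub>R x)) (\<lambda>x. c\<^sup>2 *\<^sub>R f x)"
  by (rule integrable_density) auto
 also have "\<dots> \<longleftrightarrow> integrable lborel (\<lambda>x. c\<^sup>2 *\<^sub>R f (t + c *\<^sub>R x))"
  by (subst integrable_distr_eq) auto
 also have "\<dots> \<longleftrightarrow> integrable lborel (\<lambda>x. f (t + c *\<^sub>R x))"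
 proof
  assume i: "integrable lborel (\<lambda>x. c\<^sup>2 *\<^sub>R f (t + c *\<^sub>R x))"
  have "integrable lborel (\<lambda>x. (1 / c^2) *\<^sub>R (c^2 *\<^sub>R f (t + c *\<^sub>R x)))"
   by (rule integrable_scaleR_right) (rule i)
  then show "integrable lborel (\<lambda>x. f (t + c *\<^sub>R x))" using c by simp
 qed (intro integrable_scaleR_right)
 finally show "integrable lborel f \<longleftrightarrow> integrable lborel (\<lambda>x. f (t + c *\<^sub>R x))" .
qed

text \<open>Dyadic decomposition: the disc of radius 2^j has area proportional to 4^j, while the
  integrand is at most 16 / 16^j on the ring just inside it, which leaves a geometric
  series.\<close>

lemma integrable_inverse_power4:
 "integrable lborel (\<lambda>z::complex. indicator (- ball 0 1) z / cmod z ^ 4)"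
proof (rule integrableI_bounded)
 show "(\<lambda>z::complex. indicator (- ball 0 1) z / cmod z ^ 4) \<in> borel_measurable lborel" by measurable
 have pt: "ennreal (norm (indicator (- ball 0 1) z / cmod z ^ 4)) \<le> (\<Sum>j. ennreal (16 * (1/16) ^ j) * indicator (ball 0 (2 ^ j)) z)" for z :: complex
 proof (cases "cmod z < 1")
  case False
  define j where "j = (LEAST j::nat. cmod z < 2 ^ j)"
  have ex: "\<exists>j::nat. cmod z < 2 ^ j" using real_arch_pow[of 2 "cmod z"] by auto
  have j: "cmod z < 2 ^ j" unfolding j_def by (rule LeastI_ex[OF ex])
  then have "j \<noteq> 0" using False by (intro notI) auto
  then obtain i where i: "j = Suc i" by (cases j) auto
  have "\<not> cmod z < 2 ^ i" using not_less_Least[of i "\<lambda>j. cmod z < 2 ^ j"] i by (auto simp: j_def)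
  then have "(2 ^ i) ^ 4 \<le> cmod z ^ 4" by (intro power_mono) auto
  moreover have "((2::real) ^ i) ^ 4 = (2 ^ 4) ^ i" by (simp only: power_mult[symmetric] mult.commute[of i])
  ultimately have "16 ^ i \<le> cmod z ^ 4" by simp
  then have "1 / cmod z ^ 4 \<le> 1 / 16 ^ i" by (intro divide_left_mono mult_pos_pos zero_less_power) (use False in auto)
  also have "\<dots> = 16 * (1/16) ^ j" by (simp add: i power_divide)
  finally have "ennreal (norm (indicator (- ball 0 1) z / cmod z ^ 4)) \<le> ennreal (16 * (1/16) ^ j) * indicator (ball 0 (2 ^ j)) z"
   using False j by (auto intro!: ennreal_leI)
  also have "\<dots> \<le> (\<Sum>j. ennreal (16 * (1/16) ^ j) * indicator (ball 0 (2 ^ j)) z)"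
  proof -
   define F where "F j = ennreal (16 * (1/16) ^ j) * indicator (ball 0 (2 ^ j)) z" for j :: nat
   have "sum F {j} \<le> suminf F" by (rule sum_le_suminf) auto
   then have "F j \<le> suminf F" by simp
   then show ?thesis unfolding F_def[abs_def] .
  qed
  finally show ?thesis .
 qed simp
 define A where "A = measure lborel (ball (0::complex) 1)"
 have mb: "emeasure lborel (ball (0::complex) (2 ^ j)) = ennreal (4 ^ j * A)" for j :: nat
 proof -
  have "emeasure lborel (ball (0::complex) (2 ^ j)) = ennreal (measure lborel (ball (0::complex) (2 ^ j)))"
   by (rule emeasure_eq_ennreal_measure) (use emeasure_lborel_ball_finite[of "0::complex" "2 ^ j"] in auto)
  also have "measure lborel (ball (0::complex) (2 ^ j)) = (2 ^ j) ^ 2 * A"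
   using content_ball_conv_unit_ball[of "2 ^ j" "0::complex"] by (simp add: A_def DIM_complex)
  also have "((2::real) ^ j) ^ 2 = (2 ^ 2) ^ j" by (simp only: power_mult[symmetric] mult.commute[of j])
  finally show ?thesis by simp
 qed
 have "(\<integral>\<^sup>+z. ennreal (norm (indicator (- ball 0 1) z / cmod z ^ 4)) \<partial>lborel)
   \<le> (\<integral>\<^sup>+z. (\<Sum>j. ennreal (16 * (1/16) ^ j) * indicator (ball (0::complex) (2 ^ j)) z) \<partial>lborel)"
  by (intro nn_integral_mono pt)
 also have "\<dots> = (\<Sum>j. \<integral>\<^sup>+z. ennreal (16 * (1/16) ^ j) * indicator (ball (0::complex) (2 ^ j)) z \<partial>lborel)"
  by (rule nn_integral_suminf) (auto intro!: borel_measurable_times_ennreal borel_measurable_indicator)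
 also have "\<dots> = (\<Sum>j. ennreal (16 * A * (1/4) ^ j))"
 proof (rule suminf_cong)
  fix j
  have "(\<integral>\<^sup>+z. ennreal (16 * (1/16) ^ j) * indicator (ball (0::complex) (2 ^ j)) z \<partial>lborel) = ennreal (16 * (1/16) ^ j) * ennreal (4 ^ j * A)"
   by (subst nn_integral_cmult_indicator) (auto simp: mb)
  also have "\<dots> = ennreal (16 * (1/16) ^ j * (4 ^ j * A))"
   by (rule ennreal_mult[symmetric]) (auto simp: A_def)
  also have "16 * (1/16) ^ j * (4 ^ j * A) = 16 * A * ((1/16) * 4) ^ j" by (simp only: power_mult_distrib mult_ac)
  finally show "(\<integral>\<^sup>+z. ennreal (16 * (1/16) ^ j) * indicator (ball (0::complex) (2 ^ j)) z \<partial>lborel) = ennreal (16 * A * (1/4) ^ j)"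
   by simp
 qed
 also have "\<dots> < \<infinity>"
 proof -
  have "summable (\<lambda>j. 16 * A * (1/4) ^ j)" by (intro summable_mult summable_geometric) auto
  then show ?thesis by (subst suminf_ennreal2) (auto simp: A_def)
 qed
 finally show "(\<integral>\<^sup>+z. ennreal (norm (indicator (- ball (0::complex) 1) z / cmod z ^ 4)) \<partial>lborel) < \<infinity>" .
qed

text \<open>In polar coordinates this is \<pi>.\<close>

definition kernel_mass :: real where
 "kernel_mass = (LINT z::complex|lborel. indicator (- ball 0 1) z / cmod z ^ 4)"

lemma kernel_mass_nonneg: "kernel_mass \<ge> 0"
 unfolding kernel_mass_def by (rule integral_nonneg_AE) auto

text \<open>Scaling by d contributes d^2 from the area and d^(-4) from the integrand; this is the
  origin of the weight in the Schwarzian estimate.\<close>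

lemma inverse_power4_scaled:
 assumes d: "d > 0"
 shows "integrable lborel (\<lambda>z. indicator (- ball a d) z / cmod (z - a) ^ 4)"
  "(LINT z|lborel. indicator (- ball a d) z / cmod (z - a) ^ 4) = kernel_mass / d^2"
proof -
 define f where "f z = indicator (- ball a d) z / cmod (z - a) ^ 4" for z
 have [measurable]: "f \<in> borel_measurable borel" unfolding f_def by measurable
 have eq: "f (a + d *\<^sub>R x) = (1 / d ^ 4) * (indicator (- ball 0 1) x / cmod x ^ 4)" for x
  using d by (auto simp: f_def indicator_def dist_norm power_mult_distrib)
 show "integrable lborel (\<lambda>z. indicator (- ball a d) z / cmod (z - a) ^ 4)"
  unfolding f_def[symmetric]
  by (subst integral_affine(2)[of f d a]) (use d integrable_inverse_power4 in \<open>simp_all only: eq integrable_mult_right\<close>, simp_all)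
 have "integral\<^sup>L lborel f = d^2 *\<^sub>R (LINT x|lborel. f (a + d *\<^sub>R x))"
  by (rule integral_affine(1)) (use d in auto)
 also have "\<dots> = d^2 * (1 / d ^ 4 * kernel_mass)"
  unfolding eq kernel_mass_def real_scaleR_def by (subst integral_mult_right_zero) simp
 also have "\<dots> = kernel_mass / d^2" using d by (simp add: field_simps eval_nat_numeral)
 finally show "(LINT z|lborel. indicator (- ball a d) z / cmod (z - a) ^ 4) = kernel_mass / d^2"
  by (simp add: f_def[abs_def])
qed

text \<open>The derivative of -1/(z - a), set to 0 on a disc around the singularity, where the
  Beltrami coefficient vanishes. The truncation puts it in L^2 without changing the
  equation.\<close>

definition exterior_kernel :: "complex \<Rightarrow> real \<Rightarrow> complex \<Rightarrow> complex" where
 "exterior_kernel a d z = indicator (- ball a d) z *\<^sub>R (1 / (z - a)^2)"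

lemma exterior_kernel_measurable [measurable]: "exterior_kernel a d \<in> borel_measurable borel"
 unfolding exterior_kernel_def[abs_def] by measurable

lemma norm_exterior_kernel_power2:
 "(cmod (exterior_kernel a d z))\<^sup>2 = indicator (- ball a d) z / cmod (z - a) ^ 4"
 by (auto simp: exterior_kernel_def indicator_def norm_divide norm_power power_divide simp flip: power_mult)

lemma exterior_kernel_L2:
 assumes "d > 0"
 shows "integrable lborel (\<lambda>z. (cmod (exterior_kernel a d z))\<^sup>2)"
  "(LINT z|lborel. (cmod (exterior_kernel a d z))\<^sup>2) = kernel_mass / d^2"
 unfolding norm_exterior_kernel_power2 using inverse_power4_scaled[OF assms] by auto

lemma norm_add_power2_le:
 fixes a b :: "'a::real_normed_vector"
 shows "(norm (a + b))\<^sup>2 \<le> 2 * (norm a)^2 + 2 * (norm b)^2"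
proof -
 have "(norm (a + b))\<^sup>2 \<le> (norm a + norm b)^2"
  by (intro power_mono norm_triangle_ineq) auto
 also have "\<dots> \<le> 2 * (norm a)^2 + 2 * (norm b)^2"
  using sum_squares_bound[of "norm a" "norm b"] by (simp add: power2_sum)
 finally show ?thesis .
qed

lemma cutoff_measurable [measurable]:
 "cutoff a r \<in> borel_measurable borel" "cutoff_slope a r \<in> borel_measurable borel"
 by (intro borel_measurable_continuous_onI continuous_intros)+

text \<open>The energy inequality is applied to the cutoff times U. The cutoff gradient is of order
  1/R on an area of order R^2, so the extra terms cost a multiple of m^2 independent of R.\<close>

lemma beltrami_energy_cutoff:
 assumes weak: "weak_wirtinger UNIV U G H"
  and mu: "\<mu> \<in> borel_measurable borel" "AE z in lborel. cmod (\<mu> z) \<le> k" and k: "0 \<le> k" "k \<le> 1/4"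
  and eq: "AE z in lborel. H z = \<mu> z * (G z - E z)"
  and E: "E \<in> borel_measurable borel" "integrable lborel (\<lambda>z. (cmod (E z))\<^sup>2)"
  and R: "R > 0" and m: "\<And>z. cmod (z - a) \<ge> R \<Longrightarrow> cmod (U z) \<le> m"
 shows "integrable lborel (\<lambda>z. (cmod (of_real (cutoff a R z) * G z))\<^sup>2)"
  "(LINT z|lborel. (cmod (of_real (cutoff a R z) * G z))\<^sup>2) \<le>
   16 * k^2 * (LINT z|lborel. (cmod (E z))\<^sup>2) + 3072 * measure lborel (cball (0::complex) 1) * m^2"
proof -
 define b where "b z = complex_of_real (cutoff a R z)" for z
 define p where "p z = of_real (cutoff_slope a R z) * cnj (z - a)" for z
 define q where "q z = of_real (cutoff_slope a R z) * (z - a)" for z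
 have cpq: "continuous_on UNIV p" "continuous_on UNIV q" "continuous_on UNIV b"
  unfolding p_def q_def b_def by (intro continuous_intros)+
 have [measurable]: "p \<in> borel_measurable borel" "q \<in> borel_measurable borel" "b \<in> borel_measurable borel"
  using cpq by (auto intro: borel_measurable_continuous_onI)
 have cU: "continuous_on UNIV U" and L2: "locally_L2 UNIV G" "locally_L2 UNIV H"
  using weak by (auto simp: weak_wirtinger_def)
 have [measurable]: "U \<in> borel_measurable borel" using cU by (rule borel_measurable_continuous_onI)
 have [measurable]: "G \<in> borel_measurable borel" "H \<in> borel_measurable borel"
  using L2 by (auto simp: locally_L2_def set_borel_measurable_def)
 note [measurable] = mu(1) E(1)
 have w: "weak_wirtinger UNIV (\<lambda>z. b z * U z) (\<lambda>z. b z * G z + p z * U z) (\<lambda>z. b z * H z + q z * U z)"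
  by (rule weak_wirtinger_mult[OF weak _ cpq(1,2)]) (use wirtinger_cutoff[OF R] in \<open>simp add: b_def p_def q_def\<close>)
 have out: "b z = 0" "p z = 0" "q z = 0" if "z \<notin> cball a (2 * R)" for z
  using cutoff_outer[OF R, of z a] that by (auto simp: b_def p_def q_def dist_norm norm_minus_commute)
 have inn: "p z = 0" "q z = 0" if "cmod (z - a) \<le> R" for z
  using cutoff_inner[OF R that] by (auto simp: p_def q_def)
 have pb: "cmod (p z) \<le> 8 / R" "cmod (q z) \<le> 8 / R" for z
  using cutoff_slope_bound[OF R, of a z] by (simp_all add: p_def q_def norm_mult flip: complex_cnj_diff)
 have sub: "cball a (2 * R) \<subseteq> cball 0 (2 * R + cmod a)"
  by (auto simp: dist_norm) (metis add.commute add_left_mono norm_minus_commute norm_triangle_sub order_trans)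
 have energy: "(\<integral>\<^sup>+z. ennreal ((cmod (b z * G z + p z * U z))^2) \<partial>lborel) \<le> (\<integral>\<^sup>+z. ennreal ((cmod (b z * H z + q z * U z))^2) \<partial>lborel)"
  by (rule weak_wirtinger_energy[OF w, of "2 * R + cmod a"]) (use out sub in \<open>auto simp: subset_eq\<close>)
 have i: "integrable lborel (\<lambda>z. (cmod (b z * u z))\<^sup>2)" if "locally_L2 UNIV u" for u
 proof -
  have "locally_L2 UNIV (\<lambda>z. b z * u z)" by (rule locally_L2_mult[OF open_UNIV cpq(3) that])
  from locally_L2_restrict(3)[OF this compact_cball[of a "2 * R"]]
  have "integrable lborel (\<lambda>z. (cmod (indicator (cball a (2 * R)) z *\<^sub>R (b z * u z)))\<^sup>2)" by simp
  also have "(\<lambda>z. (cmod (indicator (cball a (2 * R)) z *\<^sub>R (b z * u z)))\<^sup>2) = (\<lambda>z. (cmod (b z * u z))\<^sup>2)"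
   using out by (auto simp: fun_eq_iff indicator_def)
  finally show ?thesis .
 qed
 note iG = i[OF L2(1)] and iH = i[OF L2(2)]
 show "integrable lborel (\<lambda>z. (cmod (of_real (cutoff a R z) * G z))\<^sup>2)" using iG by (simp add: b_def)
 have m0: "0 \<le> m" using order_trans[OF norm_ge_zero m[of "a + of_real R"]] R by simp
 have pU: "(cmod (s z * U z))\<^sup>2 \<le> indicator (cball a (2 * R)) z * (8 / R * m)^2"
  if "\<And>z. z \<notin> cball a (2 * R) \<Longrightarrow> s z = 0" "\<And>z. cmod (z - a) \<le> R \<Longrightarrow> s z = 0" "\<And>z. cmod (s z) \<le> 8 / R" for s z
 proof (cases "z \<in> cball a (2 * R) \<and> cmod (z - a) > R")
  case True
  then have "cmod (s z * U z) \<le> 8 / R * m" unfolding norm_mult using that(3) m[of z] R by (intro mult_mono) auto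
  then have "(cmod (s z * U z))\<^sup>2 \<le> (8 / R * m)^2" by (intro power_mono) auto
  then show ?thesis using True by simp
 qed (use that(1)[of z] that(2)[of z] in \<open>auto simp: indicator_def\<close>)
 have ic: "integrable lborel (\<lambda>z. indicator (cball a (2 * R)) z * (8 / R * m)^2)"
  by (intro integrable_mult_left integrable_real_indicator) (use emeasure_lborel_cball_finite in auto)
 have ib: "integrable lborel (\<lambda>z. (cmod (s z * U z))\<^sup>2)" if [measurable]: "s \<in> borel_measurable borel"
  and le: "\<And>z. (cmod (s z * U z))\<^sup>2 \<le> indicator (cball a (2 * R)) z * (8 / R * m)^2" for s
 proof (rule Bochner_Integration.integrable_bound[OF ic])
  show "(\<lambda>z. (cmod (s z * U z))\<^sup>2) \<in> borel_measurable lborel" by measurable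
  show "AE z in lborel. norm ((cmod (s z * U z))^2) \<le> norm (indicator (cball a (2 * R)) z * (8 / R * m)^2)"
   unfolding real_norm_def abs_of_nonneg[OF zero_le_power2]
   by (intro always_eventually allI order_trans[OF le abs_ge_self])
 qed
 have pUp: "(cmod (p z * U z))\<^sup>2 \<le> indicator (cball a (2 * R)) z * (8 / R * m)^2" for z
  by (rule pU; (rule out inn pb; assumption) | rule pb)
 have pUq: "(cmod (q z * U z))\<^sup>2 \<le> indicator (cball a (2 * R)) z * (8 / R * m)^2" for z
  by (rule pU; (rule out inn pb; assumption) | rule pb)
 have i1: "integrable lborel (\<lambda>z. (cmod (p z * U z))\<^sup>2)"
  by (rule ib[OF _ pUp]) measurable
 have i2: "integrable lborel (\<lambda>z. (cmod (q z * U z))\<^sup>2)"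
  by (rule ib[OF _ pUq]) measurable
 note ipU = i1 i2
 define A1 where "A1 = measure lborel (cball (0::complex) 1)"
 have D: "(LINT z|lborel. (cmod (s z * U z))\<^sup>2) \<le> 256 * A1 * m^2"
  if "\<And>z. (cmod (s z * U z))\<^sup>2 \<le> indicator (cball a (2 * R)) z * (8 / R * m)^2" "integrable lborel (\<lambda>z. (cmod (s z * U z))\<^sup>2)" for s
 proof -
  have "(LINT z|lborel. (cmod (s z * U z))\<^sup>2) \<le> (LINT z|lborel. indicator (cball a (2 * R)) z * (8 / R * m)^2)"
   by (rule integral_mono[OF that(2) ic that(1)])
  also have "\<dots> = measure lborel (cball a (2 * R)) * (8 / R * m)^2" by simp
  also have "measure lborel (cball a (2 * R)) = (2 * R)^2 * A1"
   using R by (simp add: A1_def content_cball DIM_complex)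
  also have "(2 * R)\<^sup>2 * A1 * (8 / R * m)^2 = 256 * A1 * m^2" using R by (simp add: power2_eq_square field_simps)
  finally show ?thesis .
 qed
 note D1 = D[OF pUp ipU(1)] and D2 = D[OF pUq ipU(2)]
 define IG where "IG = (LINT z|lborel. (cmod (b z * G z))\<^sup>2)"
 define IH where "IH = (LINT z|lborel. (cmod (b z * H z))\<^sup>2)"
 define Ia where "Ia = (LINT z|lborel. (cmod (b z * G z + p z * U z))\<^sup>2)"
 define Ih where "Ih = (LINT z|lborel. (cmod (b z * H z + q z * U z))\<^sup>2)"
 define IE where "IE = (LINT z|lborel. (cmod (E z))\<^sup>2)"
 have ia: "integrable lborel (\<lambda>z. (cmod (b z * G z + p z * U z))\<^sup>2)"
  by (rule Bochner_Integration.integrable_bound[of _ "\<lambda>z. 2 * (cmod (b z * G z))^2 + 2 * (cmod (p z * U z))^2"])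
   (use iG ipU(1) norm_add_power2_le in auto)
 have ih: "integrable lborel (\<lambda>z. (cmod (b z * H z + q z * U z))\<^sup>2)"
  by (rule Bochner_Integration.integrable_bound[of _ "\<lambda>z. 2 * (cmod (b z * H z))^2 + 2 * (cmod (q z * U z))^2"])
   (use iH ipU(2) norm_add_power2_le in auto)
 \<comment> \<open>From here on four inequalities form a chain: IG against Ia, Ia against Ih, Ih
   against IH, and IH against k^2 (IG + IE). Each splitting of a square costs a factor 2.\<close>
 have "ennreal Ia \<le> ennreal Ih"
  using energy ia ih by (simp add: nn_integral_eq_integral Ia_def Ih_def)
 then have 1: "Ia \<le> Ih" by (subst (asm) ennreal_le_iff) (auto simp: Ih_def)
 have "IG \<le> (LINT z|lborel. 2 * (cmod (b z * G z + p z * U z))^2 + 2 * (cmod (p z * U z))^2)"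
  unfolding IG_def
 proof (rule integral_mono[OF iG])
  show "(cmod (b z * G z))\<^sup>2 \<le> 2 * (cmod (b z * G z + p z * U z))^2 + 2 * (cmod (p z * U z))^2" for z
   using norm_add_power2_le[of "b z * G z + p z * U z" "- (p z * U z)"] by simp
 qed (use ia ipU in auto)
 also have "\<dots> = 2 * Ia + 2 * (LINT z|lborel. (cmod (p z * U z))\<^sup>2)" using ia ipU by (simp add: Ia_def)
 finally have 2: "IG \<le> 2 * Ia + 512 * A1 * m^2" using D1 by simp
 have "Ih \<le> (LINT z|lborel. 2 * (cmod (b z * H z))^2 + 2 * (cmod (q z * U z))^2)"
  unfolding Ih_def by (rule integral_mono[OF ih]) (use iH ipU norm_add_power2_le in auto)
 also have "\<dots> = 2 * IH + 2 * (LINT z|lborel. (cmod (q z * U z))\<^sup>2)" using iH ipU by (simp add: IH_def)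
 finally have 3: "Ih \<le> 2 * IH + 512 * A1 * m^2" using D2 by simp
 have "IH \<le> (LINT z|lborel. 2 * k^2 * (cmod (b z * G z))^2 + 2 * k^2 * (cmod (E z))^2)"
  unfolding IH_def
 proof (rule integral_mono_AE[OF iH])
  show "integrable lborel (\<lambda>z. 2 * k^2 * (cmod (b z * G z))^2 + 2 * k^2 * (cmod (E z))^2)" using iG E by auto
  show "AE z in lborel. (cmod (b z * H z))\<^sup>2 \<le> 2 * k^2 * (cmod (b z * G z))^2 + 2 * k^2 * (cmod (E z))^2"
   using mu(2) eq
  proof eventually_elim
   case (elim z)
   have b1: "cmod (b z) \<le> 1" using cutoff_bounds[of a R z] by (simp add: b_def)
   have "cmod (b z * H z) = cmod (\<mu> z) * cmod (b z * G z + - (b z * E z))"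
    by (simp add: elim norm_mult[symmetric] algebra_simps)
   also have "\<dots> \<le> k * cmod (b z * G z + - (b z * E z))" by (intro mult_right_mono elim) auto
   finally have "(cmod (b z * H z))\<^sup>2 \<le> (k * cmod (b z * G z + - (b z * E z)))^2" by (intro power_mono) auto
   also have "\<dots> = k^2 * (cmod (b z * G z + - (b z * E z)))^2" by (simp add: power_mult_distrib)
   also have "\<dots> \<le> k^2 * (2 * (cmod (b z * G z))^2 + 2 * (cmod (- (b z * E z)))^2)"
    by (intro mult_left_mono norm_add_power2_le) auto
   also have "\<dots> \<le> k^2 * (2 * (cmod (b z * G z))^2 + 2 * (cmod (E z))^2)"
   proof -
    have "(cmod (- (b z * E z)))\<^sup>2 \<le> (cmod (E z))^2"
     using mult_right_mono[OF b1 norm_ge_zero[of "E z"]] by (intro power_mono) (auto simp: norm_mult)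
    then show ?thesis by (intro mult_left_mono) auto
   qed
   finally show ?case by (simp add: distrib_left mult_ac)
  qed
 qed
 also have "\<dots> = 2 * k^2 * IG + 2 * k^2 * IE" using iG E by (simp add: IG_def IE_def)
 finally have 4: "IH \<le> 2 * k^2 * IG + 2 * k^2 * IE" .
 \<comment> \<open>The chain gives IG \<le> 8 k^2 IG + 8 k^2 IE + 1536 A1 m^2. For k \<le> 1/4 the
   first term is at most IG / 2 and is absorbed, which doubles the other two.\<close>
 have k2: "k\<^sup>2 \<le> 1/16" using power_mono[OF k(2) k(1), of 2] by (simp add: power2_eq_square)
 have "IG \<ge> 0" by (simp add: IG_def)
 then have "k\<^sup>2 * IG \<le> 1/16 * IG" using k2 by (intro mult_right_mono) auto
 with 1 2 3 4 have "IG \<le> 16 * (k^2 * IE) + 3072 * (A1 * m^2)" by linarith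
 then show "(LINT z|lborel. (cmod (of_real (cutoff a R z) * G z))\<^sup>2) \<le>
   16 * k^2 * (LINT z|lborel. (cmod (E z))\<^sup>2) + 3072 * measure lborel (cball (0::complex) 1) * m^2"
  by (simp add: IG_def IE_def A1_def b_def mult_ac)
qed

text \<open>As the cutoff error does not depend on the radius, mere convergence of U to 0 is enough:
  m can be taken arbitrarily small at large radii, and Fatou exhausts the plane.\<close>

lemma beltrami_energy:
 assumes weak: "weak_wirtinger UNIV U G H" and lim: "(U \<longlongrightarrow> 0) at_infinity"
  and mu: "\<mu> \<in> borel_measurable borel" "AE z in lborel. cmod (\<mu> z) \<le> k" and k: "0 \<le> k" "k \<le> 1/4"
  and eq: "AE z in lborel. H z = \<mu> z * (G z - E z)"
  and E: "E \<in> borel_measurable borel" "integrable lborel (\<lambda>z. (cmod (E z))\<^sup>2)"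
 shows "integrable lborel (\<lambda>z. (cmod (G z))\<^sup>2)"
  "(LINT z|lborel. (cmod (G z))\<^sup>2) \<le> 16 * k^2 * (LINT z|lborel. (cmod (E z))\<^sup>2)"
proof -
 define IE where "IE = 16 * k^2 * (LINT z|lborel. (cmod (E z))\<^sup>2)"
 define c where "c = 3072 * measure lborel (cball (0::complex) 1)"
 have c: "c \<ge> 0" by (simp add: c_def)
 have IE: "IE \<ge> 0" by (simp add: IE_def)
 have [measurable]: "G \<in> borel_measurable borel"
  using weak by (auto simp: weak_wirtinger_def locally_L2_def set_borel_measurable_def)
 have le: "(\<integral>\<^sup>+z. ennreal ((cmod (G z))^2) \<partial>lborel) \<le> ennreal (IE + c * m^2)" if m: "m > 0" for m
 proof -
  have "\<forall>\<^sub>F z in at_infinity. cmod (U z) < m"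
   using tendstoD[OF lim m] by simp
  then obtain r where r: "\<And>z. cmod z \<ge> r \<Longrightarrow> cmod (U z) < m" by (auto simp: eventually_at_infinity)
  define R where "R n = real n + 1" for n :: nat
  have bnd: "(\<integral>\<^sup>+z. ennreal ((cmod (of_real (cutoff 0 (R n) z) * G z))^2) \<partial>lborel) \<le> ennreal (IE + c * m^2)" if "R n \<ge> r" for n
  proof -
   have "cmod (U z) \<le> m" if "cmod (z - 0) \<ge> R n" for z
    using r[of z] that \<open>R n \<ge> r\<close> by simp
   note Um = this
   have "R n > 0" by (simp add: R_def)
   from beltrami_energy_cutoff[where a=0, OF weak mu k eq E this, of m] Um
   have "integrable lborel (\<lambda>z. (cmod (of_real (cutoff 0 (R n) z) * G z))\<^sup>2)"
   "(LINT z|lborel. (cmod (of_real (cutoff 0 (R n) z) * G z))\<^sup>2) \<le> IE + c * m^2"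
    unfolding IE_def c_def by blast+
   then show ?thesis by (subst nn_integral_eq_integral) (auto intro: ennreal_leI)
  qed
  have "(\<integral>\<^sup>+z. ennreal ((cmod (G z))^2) \<partial>lborel) = (\<integral>\<^sup>+z. liminf (\<lambda>n. ennreal ((cmod (of_real (cutoff 0 (R n) z) * G z))^2)) \<partial>lborel)"
  proof (rule nn_integral_cong)
   fix z
   have "\<forall>\<^sub>F n in sequentially. ennreal ((cmod (of_real (cutoff 0 (R n) z) * G z))^2) = ennreal ((cmod (G z))^2)"
    using eventually_ge_at_top[of "nat \<lceil>cmod z\<rceil>"]
   proof eventually_elim
    case (elim n)
    then have "cmod z \<le> real n" by (simp add: nat_le_iff ceiling_le_iff)
    then have "cutoff 0 (R n) z = 1" by (intro cutoff_inner) (simp_all add: R_def)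
    then show ?case by simp
   qed
   then have "(\<lambda>n. ennreal ((cmod (of_real (cutoff 0 (R n) z) * G z))^2)) \<longlonglongrightarrow> ennreal ((cmod (G z))^2)"
    by (rule tendsto_eventually)
   then show "ennreal ((cmod (G z))^2) = liminf (\<lambda>n. ennreal ((cmod (of_real (cutoff 0 (R n) z) * G z))^2))"
    by (rule lim_imp_Liminf[OF sequentially_bot, symmetric])
  qed
  also have "\<dots> \<le> liminf (\<lambda>n. \<integral>\<^sup>+z. ennreal ((cmod (of_real (cutoff 0 (R n) z) * G z))^2) \<partial>lborel)"
   by (rule nn_integral_liminf) measurable
  also have "\<dots> \<le> ennreal (IE + c * m^2)"
  proof (rule Liminf_le)
   show "\<forall>\<^sub>F n in sequentially. (\<integral>\<^sup>+z. ennreal ((cmod (of_real (cutoff 0 (R n) z) * G z))^2) \<partial>lborel) \<le> ennreal (IE + c * m^2)"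
    using eventually_ge_at_top[of "nat \<lceil>r\<rceil>"] by eventually_elim (rule bnd, simp add: R_def nat_le_iff ceiling_le_iff)
  qed simp
  finally show ?thesis .
 qed
 have fin: "(\<integral>\<^sup>+z. ennreal ((cmod (G z))^2) \<partial>lborel) < \<infinity>"
  using le[of 1] by (auto intro: le_less_trans simp: infinity_ennreal_def)
 show i: "integrable lborel (\<lambda>z. (cmod (G z))\<^sup>2)"
  by (rule integrableI_bounded) (use fin in auto)
 have "(LINT z|lborel. (cmod (G z))\<^sup>2) \<le> IE + e" if e: "e > 0" for e
 proof -
  define m where "m = sqrt (e / (c + 1))"
  have m: "m > 0" "m\<^sup>2 = e / (c + 1)" using e c by (auto simp: m_def)
  have "ennreal (LINT z|lborel. (cmod (G z))\<^sup>2) \<le> ennreal (IE + c * m^2)"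
   using le[OF m(1)] i by (simp add: nn_integral_eq_integral)
  then have "(LINT z|lborel. (cmod (G z))\<^sup>2) \<le> IE + c * m^2"
   using IE c by (subst (asm) ennreal_le_iff) auto
  also have "c * m^2 \<le> e" unfolding m(2) using e c by (simp add: field_simps)
  finally show ?thesis by simp
 qed
 then have "(LINT z|lborel. (cmod (G z))\<^sup>2) \<le> IE" by (rule field_le_epsilon)
 then show "(LINT z|lborel. (cmod (G z))\<^sup>2) \<le> 16 * k^2 * (LINT z|lborel. (cmod (E z))\<^sup>2)"
  by (simp add: IE_def)
qed

text \<open>For a function of |z|^2 that falls from 1 to 0 this is \<pi>, whatever its profile; it
  plays the part of \<pi> in the Cauchy formulas below.\<close>

definition slope_mass :: real where
 "slope_mass = - (LINT z|lborel. cutoff_slope 0 1 z)"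

lemma cutoff_slope_nonpos: "cutoff_slope a r z \<le> 0"
 by (simp add: cutoff_slope_def mult_nonneg_nonneg)

lemma cutoff_slope_integrable:
 assumes "r > 0"
 shows "integrable lborel (cutoff_slope a r)" "integrable lborel (\<lambda>z. complex_of_real (cutoff_slope a r z))"
proof -
 obtain B where B: "\<And>z. z \<in> cball a (2 * r) \<Longrightarrow> norm (cutoff_slope a r z) \<le> B" "B > 0"
  using compact_bound[of "cball a (2 * r)" "cutoff_slope a r"] continuous_on_cutoff(2) by (metis compact_cball)
 show "integrable lborel (cutoff_slope a r)"
 proof (rule integrable_bounded_support[of _ B a "2 * r"])
  show z: "cutoff_slope a r z = 0" if "z \<notin> cball a (2 * r)" for z
   using cutoff_outer(2)[OF assms, of z a] that by (simp add: dist_norm norm_minus_commute)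
  show "norm (cutoff_slope a r z) \<le> B" for z
   using B z[of z] by (cases "z \<in> cball a (2 * r)") auto
 qed measurable
 then show "integrable lborel (\<lambda>z. complex_of_real (cutoff_slope a r z))" by simp
qed

lemma integral_cutoff_slope:
 assumes r: "r > 0"
 shows "(LINT z|lborel. cutoff_slope a r z) = - slope_mass"
proof -
 have "cutoff_slope a r (a + r *\<^sub>R x) = (1 / r^2) * cutoff_slope 0 1 x" for x
  using r by (simp add: cutoff_slope_def power_mult_distrib)
 then have "(LINT x|lborel. cutoff_slope a r (a + r *\<^sub>R x)) = (1 / r^2) * (LINT x|lborel. cutoff_slope 0 1 x)"
  by simp
 then show ?thesis
  using integral_affine(1)[of "cutoff_slope a r" r a] r by (simp add: slope_mass_def)
qed

lemma slope_mass_pos: "slope_mass > 0"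
proof -
 \<comment> \<open>On this disc |z| lies between 23/20 and 25/20, so the inner term m = |z|^2 - 1
   lies between 129/400 and 9/16 and the slope is bounded away from 0.\<close>
 have bnd: "indicator (ball (of_real (6/5)) (1/20)) z * (1/10) \<le> - cutoff_slope 0 1 z" for z
 proof (cases "z \<in> ball (of_real (6/5)) (1/20)")
  case True
  then have d: "cmod (complex_of_real (6/5) - z) < 1/20" by (simp add: dist_norm)
  have "cmod (complex_of_real (6/5)) = 6/5" by (simp only: norm_of_real)
  then have "cmod z \<ge> 23/20" "cmod z \<le> 25/20"
   using norm_triangle_ineq2[of "complex_of_real (6/5)" z] norm_triangle_ineq3[of "complex_of_real (6/5)" z] d by auto
  then have "(23/20)\<^sup>2 \<le> (cmod z)^2" "(cmod z)\<^sup>2 \<le> (25/20)^2" by (auto intro: power_mono)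
  then have s: "(cmod z)\<^sup>2 - 1 \<ge> 129/400" "(cmod z)\<^sup>2 - 1 \<le> 9/16" by (auto simp: power2_eq_square)
  define m where "m = (cmod z)^2 - 1"
  have "m\<^sup>2 \<le> (9/16)^2" using s by (intro power_mono) (auto simp: m_def)
  then have "1 - m\<^sup>2 \<ge> 1/2" by (simp add: power2_eq_square)
  then have "4 * (1/2) * (129/400) \<le> 4 * (1 - m\<^sup>2) * m" using s by (intro mult_mono) (auto simp: m_def)
  moreover have "max 0 m = m" "max 0 (1 - m\<^sup>2) = 1 - m\<^sup>2" using s \<open>1 - m\<^sup>2 \<ge> 1/2\<close> by (auto simp: m_def)
  then have "- cutoff_slope 0 1 z = 4 * (1 - m\<^sup>2) * m" by (simp add: cutoff_slope_def m_def algebra_simps)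
  ultimately show ?thesis using True by simp
 qed (simp add: cutoff_slope_nonpos)
 have "0 < measure lborel (ball (complex_of_real (6/5)) (1/20)) * (1/10)"
  using content_ball_pos[of "1/20" "complex_of_real (6/5)"] by simp
 also have "\<dots> = (LINT z|lborel. indicator (ball (complex_of_real (6/5)) (1/20)) z * (1/10))" by simp
 also have "\<dots> \<le> (LINT z|lborel. - cutoff_slope 0 1 z)"
 proof (rule integral_mono[OF _ _ bnd])
  show "integrable lborel (\<lambda>z. indicator (ball (complex_of_real (6/5)) (1/20)) z * (1/10::real))"
   by (intro integrable_mult_left integrable_real_indicator) (use emeasure_lborel_ball_finite in auto)
 qed (use cutoff_slope_integrable[of 1 0] in auto)
 finally show ?thesis by (simp add: slope_mass_def)
qed

text \<open>A residue formula: write \<open>U(z) = U(a) + U'(a) (z - a) + (z - a)^2 Q(z)\<close>. The first term drops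
 out since the integrand is odd, the third since it is the d-bar derivative of a compactly supported function.\<close>

lemma integral_cutoff_slope_deriv:
 assumes r: "r > 0" and hol: "U holomorphic_on ball a (4 * r)" and cont: "continuous_on UNIV U"
 shows "integrable lborel (\<lambda>z. U z * (of_real (cutoff_slope a r z) / (z - a)))"
  "(LINT z|lborel. U z * (of_real (cutoff_slope a r z) / (z - a))) = - of_real slope_mass * deriv U a"
proof -
 let ?B = "ball a (4 * r)"
 define s where "s z = complex_of_real (cutoff_slope a r z)" for z
 \<comment> \<open>Difference quotients of first and second order; both are holomorphic across a by
   removability.\<close>
 define D where "D z = (if z = a then deriv U a else (U z - U a) / (z - a))" for z
 define Q where "Q z = (if z = a then deriv D a else (D z - D a) / (z - a))" for z
 have aB: "a \<in> ?B" using r by auto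
 have D: "D holomorphic_on ?B" unfolding D_def by (rule pole_lemma_open[OF hol open_ball])
 have Q: "Q holomorphic_on ?B" unfolding Q_def by (rule pole_lemma_open[OF D open_ball])
 have Ueq: "U z = U a + deriv U a * (z - a) + (z - a)^2 * Q z" for z
 proof -
  have "U z = U a + (z - a) * D z" "D z = D a + (z - a) * Q z" "D a = deriv U a"
   by (auto simp: D_def Q_def)
  then show ?thesis by (metis (no_types, lifting) add.assoc distrib_left mult.assoc mult.commute power2_eq_square)
 qed
 have s0: "s z = 0" if "z \<notin> cball a (2 * r)" for z
  using cutoff_outer(2)[OF r, of z a] that by (simp add: s_def dist_norm norm_minus_commute)
 have s1: "s z = 0" if "cmod (z - a) \<le> r" for z
  using cutoff_inner(2)[OF r that] by (simp add: s_def)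
 have [measurable]: "s \<in> borel_measurable borel" unfolding s_def by measurable
 have sI: "integrable lborel s" using cutoff_slope_integrable(2)[OF r, of a] by (simp add: s_def[abs_def])
 have iv: "integrable lborel (\<lambda>z. s z / (z - a))"
 proof (rule Bochner_Integration.integrable_bound[of _ "\<lambda>z. (1 / r) * cmod (s z)"])
  show "integrable lborel (\<lambda>z. (1 / r) * cmod (s z))" using sI by auto
  show "AE z in lborel. cmod (s z / (z - a)) \<le> norm ((1 / r) * cmod (s z))"
  proof (intro always_eventually allI)
   fix z
   show "cmod (s z / (z - a)) \<le> norm ((1 / r) * cmod (s z))"
   proof (cases "cmod (z - a) \<le> r")
    case False
    then have "cmod (s z) / cmod (z - a) \<le> cmod (s z) / r"
     by (intro divide_left_mono mult_pos_pos) (use r in auto)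
    then show ?thesis using r by (simp add: norm_divide)
   qed (simp add: s1)
  qed
 qed measurable
 \<comment> \<open>The substitution z -> 2a - z preserves the slope and changes the sign of z -
   a.\<close>
 have odd: "(LINT z|lborel. s z / (z - a)) = 0"
 proof -
  have "s (2 * a + - 1 *\<^sub>R x) = s x" for x
   by (simp add: s_def cutoff_slope_def norm_minus_commute)
  then have "s (2 * a + - 1 *\<^sub>R x) / (2 * a + - 1 *\<^sub>R x - a) = - (s x / (x - a))" for x
   by (simp add: divide_simps) (auto simp: algebra_simps)
  then have "(LINT z|lborel. s z / (z - a)) = - (LINT z|lborel. s z / (z - a))"
   using integral_affine(1)[of "\<lambda>z. s z / (z - a)" "-1" "2 * a"] by simp
  then show ?thesis by simp
 qed
 define X where "X z = (if z \<in> ?B then of_real (cutoff a r z) * Q z else 0)" for z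
 define p where "p z = (if z \<in> ?B then s z * cnj (z - a) * Q z + of_real (cutoff a r z) * deriv Q z else 0)" for z
 define q where "q z = (if z \<in> ?B then s z * (z - a) * Q z else 0)" for z
 have sub: "cball a (2 * r) \<subseteq> ?B" using r by auto
 have c0: "complex_of_real (cutoff a r z) = 0" if "z \<notin> cball a (2 * r)" for z
  using cutoff_outer(1)[OF r, of z a] that by (simp add: dist_norm norm_minus_commute)
 have der: "wirtinger X (p z) (q z) z" for z
 proof (cases "z \<in> ?B")
  case True
  have "wirtinger Q (deriv Q z) 0 z"
   by (intro wirtinger_field_derivative holomorphic_derivI[OF Q open_ball True])
  from wirtinger_mult[OF wirtinger_cutoff[OF r] this]
  have "wirtinger (\<lambda>z. of_real (cutoff a r z) * Q z) (p z) (q z) z"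
   using True by (simp add: p_def q_def s_def)
  then show ?thesis by (rule wirtinger_transform[OF _ open_ball True]) (simp add: X_def)
 next
  case False
  have "wirtinger X 0 0 z"
   by (rule wirtinger_transform[OF wirtinger_const[of 0], of "- cball a (2 * r)"])
    (use False sub in \<open>auto simp: X_def c0\<close>)
  then show ?thesis using False by (simp add: p_def q_def)
 qed
 have supp: "p z = 0" "q z = 0" "X z = 0" if "z \<notin> cball a (2 * r)" for z
  using that by (auto simp: p_def q_def X_def s0 c0)
 have cQ: "continuous_on ?B Q" "continuous_on ?B (deriv Q)"
  using Q by (auto intro!: holomorphic_on_imp_continuous_on holomorphic_deriv)
 have cs: "continuous_on S s" for S unfolding s_def by (intro continuous_intros)
 have cp: "continuous_on (cball a (2 * r)) (\<lambda>z. s z * cnj (z - a) * Q z + of_real (cutoff a r z) * deriv Q z)"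
  and cq: "continuous_on (cball a (2 * r)) (\<lambda>z. s z * (z - a) * Q z)"
  by (intro continuous_intros cs continuous_on_subset[OF cQ(1) sub] continuous_on_subset[OF cQ(2) sub])+
 have peq: "p = (\<lambda>z. indicator (cball a (2 * r)) z *\<^sub>R (s z * cnj (z - a) * Q z + of_real (cutoff a r z) * deriv Q z))"
  and qeq: "q = (\<lambda>z. indicator (cball a (2 * r)) z *\<^sub>R (s z * (z - a) * Q z))"
  using sub by (auto simp: fun_eq_iff p_def q_def indicator_def s0 c0)
 have m: "p \<in> borel_measurable borel" "q \<in> borel_measurable borel"
  unfolding peq qeq by (intro borel_measurable_continuous_on_indicator cp cq; simp)+
 obtain Bp where Bp: "Bp > 0" "\<And>z. z \<in> cball a (2 * r) \<Longrightarrow> cmod (s z * cnj (z - a) * Q z + of_real (cutoff a r z) * deriv Q z) \<le> Bp"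
  using compact_bound[OF compact_cball cp] by metis
 obtain Bq where Bq: "Bq > 0" "\<And>z. z \<in> cball a (2 * r) \<Longrightarrow> cmod (s z * (z - a) * Q z) \<le> Bq"
  using compact_bound[OF compact_cball cq] by metis
 have b: "cmod (p z) \<le> max Bp Bq" for z
  unfolding peq using Bp(1) Bp(2)[of z] by (cases "z \<in> cball a (2 * r)") (simp_all add: le_max_iff_disj)
 have b': "cmod (q z) \<le> max Bp Bq" for z
  unfolding qeq using Bq(1) Bq(2)[of z] by (cases "z \<in> cball a (2 * r)") (simp_all add: le_max_iff_disj)
 have X0: "X z = 0" if "z \<notin> cball 0 (cmod a + 2 * r)" for z
 proof (rule supp(3), rule notI)
  assume "z \<in> cball a (2 * r)"
  then show False using that norm_triangle_sub[of z a] by (auto simp: dist_norm norm_minus_commute)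
 qed
 have q0: "integral\<^sup>L lborel q = 0" by (rule integral_wirtinger_eq_0(2)[OF der m b b' X0])
 have qI: "integrable lborel q"
  by (rule integrable_bounded_support[of _ "max Bp Bq" a "2 * r"]) (use m b' supp in auto)
 have eq: "U z * (s z / (z - a)) = U a * (s z / (z - a)) + deriv U a * s z + q z" for z
 proof (cases "z = a \<or> z \<notin> cball a (2 * r)")
  case True
  then show ?thesis using s0[of z] s1[of a] supp(2)[of z] r by (auto simp: q_def)
 next
  case False
  then have "z \<in> ?B" using sub by auto
  then have "q z = s z * (z - a) * Q z" by (simp add: q_def)
  moreover have "(U a + deriv U a * x + x^2 * Q z) * (s z / x) = U a * (s z / x) + deriv U a * s z + s z * x * Q z" if "x \<noteq> 0" for x
   using that by (simp add: field_simps power2_eq_square)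
  from this[of "z - a"] have "U z * (s z / (z - a)) = U a * (s z / (z - a)) + deriv U a * s z + s z * (z - a) * Q z"
   using False Ueq[of z] by auto
  ultimately show ?thesis by simp
 qed
 show "integrable lborel (\<lambda>z. U z * (of_real (cutoff_slope a r z) / (z - a)))"
  unfolding s_def[symmetric] eq using iv sI qI by (intro Bochner_Integration.integrable_add integrable_mult_right)
 have i1: "integrable lborel (\<lambda>z. U a * (s z / (z - a)))" by (intro integrable_mult_right iv)
 have i2: "integrable lborel (\<lambda>z. deriv U a * s z)" by (intro integrable_mult_right sI)
 have "(LINT z|lborel. U z * (s z / (z - a))) = (LINT z|lborel. U a * (s z / (z - a))) + (LINT z|lborel. deriv U a * s z) + integral\<^sup>L lborel q"
  unfolding eq using Bochner_Integration.integral_add[OF Bochner_Integration.integrable_add[OF i1 i2] qI]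
   Bochner_Integration.integral_add[OF i1 i2] by simp
 also have "\<dots> = deriv U a * (LINT z|lborel. s z)"
  unfolding integral_mult_right_zero using odd q0 by simp
 also have "(LINT z|lborel. s z) = - of_real slope_mass"
  unfolding s_def using integral_cutoff_slope[OF r, of a] by simp
 finally show "(LINT z|lborel. U z * (of_real (cutoff_slope a r z) / (z - a))) = - of_real slope_mass * deriv U a"
  by (simp add: s_def)
qed

lemma product_L2_integrable:
 fixes f g :: "complex \<Rightarrow> complex"
 assumes [measurable]: "f \<in> borel_measurable borel" "g \<in> borel_measurable borel"
  and "integrable lborel (\<lambda>z. (cmod (f z))\<^sup>2)" "integrable lborel (\<lambda>z. (cmod (g z))\<^sup>2)"
 shows "integrable lborel (\<lambda>z. f z * g z)"
proof (rule Bochner_Integration.integrable_bound[of _ "\<lambda>z. (cmod (f z))\<^sup>2 + (cmod (g z))^2"])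
 show "integrable lborel (\<lambda>z. (cmod (f z))\<^sup>2 + (cmod (g z))^2)" using assms by auto
 show "AE z in lborel. cmod (f z * g z) \<le> norm ((cmod (f z))^2 + (cmod (g z))^2)"
 proof (intro always_eventually allI)
  fix z
  have "2 * (cmod (f z) * cmod (g z)) \<le> (cmod (f z))^2 + (cmod (g z))^2"
   using sum_squares_bound[of "cmod (f z)" "cmod (g z)"] by (simp add: mult.assoc)
  moreover have "0 \<le> cmod (f z) * cmod (g z)" by simp
  ultimately have "cmod (f z) * cmod (g z) \<le> (cmod (f z))^2 + (cmod (g z))^2" by linarith
  then show "cmod (f z * g z) \<le> norm ((cmod (f z))^2 + (cmod (g z))^2)" by (simp add: norm_mult)
 qed
qed measurable

text \<open>The Cauchy-Pompeiu formula for a derivative: testing the weak equation with 1/(z - a)^2,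
  cut off near a and near infinity, leaves the residue U'(a) at a and the kernel integral of
  H.\<close>

lemma beltrami_representation:
 assumes weak: "weak_wirtinger UNIV U G H" and lim: "(U \<longlongrightarrow> 0) at_infinity"
  and d: "d > 0" and H0: "AE z in lborel. z \<in> ball a d \<longrightarrow> H z = 0"
  and H2: "integrable lborel (\<lambda>z. (cmod (H z))\<^sup>2)"
 shows "of_real slope_mass * deriv U a = - (LINT z|lborel. H z * exterior_kernel a d z)"
proof -
 \<comment> \<open>With r = d/4 the inner cutoff acts within radius d/2, so the test kernel equals
   the exterior kernel off \<open>ball a d\<close>, while \<open>ball a (4 * r)\<close> is the full
   disc on which U is holomorphic.\<close>
 define r where "r = d / 4"
 have r: "r > 0" using d by (simp add: r_def)
 have cU: "continuous_on UNIV U" and L2: "locally_L2 UNIV H"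
  using weak by (auto simp: weak_wirtinger_def)
 have [measurable]: "U \<in> borel_measurable borel" using cU by (rule borel_measurable_continuous_onI)
 have [measurable]: "H \<in> borel_measurable borel"
  using L2 by (auto simp: locally_L2_def set_borel_measurable_def)
 have hol: "U holomorphic_on ball a (4 * r)"
  by (rule weak_wirtinger_holomorphic[OF weak_wirtinger_subset[OF weak]]) (use H0 in \<open>auto simp: r_def\<close>)
 note res = integral_cutoff_slope_deriv[OF r hol cU]
 define s where "s z = complex_of_real (cutoff_slope a r z)" for z
 define \<Phi> where "\<Phi> z = (1 - complex_of_real (cutoff a r z)) * (1 / (z - a)^2)" for z
 define \<Phi>p where "\<Phi>p z = (0 - s z * cnj (z - a)) * (1 / (z - a)^2) + (1 - complex_of_real (cutoff a r z)) * (- 2 / (z - a) ^ 3)" for z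
 define \<Phi>q where "\<Phi>q z = - (s z / (z - a))" for z
 have \<Phi>in: "\<Phi> z = 0" "\<Phi>p z = 0" "\<Phi>q z = 0" if "cmod (z - a) \<le> r" for z
  using cutoff_inner[OF r that] by (auto simp: \<Phi>_def \<Phi>p_def \<Phi>q_def s_def)
 have \<Phi>out: "\<Phi> z = exterior_kernel a d z" if "z \<notin> ball a d" for z
  using cutoff_outer[OF r, of z a] that d by (simp add: \<Phi>_def exterior_kernel_def r_def dist_norm norm_minus_commute)
 have \<Phi>n: "cmod (\<Phi> z) \<le> 1 / (cmod (z - a))^2" for z
 proof -
  have "cmod (1 - complex_of_real (cutoff a r z)) = \<bar>1 - cutoff a r z\<bar>"
   by (metis norm_of_real of_real_1 of_real_diff)
  also have "\<dots> \<le> 1" using cutoff_bounds[of a r z] by auto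
  finally show ?thesis unfolding \<Phi>_def norm_mult by (simp add: norm_divide norm_power divide_right_mono)
 qed
 have d\<Phi>: "wirtinger \<Phi> (\<Phi>p z) (\<Phi>q z) z" for z
 proof (cases "z = a")
  case True
  have "wirtinger \<Phi> 0 0 z"
   by (rule wirtinger_transform[OF wirtinger_const[of 0], of "ball a r"])
    (use True r \<Phi>in in \<open>auto simp: dist_norm norm_minus_commute\<close>)
  then show ?thesis using \<Phi>in(2,3)[of z] True r by simp
 next
  case False
  have "((\<lambda>z. 1 / (z - a)^2) has_field_derivative (- 2 / (z - a) ^ 3)) (at z)"
  proof -
   have "((\<lambda>x. 1 / x^2) has_field_derivative (- 2 / x ^ 3)) (at x)" if "x \<noteq> 0" for x :: complex
    using that by (auto intro!: derivative_eq_intros simp: divide_simps eval_nat_numeral)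
   moreover have "((\<lambda>z. z - a) has_field_derivative 1) (at z)" by (auto intro!: derivative_eq_intros)
   ultimately show ?thesis
    using DERIV_chain2[where f="\<lambda>x. 1 / x^2" and g="\<lambda>z. z - a" and x=z and Db=1 and s=UNIV] False by simp
  qed
  note w = wirtinger_mult[OF wirtinger_diff[OF wirtinger_const[of 1] wirtinger_cutoff[OF r, of a z]] wirtinger_field_derivative[OF this]]
  have "(0 - of_real (cutoff_slope a r z) * (z - a)) * (1 / (z - a)^2) + (1 - complex_of_real (cutoff a r z)) * 0 = \<Phi>q z"
   using False by (simp add: \<Phi>q_def s_def power2_eq_square)
  with w show ?thesis unfolding \<Phi>_def[abs_def] \<Phi>p_def s_def by simp
 qed
 have cs: "continuous_on S s" for S unfolding s_def by (intro continuous_intros)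
 have cont: "continuous_on UNIV \<Phi>p" "continuous_on UNIV \<Phi>q"
 proof -
  have U: "UNIV = (UNIV - {a}) \<union> ball a r" using r by auto
  have c1: "continuous_on (UNIV - {a}) \<Phi>p" "continuous_on (UNIV - {a}) \<Phi>q"
   unfolding \<Phi>p_def \<Phi>q_def by (intro continuous_intros cs; simp)+
  have c2: "continuous_on (ball a r) \<Phi>p" "continuous_on (ball a r) \<Phi>q"
   by (rule continuous_on_eq[of _ "\<lambda>z. 0"]; use \<Phi>in in \<open>auto simp: dist_norm norm_minus_commute\<close>)+
  show "continuous_on UNIV \<Phi>p" "continuous_on UNIV \<Phi>q"
   by (subst U, rule continuous_on_open_Un; use c1 c2 in auto)+
 qed
 define T where "T n = d + real n + 1" for n :: nat
 have T: "T n > 0" "T n \<ge> d" "T n \<ge> 1" for n using d by (auto simp: T_def)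
 define \<chi>' where "\<chi>' n z = complex_of_real (cutoff a (T n) z)" for n z
 define t where "t n z = complex_of_real (cutoff_slope a (T n) z)" for n z
 \<comment> \<open>The weak dbar equation for the doubly cut-off kernel. The inner cutoff produces
   the residue integral on the left, the outer one an error located near radius T.\<close>
 have id: "(LINT z|lborel. U z * (s z / (z - a))) = (LINT z|lborel. U z * (t n z * (z - a) * \<Phi> z)) + (LINT z|lborel. H z * (\<chi>' n z * \<Phi> z))" for n
 proof -
  have c\<Phi>: "continuous_on UNIV \<Phi>"
   by (intro continuous_at_imp_continuous_on ballI) (rule wirtinger_continuous[OF d\<Phi>])
  have test: "test_function UNIV (\<lambda>z. \<chi>' n z * \<Phi> z) (\<lambda>z. t n z * cnj (z - a) * \<Phi> z + \<chi>' n z * \<Phi>p z) (\<lambda>z. t n z * (z - a) * \<Phi> z + \<chi>' n z * \<Phi>q z)"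
  proof (rule test_functionI[of "cball a (2 * T n)"])
   show "\<chi>' n z * \<Phi> z = 0" if "z \<notin> cball a (2 * T n)" for z
    using cutoff_outer(1)[OF T(1)[of n], of z a] that by (simp add: \<chi>'_def dist_norm norm_minus_commute)
   show "wirtinger (\<lambda>z. \<chi>' n z * \<Phi> z) (t n z * cnj (z - a) * \<Phi> z + \<chi>' n z * \<Phi>p z) (t n z * (z - a) * \<Phi> z + \<chi>' n z * \<Phi>q z) z" for z
    unfolding \<chi>'_def t_def by (intro wirtinger_mult wirtinger_cutoff T d\<Phi>)
   show "continuous_on UNIV (\<lambda>z. t n z * cnj (z - a) * \<Phi> z + \<chi>' n z * \<Phi>p z)"
    "continuous_on UNIV (\<lambda>z. t n z * (z - a) * \<Phi> z + \<chi>' n z * \<Phi>q z)"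
    unfolding \<chi>'_def t_def by (intro continuous_intros cont c\<Phi>)+
  qed auto
  have eq: "\<chi>' n z * \<Phi>q z = - (s z / (z - a))" for z
  proof (cases "cmod (z - a) \<le> T n")
   case True
   then show ?thesis using cutoff_inner(1)[OF T(1) True] by (simp add: \<chi>'_def \<Phi>q_def)
  next
   case False
   then have "cmod (z - a) \<ge> 2 * r" using T(2)[of n] d unfolding r_def by linarith
   then have "s z = 0" using cutoff_outer(2)[OF r, of z a] by (simp add: s_def)
   then show ?thesis by (simp add: \<Phi>q_def)
  qed
  have i1: "integrable lborel (\<lambda>z. U z * (t n z * (z - a) * \<Phi> z))"
  proof -
   have "continuous_on (cball a (2 * T n)) (\<lambda>z. U z * (t n z * (z - a) * \<Phi> z))"
    unfolding t_def by (intro continuous_intros continuous_on_subset[OF cU] continuous_on_subset[OF c\<Phi>]) auto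
   from borel_integrable_compact[OF compact_cball this]
   have "integrable lborel (\<lambda>z. indicator (cball a (2 * T n)) z *\<^sub>R (U z * (t n z * (z - a) * \<Phi> z)))" .
   also have "(\<lambda>z. indicator (cball a (2 * T n)) z *\<^sub>R (U z * (t n z * (z - a) * \<Phi> z))) = (\<lambda>z. U z * (t n z * (z - a) * \<Phi> z))"
   proof
    fix z show "indicator (cball a (2 * T n)) z *\<^sub>R (U z * (t n z * (z - a) * \<Phi> z)) = U z * (t n z * (z - a) * \<Phi> z)"
     using cutoff_outer(2)[OF T(1)[of n], of z a] by (cases "z \<in> cball a (2 * T n)") (auto simp: t_def dist_norm norm_minus_commute)
   qed
   finally show ?thesis .
  qed
  have "(LINT z|lborel. U z * (t n z * (z - a) * \<Phi> z + \<chi>' n z * \<Phi>q z)) = - (LINT z|lborel. H z * (\<chi>' n z * \<Phi> z))"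
   using weak_wirtingerD(2)[OF weak test] by simp
  also have "(\<lambda>z. U z * (t n z * (z - a) * \<Phi> z + \<chi>' n z * \<Phi>q z)) = (\<lambda>z. U z * (t n z * (z - a) * \<Phi> z) - U z * (s z / (z - a)))"
   unfolding eq by (simp add: algebra_simps)
  also have "(LINT z|lborel. U z * (t n z * (z - a) * \<Phi> z) - U z * (s z / (z - a))) = (LINT z|lborel. U z * (t n z * (z - a) * \<Phi> z)) - (LINT z|lborel. U z * (s z / (z - a)))"
   using i1 res(1) by (intro Bochner_Integration.integral_diff) (auto simp: s_def)
  finally show ?thesis by (simp add: algebra_simps)
 qed
 have HE: "integrable lborel (\<lambda>z. H z * exterior_kernel a d z)"
  by (intro product_L2_integrable H2 exterior_kernel_L2 d) measurable
 have H\<Phi>: "AE z in lborel. H z * \<Phi> z = H z * exterior_kernel a d z"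
  using H0 by eventually_elim (use \<Phi>out in auto)
 have [measurable]: "\<Phi> \<in> borel_measurable borel" unfolding \<Phi>_def by measurable
 have lim1: "(\<lambda>n. LINT z|lborel. H z * (\<chi>' n z * \<Phi> z)) \<longlonglongrightarrow> (LINT z|lborel. H z * exterior_kernel a d z)"
 proof (rule integral_dominated_convergence[where w="\<lambda>z. cmod (H z * exterior_kernel a d z)"])
  show "integrable lborel (\<lambda>z. cmod (H z * exterior_kernel a d z))" using HE by auto
  show "(\<lambda>z. H z * (\<chi>' n z * \<Phi> z)) \<in> borel_measurable lborel" for n unfolding \<chi>'_def by measurable
  show "AE z in lborel. (\<lambda>n. H z * (\<chi>' n z * \<Phi> z)) \<longlonglongrightarrow> H z * exterior_kernel a d z"
   using H\<Phi>
  proof eventually_elim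
   case (elim z)
   have "\<forall>\<^sub>F n in sequentially. H z * (\<chi>' n z * \<Phi> z) = H z * exterior_kernel a d z"
    using eventually_ge_at_top[of "nat \<lceil>cmod (z - a)\<rceil>"]
   proof eventually_elim
    case (elim n)
    then have "cmod (z - a) \<le> T n" using d by (simp add: nat_le_iff ceiling_le_iff T_def)
    from cutoff_inner(1)[OF T(1) this] show ?case using \<open>H z * \<Phi> z = _\<close> by (simp add: \<chi>'_def)
   qed
   then show ?case by (rule tendsto_eventually)
  qed
  show "AE z in lborel. cmod (H z * (\<chi>' n z * \<Phi> z)) \<le> cmod (H z * exterior_kernel a d z)" for n
   using H\<Phi>
  proof eventually_elim
   case (elim z)
   have "cmod (\<chi>' n z) \<le> 1" using cutoff_bounds[of a "T n" z] by (simp add: \<chi>'_def)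
   then have "cmod (\<chi>' n z) * cmod (H z * \<Phi> z) \<le> 1 * cmod (H z * \<Phi> z)" by (rule mult_right_mono) simp
   moreover have "cmod (H z * (\<chi>' n z * \<Phi> z)) = cmod (\<chi>' n z) * cmod (H z * \<Phi> z)"
    by (simp add: norm_mult mult_ac)
   ultimately show ?case using elim by (simp only: mult_1)
  qed
 qed measurable
 \<comment> \<open>The area is of order T^2, the cutoff gradient of order 1/T and the kernel of
   order 1/T^2. The product is 32 A m / T, and the bound m on U at large radii makes it
   small.\<close>
 have lim2: "(\<lambda>n. LINT z|lborel. U z * (t n z * (z - a) * \<Phi> z)) \<longlonglongrightarrow> 0"
 proof (rule LIMSEQ_I)
  fix e :: real assume e: "e > 0"
  define A where "A = measure lborel (cball (0::complex) 1)"
  have A: "A \<ge> 0" by (simp add: A_def)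
  define B where "B = A + 1"
  have B: "B > 0" using A by (simp add: B_def)
  define m where "m = e / (64 * B)"
  have m: "m > 0" using e B by (simp add: m_def)
  have "\<forall>\<^sub>F z in at_infinity. cmod (U z) < m" using tendstoD[OF lim m] by simp
  then obtain \<rho> where \<rho>: "\<And>z. cmod z \<ge> \<rho> \<Longrightarrow> cmod (U z) < m" by (auto simp: eventually_at_infinity)
  show "\<exists>N. \<forall>n\<ge>N. norm ((LINT z|lborel. U z * (t n z * (z - a) * \<Phi> z)) - 0) < e"
  proof (intro exI allI impI)
   fix n assume n: "n \<ge> nat \<lceil>\<rho> + cmod a\<rceil>"
   have nn: "T n \<ge> \<rho> + cmod a" using n d by (simp add: nat_le_iff ceiling_le_iff T_def)
   have bnd: "cmod (U z * (t n z * (z - a) * \<Phi> z)) \<le> indicator (cball a (2 * T n)) z * (m * (8 / T n) * (1 / (T n)^2))" for z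
   proof (cases "z \<in> cball a (2 * T n) \<and> cmod (z - a) > T n")
    case True
    have "cmod (z - a) \<le> cmod z + cmod a" by (rule norm_triangle_ineq4)
    then have "cmod (U z) \<le> m" using True nn by (intro less_imp_le \<rho>) linarith
    moreover have "cmod (t n z * (z - a)) \<le> 8 / T n" unfolding t_def by (rule cutoff_slope_bound[OF T(1)])
    moreover have "cmod (\<Phi> z) \<le> 1 / (T n)^2"
    proof (rule order_trans[OF \<Phi>n])
     have "(T n)\<^sup>2 \<le> (cmod (z - a))^2" using True T[of n] by (intro power_mono) auto
     then show "1 / (cmod (z - a))^2 \<le> 1 / (T n)^2" using T(1)[of n] True by (intro divide_left_mono mult_pos_pos) auto
    qed
    ultimately have "cmod (U z) * cmod (t n z * (z - a)) * cmod (\<Phi> z) \<le> m * (8 / T n) * (1 / (T n)^2)"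
     using m T(1)[of n] by (intro mult_mono) auto
    then show ?thesis using True by (simp add: norm_mult mult_ac)
   next
    case False
    then have "t n z = 0"
     using cutoff_inner(2)[OF T(1)[of n], of z a] cutoff_outer(2)[OF T(1)[of n], of z a]
     by (auto simp: t_def dist_norm norm_minus_commute)
    then show ?thesis using m T(1)[of n] by simp
   qed
   have ii: "integrable lborel (\<lambda>z. indicator (cball a (2 * T n)) z * (m * (8 / T n) * (1 / (T n)^2)))"
    by (intro integrable_mult_left integrable_real_indicator) (use emeasure_lborel_cball_finite in auto)
   have "integrable lborel (\<lambda>z. U z * (t n z * (z - a) * \<Phi> z))"
    by (rule Bochner_Integration.integrable_bound[OF ii])
     (unfold t_def, measurable, use bnd order_trans[OF bnd abs_ge_self] in \<open>auto simp: t_def\<close>)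
   then have "cmod (LINT z|lborel. U z * (t n z * (z - a) * \<Phi> z)) \<le> (LINT z|lborel. indicator (cball a (2 * T n)) z * (m * (8 / T n) * (1 / (T n)^2)))"
    by (intro Bochner_Integration.integral_norm_bound_integral ii bnd)
   also have "\<dots> = measure lborel (cball a (2 * T n)) * (m * (8 / T n) * (1 / (T n)^2))" by simp
   also have "measure lborel (cball a (2 * T n)) = (2 * T n)^2 * A"
    using T(1)[of n] by (simp add: A_def content_cball DIM_complex)
   also have "(2 * T n)\<^sup>2 * A * (m * (8 / T n) * (1 / (T n)^2)) = 32 * A * m * (1 / T n)"
    using T(1)[of n] by (simp add: power2_eq_square field_simps)
   also have "\<dots> \<le> 32 * A * m * 1" using T[of n] A m by (intro mult_left_mono) auto
   also have "\<dots> < e"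
   proof -
    have "B * m = e / 64" using B by (simp add: m_def)
    then have "32 * (A * m) = e / 2 - 32 * m" by (simp add: B_def distrib_right)
    then show ?thesis using m e unfolding mult.assoc by simp
   qed
   finally show "norm ((LINT z|lborel. U z * (t n z * (z - a) * \<Phi> z)) - 0) < e" by simp
  qed
 qed
 have "(\<lambda>n::nat. LINT z|lborel. U z * (s z / (z - a))) \<longlonglongrightarrow> 0 + (LINT z|lborel. H z * exterior_kernel a d z)"
  using tendsto_add[OF lim2 lim1] unfolding id[symmetric] .
 then have "(LINT z|lborel. U z * (s z / (z - a))) = (LINT z|lborel. H z * exterior_kernel a d z)"
  using LIMSEQ_unique[OF tendsto_const] by fastforce
 then show ?thesis using res(2) by (simp add: s_def minus_equation_iff)
qed

text \<open>Inserting H = \<mu> (G - E) into the representation separates the linear term, the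
  integral of \<mu> E^2, from that of \<mu> G E. The latter is quadratic in k because the energy
  estimate makes G itself of order k.\<close>

lemma beltrami_derivative_estimate:
 assumes weak: "weak_wirtinger UNIV U G H" and lim: "(U \<longlongrightarrow> l) at_infinity"
  and mu: "\<mu> \<in> borel_measurable borel" "AE z in lborel. cmod (\<mu> z) \<le> k" and k: "0 \<le> k" "k \<le> 1/4"
  and d: "d > 0" and mu0: "\<And>z. z \<in> ball a d \<Longrightarrow> \<mu> z = 0"
  and eq: "AE z in lborel. H z = \<mu> z * (G z - exterior_kernel a d z)"
 shows "cmod (of_real slope_mass * deriv U a - (LINT z|lborel. \<mu> z * (exterior_kernel a d z)^2)) \<le> 4 * kernel_mass * k^2 / d^2"
proof -
 define E where "E = exterior_kernel a d"
 define IE where "IE = (LINT z|lborel. (cmod (E z))\<^sup>2)"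
 have E2: "integrable lborel (\<lambda>z. (cmod (E z))\<^sup>2)" and IE: "IE = kernel_mass / d^2"
  unfolding E_def IE_def using exterior_kernel_L2[OF d] by auto
 have [measurable]: "E \<in> borel_measurable borel" by (simp add: E_def)
 have [measurable]: "G \<in> borel_measurable borel" "H \<in> borel_measurable borel"
  using weak by (auto simp: weak_wirtinger_def locally_L2_def set_borel_measurable_def)
 note [measurable] = mu(1)
 have w': "weak_wirtinger UNIV (\<lambda>z. U z + - l) (\<lambda>z. G z + 0) (\<lambda>z. H z + 0)"
  by (intro weak_wirtinger_add weak weak_wirtinger_classical wirtinger_const) auto
 then have w: "weak_wirtinger UNIV (\<lambda>z. U z - l) G H" by simp
 have lim0: "((\<lambda>z. U z - l) \<longlongrightarrow> 0) at_infinity" using tendsto_diff[OF lim tendsto_const[of l]] by simp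
 note G = beltrami_energy[OF w lim0 mu k eq[folded E_def] _ E2]
 have G2: "integrable lborel (\<lambda>z. (cmod (G z))\<^sup>2)" and IG: "(LINT z|lborel. (cmod (G z))\<^sup>2) \<le> 16 * k^2 * IE"
  using G by (auto simp: IE_def)
 have GE: "integrable lborel (\<lambda>z. (cmod (G z + - E z))\<^sup>2)"
 proof (rule Bochner_Integration.integrable_bound[of _ "\<lambda>z. 2 * (cmod (G z))^2 + 2 * (cmod (E z))^2"])
  show "integrable lborel (\<lambda>z. 2 * (cmod (G z))^2 + 2 * (cmod (E z))^2)" using G2 E2 by auto
  show "AE z in lborel. norm ((cmod (G z + - E z))^2) \<le> norm (2 * (cmod (G z))^2 + 2 * (cmod (E z))^2)"
   using norm_add_power2_le[of "G _" "- E _"] by auto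
 qed measurable
 have H2: "integrable lborel (\<lambda>z. (cmod (H z))\<^sup>2)"
 proof (rule Bochner_Integration.integrable_bound[of _ "\<lambda>z. k\<^sup>2 * (cmod (G z + - E z))^2"])
  show "integrable lborel (\<lambda>z. k\<^sup>2 * (cmod (G z + - E z))^2)" using GE by auto
  show "AE z in lborel. norm ((cmod (H z))^2) \<le> norm (k^2 * (cmod (G z + - E z))^2)"
   using mu(2) eq
  proof eventually_elim
   case (elim z)
   have "cmod (H z) = cmod (\<mu> z) * cmod (G z + - E z)" using elim by (simp add: norm_mult E_def)
   also have "\<dots> \<le> k * cmod (G z + - E z)" by (intro mult_right_mono elim) auto
   finally have "(cmod (H z))\<^sup>2 \<le> (k * cmod (G z + - E z))^2" by (intro power_mono) auto
   then show ?case by (simp add: power_mult_distrib)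
  qed
 qed measurable
 have H0: "AE z in lborel. z \<in> ball a d \<longrightarrow> H z = 0"
  using eq by eventually_elim (simp add: mu0)
 have dU: "deriv (\<lambda>z. U z - l) a = deriv U a"
 proof -
  have "U holomorphic_on ball a d"
   by (rule weak_wirtinger_holomorphic[OF weak_wirtinger_subset[OF weak]]) (use H0 in auto)
  then have "(U has_field_derivative deriv U a) (at a)" by (rule holomorphic_derivI) (use d in auto)
  then have "((\<lambda>z. U z - l) has_field_derivative deriv U a) (at a)" by (auto intro!: derivative_eq_intros)
  then show ?thesis by (rule DERIV_imp_deriv)
 qed
 have rep: "of_real slope_mass * deriv U a = - (LINT z|lborel. H z * E z)"
  using beltrami_representation[OF w lim0 d H0 H2] unfolding dU E_def .
 have bm: "integrable lborel (\<lambda>z. v z * \<mu> z)" if v: "integrable lborel v" for v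
 proof (rule Bochner_Integration.integrable_bound[of _ "\<lambda>z. k * cmod (v z)"])
  show "integrable lborel (\<lambda>z. k * cmod (v z))" using v by auto
  show "(\<lambda>z. v z * \<mu> z) \<in> borel_measurable lborel" using v by (auto dest: borel_measurable_integrable)
  show "AE z in lborel. cmod (v z * \<mu> z) \<le> norm (k * cmod (v z))"
   using mu(2)
  proof eventually_elim
   case (elim z)
   then have "cmod (v z) * cmod (\<mu> z) \<le> cmod (v z) * k" by (rule mult_left_mono) simp
   then show ?case using k by (simp add: norm_mult mult.commute)
  qed
 qed
 have i1: "integrable lborel (\<lambda>z. G z * E z * \<mu> z)"
  by (intro bm product_L2_integrable G2 E2) measurable
 have i2: "integrable lborel (\<lambda>z. E z * E z * \<mu> z)"
  by (intro bm product_L2_integrable E2) measurable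
 have "(LINT z|lborel. H z * E z) = (LINT z|lborel. G z * E z * \<mu> z - E z * E z * \<mu> z)"
 proof (rule integral_cong_AE)
  show "AE z in lborel. H z * E z = G z * E z * \<mu> z - E z * E z * \<mu> z"
   using eq
  proof eventually_elim
   case (elim z)
   show ?case unfolding elim E_def by (simp add: algebra_simps)
  qed
 qed measurable
 also have "\<dots> = (LINT z|lborel. G z * E z * \<mu> z) - (LINT z|lborel. E z * E z * \<mu> z)"
  using i1 i2 by (rule Bochner_Integration.integral_diff)
 also have "(\<lambda>z. E z * E z * \<mu> z) = (\<lambda>z. \<mu> z * (exterior_kernel a d z)^2)"
  by (auto simp: E_def power2_eq_square mult_ac)
 finally have "of_real slope_mass * deriv U a - (LINT z|lborel. \<mu> z * (exterior_kernel a d z)^2) = - (LINT z|lborel. G z * E z * \<mu> z)"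
  using rep by simp
 moreover have "cmod (LINT z|lborel. G z * E z * \<mu> z) \<le> 4 * kernel_mass * k^2 / d^2"
 proof -
  have "cmod (LINT z|lborel. G z * E z * \<mu> z) \<le> (LINT z|lborel. cmod (G z * E z * \<mu> z))"
   by (rule integral_norm_bound)
  also have "\<dots> \<le> (LINT z|lborel. (cmod (G z))\<^sup>2 / 8 + 2 * k^2 * (cmod (E z))^2)"
  proof (rule integral_mono_AE)
   show "integrable lborel (\<lambda>z. cmod (G z * E z * \<mu> z))" using i1 by auto
   show "integrable lborel (\<lambda>z. (cmod (G z))\<^sup>2 / 8 + 2 * k^2 * (cmod (E z))^2)" using G2 E2 by auto
   show "AE z in lborel. cmod (G z * E z * \<mu> z) \<le> (cmod (G z))^2 / 8 + 2 * k^2 * (cmod (E z))^2"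
    using mu(2)
   proof eventually_elim
    case (elim z)
    have "cmod (G z * E z * \<mu> z) \<le> cmod (G z) * cmod (E z) * k"
     unfolding norm_mult using elim by (intro mult_left_mono) auto
    \<comment> \<open>The weights 1/8 and 2 k^2 balance: the energy bound 16 k^2 IE turns each of
      the two terms into 2 k^2 IE.\<close>
    also have "\<dots> \<le> (cmod (G z))^2 / 8 + 2 * k^2 * (cmod (E z))^2"
     using zero_le_power2[of "cmod (G z) - 4 * k * cmod (E z)"]
     by (simp add: power2_eq_square algebra_simps)
    finally show ?case .
   qed
  qed
  also have "\<dots> = (LINT z|lborel. (cmod (G z))\<^sup>2) / 8 + 2 * k^2 * IE" using G2 E2 by (simp add: IE_def)
  also have "\<dots> \<le> 4 * (k^2 * IE)" using IG unfolding mult.assoc by linarith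
  finally show ?thesis by (simp add: IE mult_ac)
 qed
 ultimately show ?thesis by simp
qed

section \<open>The Schwarzian derivative of a quasiconformal homeomorphism\<close>

text \<open>Leibniz with a linear factor. At z = a the first term drops out, which lets the Taylor
  coefficients of a difference quotient be read off.\<close>

lemma higher_deriv_linear_mult:
 assumes K: "K holomorphic_on S" and S: "open S" and z: "z \<in> S"
 shows "(deriv ^^ Suc n) (\<lambda>z. (z - a) * K z) z = (z - a) * (deriv ^^ Suc n) K z + of_nat (Suc n) * (deriv ^^ n) K z"
 using z
proof (induction n arbitrary: z)
 case 0
 have "(K has_field_derivative deriv K z) (at z)" by (rule holomorphic_derivI[OF K S 0])
 then have "((\<lambda>z. (z - a) * K z) has_field_derivative (z - a) * deriv K z + K z) (at z)"
  by (auto intro!: derivative_eq_intros)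
 then show ?case by (simp add: DERIV_imp_deriv)
next
 case (Suc n)
 have h: "(deriv ^^ m) K holomorphic_on S" for m by (rule holomorphic_higher_deriv[OF K S])
 have d: "((deriv ^^ m) K has_field_derivative (deriv ^^ Suc m) K z) (at z)" for m
  using holomorphic_derivI[OF h S Suc.prems, of m] by simp
 have "deriv ((deriv ^^ Suc n) (\<lambda>z. (z - a) * K z)) z = deriv (\<lambda>z. (z - a) * (deriv ^^ Suc n) K z + of_nat (Suc n) * (deriv ^^ n) K z) z"
  by (rule complex_derivative_transform_within_open[of _ S])
   (use Suc S in \<open>auto intro!: holomorphic_intros holomorphic_higher_deriv K simp del: funpow.simps\<close>)
 also have "\<dots> = (z - a) * (deriv ^^ Suc (Suc n)) K z + (deriv ^^ Suc n) K z + of_nat (Suc n) * (deriv ^^ Suc n) K z"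
  by (rule DERIV_imp_deriv) (auto intro!: derivative_eq_intros d simp del: funpow.simps)
 finally show ?case by (simp add: algebra_simps)
qed

lemma schwarzian_eq:
 assumes f: "f holomorphic_on S" and S: "open S" and z: "z \<in> S" and nz: "deriv f z \<noteq> 0"
 shows "schwarzian f z = (deriv ^^ 3) f z / deriv f z - 3 / 2 * ((deriv ^^ 2) f z / deriv f z)^2"
proof -
 have d: "((deriv ^^ m) f has_field_derivative (deriv ^^ Suc m) f z) (at z)" for m
  using holomorphic_derivI[OF holomorphic_higher_deriv[OF f S] S z, of m] by simp
 have "((\<lambda>u. deriv (deriv f) u / deriv f u) has_field_derivative
   ((deriv ^^ 3) f z * deriv f z - deriv (deriv f) z * (deriv ^^ 2) f z) / (deriv f z * deriv f z)) (at z)"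
  using DERIV_divide[OF d[of 2] d[of 1]] nz by (simp add: eval_nat_numeral)
 then have eq: "deriv (\<lambda>u. deriv (deriv f) u / deriv f u) z = ((deriv ^^ 3) f z * deriv f z - deriv (deriv f) z * (deriv ^^ 2) f z) / (deriv f z * deriv f z)"
  by (rule DERIV_imp_deriv)
 show ?thesis unfolding schwarzian_def eq using nz by (simp add: eval_nat_numeral field_simps)
qed

text \<open>The classical expansion f'(a) / (f(z) - f(a)) = 1/(z - a) + c - (S/6)(z - a) + ... at a,
  with S the Schwarzian at a. Injectivity makes the left side finite away from a and f'(a)
  nonzero.\<close>

lemma regular_part_deriv:
 assumes f: "f holomorphic_on ball a r" and inj: "inj_on f (ball a r)" and r: "r > 0"
 obtains U where "U holomorphic_on ball a r" "\<And>z. z \<in> ball a r \<Longrightarrow> z \<noteq> a \<Longrightarrow> U z = deriv f a / (f z - f a) - 1 / (z - a)"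
  "deriv U a = - schwarzian f a / 6"
proof -
 let ?B = "ball a r"
 have aB: "a \<in> ?B" using r by simp
 have nz: "deriv f a \<noteq> 0" by (rule holomorphic_injective_imp_regular[OF f open_ball inj aB])
 define K where "K z = (if z = a then deriv f a else (f z - f a) / (z - a))" for z
 have K: "K holomorphic_on ?B" unfolding K_def by (rule pole_lemma_open[OF f open_ball])
 have Knz: "K z \<noteq> 0" if "z \<in> ?B" for z
  using that nz inj aB by (auto simp: K_def inj_on_def)
 define k where "k z = deriv f a / K z" for z
 have k: "k holomorphic_on ?B" unfolding k_def using Knz by (intro holomorphic_intros K) auto
 have ka: "k a = 1" using nz by (simp add: k_def K_def)
 define U where "U z = (if z = a then deriv k a else (k z - k a) / (z - a))" for z
 have U: "U holomorphic_on ?B" unfolding U_def by (rule pole_lemma_open[OF k open_ball])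
 have Ueq: "U z = deriv f a / (f z - f a) - 1 / (z - a)" if "z \<in> ?B" "z \<noteq> a" for z
 proof -
  have "f z - f a \<noteq> 0" using inj that aB by (auto simp: inj_on_def)
  then show ?thesis using that ka by (simp add: U_def k_def K_def field_simps)
 qed
 have e1: "(deriv ^^ Suc n) f a = of_nat (Suc n) * (deriv ^^ n) K a" for n
 proof -
  have fK: "f z - f a = (z - a) * K z" for z by (simp add: K_def)
  have "(deriv ^^ Suc n) f a = (deriv ^^ n) (deriv f) a" by (simp only: funpow_Suc_right o_apply)
  also have "deriv f = deriv (\<lambda>z. f z - f a)" by (rule ext) (simp add: deriv_def DERIV_def)
  also have "(deriv ^^ n) (deriv (\<lambda>z. f z - f a)) a = (deriv ^^ Suc n) (\<lambda>z. (z - a) * K z) a"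
   unfolding fK by (simp only: funpow_Suc_right o_apply)
  also have "\<dots> = of_nat (Suc n) * (deriv ^^ n) K a"
   using higher_deriv_linear_mult[OF K open_ball aB, of n a] by (simp del: funpow.simps)
  finally show ?thesis .
 qed
 have e2: "(deriv ^^ Suc n) k a = of_nat (Suc n) * (deriv ^^ n) U a" for n
 proof -
  have fK: "k z - k a = (z - a) * U z" for z by (simp add: U_def)
  have "(deriv ^^ Suc n) k a = (deriv ^^ n) (deriv k) a" by (simp only: funpow_Suc_right o_apply)
  also have "deriv k = deriv (\<lambda>z. k z - k a)" by (rule ext) (simp add: deriv_def DERIV_def)
  also have "(deriv ^^ n) (deriv (\<lambda>z. k z - k a)) a = (deriv ^^ Suc n) (\<lambda>z. (z - a) * U z) a"
   unfolding fK by (simp only: funpow_Suc_right o_apply)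
  also have "\<dots> = of_nat (Suc n) * (deriv ^^ n) U a"
   using higher_deriv_linear_mult[OF U open_ball aB, of n a] by (simp del: funpow.simps)
  finally show ?thesis .
 qed
 have dk: "deriv k z = - k z * deriv K z / K z" if z: "z \<in> ?B" for z
 proof -
  have "(k has_field_derivative (0 * K z - deriv f a * deriv K z) / (K z * K z)) (at z)"
   unfolding k_def by (rule DERIV_divide[OF DERIV_const holomorphic_derivI[OF K open_ball z] Knz[OF z]])
  then show ?thesis using Knz[OF z] by (simp add: DERIV_imp_deriv k_def field_simps)
 qed
 have "deriv (deriv k) a = deriv (\<lambda>z. - k z * deriv K z / K z) a"
  by (rule complex_derivative_transform_within_open[of _ ?B])
   (use dk aB Knz in \<open>auto intro!: holomorphic_intros holomorphic_deriv K k\<close>)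
 also have "\<dots> = ((- deriv k a * deriv K a + deriv (deriv K) a * - k a) * K a - - k a * deriv K a * deriv K a) / (K a * K a)"
  by (intro DERIV_imp_deriv DERIV_divide DERIV_mult DERIV_minus holomorphic_derivI[OF k open_ball aB] holomorphic_derivI[OF K open_ball aB]
    holomorphic_derivI[OF holomorphic_deriv[OF K open_ball] open_ball aB] Knz aB)
 finally have ddk: "deriv (deriv k) a = ((- deriv k a * deriv K a + deriv (deriv K) a * - k a) * K a - - k a * deriv K a * deriv K a) / (K a * K a)" .
 \<comment> \<open>The quotient K has value f1 and derivatives f2/2 and f3/3 at a; the derivative of
   U at a is half the second derivative of k = f'(a) / K.\<close>
 define f1 where "f1 = deriv f a"
 define f2 where "f2 = (deriv ^^ 2) f a"
 define f3 where "f3 = (deriv ^^ 3) f a"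
 have K0: "K a = f1" and K1: "deriv K a = f2 / 2" and K2: "deriv (deriv K) a = f3 / 3"
  using e1[of 1] e1[of 2] by (simp_all add: K_def f1_def f2_def f3_def eval_nat_numeral)
 have dka: "deriv k a = - f2 / (2 * f1)" using dk[OF aB] K0 K1 ka by simp
 have n1: "deriv (deriv k) a = (f2 / f1)^2 / 2 - (f3 / f1) / 3"
  using nz unfolding ddk K0 K1 K2 ka dka by (simp add: f1_def[symmetric] field_simps power2_eq_square)
 have n2: "deriv (deriv k) a = 2 * deriv U a" using e2[of 1] by (simp add: eval_nat_numeral)
 have n3: "schwarzian f a = f3 / f1 - 3 / 2 * (f2 / f1)^2"
  unfolding f1_def f2_def f3_def by (rule schwarzian_eq[OF f open_ball aB nz])
 have "deriv U a = (2 * deriv U a) / 2" by simp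
 also have "\<dots> = - schwarzian f a / 6" unfolding n2[symmetric] n1 n3 by (simp add: field_simps)
 finally have "deriv U a = - schwarzian f a / 6" .
 with U Ueq show thesis using that by blast
qed

section \<open>The weak Beltrami equation under composition and gluing\<close>

lemma weak_wirtinger_cong:
 assumes "weak_wirtinger Y f g h" "\<And>z. z \<in> Y \<Longrightarrow> f z = f' z"
 shows "weak_wirtinger Y f' g h"
proof (rule weak_wirtingerI)
 show "open Y" "continuous_on Y f'" "locally_L2 Y g" "locally_L2 Y h"
  using assms by (auto simp: weak_wirtinger_def cong: continuous_on_cong)
 fix \<phi> p q assume t: "test_function Y \<phi> p q"
 have "(\<lambda>z. indicator Y z *\<^sub>R (f' z * u z)) = (\<lambda>z. indicator Y z *\<^sub>R (f z * u z))" for u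
  using assms(2) by (auto simp: fun_eq_iff indicator_def)
 then show "(LINT z|lborel. indicator Y z *\<^sub>R (f' z * p z)) = - (LINT z|lborel. indicator Y z *\<^sub>R (g z * \<phi> z))"
  "(LINT z|lborel. indicator Y z *\<^sub>R (f' z * q z)) = - (LINT z|lborel. indicator Y z *\<^sub>R (h z * \<phi> z))"
  using weak_wirtingerD[OF assms(1) t] by simp_all
qed

text \<open>An inhomogeneous Beltrami equation: \<open>f - \<integral>E\<close> is a solution off the support of the kernel.\<close>

definition weak_beltrami ::
 "complex set \<Rightarrow> (complex \<Rightarrow> complex) \<Rightarrow> (complex \<Rightarrow> complex) \<Rightarrow> (complex \<Rightarrow> complex) \<Rightarrow> bool"
where
 "weak_beltrami Y \<mu> E f \<longleftrightarrow> (\<exists>g h. weak_wirtinger Y f g h \<and> (AE z in lborel. z \<in> Y \<longrightarrow> h z = \<mu> z * (g z - E z)))"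

lemma weak_beltrami_solution:
 assumes "beltrami_solution_on Y \<mu> f"
 shows "weak_beltrami Y \<mu> (\<lambda>z. 0) f"
 using assms unfolding beltrami_solution_on_def weak_beltrami_def weak_wirtinger_def by auto

lemma weak_beltrami_cong:
 assumes "weak_beltrami Y \<mu> E f" "\<And>z. z \<in> Y \<Longrightarrow> f z = f' z"
 shows "weak_beltrami Y \<mu> E f'"
 using assms weak_wirtinger_cong unfolding weak_beltrami_def by blast

lemma weak_beltrami_subset:
 assumes "weak_beltrami Y \<mu> E f" "open Y'" "Y' \<subseteq> Y"
 shows "weak_beltrami Y' \<mu> E f"
proof -
 obtain g h where gh: "weak_wirtinger Y f g h" "AE z in lborel. z \<in> Y \<longrightarrow> h z = \<mu> z * (g z - E z)"
  using assms(1) unfolding weak_beltrami_def by blast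
 have "AE z in lborel. z \<in> Y' \<longrightarrow> h z = \<mu> z * (g z - E z)"
  using gh(2) by eventually_elim (use assms(3) in auto)
 with weak_wirtinger_subset[OF gh(1) assms(2,3)] show ?thesis unfolding weak_beltrami_def by blast
qed

text \<open>A holomorphic map applied after f multiplies both weak derivatives by the same factor,
  so the homogeneous equation persists.\<close>

lemma weak_beltrami_compose:
 assumes "weak_beltrami Y \<mu> (\<lambda>z. 0) f" and F: "F holomorphic_on V" "open V" "f ` Y \<subseteq> V"
 shows "weak_beltrami Y \<mu> (\<lambda>z. 0) (\<lambda>z. F (f z))"
proof -
 obtain g h where gh: "weak_wirtinger Y f g h" "AE z in lborel. z \<in> Y \<longrightarrow> h z = \<mu> z * (g z - 0)"
  using assms(1) unfolding weak_beltrami_def by blast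
 have "AE z in lborel. z \<in> Y \<longrightarrow> deriv F (f z) * h z = \<mu> z * (deriv F (f z) * g z - 0)"
  using gh(2) by eventually_elim auto
 with weak_wirtinger_compose[OF gh(1) F] show ?thesis unfolding weak_beltrami_def by blast
qed

text \<open>The blended derivatives are convex combinations with the same weights, and the equation
  is affine in the pair of derivatives, so it survives the blending.\<close>

lemma weak_beltrami_glue:
 assumes op: "open Y" and a: "weak_beltrami (Y - {a}) \<mu> E f" "weak_beltrami (ball a r) \<mu> E f" "r > 0" "ball a r \<subseteq> Y"
 shows "weak_beltrami Y \<mu> E f"
proof -
 obtain g1 h1 where 1: "weak_wirtinger (Y - {a}) f g1 h1" "AE z in lborel. z \<in> Y - {a} \<longrightarrow> h1 z = \<mu> z * (g1 z - E z)"
  using a(1) unfolding weak_beltrami_def by blast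
 obtain g2 h2 where 2: "weak_wirtinger (ball a r) f g2 h2" "AE z in lborel. z \<in> ball a r \<longrightarrow> h2 z = \<mu> z * (g2 z - E z)"
  using a(2) unfolding weak_beltrami_def by blast
 define b where "b z = complex_of_real (cutoff a (r / 3) z)" for z
 have "AE z in lborel. z \<noteq> a" by (rule AE_lborel_singleton)
 with 1(2) 2(2) have "AE z in lborel. z \<in> Y \<longrightarrow> b z * h2 z + (1 - b z) * h1 z = \<mu> z * (b z * g2 z + (1 - b z) * g1 z - E z)"
 proof eventually_elim
  case (elim z)
  show ?case
  proof
   assume z: "z \<in> Y"
   show "b z * h2 z + (1 - b z) * h1 z = \<mu> z * (b z * g2 z + (1 - b z) * g1 z - E z)"
   proof (cases "z \<in> ball a r")
    case True
    then have "h1 z = \<mu> z * (g1 z - E z)" "h2 z = \<mu> z * (g2 z - E z)" using elim z by auto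
    then show ?thesis by (simp only:) (simp add: algebra_simps)
   next
    case False
    then have "b z = 0" using cutoff_outer(1)[of "r/3" z a] a(3) by (simp add: b_def dist_norm norm_minus_commute)
    then show ?thesis using elim z by simp
   qed
  qed
 qed
 with weak_wirtinger_glue[OF op 1(1) 2(1) a(3,4)] show ?thesis unfolding weak_beltrami_def b_def by blast
qed

lemma weak_beltrami_holomorphic:
 assumes "f holomorphic_on Y" "open Y" "\<And>z. z \<in> Y \<Longrightarrow> \<mu> z = 0"
 shows "weak_beltrami Y \<mu> E f"
proof -
 have "weak_wirtinger Y f (deriv f) (\<lambda>z. 0)"
 proof (rule weak_wirtinger_classical[OF assms(2)])
  show "wirtinger f (deriv f z) 0 z" if "z \<in> Y" for z
   by (intro wirtinger_field_derivative holomorphic_derivI[OF assms(1,2) that])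
  show "continuous_on Y (deriv f)" by (intro holomorphic_on_imp_continuous_on holomorphic_deriv assms)
 qed auto
 then show ?thesis unfolding weak_beltrami_def using assms(3)
  by (intro exI[of _ "deriv f"] exI[of _ "\<lambda>z. 0"]) auto
qed

lemma weak_beltrami_imp_holomorphic:
 assumes "weak_beltrami Y \<mu> E f" "\<And>z. z \<in> Y \<Longrightarrow> \<mu> z = 0"
 shows "f holomorphic_on Y"
proof -
 obtain g h where gh: "weak_wirtinger Y f g h" "AE z in lborel. z \<in> Y \<longrightarrow> h z = \<mu> z * (g z - E z)"
  using assms(1) unfolding weak_beltrami_def by blast
 have "AE z in lborel. z \<in> Y \<longrightarrow> h z = 0" using gh(2) by eventually_elim (use assms(2) in auto)
 with gh(1) show ?thesis by (rule weak_wirtinger_holomorphic)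
qed

text \<open>\<open>linf_norm\<close> is a \<open>real_of_ereal\<close>, which is meaningful only for
  a finite value. Nonnegativity holds because an almost everywhere bound has at least one
  witness.\<close>

lemma linf_norm_AE:
 assumes "\<mu> \<in> linf_ext"
 shows "AE z in lborel. cmod (\<mu> z) \<le> linf_norm \<mu>" "linf_norm \<mu> \<ge> 0"
proof -
 let ?S = "esssup lborel (\<lambda>z. ereal (cmod (\<mu> z)))"
 have ae: "AE z in lborel. ereal (cmod (\<mu> z)) \<le> ?S" by (rule esssup_AE)
 have "\<not> (AE z in (lborel :: complex measure). False)"
  unfolding trivial_limit_def[symmetric] ae_filter_eq_bot_iff by simp
 then have ex: "\<exists>z. ereal (cmod (\<mu> z)) \<le> ?S" using ae
  by (metis (mono_tags, lifting) eventually_mono)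
 then have "?S \<ge> 0" by (meson ereal_less_eq(5) norm_ge_zero order_trans)
 moreover have "?S < \<infinity>" using assms by (simp add: linf_ext_def)
 ultimately obtain r where r: "?S = ereal r" "r \<ge> 0" by (cases ?S) auto
 show "AE z in lborel. cmod (\<mu> z) \<le> linf_norm \<mu>" "linf_norm \<mu> \<ge> 0"
  using ae r by (auto simp: linf_norm_def)
qed

lemma topspace_riemann_sphere: "topspace riemann_sphere = UNIV"
 by (auto simp: riemann_sphere_def topspace_Alexandroff_compactification) (metis not_None_eq rangeI)

text \<open>\<open>f\<close> is \<open>w\<close> in the finite chart and has an arbitrary value
  where \<open>w\<close> is infinite, so each statement about it is restricted to points with a
  finite image. No lower bound on the distance of such a pole to the origin is assumed.\<close>

locale normalized_qc =
 fixes \<mu> :: "complex \<Rightarrow> complex" and w :: "complex option \<Rightarrow> complex option"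
 assumes mu: "\<mu> \<in> linf_ext" and sol: "normalized_qc_solution \<mu> w"
begin

abbreviation f where "f \<equiv> finite_part w"

abbreviation k where "k \<equiv> linf_norm \<mu>"

lemma mu_measurable [measurable]: "\<mu> \<in> borel_measurable borel"
 using mu by (simp add: linf_ext_def)

lemma mu_zero: "z \<in> cball 0 1 \<Longrightarrow> \<mu> z = 0"
 using mu by (auto simp: linf_ext_def)

lemma w_eq: "w (Some z) = Some (f z)" if "w (Some z) \<noteq> None"
 using that by (auto simp: finite_part_def)

lemma homeo: "homeomorphic_map riemann_sphere riemann_sphere w"
 using sol by (simp add: normalized_qc_solution_def qc_homeomorphism_def)

lemma inj_w: "w x = w y \<Longrightarrow> x = y"
 using homeomorphic_imp_injective_map[OF homeo] by (simp add: topspace_riemann_sphere inj_on_def)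

lemma w_0: "w (Some 0) = Some 0" and f_0: "f 0 = 0"
 using sol by (auto simp: normalized_qc_solution_def finite_part_def)

lemma normalization: "deriv f 0 = 1" "deriv (deriv f) 0 = 0"
 using sol by (auto simp: normalized_qc_solution_def eval_nat_numeral)

lemma sol_finite: "weak_beltrami {z. w (Some z) \<noteq> None} \<mu> (\<lambda>z. 0) f"
 using sol unfolding normalized_qc_solution_def qc_homeomorphism_def
 by (intro weak_beltrami_solution) auto

text \<open>The chart 1/w, which is 0 at the pole of \<open>w\<close>. It makes it possible to speak
  about \<open>w\<close> near a point mapped to infinity.\<close>

definition f_inv where "f_inv = finite_part (sphere_inversion \<circ> w)"

lemma sol_inverse: "weak_beltrami {z. w (Some z) \<noteq> Some 0} \<mu> (\<lambda>z. 0) f_inv"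
proof -
 have "beltrami_solution_on {z. (sphere_inversion \<circ> w \<circ> id) (Some z) \<noteq> None} \<mu> (finite_part (sphere_inversion \<circ> w \<circ> id))"
  using sol unfolding normalized_qc_solution_def qc_homeomorphism_def by auto
 moreover have "{z. (sphere_inversion \<circ> w \<circ> id) (Some z) \<noteq> None} = {z. w (Some z) \<noteq> Some 0}"
  by (auto simp: sphere_inversion_def split: option.splits)
 ultimately show ?thesis unfolding f_inv_def by (intro weak_beltrami_solution) (simp add: o_assoc)
qed

lemma f_inv_eq: "f_inv z = (if w (Some z) = None then 0 else inverse (f z))" if "w (Some z) \<noteq> Some 0"
 using that w_eq[of z] by (auto simp: f_inv_def finite_part_def sphere_inversion_def split: option.splits)

lemma open_finite: "open {z. w (Some z) \<noteq> None}"
 using sol_finite unfolding weak_beltrami_def weak_wirtinger_def by blast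

lemma continuous_finite: "continuous_on {z. w (Some z) \<noteq> None} f"
 using sol_finite unfolding weak_beltrami_def weak_wirtinger_def by blast

lemma open_nonzero: "open {z. w (Some z) \<noteq> Some 0}" and continuous_inverse: "continuous_on {z. w (Some z) \<noteq> Some 0} f_inv"
 using sol_inverse unfolding weak_beltrami_def weak_wirtinger_def by blast+

lemma holomorphic_finite: "f holomorphic_on (ball 0 1 \<inter> {z. w (Some z) \<noteq> None})"
 by (rule weak_beltrami_imp_holomorphic[OF weak_beltrami_subset[OF sol_finite]])
  (use open_finite mu_zero in auto)

lemma holomorphic_inverse: "f_inv holomorphic_on (ball 0 1 \<inter> {z. w (Some z) \<noteq> Some 0})"
 by (rule weak_beltrami_imp_holomorphic[OF weak_beltrami_subset[OF sol_inverse]])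
  (use open_nonzero mu_zero in auto)

lemma inj_f: "inj_on f {z. w (Some z) \<noteq> None}"
proof (rule inj_onI)
 fix x y assume "x \<in> {z. w (Some z) \<noteq> None}" "y \<in> {z. w (Some z) \<noteq> None}" "f x = f y"
 then have "w (Some x) = w (Some y)" using w_eq[of x] w_eq[of y] by auto
 then show "x = y" using inj_w by blast
qed

text \<open>Continuity of \<open>w\<close> at the point infinity of the source. Either
  \<open>w\<close> fixes infinity and the reciprocal tends to 0, or \<open>w\<close> has there a
  finite value b, which differs from c by injectivity.\<close>

lemma limit_infinity:
 assumes c: "w (Some a) = Some c"
 obtains l where "((\<lambda>z. case w (Some z) of None \<Rightarrow> 0 | Some x \<Rightarrow> 1 / (x - c)) \<longlongrightarrow> l) at_infinity"
proof -
 let ?v = "\<lambda>z. case w (Some z) of None \<Rightarrow> 0 | Some x \<Rightarrow> 1 / (x - c)"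
 have contw: "continuous_map riemann_sphere riemann_sphere w"
  using homeo homeomorphic_imp_continuous_map by blast
 have nbhd: "\<forall>\<^sub>F z in at_infinity. w (Some z) \<in> V" if V: "openin riemann_sphere V" "w None \<in> V" for V
 proof -
  have "openin riemann_sphere {x \<in> topspace riemann_sphere. w x \<in> V}"
   using contw V(1) by (rule openin_continuous_map_preimage)
  then have op: "openin (Alexandroff_compactification euclidean) {x. w x \<in> V}"
   by (simp add: topspace_riemann_sphere) (simp add: riemann_sphere_def)
  then have "\<exists>K. compact K \<and> {x. w x \<in> V} = insert None (Some ` (- K))"
   using V(2) unfolding openin_Alexandroff_compactification
   by (auto simp: compactin_euclidean_iff Compl_eq_Diff_UNIV)
  then obtain K where K: "compact K" "{x. w x \<in> V} = insert None (Some ` (- K))" by blast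
  obtain R where R: "K \<subseteq> cball 0 R"
   using compact_imp_bounded[OF K(1)] by (auto simp: bounded_iff subset_eq)
  have "w (Some z) \<in> V" if "R + 1 \<le> norm z" for z
  proof -
   have "z \<in> - K" using R that by (auto simp: subset_eq)
   then show ?thesis using K(2) by blast
  qed
  then show ?thesis unfolding eventually_at_infinity by blast
 qed
 show thesis
 proof (cases "w None")
  case None
  have "(?v \<longlongrightarrow> 0) at_infinity"
  proof (rule tendstoI)
   fix e :: real assume e: "e > 0"
   define K where "K = cball c (1 / e)"
   have K: "closed K" "compact K" by (auto simp: K_def)
   have "openin riemann_sphere (insert None (Some ` (UNIV - K)))"
    unfolding riemann_sphere_def openin_Alexandroff_compactification
    using K by (auto intro!: exI[of _ K])
   from nbhd[OF this] None have "\<forall>\<^sub>F z in at_infinity. w (Some z) \<in> insert None (Some ` (UNIV - K))" by simp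
   then show "\<forall>\<^sub>F z in at_infinity. dist (?v z) 0 < e"
   proof eventually_elim
    case (elim z)
    show ?case
    proof (cases "w (Some z)")
     case (Some x)
     then have "x \<notin> K" using elim by auto
     then have "1 / e < cmod (x - c)" by (simp add: K_def dist_norm norm_minus_commute)
     moreover have "0 < 1 / e" using e by simp
     ultimately have "1 / e < cmod (x - c)" "0 < cmod (x - c)" by linarith+
     then have "1 / cmod (x - c) < e" using e by (simp add: field_simps)
     then show ?thesis using Some by (simp add: norm_divide)
    qed (use e in simp)
   qed
  qed
  then show thesis by (rule that)
 next
  case (Some b)
  have bc: "b \<noteq> c" using c Some inj_w[of "Some a" None] by auto
  have "(?v \<longlongrightarrow> 1 / (b - c)) at_infinity"
  proof (rule tendstoI)
   fix e :: real assume e: "e > 0"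
   have "((\<lambda>x. 1 / (x - c)) \<longlongrightarrow> 1 / (b - c)) (nhds b)"
    using bc by (auto intro!: tendsto_intros filterlim_ident)
   then have "\<forall>\<^sub>F x in nhds b. dist (1 / (x - c)) (1 / (b - c)) < e" using e by (rule tendstoD)
   then obtain S where S: "open S" "b \<in> S" "\<And>x. x \<in> S \<Longrightarrow> dist (1 / (x - c)) (1 / (b - c)) < e"
    unfolding eventually_nhds by blast
   have "openin riemann_sphere (Some ` S)"
    unfolding riemann_sphere_def openin_Alexandroff_compactification using S(1) by auto
   from nbhd[OF this] Some S(2) have "\<forall>\<^sub>F z in at_infinity. w (Some z) \<in> Some ` S" by auto
   then show "\<forall>\<^sub>F z in at_infinity. dist (?v z) (1 / (b - c)) < e"
    by eventually_elim (use S(3) in auto)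
  qed
  then show thesis by (rule that)
 qed
qed

text \<open>Only the poles of 1/(w - c) matter, and a is the only one: at the pole of
  \<open>w\<close> the function is 0 and is expressed through \<open>f_inv\<close>.\<close>

lemma reciprocal_solution:
 assumes c: "w (Some a) = Some c"
 shows "weak_beltrami (- {a}) \<mu> (\<lambda>z. 0) (\<lambda>z. case w (Some z) of None \<Rightarrow> 0 | Some x \<Rightarrow> 1 / (x - c))"
  (is "weak_beltrami _ _ _ ?v")
proof -
 have fa: "f a = c" using c by (simp add: finite_part_def)
 have ne: "f z \<noteq> c" if "w (Some z) \<noteq> None" "z \<noteq> a" for z
  using inj_w[of "Some z" "Some a"] c w_eq[of z] that by auto
 have 1: "weak_beltrami ({z. w (Some z) \<noteq> None} - {a}) \<mu> (\<lambda>z. 0) ?v"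
 proof (rule weak_beltrami_cong[where f="\<lambda>z. 1 / (f z - c)"])
  show "weak_beltrami ({z. w (Some z) \<noteq> None} - {a}) \<mu> (\<lambda>z. 0) (\<lambda>z. 1 / (f z - c))"
  proof (rule weak_beltrami_compose[where V="- {c}" and F="\<lambda>x. 1 / (x - c)"])
   show "weak_beltrami ({z. w (Some z) \<noteq> None} - {a}) \<mu> (\<lambda>z. 0) f"
    by (rule weak_beltrami_subset[OF sol_finite]) (use open_finite in auto)
   show "(\<lambda>x. 1 / (x - c)) holomorphic_on - {c}" by (intro holomorphic_intros) auto
  qed (use ne in auto)
  show "1 / (f z - c) = ?v z" if "z \<in> {z. w (Some z) \<noteq> None} - {a}" for z
   using that w_eq[of z] by auto
 qed
 show ?thesis
 proof (cases "\<exists>P. w (Some P) = None")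
  case False
  then have "{z. w (Some z) \<noteq> None} - {a} = - {a}" by auto
  then show ?thesis using 1 by simp
 next
  case True
  then obtain P where P: "w (Some P) = None" by blast
  have uniq: "z = P" if "w (Some z) = None" for z using that P inj_w[of "Some z" "Some P"] by auto
  have Pa: "P \<noteq> a" using P c by auto
  have P0: "w (Some P) \<noteq> Some 0" using P by simp
  have "open ({z. w (Some z) \<noteq> Some 0} - {a})" using open_nonzero by auto
  then obtain r where r: "r > 0" "ball P r \<subseteq> {z. w (Some z) \<noteq> Some 0} - {a}"
   using P0 Pa open_contains_ball by blast
  have 2: "weak_beltrami (ball P r) \<mu> (\<lambda>z. 0) ?v"
  \<comment> \<open>In terms of y = 1/w the function 1/(w - c) is y / (1 - c y), which is
    holomorphic in y near y = 0.\<close>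
  proof (rule weak_beltrami_cong[where f="\<lambda>z. f_inv z / (1 - c * f_inv z)"])
   show "weak_beltrami (ball P r) \<mu> (\<lambda>z. 0) (\<lambda>z. f_inv z / (1 - c * f_inv z))"
   proof (rule weak_beltrami_compose[where F="\<lambda>x. x / (1 - c * x)" and V="{x. 1 - c * x \<noteq> 0}"])
    show "weak_beltrami (ball P r) \<mu> (\<lambda>z. 0) f_inv"
     by (rule weak_beltrami_subset[OF sol_inverse]) (use r in auto)
    show "(\<lambda>x. x / (1 - c * x)) holomorphic_on {x. 1 - c * x \<noteq> 0}" by (intro holomorphic_intros) auto
    show "open {x. 1 - c * x \<noteq> 0}" by (intro open_Collect_neq continuous_intros)
    show "f_inv ` ball P r \<subseteq> {x. 1 - c * x \<noteq> 0}"
    proof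
     fix y assume "y \<in> f_inv ` ball P r"
     then obtain z where z: "z \<in> ball P r" "y = f_inv z" by blast
     then have nz: "w (Some z) \<noteq> Some 0" "z \<noteq> a" using r by auto
     show "y \<in> {x. 1 - c * x \<noteq> 0}"
     proof (cases "w (Some z) = None")
      case False
      then have "f z \<noteq> c" "f z \<noteq> 0" using ne nz w_eq[of z] by auto
      then have "1 - c * inverse (f z) \<noteq> 0" by (simp add: field_simps)
      then show ?thesis using z False f_inv_eq[OF nz(1)] by simp
     qed (use z f_inv_eq[OF nz(1)] in auto)
    qed
   qed
   show "f_inv z / (1 - c * f_inv z) = ?v z" if "z \<in> ball P r" for z
   proof -
    have nz: "w (Some z) \<noteq> Some 0" "z \<noteq> a" using r that by auto
    show ?thesis
    proof (cases "w (Some z) = None")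
     case False
     then have fz: "f z \<noteq> c" "f z \<noteq> 0" using ne nz w_eq[of z] by auto
     have "inverse x / (1 - c * inverse x) = 1 / (x - c)" if "x \<noteq> 0" "x \<noteq> c" for x
      using that by (simp add: field_simps)
     from this[OF fz(2,1)] show ?thesis using False w_eq[of z] f_inv_eq[OF nz(1)] by auto
    qed (use f_inv_eq[OF nz(1)] in auto)
   qed
  qed
  have "- {a} - {P} = {z. w (Some z) \<noteq> None} - {a}"
  proof (rule set_eqI)
   fix z
   have "w (Some z) = None \<longleftrightarrow> z = P" using uniq P by blast
   then show "z \<in> - {a} - {P} \<longleftrightarrow> z \<in> {z. w (Some z) \<noteq> None} - {a}"
    by (simp del: not_None_eq add: conj_commute)
  qed
  with 1 have 3: "weak_beltrami (- {a} - {P}) \<mu> (\<lambda>z. 0) ?v" by (simp only:)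
  show ?thesis by (rule weak_beltrami_glue[OF _ 3 2 r(1)]) (use r in auto)
 qed
qed

text \<open>The global function U is the reciprocal minus its principal part at a. Off a it solves
  the inhomogeneous equation, near a it is holomorphic by injectivity, and gluing makes it a
  solution on the whole plane.\<close>

lemma schwarzian_estimate:
 assumes k: "k \<le> 1/4" and a: "a \<in> ball 0 1" and c: "w (Some a) \<noteq> None"
 shows "cmod (schwarzian f a + 6 / of_real slope_mass * (LINT z|lborel. \<mu> z * (exterior_kernel a (1 - cmod a) z)^2))
  \<le> 24 * kernel_mass / slope_mass * k^2 / (1 - cmod a)^2"
proof -
 \<comment> \<open>The distance of a from the circle, so that the coefficient vanishes on
   \<open>ball a d\<close>.\<close>
 define d where "d = 1 - cmod a"
 have d: "d > 0" using a by (simp add: d_def)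
 have ballD: "ball a d \<subseteq> cball 0 1"
 proof
  fix z assume "z \<in> ball a d"
  then have "cmod (z - a) < d" by (simp add: dist_norm norm_minus_commute)
  moreover have "cmod z \<le> cmod a + cmod (z - a)" by (rule norm_triangle_sub)
  ultimately show "z \<in> cball 0 1" by (simp add: d_def)
 qed
 have cf: "w (Some a) = Some (f a)" using w_eq[OF c] .
 let ?v = "\<lambda>z. case w (Some z) of None \<Rightarrow> 0 | Some x \<Rightarrow> 1 / (x - f a)"
 have "open (ball 0 1 \<inter> {z. w (Some z) \<noteq> None})" using open_finite by auto
 then obtain r where r: "r > 0" "ball a r \<subseteq> ball 0 1 \<inter> {z. w (Some z) \<noteq> None}"
  using a c open_contains_ball[of "ball 0 1 \<inter> {z. w (Some z) \<noteq> None}"] by blast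
 have hol: "f holomorphic_on ball a r" by (rule holomorphic_on_subset[OF holomorphic_finite r(2)])
 have inj: "inj_on f (ball a r)" by (rule inj_on_subset[OF inj_f]) (use r in auto)
 obtain U0 where U0: "U0 holomorphic_on ball a r" "\<And>z. z \<in> ball a r \<Longrightarrow> z \<noteq> a \<Longrightarrow> U0 z = deriv f a / (f z - f a) - 1 / (z - a)"
  "deriv U0 a = - schwarzian f a / 6"
  using regular_part_deriv[OF hol inj r(1)] by blast
 define U where "U z = (if z = a then U0 a else deriv f a * ?v z - 1 / (z - a))" for z
 define E where "E = exterior_kernel a d"
 have UU0: "U z = U0 z" if "z \<in> ball a r" for z
 proof (cases "z = a")
  case False
  have "w (Some z) = Some (f z)" using r that by (intro w_eq) auto
  then show ?thesis using U0(2)[OF that False] False by (simp add: U_def)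
 qed (simp add: U_def)
 have 1: "weak_beltrami (UNIV - {a}) \<mu> E U"
 proof -
  have o: "open (- {a})" by auto
  obtain g h where gh: "weak_wirtinger (- {a}) ?v g h" "AE z in lborel. z \<in> - {a} \<longrightarrow> h z = \<mu> z * (g z - 0)"
   using reciprocal_solution[OF cf] unfolding weak_beltrami_def by blast
  have cl: "weak_wirtinger (- {a}) (\<lambda>z. - 1 / (z - a)) (\<lambda>z. 1 / (z - a)^2) (\<lambda>z. 0)"
  proof (rule weak_wirtinger_classical[OF o])
   show "wirtinger (\<lambda>z. - 1 / (z - a)) (1 / (z - a)^2) 0 z" if "z \<in> - {a}" for z
    using that by (intro wirtinger_field_derivative) (auto intro!: derivative_eq_intros simp: power2_eq_square)
  qed (auto intro!: continuous_intros)
  have "weak_wirtinger (- {a}) (\<lambda>z. deriv f a * ?v z + - 1 / (z - a)) (\<lambda>z. deriv f a * g z + 1 / (z - a)^2) (\<lambda>z. deriv f a * h z + 0)"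
   by (intro weak_wirtinger_add weak_wirtinger_cmult gh(1) cl)
  then have "weak_wirtinger (- {a}) U (\<lambda>z. deriv f a * g z + 1 / (z - a)^2) (\<lambda>z. deriv f a * h z + 0)"
   by (rule weak_wirtinger_cong) (simp add: U_def)
  moreover have "AE z in lborel. z \<in> - {a} \<longrightarrow> deriv f a * h z + 0 = \<mu> z * (deriv f a * g z + 1 / (z - a)^2 - E z)"
   using gh(2)
  proof eventually_elim
   case (elim z)
   show ?case
   proof (cases "z \<in> ball a d")
    case True
    then have "\<mu> z = 0" using ballD by (intro mu_zero) auto
    then show ?thesis using elim by auto
   next
    case False
    then have "E z = 1 / (z - a)^2" by (simp add: E_def exterior_kernel_def)
    then show ?thesis using elim by (auto simp: mult_ac)
   qed
  qed
  ultimately show ?thesis unfolding weak_beltrami_def Compl_eq_Diff_UNIV by blast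
 qed
 have "weak_beltrami (ball a r) \<mu> E U0"
 proof (rule weak_beltrami_holomorphic[OF U0(1) open_ball])
  fix z assume "z \<in> ball a r"
  then have "z \<in> ball 0 1" using r by blast
  then show "\<mu> z = 0" by (intro mu_zero) auto
 qed
 then have 2: "weak_beltrami (ball a r) \<mu> E U" by (rule weak_beltrami_cong) (simp add: UU0)
 have "weak_beltrami UNIV \<mu> E U" by (rule weak_beltrami_glue[OF open_UNIV 1 2 r(1)]) auto
 then obtain G H where GH: "weak_wirtinger UNIV U G H" "AE z in lborel. H z = \<mu> z * (G z - E z)"
  unfolding weak_beltrami_def by auto
 obtain l where l: "(?v \<longlongrightarrow> l) at_infinity" using limit_infinity[OF cf] by blast
 have "((\<lambda>z. deriv f a * ?v z - 1 / (z - a)) \<longlongrightarrow> deriv f a * l - 0) at_infinity"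
 proof (intro tendsto_diff tendsto_mult l tendsto_const)
  have "filterlim (\<lambda>z. z - a) at_infinity at_infinity"
   using tendsto_add_filterlim_at_infinity'[OF filterlim_ident tendsto_const[of "- a"]] by simp
  then show "((\<lambda>z. 1 / (z - a)) \<longlongrightarrow> 0) at_infinity"
   using tendsto_divide_0[OF tendsto_const] by blast
 qed
 moreover have "\<forall>\<^sub>F z in at_infinity. deriv f a * ?v z - 1 / (z - a) = U z"
  unfolding eventually_at_infinity by (rule exI[of _ "cmod a + 1"]) (auto simp: U_def)
 ultimately have lim: "(U \<longlongrightarrow> deriv f a * l) at_infinity"
  by (simp add: tendsto_cong)
 have "deriv U a = deriv U0 a"
  by (rule complex_derivative_transform_within_open[of _ "ball a r"])
   (use UU0 U0(1) r in \<open>auto intro: holomorphic_transform[OF U0(1)]\<close>)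
 then have dU: "deriv U a = - schwarzian f a / 6" using U0 by simp
 have A: "cmod (of_real slope_mass * deriv U a - (LINT z|lborel. \<mu> z * (exterior_kernel a d z)^2)) \<le> 4 * kernel_mass * k^2 / d^2"
  by (rule beltrami_derivative_estimate[OF GH(1) lim mu_measurable linf_norm_AE(1)[OF mu] linf_norm_AE(2)[OF mu] k d])
   (use GH(2) mu_zero ballD in \<open>auto simp: E_def\<close>)
 \<comment> \<open>Multiplication by -6 / \<open>slope_mass\<close> turns U'(a) = -S/6 into S; it
   also turns the error constant 4 into 24.\<close>
 have "schwarzian f a + 6 / of_real slope_mass * (LINT z|lborel. \<mu> z * (exterior_kernel a d z)^2)
  = - (6 / of_real slope_mass) * (of_real slope_mass * deriv U a - (LINT z|lborel. \<mu> z * (exterior_kernel a d z)^2))"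
  using slope_mass_pos by (simp add: dU field_simps)
 then have "cmod (schwarzian f a + 6 / of_real slope_mass * (LINT z|lborel. \<mu> z * (exterior_kernel a d z)^2))
  = cmod (- (6 / of_real slope_mass) * (of_real slope_mass * deriv U a - (LINT z|lborel. \<mu> z * (exterior_kernel a d z)^2)))"
  by (simp only:)
 then have B: "cmod (schwarzian f a + 6 / of_real slope_mass * (LINT z|lborel. \<mu> z * (exterior_kernel a d z)^2))
  = 6 / slope_mass * cmod (of_real slope_mass * deriv U a - (LINT z|lborel. \<mu> z * (exterior_kernel a d z)^2))"
  unfolding norm_mult[of "- (6 / of_real slope_mass)"] norm_minus_cancel norm_divide
  using slope_mass_pos by (simp only: norm_of_real norm_numeral abs_of_pos)
 have C: "6 / slope_mass * (4 * kernel_mass * k^2 / d^2) = 24 * kernel_mass / slope_mass * k^2 / d^2" by simp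
 have D: "6 / slope_mass * x \<le> 6 / slope_mass * y" if "x \<le> y" for x y
  by (rule mult_left_mono[OF that]) (use slope_mass_pos in simp)
 show ?thesis
  unfolding d_def[symmetric] B C[symmetric] by (rule D[OF A])
qed

end

section \<open>Growth of holomorphic functions in the disc\<close>

text \<open>Integration of the derivative along the radius to z against a real majorant of the
  modulus.\<close>

lemma radial_bound:
 fixes F :: "complex \<Rightarrow> complex"
 assumes F: "F holomorphic_on ball 0 \<rho>" and z: "z \<in> ball 0 \<rho>"
  and \<phi>: "\<And>t. 0 \<le> t \<Longrightarrow> t < \<rho> \<Longrightarrow> (\<phi> has_real_derivative \<phi>' t) (at t)"
  and bnd: "\<And>t. 0 < t \<Longrightarrow> t < 1 \<Longrightarrow> cmod (deriv F (of_real t * z)) \<le> \<phi>' (t * cmod z)"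
 shows "cmod (F z - F 0) \<le> \<phi> (cmod z) - \<phi> 0"
proof -
 have in_ball: "of_real t * z \<in> ball 0 \<rho>" "t * cmod z < \<rho>" if "0 \<le> t" "t \<le> 1" for t
  using z that mult_left_le_one_le[of "cmod z" t] by (auto simp: norm_mult)
 have dF: "((\<lambda>t. F (of_real t * z)) has_vector_derivative (z * deriv F (of_real t * z))) (at t)" if "0 \<le> t" "t \<le> 1" for t
 proof -
  have 1: "(F has_field_derivative deriv F (of_real t * z)) (at (of_real t * z))"
   by (rule holomorphic_derivI[OF F open_ball in_ball(1)[OF that]])
  have 2: "((\<lambda>t. of_real t * z) has_vector_derivative z) (at t)"
   by (auto intro!: derivative_eq_intros simp: has_vector_derivative_def scaleR_conv_of_real)
  show ?thesis using field_vector_diff_chain_at[OF 2 1] by (simp add: o_def)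
 qed
 have d\<phi>: "((\<lambda>t. \<phi> (t * cmod z)) has_real_derivative \<phi>' (t * cmod z) * cmod z) (at t)" if "0 \<le> t" "t \<le> 1" for t
  by (rule DERIV_chain2[OF \<phi>]) (use in_ball(2)[OF that] that in \<open>auto intro!: derivative_eq_intros\<close>)
 have "norm (F (of_real 1 * z) - F (of_real 0 * z)) \<le> \<phi> (1 * cmod z) - \<phi> (0 * cmod z)"
 proof (rule differentiable_bound_general)
  show "continuous_on {0..1} (\<lambda>t. F (of_real t * z))"
   using dF by (intro continuous_at_imp_continuous_on ballI) (auto intro: has_vector_derivative_continuous)
  show "continuous_on {0..1} (\<lambda>t. \<phi> (t * cmod z))"
   using d\<phi> by (intro continuous_at_imp_continuous_on ballI) (auto intro: DERIV_isCont)
  show "((\<lambda>t. \<phi> (t * cmod z)) has_vector_derivative \<phi>' (t * cmod z) * cmod z) (at t)" if "0 < t" "t < 1" for t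
   using d\<phi>[of t] that by (simp add: has_real_derivative_iff_has_vector_derivative)
  show "norm (z * deriv F (of_real t * z)) \<le> \<phi>' (t * cmod z) * cmod z" if "0 < t" "t < 1" for t
   using mult_left_mono[OF bnd[OF that] norm_ge_zero[of z]] by (simp add: norm_mult mult.commute)
 qed (use dF in auto)
 then show ?thesis by simp
qed

text \<open>With p = f''/f' the Schwarzian is p' - p^2/2. A continuity argument along one radius:
  before |p| (1 - |z|) reaches m, the derivative is at most (A + m^2/2) / (1 - |z|)^2, and
  integrating from p(0) = 0 keeps the quantity strictly below m.\<close>

lemma riccati_bound_aux:
 assumes p: "p holomorphic_on ball 0 \<rho>" and \<rho>: "\<rho> \<le> 1" and p0: "p 0 = 0"
  and eq: "\<And>z. z \<in> ball 0 \<rho> \<Longrightarrow> cmod (deriv p z - (p z)\<^sup>2 / 2) \<le> A / (1 - cmod z)^2"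
  and m: "m > 0" "A + m^2 / 2 \<le> m" and z: "z \<in> ball 0 \<rho>"
 shows "cmod (p z) * (1 - cmod z) < m"
proof (rule ccontr)
 assume neg: "\<not> cmod (p z) * (1 - cmod z) < m"
 define g where "g t = cmod (p (of_real t * z)) * (1 - t * cmod z)" for t
 have in_ball: "of_real t * z \<in> ball 0 \<rho>" if "0 \<le> t" "t \<le> 1" for t
  using z that mult_left_le_one_le[of "cmod z" t] by (auto simp: norm_mult)
 have cp: "continuous_on (ball 0 \<rho>) p" by (rule holomorphic_on_imp_continuous_on[OF p])
 have cg: "continuous_on {0..1} g"
  unfolding g_def by (intro continuous_intros continuous_on_compose2[OF cp]) (use in_ball in auto)
 define T where "T = {t \<in> {0..1}. g t \<ge> m}"
 have "closed T" unfolding T_def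
  using continuous_closed_preimage[OF cg, of "{m..}"] by (simp add: vimage_def Int_def)
 moreover have "bounded T" by (rule bounded_subset[of "{0..1}"]) (auto simp: T_def)
 ultimately have "compact T" by (simp add: compact_eq_bounded_closed)
 moreover have "1 \<in> T" using neg by (simp add: T_def g_def)
 \<comment> \<open>The parameter of the first point on the radius where the bound m is
   attained.\<close>
 ultimately obtain t0 where t0: "t0 \<in> T" "\<And>t. t \<in> T \<Longrightarrow> t0 \<le> t"
  using compact_attains_inf[of T] by auto
 have g0: "g 0 = 0" by (simp add: g_def p0)
 have t0': "0 \<le> t0" "t0 \<le> 1" "g t0 \<ge> m" using t0 by (auto simp: T_def)
 define u where "u = of_real t0 * z"
 have u: "u \<in> ball 0 \<rho>" unfolding u_def by (rule in_ball) (use t0' in auto)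
 have nu: "cmod u = t0 * cmod z" using t0' by (simp add: u_def norm_mult)
 have nu1: "cmod u < 1" using u \<rho> by simp
 have less: "cmod (p (of_real t * u)) * (1 - t * cmod u) < m" if "0 < t" "t < 1" for t
 proof (cases "t0 = 0")
  case True
  then show ?thesis using p0 m by (simp add: u_def)
 next
  case False
  then have "t * t0 < t0" "0 \<le> t * t0" using that t0' by auto
  then have "t * t0 \<notin> T" "t * t0 \<in> {0..1}"
   using t0(2)[of "t * t0"] t0'(2) unfolding atLeastAtMost_iff by linarith+
  then have "g (t * t0) < m" by (auto simp: T_def)
  then show ?thesis by (simp add: g_def u_def norm_mult mult_ac t0')
 qed
 have "cmod (p u - p 0) \<le> (A + m^2 / 2) / (1 - cmod u) - (A + m^2 / 2) / (1 - 0)"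
 proof (rule radial_bound[OF p u, of "\<lambda>t. (A + m^2 / 2) / (1 - t)" "\<lambda>t. (A + m^2 / 2) / (1 - t)^2"])
  show "((\<lambda>t. (A + m^2 / 2) / (1 - t)) has_real_derivative (A + m^2 / 2) / (1 - t)^2) (at t)" if "0 \<le> t" "t < \<rho>" for t
   using that \<rho> by (auto intro!: derivative_eq_intros simp: power2_eq_square)
  fix t :: real assume t: "0 < t" "t < 1"
  let ?x = "of_real t * u"
  have x: "?x \<in> ball 0 \<rho>" using in_ball[of "t * t0"] t t0' by (simp add: u_def mult_le_one mult_ac)
  have nx: "cmod ?x = t * cmod u" using t by (simp add: norm_mult)
  have pos: "1 - t * cmod u > 0" using x \<rho> nx by auto
  have "cmod (p ?x) \<le> m / (1 - t * cmod u)" using less[OF t] pos by (simp add: field_simps)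
  then have "(cmod (p ?x))\<^sup>2 \<le> (m / (1 - t * cmod u))^2" by (intro power_mono) auto
  then have 2: "cmod ((p ?x)^2 / 2) \<le> (m^2 / 2) / (1 - t * cmod u)^2"
   by (simp add: norm_divide norm_power power_divide)
  have "cmod (deriv p ?x) \<le> cmod (deriv p ?x - (p ?x)\<^sup>2 / 2) + cmod ((p ?x)^2 / 2)"
   using norm_triangle_ineq[of "deriv p ?x - (p ?x)\<^sup>2 / 2" "(p ?x)\<^sup>2 / 2"] by simp
  also have "\<dots> \<le> A / (1 - t * cmod u)^2 + (m^2 / 2) / (1 - t * cmod u)^2"
   using eq[OF x] 2 unfolding nx by (rule add_mono)
  finally show "cmod (deriv p ?x) \<le> (A + m^2 / 2) / (1 - t * cmod u)^2" by (simp add: add_divide_distrib)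
 qed
 then have "cmod (p u) \<le> (A + m^2 / 2) * (1 / (1 - cmod u) - 1)"
  using p0 by (simp add: right_diff_distrib)
 also have "\<dots> \<le> m * (1 / (1 - cmod u) - 1)"
  using nu1 m by (intro mult_right_mono) auto
 \<comment> \<open>The term -1 from the lower end of integration makes the inequality strict, which
   contradicts the choice of t0.\<close>
 also have "\<dots> < m / (1 - cmod u)" using m by (simp add: right_diff_distrib)
 finally have "cmod (p u) * (1 - cmod u) < m" using nu1 by (simp add: field_simps)
 then show False using t0'(3) by (simp add: g_def u_def[symmetric] nu[symmetric])
qed

text \<open>For m slightly above 2A and m \<le> 1, m^2/2 is at most m/2, so A + m^2/2 \<le> m. The
  assumption A \<le> 1/4 leaves room for such an m.\<close>

lemma riccati_bound:
 assumes p: "p holomorphic_on ball 0 \<rho>" and \<rho>: "\<rho> \<le> 1" and p0: "p 0 = 0"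
  and eq: "\<And>z. z \<in> ball 0 \<rho> \<Longrightarrow> cmod (deriv p z - (p z)\<^sup>2 / 2) \<le> A / (1 - cmod z)^2"
  and A: "0 \<le> A" "A \<le> 1/4" and z: "z \<in> ball 0 \<rho>"
 shows "cmod (p z) * (1 - cmod z) \<le> 2 * A"
proof (rule field_le_epsilon)
 fix e :: real assume e: "e > 0"
 define m where "m = 2 * A + min e (1/2)"
 have m: "m > 0" "2 * A \<le> m" "m \<le> 1" using A e by (auto simp: m_def)
 have "m\<^sup>2 \<le> m" using m by (simp add: power2_eq_square mult_left_le)
 then have "A + m^2 / 2 \<le> m" using m by simp
 from riccati_bound_aux[OF p \<rho> p0 eq m(1) this z]
 show "cmod (p z) * (1 - cmod z) \<le> 2 * A + e" by (simp add: m_def)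
qed

text \<open>Two integrations along radii: |log f'| \<le> -(1/2) log (1 - |z|), hence |f'| \<le> (1 -
  |z|)^(-1/2), which is integrable up to the circle with integral 2. The constant 1/2 is what keeps
  the exponent below 1.\<close>

lemma normalized_bounded:
 assumes f: "f holomorphic_on ball 0 \<rho>" and \<rho>: "\<rho> \<le> 1" "\<rho> > 0" and f0: "f 0 = 0" "deriv f 0 = 1"
  and nz: "\<And>z. z \<in> ball 0 \<rho> \<Longrightarrow> deriv f z \<noteq> 0"
  and bnd: "\<And>z. z \<in> ball 0 \<rho> \<Longrightarrow> cmod (deriv (deriv f) z / deriv f z) * (1 - cmod z) \<le> 1 / 2"
  and z: "z \<in> ball 0 \<rho>"
 shows "cmod (f z) \<le> 2"
proof -
 let ?p = "\<lambda>z. deriv (deriv f) z / deriv f z"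
 have df: "deriv f holomorphic_on ball 0 \<rho>" and ddf: "deriv (deriv f) holomorphic_on ball 0 \<rho>"
  using f by (auto intro!: holomorphic_deriv)
 have hp: "?p holomorphic_on ball 0 \<rho>" using nz by (intro holomorphic_intros df ddf) auto
 then obtain P where P: "\<And>z. z \<in> ball 0 \<rho> \<Longrightarrow> (P has_field_derivative ?p z) (at z within ball 0 \<rho>)"
  using holomorphic_convex_primitive'[OF convex_ball open_ball hp] by blast
 then have dP: "(P has_field_derivative ?p z) (at z)" if "z \<in> ball 0 \<rho>" for z
  using that by (metis at_within_open open_ball)
 then have P: "P holomorphic_on ball 0 \<rho>" unfolding holomorphic_on_open[OF open_ball] by blast
 have 0: "0 \<in> ball (0::complex) \<rho>" using \<rho> by simp
 have lt1: "cmod z < 1" if "z \<in> ball 0 \<rho>" for z :: complex using that \<rho> by simp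
 have scale: "of_real t * z \<in> ball 0 \<rho>" if "z \<in> ball 0 \<rho>" "0 < t" "t < 1" for z :: complex and t :: real
  using that mult_left_le_one_le[of "cmod z" t] by (auto simp: norm_mult)
 \<comment> \<open>P is a primitive of f''/f', that is, a logarithm of f' up to an additive
   constant.\<close>
 have "(\<lambda>z. deriv f z * exp (- P z)) constant_on ball 0 \<rho>"
 proof (rule has_field_derivative_0_imp_constant_on[OF _ connected_ball open_ball])
  fix z :: complex assume z: "z \<in> ball 0 \<rho>"
  have "((\<lambda>z. deriv f z * exp (- P z)) has_field_derivative deriv (deriv f) z * exp (- P z) + (exp (- P z) * - ?p z) * deriv f z) (at z)"
   by (auto intro!: derivative_eq_intros dP z holomorphic_derivI[OF df open_ball z])
  then show "((\<lambda>z. deriv f z * exp (- P z)) has_field_derivative 0) (at z)"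
   using nz[OF z] by simp
 qed
 then have feq: "deriv f z = exp (P z - P 0)" if "z \<in> ball 0 \<rho>" for z
 proof -
  obtain c where c: "\<And>z. z \<in> ball 0 \<rho> \<Longrightarrow> deriv f z * exp (- P z) = c"
   using \<open>(\<lambda>z. deriv f z * exp (- P z)) constant_on ball 0 \<rho>\<close> unfolding constant_on_def by blast
  have "deriv f z * exp (- P z) = exp (- P 0)" using c[OF that] c[OF 0] f0 by simp
  then have "deriv f z * (exp (- P z) * exp (P z)) = exp (- P 0) * exp (P z)" by (simp only: mult.assoc[symmetric])
  then show ?thesis by (simp add: mult_exp_exp exp_minus_inverse mult.commute)
 qed
 have Pb: "cmod (P z - P 0) \<le> - ln (1 - cmod z) / 2" if z: "z \<in> ball 0 \<rho>" for z
 proof -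
  have "cmod (P z - P 0) \<le> - ln (1 - cmod z) / 2 - - ln (1 - 0) / 2"
  proof (rule radial_bound[OF P z, of "\<lambda>t. - ln (1 - t) / 2" "\<lambda>t. 1 / (2 * (1 - t))"])
   show "((\<lambda>t. - ln (1 - t) / 2) has_real_derivative 1 / (2 * (1 - t))) (at t)" if "0 \<le> t" "t < \<rho>" for t
    using that \<rho> by (auto intro!: derivative_eq_intros simp: field_simps)
   fix t :: real assume t: "0 < t" "t < 1"
   have x: "of_real t * z \<in> ball 0 \<rho>" by (rule scale[OF z t])
   have "deriv P (of_real t * z) = ?p (of_real t * z)" by (rule DERIV_imp_deriv[OF dP[OF x]])
   moreover have "cmod (?p (of_real t * z)) * (1 - t * cmod z) \<le> 1 / 2" using bnd[OF x] t by (simp add: norm_mult)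
   ultimately show "cmod (deriv P (of_real t * z)) \<le> 1 / (2 * (1 - t * cmod z))"
    using lt1[OF x] t by (simp add: norm_mult field_simps)
  qed
  then show ?thesis by simp
 qed
 have "cmod (f z - f 0) \<le> - 2 * sqrt (1 - cmod z) - - 2 * sqrt (1 - 0)"
 proof (rule radial_bound[OF f z, of "\<lambda>t. - 2 * sqrt (1 - t)" "\<lambda>t. 1 / sqrt (1 - t)"])
  show "((\<lambda>t. - 2 * sqrt (1 - t)) has_real_derivative 1 / sqrt (1 - t)) (at t)" if "0 \<le> t" "t < \<rho>" for t
   using that \<rho> by (auto intro!: derivative_eq_intros simp: field_simps)
  fix t :: real assume t: "0 < t" "t < 1"
  let ?x = "of_real t * z"
  have x: "?x \<in> ball 0 \<rho>" by (rule scale[OF z t])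
  have nx: "cmod ?x = t * cmod z" using t by (simp add: norm_mult)
  have pos: "1 - cmod ?x > 0" using lt1[OF x] by simp
  have "cmod (deriv f ?x) = exp (Re (P ?x - P 0))" unfolding feq[OF x] by simp
  also have "\<dots> \<le> exp (- ln (1 - cmod ?x) / 2)"
   using order_trans[OF complex_Re_le_cmod Pb[OF x]] by simp
  also have "\<dots> = 1 / sqrt (1 - cmod ?x)"
   using pos by (simp add: ln_sqrt[symmetric] exp_minus inverse_eq_divide)
  finally show "cmod (deriv f ?x) \<le> 1 / sqrt (1 - t * cmod z)" unfolding nx .
 qed
 also have "\<dots> \<le> 2" using lt1[OF z] by simp
 finally show ?thesis using f0 by simp
qed

text \<open>The Bers space condition with 1 - |z| in place of 1 - |z|^2. The two weights differ by
  at most 2^q, and this one fits Cauchy estimates and radial integrals.\<close>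

definition growth :: "nat \<Rightarrow> real \<Rightarrow> (complex \<Rightarrow> complex) \<Rightarrow> bool" where
 "growth q B h \<longleftrightarrow> h holomorphic_on ball 0 1 \<and> (\<forall>z\<in>ball 0 1. cmod (h z) * (1 - cmod z) ^ q \<le> B)"

lemma growth_mono: "growth q B h \<Longrightarrow> B \<le> B' \<Longrightarrow> growth q B' h"
 unfolding growth_def by force

lemma growth_nonneg: "growth q B h \<Longrightarrow> 0 \<le> B"
 unfolding growth_def by (auto dest!: bspec[where x=0] intro: order_trans[OF norm_ge_zero])

lemma growth_cong:
 assumes "growth q B h" "\<And>z. z \<in> ball 0 1 \<Longrightarrow> h z = h' z"
 shows "growth q B h'"
 using assms unfolding growth_def by (auto intro: holomorphic_transform)

lemma growth_add:
 assumes "growth q A g" "growth q B h"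
 shows "growth q (A + B) (\<lambda>z. g z + h z)"
 unfolding growth_def
proof (intro conjI ballI)
 show "(\<lambda>z. g z + h z) holomorphic_on ball 0 1" using assms by (auto simp: growth_def intro: holomorphic_intros)
 fix z :: complex assume z: "z \<in> ball 0 1"
 have "cmod (g z + h z) * (1 - cmod z) ^ q \<le> (cmod (g z) + cmod (h z)) * (1 - cmod z) ^ q"
  using z by (intro mult_right_mono norm_triangle_ineq) auto
 also have "\<dots> \<le> A + B" using assms z by (auto simp: growth_def distrib_right intro!: add_mono)
 finally show "cmod (g z + h z) * (1 - cmod z) ^ q \<le> A + B" .
qed

lemma growth_mult:
 assumes "growth q A g" "growth r B h"
 shows "growth (q + r) (A * B) (\<lambda>z. g z * h z)"
 unfolding growth_def
proof (intro conjI ballI)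
 show "(\<lambda>z. g z * h z) holomorphic_on ball 0 1" using assms by (auto simp: growth_def intro: holomorphic_intros)
 fix z :: complex assume z: "z \<in> ball 0 1"
 have "cmod (g z * h z) * (1 - cmod z) ^ (q + r) = (cmod (g z) * (1 - cmod z) ^ q) * (cmod (h z) * (1 - cmod z) ^ r)"
  by (simp add: norm_mult power_add mult_ac)
 also have "\<dots> \<le> A * B"
  using assms z growth_nonneg[OF assms(1)] by (intro mult_mono) (auto simp: growth_def)
 finally show "cmod (g z * h z) * (1 - cmod z) ^ (q + r) \<le> A * B" .
qed

lemma growth_cmult:
 assumes "growth q B h"
 shows "growth q (cmod c * B) (\<lambda>z. c * h z)"
 unfolding growth_def
proof (intro conjI ballI)
 show "(\<lambda>z. c * h z) holomorphic_on ball 0 1" using assms by (auto simp: growth_def intro: holomorphic_intros)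
 fix z :: complex assume z: "z \<in> ball 0 1"
 then have "cmod c * (cmod (h z) * (1 - cmod z) ^ q) \<le> cmod c * B"
  using assms by (intro mult_left_mono) (auto simp: growth_def)
 then show "cmod (c * h z) * (1 - cmod z) ^ q \<le> cmod c * B" by (simp add: norm_mult mult.assoc)
qed

text \<open>Cauchy's inequality on the disc around z whose radius is half the distance to the
  circle; halving costs 2 to the power q + 1.\<close>

lemma growth_deriv:
 assumes h: "growth q B h"
 shows "growth (Suc q) (2 ^ Suc q * B) (deriv h)"
 unfolding growth_def
proof (intro conjI ballI)
 have hol: "h holomorphic_on ball 0 1" using h by (simp add: growth_def)
 then show "deriv h holomorphic_on ball 0 1" by (rule holomorphic_deriv) simp
 fix z :: complex assume z: "z \<in> ball 0 1"
 define r where "r = (1 - cmod z) / 2"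
 have r: "r > 0" using z by (simp add: r_def)
 have sub: "cmod u \<le> 1 - r" if "u \<in> cball z r" for u
 proof -
  have "cmod u \<le> cmod z + cmod (u - z)" by (rule norm_triangle_sub)
  then show ?thesis using that by (simp add: r_def dist_norm norm_minus_commute field_simps)
 qed
 then have subs: "cball z r \<subseteq> ball 0 1" using r by force
 have "cmod ((deriv ^^ 1) h z) \<le> fact 1 * (B / r ^ q) / r ^ 1"
 proof (rule Cauchy_inequality)
  show "h holomorphic_on ball z r" by (rule holomorphic_on_subset[OF hol]) (use subs in auto)
  show "continuous_on (cball z r) h"
   by (rule continuous_on_subset[OF holomorphic_on_imp_continuous_on[OF hol] subs])
  fix x assume x: "cmod (z - x) = r"
  then have xb: "x \<in> cball z r" by (simp add: dist_norm)
  have "cmod (h x) * r ^ q \<le> cmod (h x) * (1 - cmod x) ^ q"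
   using sub[OF xb] r by (intro mult_left_mono power_mono) auto
  also have "\<dots> \<le> B" using h subs xb unfolding growth_def by blast
  finally show "cmod (h x) \<le> B / r ^ q" using r by (simp add: field_simps)
 qed (fact r)
 then have "cmod (deriv h z) * r ^ Suc q \<le> B" using r by (simp add: field_simps)
 moreover have "(1 - cmod z) ^ Suc q = 2 ^ Suc q * r ^ Suc q"
 proof -
  have "1 - cmod z = 2 * r" by (simp add: r_def)
  then show ?thesis by (simp only: power_mult_distrib)
 qed
 ultimately show "cmod (deriv h z) * (1 - cmod z) ^ Suc q \<le> 2 ^ Suc q * B" by simp
qed

lemma growth_higher_deriv:
 assumes "growth q B h"
 shows "growth (q + j) ((\<Prod>i=1..j. 2 ^ (q + i)) * B) ((deriv ^^ j) h)"
proof (induction j)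
 case (Suc j)
 show ?case using growth_deriv[OF Suc] by (simp add: mult_ac)
qed (use assms in simp)

text \<open>Integration of (1 - t)^(-q-1) along a radius gives (1 - t)^(-q) / q; for q = 0 a
  logarithm would appear instead.\<close>

lemma growth_antiderivative:
 assumes h: "growth (Suc q) B h" and q: "q \<ge> 1"
 obtains H C where "growth q C H" "\<And>z. z \<in> ball 0 1 \<Longrightarrow> deriv H z = h z"
proof -
 have hol: "h holomorphic_on ball 0 1" using h by (simp add: growth_def)
 obtain H0 where "\<And>z. z \<in> ball 0 1 \<Longrightarrow> (H0 has_field_derivative h z) (at z within ball 0 1)"
  using holomorphic_convex_primitive'[OF convex_ball open_ball hol] by blast
 then have d: "(H0 has_field_derivative h z) (at z)" if "z \<in> ball 0 1" for z
  using that by (metis at_within_open open_ball)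
 define H where "H z = H0 z - H0 0" for z
 have dH: "(H has_field_derivative h z) (at z)" if "z \<in> ball 0 1" for z
  unfolding H_def using d[OF that] by (auto intro!: derivative_eq_intros)
 then have H: "H holomorphic_on ball 0 1" unfolding holomorphic_on_open[OF open_ball] by blast
 have dd: "deriv H z = h z" if "z \<in> ball 0 1" for z by (rule DERIV_imp_deriv[OF dH[OF that]])
 have B: "B \<ge> 0" by (rule growth_nonneg[OF h])
 have "cmod (H z) * (1 - cmod z) ^ q \<le> B / q" if z: "z \<in> ball 0 1" for z
 proof -
  have "cmod (H z - H 0) \<le> B / q * (1 / (1 - cmod z) ^ q) - B / q * (1 / (1 - 0) ^ q)"
  proof (rule radial_bound[OF H z, of "\<lambda>t. B / q * (1 / (1 - t) ^ q)" "\<lambda>t. B / (1 - t) ^ Suc q"])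
   show "((\<lambda>t. B / q * (1 / (1 - t) ^ q)) has_real_derivative B / (1 - t) ^ Suc q) (at t)" if "0 \<le> t" "t < 1" for t
   proof -
    have "((\<lambda>t. inverse ((1 - t) ^ q)) has_real_derivative - (of_nat q * (- 1 * (1 - t) ^ (q - 1))) * inverse (((1 - t) ^ q)^2)) (at t)"
     using that by (auto intro!: derivative_eq_intros simp: power2_eq_square field_simps)
    also have "- (of_nat q * (- 1 * (1 - t) ^ (q - 1))) * inverse (((1 - t) ^ q)^2) = of_nat q / (1 - t) ^ Suc q"
    proof -
     have "- (of_nat q * (- 1 * x ^ (q - 1))) * inverse ((x ^ q)^2) = of_nat q / x ^ Suc q" if "x \<noteq> 0" for x :: real
      using that q by (cases q) (auto simp: field_simps power2_eq_square)
     from this[of "1 - t"] show ?thesis using that by simp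
    qed
    finally have "((\<lambda>t. B / q * inverse ((1 - t) ^ q)) has_real_derivative B / q * (of_nat q / (1 - t) ^ Suc q)) (at t)"
     by (rule DERIV_cmult)
    then show ?thesis using q by (simp add: inverse_eq_divide)
   qed
   fix t :: real assume t: "0 < t" "t < 1"
   let ?x = "of_real t * z"
   have nx: "cmod ?x = t * cmod z" using t by (simp add: norm_mult)
   have x: "?x \<in> ball 0 1" using z t mult_left_le_one_le[of "cmod z" t] nx by auto
   have "cmod (h ?x) * (1 - t * cmod z) ^ Suc q \<le> B" using h x nx unfolding growth_def by (metis)
   moreover have "(1 - t * cmod z) ^ Suc q > 0" using x nx by (intro zero_less_power) auto
   ultimately show "cmod (deriv H ?x) \<le> B / (1 - t * cmod z) ^ Suc q"
    unfolding dd[OF x] by (simp add: pos_le_divide_eq)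
  qed
  also have "\<dots> \<le> B / q * (1 / (1 - cmod z) ^ q)" using B by simp
  finally have "cmod (H z) \<le> (B / q) / (1 - cmod z) ^ q" by (simp add: H_def)
  moreover have "(1 - cmod z) ^ q > 0" using z by simp
  ultimately show ?thesis by (simp only: pos_le_divide_eq)
 qed
 then have "growth q (B / q) H" using H by (simp add: growth_def)
 then show thesis using dd that by blast
qed

section \<open>Linearization of the higher Schwarzians\<close>

text \<open>Both families arise from a recursion \<open>X\<^sub>j\<^sub>+\<^sub>1 = X\<^sub>j' - a\<^sub>j p X\<^sub>j\<close> with \<open>p = f''/f'\<close>; the second term is of
 second order.\<close>

lemma recursion_growth:
 fixes a :: "nat \<Rightarrow> complex" and b :: complex
 assumes c: "c \<ge> 0"
 shows "\<exists>C\<ge>0. \<forall>k p \<Lambda> X. 0 \<le> k \<longrightarrow> k \<le> 1 \<longrightarrow> growth 1 (c * k) p \<longrightarrow> growth 2 (c * k) \<Lambda> \<longrightarrow>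
   growth 2 (c * k^2) (\<lambda>z. X 0 z - b * \<Lambda> z) \<longrightarrow>
   (\<forall>j. \<forall>z\<in>ball 0 1. X (Suc j) z = deriv (X j) z - a j * p z * X j z) \<longrightarrow>
   growth (2 + j) (C * k^2) (\<lambda>z. X j z - b * (deriv ^^ j) \<Lambda> z)"
proof (induction j)
 case 0
 show ?case by (rule exI[of _ c]) (use c in \<open>auto simp: numeral_2_eq_2\<close>)
next
 case (Suc j)
 then obtain C where C: "C \<ge> 0" and IH: "\<And>k p \<Lambda> X. 0 \<le> k \<Longrightarrow> k \<le> 1 \<Longrightarrow> growth 1 (c * k) p \<Longrightarrow> growth 2 (c * k) \<Lambda> \<Longrightarrow>
   growth 2 (c * k^2) (\<lambda>z. X 0 z - b * \<Lambda> z) \<Longrightarrow>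
   (\<forall>j. \<forall>z\<in>ball 0 1. X (Suc j) z = deriv (X j) z - a j * p z * X j z) \<Longrightarrow>
   growth (2 + j) (C * k^2) (\<lambda>z. X j z - b * (deriv ^^ j) \<Lambda> z)" by blast
 \<comment> \<open>The constant for j derivatives of \<Lambda>, accumulated from the Cauchy
   estimates.\<close>
 define D where "D = (\<Prod>i=1..j. 2 ^ (2 + i) :: real) * c"
 have D: "D \<ge> 0" unfolding D_def using c by (intro mult_nonneg_nonneg prod_nonneg) auto
 define C' where "C' = 2 ^ Suc (2 + j) * C + cmod (a j) * (c * (C + cmod b * D))"
 show ?case
 proof (intro exI[of _ C'] conjI allI impI)
  show "C' \<ge> 0" unfolding C'_def using C D c by simp
  fix k :: real and p \<Lambda> :: "complex \<Rightarrow> complex" and X :: "nat \<Rightarrow> complex \<Rightarrow> complex"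
  assume k: "0 \<le> k" "k \<le> 1" and p: "growth 1 (c * k) p" and \<Lambda>: "growth 2 (c * k) \<Lambda>"
   and X0: "growth 2 (c * k^2) (\<lambda>z. X 0 z - b * \<Lambda> z)"
   and X: "\<forall>j. \<forall>z\<in>ball 0 1. X (Suc j) z = deriv (X j) z - a j * p z * X j z"
  define R where "R z = X j z - b * (deriv ^^ j) \<Lambda> z" for z
  have gR: "growth (2 + j) (C * k^2) R" unfolding R_def by (rule IH[OF k p \<Lambda> X0 X])
  have g\<Lambda>: "growth (2 + j) (D * k) ((deriv ^^ j) \<Lambda>)"
   using growth_higher_deriv[OF \<Lambda>, of j] by (simp add: D_def mult_ac)
  \<comment> \<open>The iterate itself is only of first order in k; its product with p, also of
    first order, belongs to the quadratic error. This uses k^2 \<le> k.\<close>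
  have gX: "growth (2 + j) ((C + cmod b * D) * k) (X j)"
  proof (rule growth_mono)
   have "growth (2 + j) (C * k^2 + cmod b * (D * k)) (\<lambda>z. R z + b * (deriv ^^ j) \<Lambda> z)"
    by (intro growth_add growth_cmult gR g\<Lambda>)
   then show "growth (2 + j) (C * k^2 + cmod b * (D * k)) (X j)" by (simp add: R_def)
   have "k\<^sup>2 \<le> k" using k by (simp add: power2_eq_square mult_left_le)
   then have "C * k^2 \<le> C * k" using C by (rule mult_left_mono)
   then show "C * k^2 + cmod b * (D * k) \<le> (C + cmod b * D) * k" by (simp add: algebra_simps)
  qed
  have "growth (1 + (2 + j)) ((c * k) * ((C + cmod b * D) * k)) (\<lambda>z. p z * X j z)"
   by (rule growth_mult[OF p gX])
  then have g1: "growth (Suc (2 + j)) (cmod (- a j) * ((c * k) * ((C + cmod b * D) * k))) (\<lambda>z. - a j * (p z * X j z))"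
   using growth_cmult[of "Suc (2 + j)" "(c * k) * ((C + cmod b * D) * k)" _ "- a j"] by simp
  have "growth (Suc (2 + j)) (2 ^ Suc (2 + j) * (C * k^2) + cmod (- a j) * ((c * k) * ((C + cmod b * D) * k)))
   (\<lambda>z. deriv R z + - a j * (p z * X j z))"
   by (rule growth_add[OF growth_deriv[OF gR] g1])
  moreover have "2 ^ Suc (2 + j) * (C * k^2) + cmod (- a j) * ((c * k) * ((C + cmod b * D) * k)) = C' * k^2"
   by (simp add: C'_def algebra_simps power2_eq_square)
  ultimately have g: "growth (Suc (2 + j)) (C' * k^2) (\<lambda>z. deriv R z + - a j * (p z * X j z))" by (simp only:)
  show "growth (2 + Suc j) (C' * k^2) (\<lambda>z. X (Suc j) z - b * (deriv ^^ Suc j) \<Lambda> z)"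
  proof (rule growth_cong)
   show "growth (2 + Suc j) (C' * k^2) (\<lambda>z. deriv R z + - a j * (p z * X j z))" using g by simp
   fix z :: complex assume z: "z \<in> ball 0 1"
   have hX: "X j holomorphic_on ball 0 1" and h\<Lambda>: "(deriv ^^ j) \<Lambda> holomorphic_on ball 0 1"
    using gX g\<Lambda> by (auto simp: growth_def)
   have "(R has_field_derivative deriv (X j) z - b * deriv ((deriv ^^ j) \<Lambda>) z) (at z)"
    unfolding R_def by (intro DERIV_diff DERIV_cmult holomorphic_derivI[OF hX open_ball z] holomorphic_derivI[OF h\<Lambda> open_ball z])
   then have "deriv R z = deriv (X j) z - b * deriv ((deriv ^^ j) \<Lambda>) z" by (rule DERIV_imp_deriv)
   then show "deriv R z + - a j * (p z * X j z) = X (Suc j) z - b * (deriv ^^ Suc j) \<Lambda> z"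
    using X z by simp
  qed
 qed
qed

text \<open>The factor with which the (n - 3)-rd derivative of the Schwarzian enters each family to
  first order. For \<open>KindB\<close> it is (-2)(-(n - 2)/2): the factor in front of
  \<open>sigma_B\<close> times the one from differentiating f' to the power 1 - n/2.\<close>

definition linear_coefficient :: "schwarzian_kind \<Rightarrow> nat \<Rightarrow> complex" where
 "linear_coefficient \<kappa> n = (case \<kappa> of KindA \<Rightarrow> 1 | KindB \<Rightarrow> of_nat (n - 2))"

text \<open>\<open>sigma_B n f = - 2 T\<^sub>n\<^sub>-\<^sub>1\<close>, where \<open>T\<^sub>j\<close> is the \<open>j\<close>-th derivative of \<open>Y = s\<^sup>-\<^sup>(\<^sup>n\<^sup>-\<^sup>2\<^sup>)\<close> divided by \<open>Y\<close>.\<close>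

primrec log_deriv_power :: "complex \<Rightarrow> (complex \<Rightarrow> complex) \<Rightarrow> nat \<Rightarrow> complex \<Rightarrow> complex" where
 "log_deriv_power N p 0 = (\<lambda>z. 1)"
| "log_deriv_power N p (Suc j) = (\<lambda>z. deriv (log_deriv_power N p j) z - N / 2 * p z * log_deriv_power N p j z)"

lemma log_deriv_power_holomorphic:
 assumes "p holomorphic_on S" "open S"
 shows "log_deriv_power N p j holomorphic_on S"
 using assms by (induction j) (auto intro!: holomorphic_intros holomorphic_deriv)

text \<open>A nonvanishing holomorphic function on the disc has a holomorphic square root, so the
  choice in the definition of \<open>sqrt_deriv\<close> picks an actual root.\<close>

lemma sqrt_deriv:
 assumes "f holomorphic_on ball 0 1" "\<And>z. z \<in> ball 0 1 \<Longrightarrow> deriv f z \<noteq> 0"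
 shows "sqrt_deriv f holomorphic_on ball 0 1" "z \<in> ball 0 1 \<Longrightarrow> (sqrt_deriv f z)\<^sup>2 = deriv f z"
proof -
 have "deriv f holomorphic_on ball 0 1" using assms(1) by (rule holomorphic_deriv) simp
 then obtain s where "s holomorphic_on ball 0 1" "\<And>z. z \<in> ball 0 1 \<Longrightarrow> deriv f z = (s z)^2"
  using contractible_imp_holomorphic_sqrt[of "deriv f" "ball 0 1"] assms(2) by (auto simp: convex_imp_contractible)
 then have "\<exists>s. s holomorphic_on unit_disc \<and> (\<forall>z\<in>unit_disc. (s z)\<^sup>2 = deriv f z)" by auto
 then have "sqrt_deriv f holomorphic_on unit_disc \<and> (\<forall>z\<in>unit_disc. (sqrt_deriv f z)\<^sup>2 = deriv f z)"
  unfolding sqrt_deriv_def by (rule someI_ex)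
 then show "sqrt_deriv f holomorphic_on ball 0 1" "z \<in> ball 0 1 \<Longrightarrow> (sqrt_deriv f z)\<^sup>2 = deriv f z" by auto
qed

text \<open>From s^2 = f' follows s' = (p/2) s, so Y = s^(-N) with N = n - 2 satisfies Y' = -(N/2) p
  Y. Every derivative of Y is therefore Y times a polynomial in p and its derivatives, and s^N
  cancels Y.\<close>

lemma sigma_B_eq:
 assumes f: "f holomorphic_on ball 0 1" and nz: "\<And>z. z \<in> ball 0 1 \<Longrightarrow> deriv f z \<noteq> 0" and z: "z \<in> ball 0 1"
 shows "sigma_B n f z = - 2 * log_deriv_power (of_nat (n - 2)) (\<lambda>z. deriv (deriv f) z / deriv f z) (n - 1) z"
proof -
 define p where "p z = deriv (deriv f) z / deriv f z" for z
 define s where "s = sqrt_deriv f"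
 define N where "N = n - 2"
 define Y where "Y u = inverse (s u ^ N)" for u
 have df: "deriv f holomorphic_on ball 0 1" and ddf: "deriv (deriv f) holomorphic_on ball 0 1"
  using f by (auto intro!: holomorphic_deriv)
 have p: "p holomorphic_on ball 0 1" unfolding p_def using nz by (intro holomorphic_intros df ddf) auto
 have s: "s holomorphic_on ball 0 1" "\<And>z. z \<in> ball 0 1 \<Longrightarrow> (s z)\<^sup>2 = deriv f z"
  using sqrt_deriv[OF f nz] by (auto simp: s_def)
 have snz: "s z \<noteq> 0" if "z \<in> ball 0 1" for z using s(2)[OF that] nz[OF that] by auto
 have ds: "deriv s z = p z / 2 * s z" if z: "z \<in> ball 0 1" for z
 proof -
  have "deriv (deriv f) z = deriv (\<lambda>z. (s z)\<^sup>2) z"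
   by (rule complex_derivative_transform_within_open[of _ "ball 0 1"])
    (use s z df in \<open>auto intro!: holomorphic_intros\<close>)
  also have "\<dots> = 2 * s z * deriv s z"
   by (rule DERIV_imp_deriv) (auto intro!: derivative_eq_intros holomorphic_derivI[OF s(1) open_ball z])
  finally have "p z = 2 * s z * deriv s z / (s z)^2" by (simp add: p_def s(2)[OF z])
  then show ?thesis using snz[OF z] by (simp add: power2_eq_square)
 qed
 have Y: "Y holomorphic_on ball 0 1" unfolding Y_def using snz by (intro holomorphic_intros s(1)) auto
 have dY: "(Y has_field_derivative - (of_nat N / 2) * p z * Y z) (at z)" if z: "z \<in> ball 0 1" for z
 proof -
  have "(s has_field_derivative p z / 2 * s z) (at z)"
   using holomorphic_derivI[OF s(1) open_ball z] ds[OF z] by simp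
  then have "((\<lambda>z. s z ^ N) has_field_derivative of_nat N * (p z / 2 * s z * s z ^ (N - 1))) (at z)"
   using DERIV_power[of s "p z / 2 * s z" z UNIV N] by simp
  also have "of_nat N * (p z / 2 * s z * s z ^ (N - 1)) = of_nat N / 2 * p z * s z ^ N"
   by (cases N) auto
  finally have "((\<lambda>z. inverse (s z ^ N)) has_field_derivative - (inverse (s z ^ N) * (of_nat N / 2 * p z * s z ^ N) * inverse (s z ^ N))) (at z)"
   by (rule DERIV_inverse') (use snz[OF z] in simp)
  then show ?thesis using snz[OF z] unfolding Y_def[abs_def] by (simp add: field_simps)
 qed
 have T: "log_deriv_power (of_nat N) p j holomorphic_on ball 0 1" for j
  by (rule log_deriv_power_holomorphic[OF p open_ball])
 have "(deriv ^^ j) Y z = Y z * log_deriv_power (of_nat N) p j z" if "z \<in> ball 0 1" for j z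
  using that
 proof (induction j arbitrary: z)
  case (Suc j)
  have "deriv ((deriv ^^ j) Y) z = deriv (\<lambda>z. Y z * log_deriv_power (of_nat N) p j z) z"
   by (rule complex_derivative_transform_within_open[of _ "ball 0 1"])
    (use Suc in \<open>auto intro!: holomorphic_intros holomorphic_higher_deriv Y T\<close>)
  also have "\<dots> = - (of_nat N / 2) * p z * Y z * log_deriv_power (of_nat N) p j z + deriv (log_deriv_power (of_nat N) p j) z * Y z"
   by (intro DERIV_imp_deriv DERIV_mult dY Suc.prems holomorphic_derivI[OF T open_ball])
  finally show ?case by (simp add: algebra_simps)
 qed simp
 from this[OF z, of "n - 1"]
 have "sigma_B n f z = - 2 * s z ^ N * (Y z * log_deriv_power (of_nat N) p (n - 1) z)"
  by (simp add: sigma_B_def Y_def[abs_def] s_def N_def)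
 then show ?thesis using snz[OF z] by (simp add: Y_def N_def p_def[abs_def])
qed

text \<open>The order of quantifiers matters: C depends on c, n and the kind but not on the map,
  which makes the remainder uniform over small coefficients.\<close>

lemma higher_schwarzian_linearization:
 assumes c: "c \<ge> 0" and n: "n \<ge> 3"
 shows "\<exists>C\<ge>0. \<forall>k f \<Lambda>. 0 \<le> k \<longrightarrow> k \<le> 1 \<longrightarrow> f holomorphic_on ball 0 1 \<longrightarrow> (\<forall>z\<in>ball 0 1. deriv f z \<noteq> 0) \<longrightarrow>
   growth 1 (c * k) (\<lambda>z. deriv (deriv f) z / deriv f z) \<longrightarrow> growth 2 (c * k) \<Lambda> \<longrightarrow>
   growth 2 (c * k^2) (\<lambda>z. schwarzian f z - \<Lambda> z) \<longrightarrow>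
   growth (n - 1) (C * k^2) (\<lambda>z. higher_schwarzian \<kappa> n f z - linear_coefficient \<kappa> n * (deriv ^^ (n - 3)) \<Lambda> z)"
proof -
 define j where "j = n - 3"
 have nj: "n = j + 3" using n by (simp add: j_def)
 show ?thesis
 proof (cases \<kappa>)
  case KindA
  obtain C where C: "C \<ge> 0" and *: "\<And>k p \<Lambda> X. 0 \<le> k \<Longrightarrow> k \<le> 1 \<Longrightarrow> growth 1 (c * k) p \<Longrightarrow> growth 2 (c * k) \<Lambda> \<Longrightarrow>
   growth 2 (c * k^2) (\<lambda>z. X 0 z - 1 * \<Lambda> z) \<Longrightarrow>
   (\<forall>j. \<forall>z\<in>ball 0 1. X (Suc j) z = deriv (X j) z - (of_nat (j + 3) - 1) * p z * X j z) \<Longrightarrow>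
   growth (2 + j) (C * k^2) (\<lambda>z. X j z - 1 * (deriv ^^ j) \<Lambda> z)"
   using recursion_growth[OF c, of 1 "\<lambda>j. of_nat (j + 3) - 1" j] by blast
  show ?thesis
  proof (intro exI[of _ C] conjI allI impI C)
   fix k :: real and f \<Lambda> :: "complex \<Rightarrow> complex"
   assume a: "0 \<le> k" "k \<le> 1" "growth 1 (c * k) (\<lambda>z. deriv (deriv f) z / deriv f z)" "growth 2 (c * k) \<Lambda>"
    "growth 2 (c * k^2) (\<lambda>z. schwarzian f z - \<Lambda> z)"
   have "growth (2 + j) (C * k^2) (\<lambda>z. sigma_A (j + 3) f z - 1 * (deriv ^^ j) \<Lambda> z)"
    by (rule *[where X="\<lambda>j. sigma_A (j + 3) f", OF a(1-4)]) (use a(5) in \<open>auto simp: eval_nat_numeral\<close>)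
   moreover have "n - 1 = 2 + j" "n - 3 = j" by (auto simp: nj)
   moreover have "sigma_A (j + 3) f z - 1 * (deriv ^^ j) \<Lambda> z = higher_schwarzian \<kappa> n f z - linear_coefficient \<kappa> n * (deriv ^^ j) \<Lambda> z"
    if "z \<in> ball 0 1" for z using that by (simp add: higher_schwarzian_def linear_coefficient_def KindA nj)
   ultimately show "growth (n - 1) (C * k^2) (\<lambda>z. higher_schwarzian \<kappa> n f z - linear_coefficient \<kappa> n * (deriv ^^ (n - 3)) \<Lambda> z)"
    by (auto intro: growth_cong)
  qed
 next
  case KindB
  define N where "N = complex_of_nat (n - 2)"
  \<comment> \<open>Large enough to dominate c and also the error of the initial term, which
    contains p^2 from the Schwarzian and from the second derivative of Y.\<close>
  define c' where "c' = c + cmod N * (c + c^2) + (cmod N)^2 * c^2"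
  have c': "c' \<ge> c" "c' \<ge> 0" using c by (auto simp: c'_def)
  obtain C where C: "C \<ge> 0" and *: "\<And>k p \<Lambda> X. 0 \<le> k \<Longrightarrow> k \<le> 1 \<Longrightarrow> growth 1 (c' * k) p \<Longrightarrow> growth 2 (c' * k) \<Lambda> \<Longrightarrow>
   growth 2 (c' * k^2) (\<lambda>z. X 0 z - (- N / 2) * \<Lambda> z) \<Longrightarrow>
   (\<forall>j. \<forall>z\<in>ball 0 1. X (Suc j) z = deriv (X j) z - N / 2 * p z * X j z) \<Longrightarrow>
   growth (2 + j) (C * k^2) (\<lambda>z. X j z - (- N / 2) * (deriv ^^ j) \<Lambda> z)"
   using recursion_growth[OF c'(2), of "- N / 2" "\<lambda>j. N / 2" j] by blast
  show ?thesis
  proof (intro exI[of _ "2 * C"] conjI allI impI)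
   show "0 \<le> 2 * C" using C by simp
   fix k :: real and f \<Lambda> :: "complex \<Rightarrow> complex"
   assume k: "0 \<le> k" "k \<le> 1" and f: "f holomorphic_on ball 0 1" "\<forall>z\<in>ball 0 1. deriv f z \<noteq> 0"
    and p: "growth 1 (c * k) (\<lambda>z. deriv (deriv f) z / deriv f z)" and \<Lambda>: "growth 2 (c * k) \<Lambda>"
    and S: "growth 2 (c * k^2) (\<lambda>z. schwarzian f z - \<Lambda> z)"
   define p where "p = (\<lambda>z. deriv (deriv f) z / deriv f z)"
   \<comment> \<open>The recursion is entered at index 2: this term contains p' and so the
     Schwarzian, whereas index 1 is a multiple of p, of order one only. Accordingly n - 1 = j +
     2.\<close>
   define X where "X i = log_deriv_power N p (i + 2)" for i
   have gp: "growth 1 (c * k) p" using p by (simp add: p_def)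
   have gpp: "growth 2 ((c * k) * (c * k)) (\<lambda>z. p z * p z)" using growth_mult[OF gp gp] by (simp add: numeral_2_eq_2)
   have X0: "growth 2 (c' * k^2) (\<lambda>z. X 0 z - (- N / 2) * \<Lambda> z)"
   proof (rule growth_mono[OF growth_cong])
    show "growth 2 (cmod (- N / 2) * (c * k^2 + cmod (1/2) * ((c * k) * (c * k))) + cmod (N^2 / 4) * ((c * k) * (c * k)))
     (\<lambda>z. (- N / 2) * ((schwarzian f z - \<Lambda> z) + (1/2) * (p z * p z)) + (N^2 / 4) * (p z * p z))"
     by (intro growth_add growth_cmult S gpp)
    fix z :: complex assume z: "z \<in> ball 0 1"
    have hp: "p holomorphic_on ball 0 1" using gp by (simp add: growth_def)
    have "((\<lambda>z. - (N / 2 * p z)) has_field_derivative - (N / 2 * deriv p z)) (at z)"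
     by (intro DERIV_minus DERIV_cmult holomorphic_derivI[OF hp open_ball z])
    then have "deriv (\<lambda>z. - (N / 2 * p z)) z = - (N / 2 * deriv p z)" by (rule DERIV_imp_deriv)
    then have x0: "X 0 z = - (N / 2 * deriv p z) + N / 2 * p z * (N / 2 * p z)"
     by (simp add: X_def numeral_2_eq_2)
    have sc: "schwarzian f z = deriv p z - 1 / 2 * (p z * p z)"
     by (simp add: schwarzian_def p_def power2_eq_square)
    show "(- N / 2) * ((schwarzian f z - \<Lambda> z) + (1/2) * (p z * p z)) + (N^2 / 4) * (p z * p z) = X 0 z - (- N / 2) * \<Lambda> z"
     unfolding x0 sc by (simp add: field_simps power2_eq_square)
   next
    have "cmod (- N / 2) * (c * k^2 + cmod (1/2) * ((c * k) * (c * k))) + cmod (N^2 / 4) * ((c * k) * (c * k))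
     = (cmod N / 2 * (c + c^2 / 2) + (cmod N)^2 / 4 * c^2) * k^2"
     by (simp add: norm_divide norm_mult norm_power power2_eq_square algebra_simps)
    also have "\<dots> \<le> c' * k^2"
    proof (rule mult_right_mono)
     have "cmod N / 2 * (c + c^2 / 2) \<le> cmod N * (c + c^2)" using c by (intro mult_mono) auto
     moreover have "(cmod N)\<^sup>2 / 4 * c^2 \<le> (cmod N)^2 * c^2" by (intro mult_right_mono) auto
     ultimately show "cmod N / 2 * (c + c^2 / 2) + (cmod N)^2 / 4 * c^2 \<le> c'"
      unfolding c'_def using c by linarith
    qed simp
    finally show "cmod (- N / 2) * (c * k^2 + cmod (1/2) * ((c * k) * (c * k))) + cmod (N^2 / 4) * ((c * k) * (c * k)) \<le> c' * k^2" .
   qed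
   have ck: "c * k \<le> c' * k" using c' k by (intro mult_right_mono) auto
   have "growth (2 + j) (C * k^2) (\<lambda>z. X j z - (- N / 2) * (deriv ^^ j) \<Lambda> z)"
    by (rule *[where X=X and \<Lambda>=\<Lambda> and p=p, OF k growth_mono[OF gp ck] growth_mono[OF \<Lambda> ck] X0]) (simp add: X_def)
   then have g: "growth (2 + j) (cmod (- 2) * (C * k^2)) (\<lambda>z. - 2 * (X j z - (- N / 2) * (deriv ^^ j) \<Lambda> z))"
    by (rule growth_cmult)
   have nn: "n - 1 = 2 + j" "n - 3 = j" by (auto simp: nj)
   have eq: "- 2 * (X j z - (- N / 2) * (deriv ^^ j) \<Lambda> z) = higher_schwarzian \<kappa> n f z - linear_coefficient \<kappa> n * (deriv ^^ j) \<Lambda> z"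
    if z: "z \<in> ball 0 1" for z
   proof -
    have "sigma_B n f z = - 2 * X j z"
     using sigma_B_eq[OF f(1) _ z, of n] f(2) by (simp add: X_def N_def p_def nj)
    then show ?thesis using z by (simp add: higher_schwarzian_def linear_coefficient_def KindB N_def algebra_simps)
   qed
   have Ck: "cmod (- 2) * (C * k^2) = 2 * C * k^2" by simp
   show "growth (n - 1) (2 * C * k^2) (\<lambda>z. higher_schwarzian \<kappa> n f z - linear_coefficient \<kappa> n * (deriv ^^ (n - 3)) \<Lambda> z)"
    unfolding nn by (rule growth_cong[OF g[unfolded Ck] eq])
  qed
 qed
qed

section \<open>The integral operator and its surjectivity\<close>

text \<open>Up to the factor -6 / \<pi> this is the first variation of the Schwarzian in the
  direction \<mu>.\<close>

definition cauchy_power :: "(complex \<Rightarrow> complex) \<Rightarrow> complex \<Rightarrow> complex" where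
 "cauchy_power \<mu> z = (LINT \<zeta>|lborel. \<mu> \<zeta> / (\<zeta> - z) ^ 4)"

lemma linf_ext_measurable: "\<mu> \<in> linf_ext \<Longrightarrow> \<mu> \<in> borel_measurable borel"
 and linf_ext_zero: "\<mu> \<in> linf_ext \<Longrightarrow> z \<in> cball 0 1 \<Longrightarrow> \<mu> z = 0"
 by (auto simp: linf_ext_def)

lemma ball_subset_unit_disc: "ball a (1 - cmod a) \<subseteq> cball 0 1"
proof
 fix z assume "z \<in> ball a (1 - cmod a)"
 then have "cmod (z - a) < 1 - cmod a" by (simp add: dist_norm norm_minus_commute)
 moreover have "cmod z \<le> cmod a + cmod (z - a)" by (rule norm_triangle_sub)
 ultimately show "z \<in> cball 0 1" by simp
qed

lemma linf_ext_mult_integrable: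
 assumes mu: "\<mu> \<in> linf_ext" and g: "g \<in> borel_measurable borel" "integrable lborel (\<lambda>z. indicator (- cball 0 1) z * cmod (g z))"
 shows "integrable lborel (\<lambda>z. \<mu> z * g z)"
  "cmod (LINT z|lborel. \<mu> z * g z) \<le> linf_norm \<mu> * (LINT z|lborel. indicator (- cball 0 1) z * cmod (g z))"
proof -
 note ae = linf_norm_AE[OF mu]
 have [measurable]: "\<mu> \<in> borel_measurable borel" "g \<in> borel_measurable borel"
  using mu g by (auto intro: linf_ext_measurable)
 have bnd: "AE z in lborel. cmod (\<mu> z * g z) \<le> linf_norm \<mu> * (indicator (- cball 0 1) z * cmod (g z))"
  using ae(1)
 proof eventually_elim
  case (elim z)
  show ?case
  proof (cases "z \<in> cball 0 1")
   case False
   have "cmod (\<mu> z) * cmod (g z) \<le> linf_norm \<mu> * cmod (g z)" using elim by (rule mult_right_mono) simp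
   then show ?thesis using False by (simp add: norm_mult)
  qed (simp add: linf_ext_zero[OF mu])
 qed
 have ib: "integrable lborel (\<lambda>z. linf_norm \<mu> * (indicator (- cball 0 1) z * cmod (g z)))"
  using g(2) by (rule integrable_mult_right)
 show i: "integrable lborel (\<lambda>z. \<mu> z * g z)"
 proof (rule Bochner_Integration.integrable_bound[OF ib])
  show "AE z in lborel. cmod (\<mu> z * g z) \<le> norm (linf_norm \<mu> * (indicator (- cball 0 1) z * cmod (g z)))"
   using bnd by eventually_elim (auto intro: order_trans[OF _ abs_ge_self])
 qed measurable
 have "cmod (LINT z|lborel. \<mu> z * g z) \<le> (LINT z|lborel. cmod (\<mu> z * g z))" by (rule integral_norm_bound)
 also have "\<dots> \<le> (LINT z|lborel. linf_norm \<mu> * (indicator (- cball 0 1) z * cmod (g z)))"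
  using i ib bnd by (intro integral_mono_AE) auto
 finally show "cmod (LINT z|lborel. \<mu> z * g z) \<le> linf_norm \<mu> * (LINT z|lborel. indicator (- cball 0 1) z * cmod (g z))" by simp
qed

lemma cauchy_power_integrable:
 assumes mu: "\<mu> \<in> linf_ext" and a: "a \<in> ball 0 1"
 shows "integrable lborel (\<lambda>\<zeta>. \<mu> \<zeta> / (\<zeta> - a) ^ 4)"
  "cmod (cauchy_power \<mu> a) \<le> linf_norm \<mu> * (kernel_mass / (1 - cmod a)^2)"
proof -
 define d where "d = 1 - cmod a"
 have d: "d > 0" using a by (simp add: d_def)
 note s = inverse_power4_scaled[OF d, of a]
 have le: "indicator (- cball 0 1) z * cmod (1 / (z - a) ^ 4) \<le> indicator (- ball a d) z / cmod (z - a) ^ 4" for z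
  using ball_subset_unit_disc[of a] by (auto simp: indicator_def norm_divide norm_power d_def)
 have i: "integrable lborel (\<lambda>z. indicator (- cball 0 1) z * cmod (1 / (z - a) ^ 4))"
  by (rule Bochner_Integration.integrable_bound[OF s(1)]) (measurable, use le in \<open>auto simp: norm_divide norm_power indicator_def\<close>)
 note m = linf_ext_mult_integrable[OF mu _ i]
 show "integrable lborel (\<lambda>\<zeta>. \<mu> \<zeta> / (\<zeta> - a) ^ 4)" using m(1) by simp
 have "cmod (cauchy_power \<mu> a) \<le> linf_norm \<mu> * (LINT z|lborel. indicator (- cball 0 1) z * cmod (1 / (z - a) ^ 4))"
  using m(2) by (simp add: cauchy_power_def)
 also have "\<dots> \<le> linf_norm \<mu> * (LINT z|lborel. indicator (- ball a d) z / cmod (z - a) ^ 4)"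
  by (intro mult_left_mono integral_mono i s le linf_norm_AE[OF mu])
 finally show "cmod (cauchy_power \<mu> a) \<le> linf_norm \<mu> * (kernel_mass / (1 - cmod a)^2)"
  using s by (simp add: d_def)
qed

text \<open>The truncation of the kernel lies inside the unit disc, where \<mu> is 0.\<close>

lemma cauchy_power_eq_exterior_kernel:
 assumes mu: "\<mu> \<in> linf_ext"
 shows "(LINT z|lborel. \<mu> z * (exterior_kernel a (1 - cmod a) z)^2) = cauchy_power \<mu> a"
proof -
 have "\<mu> z * (exterior_kernel a (1 - cmod a) z)^2 = \<mu> z / (z - a) ^ 4" for z
 proof (cases "z \<in> ball a (1 - cmod a)")
  case True
  then show ?thesis using ball_subset_unit_disc[of a] linf_ext_zero[OF mu, of z] by auto
 next
  case False
  then show ?thesis by (simp add: exterior_kernel_def power_divide flip: power_mult)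
 qed
 then show ?thesis by (simp add: cauchy_power_def)
qed

lemma kernel_lower_bound:
 assumes "1 \<le> cmod \<zeta>" "cmod u \<le> \<rho>" "\<rho> < 1"
 shows "(1 - \<rho>) * cmod \<zeta> \<le> cmod (\<zeta> - u)"
proof -
 have "\<rho> * 1 \<le> \<rho> * cmod \<zeta>" using assms order_trans[OF norm_ge_zero assms(2)] by (intro mult_left_mono) auto
 moreover have "cmod \<zeta> - cmod u \<le> cmod (\<zeta> - u)" by (rule norm_triangle_ineq2)
 ultimately show ?thesis using assms by (simp add: left_diff_distrib)
qed

lemma integrable_exterior_power4:
 "integrable lborel (\<lambda>z. indicator (- cball 0 1) z * (1 / cmod z ^ 4))"
 by (rule Bochner_Integration.integrable_bound[OF integrable_inverse_power4]) (measurable, auto simp: indicator_def)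

text \<open>Differentiation under the integral: for all u in a disc of radius \<rho> < 1 the derived
  kernel is at most a constant times |\<zeta>|^(-4) on the exterior, an integrable bound.\<close>

lemma cauchy_power_holomorphic:
 assumes mu: "\<mu> \<in> linf_ext"
 shows "cauchy_power \<mu> holomorphic_on ball 0 1"
proof -
 have [measurable]: "\<mu> \<in> borel_measurable borel" using mu by (rule linf_ext_measurable)
 have "(cauchy_power \<mu> has_field_derivative (LINT \<zeta>|lborel. \<mu> \<zeta> * (4 / (\<zeta> - z) ^ 5))) (at z)" if z: "z \<in> ball 0 1" for z
  unfolding has_field_derivative_iff tendsto_at_iff_sequentially
 proof (intro allI impI)
  fix X :: "nat \<Rightarrow> complex" assume X: "\<forall>i. X i \<in> UNIV - {z}" "X \<longlonglongrightarrow> z"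
  define \<rho> where "\<rho> = (1 + cmod z) / 2"
  have \<rho>: "cmod z < \<rho>" "\<rho> < 1" using z by (auto simp: \<rho>_def)
  have "\<forall>\<^sub>F i in sequentially. cmod (X i) < \<rho>"
   using order_tendstoD(2)[OF tendsto_norm[OF X(2)] \<rho>(1)] .
  then obtain N where N: "\<And>i. i \<ge> N \<Longrightarrow> cmod (X i) < \<rho>" by (auto simp: eventually_sequentially)
  \<comment> \<open>The index is shifted by N so that every point of the sequence already lies in
    the disc of radius \<rho>.\<close>
  define Q where "Q i \<zeta> = (1 / (\<zeta> - X (i + N)) ^ 4 - 1 / (\<zeta> - z) ^ 4) / (X (i + N) - z)" for i \<zeta>
  define C where "C = 4 / (1 - \<rho>) ^ 5"
  have XN: "cmod (X (i + N)) < \<rho>" "X (i + N) \<noteq> z" for i using N[of "i + N"] X(1) by auto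
  have dk: "((\<lambda>u. 1 / (\<zeta> - u) ^ 4) has_field_derivative 4 / (\<zeta> - u) ^ 5) (at u within S)" if "\<zeta> \<noteq> u" for \<zeta> u S
  proof -
   have "((\<lambda>u. inverse ((\<zeta> - u) ^ 4)) has_field_derivative - (inverse ((\<zeta> - u) ^ 4) * (4 * (- 1 * (\<zeta> - u) ^ 3)) * inverse ((\<zeta> - u) ^ 4))) (at u within S)"
    using that by (auto intro!: derivative_eq_intros)
   also have "- (inverse ((\<zeta> - u) ^ 4) * (4 * (- 1 * (\<zeta> - u) ^ 3)) * inverse ((\<zeta> - u) ^ 4)) = 4 / (\<zeta> - u) ^ 5"
    using that by (simp add: field_simps flip: power_add)
   finally show ?thesis by (simp add: inverse_eq_divide)
  qed
  have bQ: "cmod (Q i \<zeta>) \<le> C * (1 / cmod \<zeta> ^ 4)" if \<zeta>: "\<zeta> \<notin> cball 0 1" for i \<zeta>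
  proof -
   have z1: "1 \<le> cmod \<zeta>" using \<zeta> by simp
   have "cmod (1 / (\<zeta> - X (i + N)) ^ 4 - 1 / (\<zeta> - z) ^ 4) \<le> C * (1 / cmod \<zeta> ^ 4) * cmod (X (i + N) - z)"
   proof (rule field_differentiable_bound[where S="ball 0 \<rho>"])
    fix u :: complex assume u: "u \<in> ball 0 \<rho>"
    then have "cmod u < cmod \<zeta>" using \<rho> z1 by auto
    then have ne: "\<zeta> \<noteq> u" by auto
    show "((\<lambda>u. 1 / (\<zeta> - u) ^ 4) has_field_derivative 4 / (\<zeta> - u) ^ 5) (at u within ball 0 \<rho>)" by (rule dk[OF ne])
    have "((1 - \<rho>) * cmod \<zeta>) ^ 5 \<le> cmod (\<zeta> - u) ^ 5"
     using kernel_lower_bound[of \<zeta> u \<rho>] z1 u \<rho> by (intro power_mono) auto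
    moreover have "(1 - \<rho>) ^ 5 * cmod \<zeta> ^ 4 \<le> (1 - \<rho>) ^ 5 * cmod \<zeta> ^ 5"
     using z1 \<rho> by (intro mult_left_mono power_increasing) auto
    ultimately have "(1 - \<rho>) ^ 5 * cmod \<zeta> ^ 4 \<le> cmod (\<zeta> - u) ^ 5" by (simp add: power_mult_distrib)
    then have "4 / cmod (\<zeta> - u) ^ 5 \<le> 4 / ((1 - \<rho>) ^ 5 * cmod \<zeta> ^ 4)"
     using \<rho> z1 ne by (intro divide_left_mono mult_pos_pos zero_less_power) auto
    then show "cmod (4 / (\<zeta> - u) ^ 5) \<le> C * (1 / cmod \<zeta> ^ 4)" by (simp add: C_def norm_divide norm_power)
   qed (use XN \<rho> in auto)
   then show ?thesis using XN(2)[of i] by (simp add: Q_def norm_divide pos_divide_le_eq)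
  qed
  have "(\<lambda>i. LINT \<zeta>|lborel. \<mu> \<zeta> * Q i \<zeta>) \<longlonglongrightarrow> (LINT \<zeta>|lborel. \<mu> \<zeta> * (4 / (\<zeta> - z) ^ 5))"
  proof (rule integral_dominated_convergence[where w="\<lambda>\<zeta>. linf_norm \<mu> * (C * (indicator (- cball 0 1) \<zeta> * (1 / cmod \<zeta> ^ 4)))"])
   show "integrable lborel (\<lambda>\<zeta>. linf_norm \<mu> * (C * (indicator (- cball 0 1) \<zeta> * (1 / cmod \<zeta> ^ 4))))"
    by (intro integrable_mult_right integrable_exterior_power4)
   show "(\<lambda>\<zeta>. \<mu> \<zeta> * Q i \<zeta>) \<in> borel_measurable lborel" for i unfolding Q_def by measurable
   show "AE \<zeta> in lborel. (\<lambda>i. \<mu> \<zeta> * Q i \<zeta>) \<longlonglongrightarrow> \<mu> \<zeta> * (4 / (\<zeta> - z) ^ 5)"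
   proof (intro always_eventually allI)
    fix \<zeta>
    show "(\<lambda>i. \<mu> \<zeta> * Q i \<zeta>) \<longlonglongrightarrow> \<mu> \<zeta> * (4 / (\<zeta> - z) ^ 5)"
    proof (cases "\<zeta> \<in> cball 0 1")
     case False
     then have "\<zeta> \<noteq> z" using z by auto
     then have "((\<lambda>u. (1 / (\<zeta> - u) ^ 4 - 1 / (\<zeta> - z) ^ 4) / (u - z)) \<longlongrightarrow> 4 / (\<zeta> - z) ^ 5) (at z)"
      using dk[of \<zeta> z UNIV] by (simp add: has_field_derivative_iff)
     then have "(\<lambda>i. Q i \<zeta>) \<longlonglongrightarrow> 4 / (\<zeta> - z) ^ 5"
      unfolding Q_def by (rule filterlim_compose)
       (rule filterlim_atI, use LIMSEQ_ignore_initial_segment[OF X(2), of N] XN(2) in auto)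
     then show ?thesis by (intro tendsto_intros)
    qed (simp add: linf_ext_zero[OF mu])
   qed
   show "AE \<zeta> in lborel. cmod (\<mu> \<zeta> * Q i \<zeta>) \<le> linf_norm \<mu> * (C * (indicator (- cball 0 1) \<zeta> * (1 / cmod \<zeta> ^ 4)))" for i
    using linf_norm_AE(1)[OF mu]
   proof eventually_elim
    case (elim \<zeta>)
    show ?case
    proof (cases "\<zeta> \<in> cball 0 1")
     case False
     have "cmod (\<mu> \<zeta>) * cmod (Q i \<zeta>) \<le> linf_norm \<mu> * (C * (1 / cmod \<zeta> ^ 4))"
      using elim bQ[OF False, of i] linf_norm_AE(2)[OF mu] by (intro mult_mono) auto
     then show ?thesis using False by (simp add: norm_mult)
    qed (simp add: linf_ext_zero[OF mu])
   qed
  qed measurable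
  also have "(\<lambda>i. LINT \<zeta>|lborel. \<mu> \<zeta> * Q i \<zeta>) = (\<lambda>i. (cauchy_power \<mu> (X (i + N)) - cauchy_power \<mu> z) / (X (i + N) - z))"
  proof
   fix i
   have i: "integrable lborel (\<lambda>\<zeta>. \<mu> \<zeta> / (\<zeta> - X (i + N)) ^ 4)" "integrable lborel (\<lambda>\<zeta>. \<mu> \<zeta> / (\<zeta> - z) ^ 4)"
    using XN(1)[of i] \<rho> z by (auto intro!: cauchy_power_integrable[OF mu])
   have "(\<lambda>\<zeta>. \<mu> \<zeta> * Q i \<zeta>) = (\<lambda>\<zeta>. (\<mu> \<zeta> / (\<zeta> - X (i + N)) ^ 4 - \<mu> \<zeta> / (\<zeta> - z) ^ 4) / (X (i + N) - z))"
    by (auto simp: Q_def fun_eq_iff algebra_simps diff_divide_distrib)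
   then show "(LINT \<zeta>|lborel. \<mu> \<zeta> * Q i \<zeta>) = (cauchy_power \<mu> (X (i + N)) - cauchy_power \<mu> z) / (X (i + N) - z)"
    using i by (simp add: cauchy_power_def)
  qed
  finally have "(\<lambda>i. (cauchy_power \<mu> (X (i + N)) - cauchy_power \<mu> z) / (X (i + N) - z)) \<longlonglongrightarrow> (LINT \<zeta>|lborel. \<mu> \<zeta> * (4 / (\<zeta> - z) ^ 5))" .
  then show "((\<lambda>y. (cauchy_power \<mu> y - cauchy_power \<mu> z) / (y - z)) \<circ> X) \<longlonglongrightarrow> (LINT \<zeta>|lborel. \<mu> \<zeta> * (4 / (\<zeta> - z) ^ 5))"
   unfolding o_def by (rule LIMSEQ_offset)
 qed
 then show ?thesis unfolding holomorphic_on_open[OF open_ball] by blast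
qed

lemma growth_cauchy_power:
 assumes mu: "\<mu> \<in> linf_ext"
 shows "growth 2 (kernel_mass * linf_norm \<mu>) (cauchy_power \<mu>)"
 unfolding growth_def
proof (intro conjI ballI cauchy_power_holomorphic[OF mu])
 fix z :: complex assume z: "z \<in> ball 0 1"
 then have p: "(1 - cmod z)\<^sup>2 > 0" by simp
 show "cmod (cauchy_power \<mu> z) * (1 - cmod z)^2 \<le> kernel_mass * linf_norm \<mu>"
  using cauchy_power_integrable(2)[OF mu z] p by (simp add: pos_le_divide_eq mult.commute)
qed

lemma cauchy_power_add:
 assumes "\<mu> \<in> linf_ext" "\<nu> \<in> linf_ext" "z \<in> ball 0 1"
 shows "cauchy_power (\<lambda>\<zeta>. \<mu> \<zeta> + \<nu> \<zeta>) z = cauchy_power \<mu> z + cauchy_power \<nu> z"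
 unfolding cauchy_power_def add_divide_distrib
 by (intro Bochner_Integration.integral_add cauchy_power_integrable assms)

lemma cauchy_power_cmult: "cauchy_power (\<lambda>\<zeta>. c * \<mu> \<zeta>) z = c * cauchy_power \<mu> z"
 unfolding cauchy_power_def by (simp add: integral_mult_right_zero[symmetric] del: integral_mult_right_zero)

section \<open>Integration by parts on the exterior of the disc\<close>

lemma wirtinger_exterior_extension:
 assumes der: "\<And>v. cmod v > 1 \<Longrightarrow> wirtinger Y (p v) (q v) v"
  and bnd: "\<And>v. cmod v > 1 \<Longrightarrow> cmod v \<le> 2 \<Longrightarrow> cmod (Y v) \<le> A * (cmod v - 1)^2"
 shows "wirtinger (\<lambda>v. if cmod v > 1 then Y v else 0) (if cmod v > 1 then p v else 0) (if cmod v > 1 then q v else 0) v"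
proof -
 let ?X = "\<lambda>v. if cmod v > 1 then Y v else 0"
 have A: "A \<ge> 0"
 proof -
  have "0 \<le> A * (cmod 2 - 1)^2" by (rule order_trans[OF norm_ge_zero bnd]) auto
  then show ?thesis by simp
 qed
 consider "cmod v > 1" | "cmod v < 1" | "cmod v = 1" by linarith
 then show ?thesis
 proof cases
  case 1
  have "open {v. cmod v > 1}" by (intro open_Collect_less continuous_intros)
  from wirtinger_transform[OF der[OF 1] this] show ?thesis using 1 by auto
 next
  case 2
  have "open {v. cmod v < 1}" by (intro open_Collect_less continuous_intros)
  from wirtinger_transform[OF wirtinger_const[of 0] this, of v ?X] show ?thesis using 2 by auto
 next
  case 3
  \<comment> \<open>At a point of the circle the quadratic vanishing of Y gives differential 0, so
    the extension by 0 is differentiable and no boundary term arises.\<close>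
  have "((\<lambda>y. cmod (?X y - ?X v - 0) / cmod (y - v)) \<longlongrightarrow> 0) (at v)"
  proof (rule Lim_null_comparison)
   have "\<forall>\<^sub>F y in at v. dist y v < 1"
    unfolding eventually_at by (rule exI[of _ 1]) simp
   then show "\<forall>\<^sub>F y in at v. norm (cmod (?X y - ?X v - 0) / cmod (y - v)) \<le> A * cmod (y - v)"
   proof eventually_elim
    case (elim y)
    have le: "cmod y - 1 \<le> cmod (y - v)" using norm_triangle_ineq2[of y v] 3 by simp
    have "cmod (?X y) \<le> A * (cmod (y - v))^2"
    proof (cases "cmod y > 1")
     case True
     have "cmod (Y y) \<le> A * (cmod y - 1)^2" using True le elim by (intro bnd) (auto simp: dist_norm)
     also have "\<dots> \<le> A * (cmod (y - v))^2" using A le True by (intro mult_left_mono power_mono) auto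
     finally show ?thesis using True by simp
    qed (use A in simp)
    then show ?case using 3 by (cases "y = v") (auto simp: power2_eq_square divide_simps mult_ac)
   qed
   have "((\<lambda>y. A * cmod (y - v)) \<longlongrightarrow> A * cmod (v - v)) (at v)" by (intro tendsto_intros)
   then show "((\<lambda>y. A * cmod (y - v)) \<longlongrightarrow> 0) (at v)" by simp
  qed
  then have "wirtinger ?X 0 0 v" unfolding wirtinger_def has_derivative_iff_norm by simp
  then show ?thesis using 3 by simp
 qed
qed

text \<open>The Stokes-type lemma for decay |z|^(-2) instead of compact support: the cutoff error is
  area R^2 times gradient 1/R times R^(-2), hence O(1/R). The integrability of p and that of q are
  separate premises because the applications have only one of them at a time.\<close>

lemma integral_wirtinger_decay:
 assumes der: "\<And>z. wirtinger X (p z) (q z) z"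
  and meas: "p \<in> borel_measurable borel" "q \<in> borel_measurable borel"
  and bnd: "\<And>z. cmod (p z) \<le> B" "\<And>z. cmod (q z) \<le> B"
  and decay: "\<And>z. cmod z \<ge> 1 \<Longrightarrow> cmod (X z) \<le> A / (cmod z)^2"
 shows "integrable lborel p \<Longrightarrow> integral\<^sup>L lborel p = 0"
  "integrable lborel q \<Longrightarrow> integral\<^sup>L lborel q = 0"
proof -
 note [measurable] = meas
 have cX: "continuous_on UNIV X"
  by (intro continuous_at_imp_continuous_on ballI) (rule wirtinger_continuous[OF der])
 have [measurable]: "X \<in> borel_measurable borel" using cX by (rule borel_measurable_continuous_onI)
 have A: "A \<ge> 0"
 proof -
  have "0 \<le> A / (cmod 1)^2" by (rule order_trans[OF norm_ge_zero decay]) simp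
  then show ?thesis by simp
 qed
 have B: "B \<ge> 0" by (rule order_trans[OF norm_ge_zero bnd(1)])
 define R where "R n = real n + 1" for n :: nat
 have R: "R n > 0" "R n \<ge> 1" for n by (auto simp: R_def)
 define b where "b n z = complex_of_real (cutoff 0 (R n) z)" for n z
 define s where "s n z = complex_of_real (cutoff_slope 0 (R n) z)" for n z
 have [measurable]: "b n \<in> borel_measurable borel" "s n \<in> borel_measurable borel" for n
  unfolding b_def s_def by measurable
 have out: "b n z = 0" "s n z = 0" if "z \<notin> cball 0 (2 * R n)" for n z
  using cutoff_outer[OF R(1)[of n], of z 0] that by (auto simp: b_def s_def)
 have zero: "(LINT z|lborel. s n z * cnj z * X z + b n z * p z) = 0 \<and> (LINT z|lborel. s n z * z * X z + b n z * q z) = 0" for n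
 proof -
  obtain M where M: "M > 0" "\<And>z. z \<in> cball 0 (2 * R n) \<Longrightarrow> cmod (X z) \<le> M"
   using compact_bound[OF compact_cball continuous_on_subset[OF cX subset_UNIV]] by metis
  have sb: "cmod (s n z * z) \<le> 8 / R n" "cmod (s n z * cnj z) \<le> 8 / R n" for z
   using cutoff_slope_bound[OF R(1)[of n], of 0 z] by (simp_all add: s_def norm_mult)
  have b1: "cmod (b n z) \<le> 1" for z using cutoff_bounds[of 0 "R n" z] by (simp add: b_def)
  have bound: "cmod (y * X z + b n z * x) \<le> 8 / R n * M + B"
   if "cmod y \<le> 8 / R n" "cmod x \<le> B" "z \<notin> cball 0 (2 * R n) \<Longrightarrow> y = 0" for y x z
  proof -
   have "cmod (y * X z) \<le> 8 / R n * M"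
   proof (cases "z \<in> cball 0 (2 * R n)")
    case True
    then show ?thesis unfolding norm_mult using that M(2) R(1)[of n] by (intro mult_mono) auto
   qed (use that M R(1)[of n] in auto)
   moreover have "cmod (b n z * x) \<le> 1 * B" unfolding norm_mult using b1 that by (intro mult_mono) auto
   ultimately show ?thesis by (intro norm_triangle_le add_mono) auto
  qed
  have d: "wirtinger (\<lambda>z. b n z * X z) (s n z * cnj z * X z + b n z * p z) (s n z * z * X z + b n z * q z) z" for z
   using wirtinger_mult[OF wirtinger_cutoff[OF R(1)[of n], of 0 z] der[of z]] by (simp add: b_def s_def)
  have "cmod (s n z * cnj z * X z + b n z * p z) \<le> 8 / R n * M + B" for z
   by (rule bound) (use sb bnd out in auto)
  moreover have "cmod (s n z * z * X z + b n z * q z) \<le> 8 / R n * M + B" for z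
   by (rule bound) (use sb bnd out in auto)
  moreover have "b n z * X z = 0" if "z \<notin> cball 0 (2 * R n)" for z using out that by simp
  moreover have "(\<lambda>z. s n z * cnj z * X z + b n z * p z) \<in> borel_measurable borel"
   "(\<lambda>z. s n z * z * X z + b n z * q z) \<in> borel_measurable borel" by measurable
  ultimately show ?thesis using integral_wirtinger_eq_0[OF d] by blast
 qed
 have lims: "(\<lambda>n. LINT z|lborel. s n z * y z * X z) \<longlonglongrightarrow> 0 \<and> (\<forall>n. integrable lborel (\<lambda>z. s n z * y z * X z))"
  if y: "\<And>z. cmod (y z) = cmod z" "y \<in> borel_measurable borel" for y
 proof
  note [measurable] = y(2)
  define A1 where "A1 = measure lborel (cball (0::complex) 1)"
  have le: "cmod (s n z * y z * X z) \<le> indicator (cball 0 (2 * R n)) z * (8 / R n * (A / (R n)^2))" for n z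
  proof (cases "z \<in> cball 0 (2 * R n) \<and> cmod z > R n")
   case True
   have "cmod (s n z * y z) \<le> 8 / R n"
    using cutoff_slope_bound[OF R(1)[of n], of 0 z] y(1)[of z] by (simp add: s_def norm_mult)
   moreover have "cmod (X z) \<le> A / (R n)^2"
   proof (rule order_trans[OF decay])
    have "(R n)\<^sup>2 \<le> (cmod z)^2" using True R[of n] by (intro power_mono) auto
    then show "A / (cmod z)^2 \<le> A / (R n)^2" using A R[of n] True by (intro divide_left_mono mult_pos_pos) auto
   qed (use True R[of n] in auto)
   ultimately have "cmod (s n z * y z) * cmod (X z) \<le> 8 / R n * (A / (R n)^2)"
    using R(1)[of n] by (intro mult_mono) auto
   then show ?thesis using True by (simp add: norm_mult)
  next
   case False
   then have "s n z = 0" using cutoff_inner(2)[OF R(1)[of n], of z 0] out(2)[of z n] by (auto simp: s_def)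
   then show ?thesis using A R(1)[of n] by simp
  qed
  have ii: "integrable lborel (\<lambda>z::complex. indicator (cball 0 (2 * R n)) z * (8 / R n * (A / (R n)^2)))" for n
   by (intro integrable_mult_left integrable_real_indicator) (use emeasure_lborel_cball_finite in auto)
  show int: "\<forall>n. integrable lborel (\<lambda>z. s n z * y z * X z)"
  proof
   fix n
   show "integrable lborel (\<lambda>z. s n z * y z * X z)"
    by (rule Bochner_Integration.integrable_bound[OF ii[of n]]) (measurable, use order_trans[OF le abs_ge_self] in auto)
  qed
  show "(\<lambda>n. LINT z|lborel. s n z * y z * X z) \<longlonglongrightarrow> 0"
  proof (rule Lim_null_comparison)
   show "\<forall>\<^sub>F n in sequentially. cmod (LINT z|lborel. s n z * y z * X z) \<le> 32 * A * A1 * (1 / R n)"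
   proof (intro always_eventually allI)
    fix n
    have "cmod (LINT z|lborel. s n z * y z * X z) \<le> (LINT z|lborel. indicator (cball (0::complex) (2 * R n)) z * (8 / R n * (A / (R n)^2)))"
     by (intro Bochner_Integration.integral_norm_bound_integral ii le int[rule_format])
    also have "\<dots> = measure lborel (cball (0::complex) (2 * R n)) * (8 / R n * (A / (R n)^2))" by simp
    also have "measure lborel (cball (0::complex) (2 * R n)) = (2 * R n)^2 * A1"
     using R(1)[of n] by (simp add: A1_def content_cball DIM_complex)
    also have "(2 * R n)\<^sup>2 * A1 * (8 / R n * (A / (R n)^2)) = 32 * A * A1 * (1 / R n)"
     using R(1)[of n] by (simp add: power2_eq_square field_simps)
    finally show "cmod (LINT z|lborel. s n z * y z * X z) \<le> 32 * A * A1 * (1 / R n)" .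
   qed
   have "(\<lambda>n. 1 / R n) \<longlonglongrightarrow> 0" unfolding R_def by real_asymp
   from tendsto_mult_right_zero[OF this, of "32 * A * A1"] show "(\<lambda>n. 32 * A * A1 * (1 / R n)) \<longlonglongrightarrow> 0" .
  qed
 qed
 have dom: "(\<lambda>n. LINT z|lborel. b n z * u z) \<longlonglongrightarrow> integral\<^sup>L lborel u \<and> (\<forall>n. integrable lborel (\<lambda>z. b n z * u z))"
  if u: "integrable lborel u" for u
 proof
  have [measurable]: "u \<in> borel_measurable borel" using u by (auto dest: borel_measurable_integrable)
  have le: "cmod (b n z * u z) \<le> cmod (u z)" for n z
   using mult_right_mono[of "cmod (b n z)" 1 "cmod (u z)"] cutoff_bounds[of 0 "R n" z] by (simp add: b_def norm_mult)
  show "\<forall>n. integrable lborel (\<lambda>z. b n z * u z)"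
  proof
   fix n show "integrable lborel (\<lambda>z. b n z * u z)"
    by (rule Bochner_Integration.integrable_bound[OF u]) (use le in auto)
  qed
  show "(\<lambda>n. LINT z|lborel. b n z * u z) \<longlonglongrightarrow> integral\<^sup>L lborel u"
  proof (rule integral_dominated_convergence[where w="\<lambda>z. cmod (u z)"])
   show "AE z in lborel. (\<lambda>n. b n z * u z) \<longlonglongrightarrow> u z"
   proof (intro always_eventually allI)
    fix z
    have "\<forall>\<^sub>F n in sequentially. b n z * u z = u z"
     using eventually_ge_at_top[of "nat \<lceil>cmod z\<rceil>"]
    proof eventually_elim
     case (elim n)
     then have "cmod (z - 0) \<le> R n" by (simp add: R_def nat_le_iff ceiling_le_iff)
     from cutoff_inner(1)[OF R(1) this] show ?case by (simp add: b_def)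
    qed
    then show "(\<lambda>n. b n z * u z) \<longlonglongrightarrow> u z" by (rule tendsto_eventually)
   qed
  qed (use u le in auto)
 qed
 show "integral\<^sup>L lborel p = 0" if ip: "integrable lborel p"
 proof -
  have l: "(\<lambda>n. LINT z|lborel. s n z * cnj z * X z) \<longlonglongrightarrow> 0" "\<forall>n. integrable lborel (\<lambda>z. s n z * cnj z * X z)"
   using lims[of cnj] borel_measurable_cnj[of "\<lambda>z. z" borel] by auto
  have "(\<lambda>n. (LINT z|lborel. s n z * cnj z * X z) + (LINT z|lborel. b n z * p z)) \<longlonglongrightarrow> 0 + integral\<^sup>L lborel p"
   by (intro tendsto_add l dom[THEN conjunct1] ip)
  moreover have "(LINT z|lborel. s n z * cnj z * X z) + (LINT z|lborel. b n z * p z) = 0" for n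
   using zero[of n] Bochner_Integration.integral_add[OF l(2)[rule_format, of n] dom[OF ip, THEN conjunct2, rule_format, of n]] by simp
  ultimately show ?thesis by (simp add: LIMSEQ_const_iff)
 qed
 show "integral\<^sup>L lborel q = 0" if iq: "integrable lborel q"
 proof -
  have l: "(\<lambda>n. LINT z|lborel. s n z * z * X z) \<longlonglongrightarrow> 0" "\<forall>n. integrable lborel (\<lambda>z. s n z * z * X z)"
   using lims[of "\<lambda>z. z"] by auto
  have "(\<lambda>n. (LINT z|lborel. s n z * z * X z) + (LINT z|lborel. b n z * q z)) \<longlonglongrightarrow> 0 + integral\<^sup>L lborel q"
   by (intro tendsto_add l dom[THEN conjunct1] iq)
  moreover have "(LINT z|lborel. s n z * z * X z) + (LINT z|lborel. b n z * q z) = 0" for n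
   using zero[of n] Bochner_Integration.integral_add[OF l(2)[rule_format, of n] dom[OF iq, THEN conjunct2, rule_format, of n]] by simp
  ultimately show ?thesis by (simp add: LIMSEQ_const_iff)
 qed
qed

lemma linf_extI:
 assumes "\<mu> \<in> borel_measurable borel" "\<And>z. z \<in> cball 0 1 \<Longrightarrow> \<mu> z = 0" "AE z in lborel. cmod (\<mu> z) \<le> B"
 shows "\<mu> \<in> linf_ext" "0 \<le> B \<Longrightarrow> linf_norm \<mu> \<le> B"
proof -
 have [measurable]: "\<mu> \<in> borel_measurable borel" by fact
 have le: "esssup lborel (\<lambda>z. ereal (cmod (\<mu> z))) \<le> ereal B"
  by (rule esssup_I) (use assms(3) in auto)
 have "esssup lborel (\<lambda>z. ereal (cmod (\<mu> z))) < \<infinity>"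
  by (rule le_less_trans[OF le]) simp
 with assms show "\<mu> \<in> linf_ext" by (simp add: linf_ext_def)
 assume "0 \<le> B"
 with le show "linf_norm \<mu> \<le> B" unfolding linf_norm_def
  by (cases "esssup lborel (\<lambda>z. ereal (cmod (\<mu> z)))") auto
qed

lemma borel_measurable_exterior:
 fixes f :: "complex \<Rightarrow> complex"
 assumes "continuous_on {v. 1 < cmod v} f"
 shows "(\<lambda>v. if 1 < cmod v then f v else 0) \<in> borel_measurable borel"
proof -
 have "open {v::complex. 1 < cmod v}" by (intro open_Collect_less continuous_intros)
 then have "(\<lambda>v. indicator {v. 1 < cmod v} v *\<^sub>R f v) \<in> borel_measurable borel"
  by (intro borel_measurable_continuous_on_indicator assms) auto
 also have "(\<lambda>v. indicator {v. 1 < cmod v} v *\<^sub>R f v) = (\<lambda>v. if 1 < cmod v then f v else 0)"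
  by auto
 finally show ?thesis .
qed

section \<open>The reproducing formula for reflected coefficients\<close>

definition circle_reflection :: "complex \<Rightarrow> complex" where
 "circle_reflection v = inverse (cnj v)"

lemma wirtinger_circle_reflection:
 assumes "v \<noteq> 0"
 shows "wirtinger circle_reflection 0 (- (circle_reflection v)\<^sup>2) v"
proof -
 have "(inverse has_field_derivative - (inverse (cnj v) ^ Suc (Suc 0))) (at (cnj v))"
  by (rule DERIV_inverse) (use assms in simp)
 from wirtinger_comp_field[OF wirtinger_cnj_ident this] show ?thesis
  by (simp add: circle_reflection_def[abs_def] power2_eq_square)
qed

lemma norm_circle_reflection: "cmod (circle_reflection v) = 1 / cmod v"
 by (simp add: circle_reflection_def norm_inverse divide_inverse)

lemma inverse_norm_le_1:
 fixes v :: complex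
 assumes "1 < cmod v"
 shows "1 / cmod v < 1" "1 / cmod v \<le> 1" "1 / (cmod v)^2 \<le> 1"
proof -
 have "0 < cmod v" "1 < (cmod v)^2" using assms by (auto simp: one_less_power)
 with assms show "1 / cmod v < 1" "1 / cmod v \<le> 1" "1 / (cmod v)^2 \<le> 1"
  by (simp_all add: divide_less_eq divide_le_eq)
qed

lemma continuous_circle_reflection: "continuous_on {v. 1 < cmod v} circle_reflection"
 unfolding circle_reflection_def by (intro continuous_intros) auto

text \<open>A point and its reflection lie on the same ray, so their distance is the difference of
  their moduli.\<close>

lemma reflection_gap:
 assumes "1 < cmod v"
 shows "cmod (v - circle_reflection v) = cmod v - 1 / cmod v"
proof -
 have ne: "v \<noteq> 0" using assms by auto
 have "v * of_real (1 / (cmod v)^2) = circle_reflection v"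
  unfolding of_real_divide complex_norm_square circle_reflection_def using ne by (simp add: field_simps)
 then have "v - circle_reflection v = v * of_real (1 - 1 / (cmod v)^2)"
  by (simp add: algebra_simps)
 then have "cmod (v - circle_reflection v) = cmod v * \<bar>1 - 1 / (cmod v)^2\<bar>"
  by (simp only: norm_mult norm_of_real)
 also have "cmod v * \<bar>1 - 1 / (cmod v)^2\<bar> = cmod v - 1 / cmod v"
  using inverse_norm_le_1(3)[OF assms] ne by (simp add: right_diff_distrib power2_eq_square)
 finally show ?thesis .
qed

lemma reflection_gap_le:
 assumes "1 < cmod v"
 shows "cmod (v - circle_reflection v) \<le> 2 * (cmod v - 1)" "cmod (v - circle_reflection v) \<le> cmod v"
proof -
 have ne: "v \<noteq> 0" using assms by auto
 have "cmod v - 1 / cmod v = (cmod v - 1) * (1 + 1 / cmod v)" using ne by (simp add: field_simps)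
 also have "\<dots> \<le> (cmod v - 1) * 2" using assms inverse_norm_le_1[OF assms] by (intro mult_left_mono) auto
 finally show "cmod (v - circle_reflection v) \<le> 2 * (cmod v - 1)" using reflection_gap[OF assms] by simp
 show "cmod (v - circle_reflection v) \<le> cmod v" using reflection_gap[OF assms] by simp
qed

text \<open>The Ahlfors--Weill coefficient, up to a constant factor: \<open>\<phi>\<close> is recovered from it by the integral operator.\<close>

definition reflected_differential :: "(complex \<Rightarrow> complex) \<Rightarrow> complex \<Rightarrow> complex" where
 "reflected_differential \<phi> v = (if 1 < cmod v
  then \<phi> (circle_reflection v) * (circle_reflection v)^2 * (v - circle_reflection v)^2 else 0)"

text \<open>The reflected point s has 1 - |s| = 1 - 1/r, and |s| |v - s| is at most twice that; its
  square compensates exactly the growth of order 2.\<close>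

lemma reflected_differential_bound:
 assumes "growth 2 M \<phi>"
 shows "cmod (reflected_differential \<phi> v) \<le> 4 * M"
proof (cases "1 < cmod v")
 case True
 define r where "r = cmod v"
 define s where "s = circle_reflection v"
 have r: "r > 1" using True by (simp add: r_def)
 have s: "cmod s = 1 / r" by (simp add: s_def r_def norm_circle_reflection)
 then have "s \<in> ball 0 1" using r by simp
 then have M: "cmod (\<phi> s) * (1 - 1 / r)^2 \<le> M" using assms unfolding growth_def s[symmetric] by blast
 have "cmod s * cmod (v - s) \<le> 1 / r * (2 * (r - 1))"
  unfolding s using reflection_gap_le(1)[OF True] r by (intro mult_left_mono) (auto simp: s_def r_def)
 also have "\<dots> = 2 * (1 - 1 / r)" using r by (simp add: field_simps)
 finally have "(cmod s * cmod (v - s))\<^sup>2 \<le> (2 * (1 - 1 / r))^2" by (intro power_mono) auto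
 then have "cmod (\<phi> s) * (cmod s * cmod (v - s))^2 \<le> cmod (\<phi> s) * (2 * (1 - 1 / r))^2" by (intro mult_left_mono) auto
 also have "\<dots> = 4 * (cmod (\<phi> s) * (1 - 1 / r)^2)" unfolding power_mult_distrib by simp
 finally show ?thesis using M True
  by (simp add: reflected_differential_def norm_mult norm_power power_mult_distrib mult_ac flip: s_def)
qed (use growth_nonneg[OF assms] in \<open>simp add: reflected_differential_def\<close>)

lemma reflected_differential_linf_ext:
 assumes "growth 2 M \<phi>"
 shows "reflected_differential \<phi> \<in> linf_ext"
proof (rule linf_extI)
 have "continuous_on (ball 0 1) \<phi>" using assms by (auto simp: growth_def intro: holomorphic_on_imp_continuous_on)
 then have "continuous_on {v. 1 < cmod v} (\<lambda>v. \<phi> (circle_reflection v))"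
  by (rule continuous_on_compose2[OF _ continuous_circle_reflection]) (auto simp: norm_circle_reflection inverse_norm_le_1)
 then show "reflected_differential \<phi> \<in> borel_measurable borel"
  unfolding reflected_differential_def[abs_def]
  by (intro borel_measurable_exterior continuous_intros continuous_circle_reflection)
 show "AE z in lborel. cmod (reflected_differential \<phi> z) \<le> 4 * M"
  using reflected_differential_bound[OF assms] by simp
qed (simp add: reflected_differential_def)

text \<open>For fixed z the kernel is comparable with the one at the origin; the constant c measures
  the distance of z from the circle.\<close>

lemma exterior_kernel_bounds:
 assumes z: "z \<in> ball 0 1" and v: "1 < cmod v" and c: "c = 1 / (1 - cmod z)"
 shows "cmod (inverse (v - z)) \<le> c / cmod v" "cmod (inverse (v - z)) \<le> c" "cmod (inverse v) \<le> c / cmod v" "1 \<le> c" "v \<noteq> z"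
proof -
 have d: "1 - cmod z > 0" using z by simp
 show ne: "v \<noteq> z" using z v by auto
 show c1: "1 \<le> c" using d by (simp add: c)
 have "(1 - cmod z) * cmod v \<le> cmod (v - z)" using kernel_lower_bound[of v z "cmod z"] z v by simp
 then have "inverse (cmod (v - z)) \<le> inverse ((1 - cmod z) * cmod v)" using d v by (intro le_imp_inverse_le mult_pos_pos) auto
 also have "\<dots> = c / cmod v" by (simp add: c field_simps)
 finally show 1: "cmod (inverse (v - z)) \<le> c / cmod v" by (simp add: norm_inverse)
 have "c * (1 / cmod v) \<le> c * 1" using c1 inverse_norm_le_1[OF v] by (intro mult_left_mono) auto
 with 1 show "cmod (inverse (v - z)) \<le> c" by simp
 show "cmod (inverse v) \<le> c / cmod v" using c1 v divide_right_mono[of 1 c "cmod v"] by (simp add: norm_inverse divide_inverse)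
qed

lemma integrable_exterior_bound:
 fixes p :: "complex \<Rightarrow> complex"
 assumes "p \<in> borel_measurable borel" "\<And>v. cmod (p v) \<le> indicator (- cball 0 1) v * (B / cmod v ^ 4)"
 shows "integrable lborel p"
proof (rule Bochner_Integration.integrable_bound[OF integrable_mult_right[OF integrable_exterior_power4, of B]])
 show "AE v in lborel. cmod (p v) \<le> norm (B * (indicator (- cball 0 1) v * (1 / cmod v ^ 4)))"
 proof (intro always_eventually allI)
  fix v
  have "cmod (p v) \<le> B * (indicator (- cball 0 1) v * (1 / cmod v ^ 4))" using assms(2)[of v] by (simp add: mult_ac)
  also have "\<dots> \<le> norm \<dots>" unfolding real_norm_def by (rule abs_ge_self)
  finally show "cmod (p v) \<le> norm (B * (indicator (- cball 0 1) v * (1 / cmod v ^ 4)))" .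
 qed
qed (use assms in simp)

text \<open>The two bounds on Y serve the two ends: quadratic vanishing at the circle allows the
  extension by 0, decay |v|^(-2) removes infinity. The bound |v|^(-4) provides integrability for the
  derivative in question.\<close>

lemma exterior_integral_zero:
 fixes Y p q :: "complex \<Rightarrow> complex"
 assumes der: "\<And>v. 1 < cmod v \<Longrightarrow> wirtinger Y (p v) (q v) v"
  and cont: "continuous_on {v. 1 < cmod v} p" "continuous_on {v. 1 < cmod v} q"
  and bnd: "\<And>v. 1 < cmod v \<Longrightarrow> cmod (p v) \<le> B" "\<And>v. 1 < cmod v \<Longrightarrow> cmod (q v) \<le> B"
  and Y: "\<And>v. 1 < cmod v \<Longrightarrow> cmod (Y v) \<le> A / (cmod v)^2" "\<And>v. 1 < cmod v \<Longrightarrow> cmod v \<le> 2 \<Longrightarrow> cmod (Y v) \<le> A * (cmod v - 1)^2"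
 shows "(\<And>v. 1 < cmod v \<Longrightarrow> cmod (p v) \<le> D / cmod v ^ 4) \<Longrightarrow> (LINT v|lborel. (if 1 < cmod v then p v else 0)) = 0"
  "(\<And>v. 1 < cmod v \<Longrightarrow> cmod (q v) \<le> D / cmod v ^ 4) \<Longrightarrow> (LINT v|lborel. (if 1 < cmod v then q v else 0)) = 0"
proof -
 note m = borel_measurable_exterior[OF cont(1)] borel_measurable_exterior[OF cont(2)]
 have B: "B \<ge> 0" by (rule order_trans[OF norm_ge_zero bnd(1)[of 2]]) simp
 have A: "A \<ge> 0"
 proof -
  have "0 \<le> A / (cmod 2)^2" by (rule order_trans[OF norm_ge_zero Y(1)]) simp
  then show ?thesis by simp
 qed
 have d: "cmod (if 1 < cmod v then Y v else 0) \<le> A / (cmod v)^2" for v using Y(1)[of v] A by simp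
 have b: "cmod (if 1 < cmod v then p v else 0) \<le> B" "cmod (if 1 < cmod v then q v else 0) \<le> B" for v using bnd B by auto
 note i = integral_wirtinger_decay[OF wirtinger_exterior_extension[OF der Y(2)] m b d]
 show "(LINT v|lborel. (if 1 < cmod v then p v else 0)) = 0" if D: "\<And>v. 1 < cmod v \<Longrightarrow> cmod (p v) \<le> D / cmod v ^ 4"
  by (intro i integrable_exterior_bound[OF m(1), of D]) (use D in auto)
 show "(LINT v|lborel. (if 1 < cmod v then q v else 0)) = 0" if D: "\<And>v. 1 < cmod v \<Longrightarrow> cmod (q v) \<le> D / cmod v ^ 4"
  by (intro i integrable_exterior_bound[OF m(2), of D]) (use D in auto)
qed

text \<open>The difference of the integrands at z and at 0 is s^2 (v - s)^2 K, which is dbar of (v -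
  s)^3 K / 3, because dbar (v - s) = s^2 and K is holomorphic in v.\<close>

lemma cauchy_power_reflected_1:
 assumes z: "z \<in> ball 0 1"
 shows "cauchy_power (reflected_differential (\<lambda>_. 1)) z = cauchy_power (reflected_differential (\<lambda>_. 1)) 0"
proof -
 let ?s = circle_reflection
 define c where "c = 1 / (1 - cmod z)"
 define K where "K v = inverse (v - z) ^ 4 - inverse v ^ 4" for v
 define K' where "K' v = 4 * (inverse v ^ 5 - inverse (v - z) ^ 5)" for v
 note kb = exterior_kernel_bounds[OF z _ c_def]
 have c1: "c \<ge> 1" using kb(4)[of 2] by simp
 have ne: "v \<noteq> 0" "v - z \<noteq> 0" if "1 < cmod v" for v using that kb(5)[OF that] by auto
 have K: "cmod (K v) \<le> 4 * c ^ 4 / cmod v ^ 5" and K2: "cmod (K' v) \<le> 8 * c ^ 5 / cmod v ^ 5" if v: "1 < cmod v" for v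
 proof -
  define a b where "a = inverse (v - z)" and "b = inverse v"
  define r where "r = cmod v"
  have r: "r > 1" using v by (simp add: r_def)
  have ab: "cmod a \<le> c / r" "cmod b \<le> c / r" using kb(1,3)[OF v] by (auto simp: a_def b_def r_def)
  \<comment> \<open>Subtracting the kernel at 0 gains one power of decay, |v|^(-5) instead of
    |v|^(-4); without it (v - s)^3 K would not decay like |v|^(-2).\<close>
  have "a - b = z * (b * a)" using ne[OF v] by (simp add: a_def b_def field_simps)
  then have e: "K v = z * (b * a * ((a + b) * (a^2 + b^2)))"
  proof -
   have "K v = (a - b) * ((a + b) * (a^2 + b^2))" by (simp add: K_def algebra_simps eval_nat_numeral flip: a_def b_def)
   then show ?thesis using \<open>a - b = z * (b * a)\<close> by (simp add: mult.assoc)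
  qed
  have "cmod b = 1 / r" by (simp add: b_def r_def norm_inverse divide_inverse)
  moreover have "cmod (a + b) \<le> 2 * (c / r)" using ab by (intro norm_triangle_le) simp
  moreover have "cmod (a^2 + b^2) \<le> 2 * (c / r)^2"
  proof -
   have "(cmod a)\<^sup>2 \<le> (c / r)^2" "(cmod b)\<^sup>2 \<le> (c / r)^2" using ab by (auto intro: power_mono)
   then show ?thesis by (intro norm_triangle_le) (simp add: norm_power)
  qed
  ultimately have "cmod (K v) \<le> 1 * (1 / r * (c / r) * (2 * (c / r) * (2 * (c / r)^2)))"
   unfolding e norm_mult using ab z r c1 by (intro mult_mono) auto
  also have "\<dots> = 4 * c ^ 4 / r ^ 5" using r by (simp add: field_simps power2_eq_square eval_nat_numeral)
  finally show "cmod (K v) \<le> 4 * c ^ 4 / cmod v ^ 5" by (simp add: r_def)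
  have "cmod a ^ 5 \<le> (c / r) ^ 5" "cmod b ^ 5 \<le> (c / r) ^ 5" using ab by (auto intro: power_mono)
  then have "cmod (b ^ 5 - a ^ 5) \<le> 2 * (c / r) ^ 5" by (intro order_trans[OF norm_triangle_ineq4]) (simp add: norm_power)
  then show "cmod (K' v) \<le> 8 * c ^ 5 / cmod v ^ 5"
   unfolding K'_def a_def[symmetric] b_def[symmetric] norm_mult by (simp add: power_divide flip: r_def)
 qed
 define Y where "Y v = (v - ?s v) ^ 3 / 3 * K v" for v
 define p where "p v = (v - ?s v)^2 * K v + (v - ?s v) ^ 3 / 3 * K' v" for v
 define q where "q v = (?s v)^2 * (v - ?s v)^2 * K v" for v
 have g: "cmod (v - ?s v) \<le> cmod v" if "1 < cmod v" for v by (rule reflection_gap_le[OF that])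
 have "(LINT v|lborel. (if 1 < cmod v then q v else 0)) = 0"
 proof (rule exterior_integral_zero(2)[where Y=Y and p=p and B="12 * c ^ 5" and A="32 * c ^ 4" and D="4 * c ^ 4"])
  have co: "continuous_on {v. 1 < cmod v} K" "continuous_on {v. 1 < cmod v} K'"
   unfolding K_def K'_def by (intro continuous_intros; use ne in force)+
  show "continuous_on {v. 1 < cmod v} p" "continuous_on {v. 1 < cmod v} q"
   unfolding p_def q_def by (intro continuous_intros co continuous_circle_reflection; simp)+
  fix v :: complex assume v: "1 < cmod v"
  define r where "r = cmod v"
  have r: "r > 1" using v by (simp add: r_def)
  have gr: "cmod (v - ?s v) \<le> r" using g[OF v] by (simp add: r_def)
  have Kr: "cmod (K v) \<le> 4 * c ^ 4 / r ^ 5" "cmod (K' v) \<le> 8 * c ^ 5 / r ^ 5" using K[OF v] K2[OF v] by (auto simp: r_def)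
  have c45: "c ^ 4 \<le> c ^ 5" using c1 by (intro power_increasing) auto
  have "(K has_field_derivative K' v) (at v)"
   unfolding K_def K'_def using ne[OF v]
   by (auto intro!: derivative_eq_intros simp: field_simps simp flip: power_Suc power_add)
  then have dK: "wirtinger K (K' v) 0 v" by (rule wirtinger_field_derivative)
  have d1: "wirtinger (\<lambda>v. v - ?s v) 1 ((?s v)^2) v"
   using wirtinger_diff[OF wirtinger_field_derivative[OF DERIV_ident] wirtinger_circle_reflection[OF ne(1)[OF v]]] by simp
  have "((\<lambda>u. u ^ 3 / 3) has_field_derivative (v - ?s v)\<^sup>2) (at (v - ?s v))"
   by (auto intro!: derivative_eq_intros)
  from wirtinger_mult[OF wirtinger_comp_field[OF d1 this] dK]
  show "wirtinger Y (p v) (q v) v" by (simp add: Y_def[abs_def] p_def q_def mult_ac)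
  have pb: "cmod (v - ?s v) ^ j \<le> r ^ j" for j using gr by (intro power_mono) auto
  have t1: "cmod ((v - ?s v)^2 * K v) \<le> r^2 * (4 * c ^ 4 / r ^ 5)"
   unfolding norm_mult norm_power using pb Kr r by (intro mult_mono) auto
  also have e1: "r\<^sup>2 * (4 * c ^ 4 / r ^ 5) = 4 * c ^ 4 / r ^ 3" using r by (simp add: field_simps eval_nat_numeral)
  finally have t1': "cmod ((v - ?s v)^2 * K v) \<le> 4 * c ^ 4 / r ^ 3" .
  have r3: "x / r ^ j \<le> x" if "x \<ge> 0" for x j using r that mult_left_mono[of 1 "r ^ j" x] by (simp add: field_simps)
  have "cmod ((v - ?s v) ^ 3 / 3 * K' v) \<le> r ^ 3 / 3 * (8 * c ^ 5 / r ^ 5)"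
   unfolding norm_mult norm_power norm_divide using pb Kr r by (intro mult_mono) auto
  also have "\<dots> = (8 / 3) * c ^ 5 / r^2" using r by (simp add: field_simps eval_nat_numeral)
  also have "\<dots> \<le> (8 / 3) * c ^ 5" using c1 by (intro r3) simp
  finally have t2: "cmod ((v - ?s v) ^ 3 / 3 * K' v) \<le> 8 * c ^ 5" using zero_le_power[of c 5] c1 by linarith
  have t3: "4 * c ^ 4 / r ^ 3 \<le> 4 * c ^ 5" using r3[of "4 * c ^ 4" 3] c1 c45 by simp
  show "cmod (p v) \<le> 12 * c ^ 5" unfolding p_def using t1' t2 t3 by (intro norm_triangle_le) simp
  have "cmod (q v) = (1 / r)^2 * cmod ((v - ?s v)^2 * K v)"
   by (simp add: q_def norm_mult norm_power norm_circle_reflection r_def mult_ac)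
  also have "\<dots> \<le> (1 / r)^2 * (4 * c ^ 4 / r ^ 3)" using t1' by (intro mult_left_mono) auto
  also have "\<dots> = 4 * c ^ 4 / r ^ 4 / r" by (simp add: field_simps eval_nat_numeral)
  also have "\<dots> \<le> 4 * c ^ 4 / r ^ 4" using r3[of "4 * c ^ 4 / r ^ 4" 1] c1 r by simp
  finally have qb: "cmod (q v) \<le> 4 * c ^ 4 / r ^ 4" .
  then show "cmod (q v) \<le> 4 * c ^ 4 / cmod v ^ 4" by (simp add: r_def)
  show "cmod (q v) \<le> 12 * c ^ 5"
  proof -
   have "0 \<le> c ^ 4" "0 \<le> c ^ 5" using c1 by auto
   then show ?thesis using qb r3[of "4 * c ^ 4" 4] c45 by linarith
  qed
  have "cmod (Y v) = cmod (v - ?s v) ^ 3 / 3 * cmod (K v)" by (simp add: Y_def norm_mult norm_power)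
  also have "\<dots> \<le> r ^ 3 / 3 * (4 * c ^ 4 / r ^ 5)" using pb[of 3] Kr r by (intro mult_mono) auto
  also have "\<dots> = (4 / 3) * c ^ 4 / r^2" using r by (simp add: field_simps eval_nat_numeral)
  also have "\<dots> \<le> 32 * c ^ 4 / r^2" using c1 by (intro divide_right_mono mult_right_mono) auto
  finally show "cmod (Y v) \<le> 32 * c ^ 4 / (cmod v)^2" by (simp add: r_def)
  assume "cmod v \<le> 2"
  \<comment> \<open>Near the circle (v - s)^3 vanishes to third order, one more than the extension
    by 0 asks for.\<close>
  then have r2: "r \<le> 2" by (simp add: r_def)
  have "cmod (v - ?s v) ^ 3 \<le> (2 * (r - 1)) ^ 3" using reflection_gap_le(1)[OF v] by (intro power_mono) (auto simp: r_def)
  also have "\<dots> = 8 * (r - 1)^2 * (r - 1)" unfolding power_mult_distrib by (simp add: power2_eq_square power3_eq_cube)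
  also have "\<dots> \<le> 8 * (r - 1)^2 * 1" using r r2 by (intro mult_left_mono) auto
  finally have g3: "cmod (v - ?s v) ^ 3 \<le> 8 * (r - 1)^2" by simp
  have "cmod (K v) \<le> 4 * c ^ 4" using Kr(1) r3[of "4 * c ^ 4" 5] c1 by simp
  then have "cmod (v - ?s v) ^ 3 / 3 * cmod (K v) \<le> 8 * (r - 1)^2 * (4 * c ^ 4)"
   using g3 c1 zero_le_power2[of "r - 1"] norm_ge_zero[of "K v"] by (intro mult_mono) linarith+
  then show "cmod (Y v) \<le> 32 * c ^ 4 * (cmod v - 1)^2" by (simp add: Y_def norm_mult norm_power r_def mult_ac)
 qed
 moreover have "(if 1 < cmod v then q v else 0) = reflected_differential (\<lambda>_. 1) v / (v - z) ^ 4 - reflected_differential (\<lambda>_. 1) v / (v - 0) ^ 4" for v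
  by (simp add: reflected_differential_def q_def K_def divide_inverse power_inverse algebra_simps)
 moreover have "growth 2 1 (\<lambda>_. 1)"
  by (auto simp: growth_def intro!: power_le_one)
 note i = cauchy_power_integrable(1)[OF reflected_differential_linf_ext[OF this]]
 ultimately show ?thesis using i[of z] i[of 0] z by (simp add: cauchy_power_def)
qed

text \<open>With U = (v - s)/(v - z) one has dU = (s - z)/(v - z)^2, while functions of s are
  antiholomorphic in v. The factor s - z of \<phi>(s) - \<phi>(z) thus makes the integrand of the
  difference an exact d-derivative, and \<phi>(z) comes out of the integral. Holomorphy beyond the
  closed disc supplies bounds up to the circle.\<close>

lemma cauchy_power_reflected_holomorphic:
 assumes hol: "\<phi> holomorphic_on ball 0 \<rho>" and \<rho>: "\<rho> > 1" and z: "z \<in> ball 0 1"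
 shows "cauchy_power (reflected_differential \<phi>) z = \<phi> z * cauchy_power (reflected_differential (\<lambda>_. 1)) 0"
proof -
 let ?s = circle_reflection
 define c where "c = 1 / (1 - cmod z)"
 note kb = exterior_kernel_bounds[OF z _ c_def]
 have c1: "c \<ge> 1" using kb(4)[of 2] by simp
 define \<Theta> where "\<Theta> u = (if u = z then deriv \<phi> z else (\<phi> u - \<phi> z) / (u - z))" for u
 have \<Theta>: "\<Theta> holomorphic_on ball 0 \<rho>" unfolding \<Theta>_def by (rule pole_lemma_open[OF hol open_ball])
 \<comment> \<open>The part of the integrand that depends on the reflected point alone; d treats it
   as a constant.\<close>
 define G where "G u = \<Theta> u * u^2" for u
 have G: "G holomorphic_on ball 0 \<rho>" unfolding G_def by (intro holomorphic_intros \<Theta>)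
 have G': "deriv G holomorphic_on ball 0 \<rho>" by (rule holomorphic_deriv[OF G open_ball])
 have sub: "cball 0 1 \<subseteq> ball (0::complex) \<rho>" using \<rho> by auto
 obtain M1 where M1: "M1 > 0" "\<And>u. u \<in> cball 0 1 \<Longrightarrow> cmod (\<Theta> u) \<le> M1"
  using compact_bound[OF compact_cball continuous_on_subset[OF holomorphic_on_imp_continuous_on[OF \<Theta>] sub]] by metis
 obtain M2 where M2: "M2 > 0" "\<And>u. u \<in> cball 0 1 \<Longrightarrow> cmod (deriv G u) \<le> M2"
  using compact_bound[OF compact_cball continuous_on_subset[OF holomorphic_on_imp_continuous_on[OF G'] sub]] by metis
 obtain M3 where M3: "M3 > 0" "\<And>u. u \<in> cball 0 1 \<Longrightarrow> cmod (\<phi> u) \<le> M3"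
  using compact_bound[OF compact_cball continuous_on_subset[OF holomorphic_on_imp_continuous_on[OF hol] sub]] by metis
 define M where "M = max M1 M2"
 have M: "M > 0" "M1 \<le> M" "M2 \<le> M" using M1 by (auto simp: M_def)
 have s1: "?s v \<in> cball 0 1" if "1 < cmod v" for v using that by (simp add: norm_circle_reflection inverse_norm_le_1)
 have co: "continuous_on {v. 1 < cmod v} (\<lambda>v. h (?s v))" if "h holomorphic_on ball 0 \<rho>" for h
  using s1 sub by (intro continuous_on_compose2[OF holomorphic_on_imp_continuous_on[OF that] continuous_circle_reflection]) auto
 have ne: "v \<noteq> 0" "v - z \<noteq> 0" if "1 < cmod v" for v using that kb(5)[OF that] by auto
 define U where "U v = (v - ?s v) * inverse (v - z)" for v
 define Y where "Y v = G (?s v) * (U v ^ 3 / 3)" for v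
 define p where "p v = G (?s v) * ((U v)^2 * ((inverse (v - z))^2 * (?s v - z)))" for v
 define q where "q v = deriv G (?s v) * - (?s v)\<^sup>2 * (U v ^ 3 / 3) + G (?s v) * ((U v)^2 * ((?s v)^2 * inverse (v - z)))" for v
 have "(LINT v|lborel. (if 1 < cmod v then p v else 0)) = 0"
 proof (rule exterior_integral_zero(1)[where Y=Y and q=q and B="2 * M * c ^ 4" and A="8 * M * c ^ 3" and D="2 * M * c ^ 4"])
  have cU: "continuous_on {v. 1 < cmod v} (\<lambda>v. inverse (v - z))" "continuous_on {v. 1 < cmod v} U"
   unfolding U_def by (intro continuous_intros continuous_circle_reflection; use ne in force)+
  show "continuous_on {v. 1 < cmod v} p" "continuous_on {v. 1 < cmod v} q"
   unfolding p_def q_def by (intro continuous_intros co[OF G] co[OF G'] cU continuous_circle_reflection; simp)+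
  fix v :: complex assume v: "1 < cmod v"
  define r where "r = cmod v"
  have r: "r > 1" using v by (simp add: r_def)
  define a where "a = inverse (v - z)"
  have a: "cmod a \<le> c / r" "cmod a \<le> c" using kb(1,2)[OF v] by (auto simp: a_def r_def)
  have az: "a * (v - z) = 1" using ne[OF v] by (simp add: a_def)
  have sb: "?s v \<in> ball 0 \<rho>" using s1[OF v] sub by auto
  have ns: "cmod (?s v) = 1 / r" by (simp add: norm_circle_reflection r_def)
  have d1: "wirtinger (\<lambda>v. v - ?s v) 1 ((?s v)^2) v"
   using wirtinger_diff[OF wirtinger_field_derivative[OF DERIV_ident] wirtinger_circle_reflection[OF ne(1)[OF v]]] by simp
  have "((\<lambda>v. inverse (v - z)) has_field_derivative - a\<^sup>2) (at v)"
   using ne[OF v] by (auto intro!: derivative_eq_intros simp: a_def power2_eq_square)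
  from wirtinger_mult[OF d1 wirtinger_field_derivative[OF this]]
  have dU: "wirtinger U (a^2 * (?s v - z)) ((?s v)^2 * a) v"
  proof -
   have e: "1 * a + (v - ?s v) * - a\<^sup>2 = a^2 * (?s v - z)"
   proof -
    have "1 * a = a^2 * (v - z)" using az by (simp add: power2_eq_square mult.assoc)
    then show ?thesis by (simp add: algebra_simps)
   qed
   show ?thesis using \<open>wirtinger (\<lambda>z'. (z' - ?s z') * inverse (z' - z)) _ _ v\<close> e by (simp add: U_def[abs_def] flip: a_def)
  qed
  have "((\<lambda>u. u ^ 3 / 3) has_field_derivative (U v)\<^sup>2) (at (U v))" by (auto intro!: derivative_eq_intros)
  from wirtinger_mult[OF wirtinger_comp_field[OF wirtinger_circle_reflection[OF ne(1)[OF v]] holomorphic_derivI[OF G open_ball sb]] wirtinger_comp_field[OF dU this]]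
  show "wirtinger Y (p v) (q v) v" by (simp add: Y_def[abs_def] p_def q_def flip: a_def)
  have Ub: "cmod (U v) \<le> c"
  proof -
   have "cmod (U v) \<le> r * (c / r)" unfolding U_def norm_mult a_def[symmetric]
    using reflection_gap_le(2)[OF v] a r by (intro mult_mono) (auto simp: r_def)
   then show ?thesis using r by simp
  qed
  have Up: "cmod (U v) ^ j \<le> c ^ j" for j using Ub by (intro power_mono) auto
  have Gb: "cmod (G (?s v)) \<le> M / r^2"
   using M1(2)[OF s1[OF v]] M r by (simp add: G_def norm_mult norm_power ns power_divide divide_right_mono)
  have r3: "x / r ^ j \<le> x" if "x \<ge> 0" for x j using r that mult_left_mono[of 1 "r ^ j" x] by (simp add: field_simps)
  have Gb1: "cmod (G (?s v)) \<le> M" using Gb r3[of M 2] M by simp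
  have c34: "c ^ 3 \<le> c ^ 4" using c1 by (intro power_increasing) auto
  have "cmod (?s v - z) \<le> 1 + 1" using s1[OF v] z by (intro order_trans[OF norm_triangle_ineq4] add_mono) auto
  then have "cmod (p v) \<le> M / r^2 * (c^2 * ((c / r)^2 * 2))"
   unfolding p_def norm_mult norm_power a_def[symmetric] using Gb Up[of 2] a r M c1
   by (intro mult_mono power_mono) auto
  also have "\<dots> = 2 * M * c ^ 4 / r ^ 4" using r by (simp add: field_simps eval_nat_numeral)
  finally have pb: "cmod (p v) \<le> 2 * M * c ^ 4 / r ^ 4" .
  then show "cmod (p v) \<le> 2 * M * c ^ 4 / cmod v ^ 4" by (simp add: r_def)
  show "cmod (p v) \<le> 2 * M * c ^ 4" using pb r3[of "2 * M * c ^ 4" 4] M c1 by simp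
  have sl: "cmod (?s v) ^ 2 \<le> 1" using s1[OF v] by (intro power_le_one) auto
  have "cmod (deriv G (?s v) * - (?s v)\<^sup>2 * (U v ^ 3 / 3)) \<le> M * 1 * (c ^ 3 / 1)"
   unfolding norm_mult norm_divide norm_power norm_minus_cancel using M2(2)[OF s1[OF v]] M sl Up[of 3] c1
   by (intro mult_mono frac_le) auto
  moreover have "cmod (G (?s v) * ((U v)^2 * ((?s v)^2 * inverse (v - z)))) \<le> M * (c^2 * (1 * c))"
   unfolding norm_mult norm_power a_def[symmetric] using Gb1 M sl Up[of 2] a c1 by (intro mult_mono) auto
  ultimately have "cmod (q v) \<le> M * 1 * (c ^ 3 / 1) + M * (c^2 * (1 * c))"
   unfolding q_def by (intro norm_triangle_le add_mono)
  also have "\<dots> = 2 * M * c ^ 3" by (simp add: eval_nat_numeral)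
  also have "\<dots> \<le> 2 * M * c ^ 4" using M c34 by simp
  finally show "cmod (q v) \<le> 2 * M * c ^ 4" .
  have "cmod (Y v) \<le> M / r^2 * (c ^ 3 / 1)"
   unfolding Y_def norm_mult norm_divide norm_power using Gb Up[of 3] M r c1 by (intro mult_mono frac_le) auto
  also have "\<dots> \<le> 8 * M * c ^ 3 / r^2" using M c1 r by (simp add: divide_right_mono)
  finally show "cmod (Y v) \<le> 8 * M * c ^ 3 / (cmod v)^2" by (simp add: r_def)
  assume "cmod v \<le> 2"
  then have r2: "r \<le> 2" by (simp add: r_def)
  have "cmod (U v) \<le> 2 * (r - 1) * c" unfolding U_def norm_mult a_def[symmetric]
   using reflection_gap_le(1)[OF v] a r by (intro mult_mono) (auto simp: r_def)
  then have "cmod (U v) ^ 3 \<le> (2 * (r - 1) * c) ^ 3" by (intro power_mono) auto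
  also have "\<dots> = 8 * (r - 1)^2 * c ^ 3 * (r - 1)" by (simp add: power_mult_distrib power2_eq_square power3_eq_cube del: distrib_left_numeral right_diff_distrib_numeral)
  also have "\<dots> \<le> 8 * (r - 1)^2 * c ^ 3 * 1" using r r2 c1 by (intro mult_left_mono) auto
  finally have g3: "cmod (U v) ^ 3 \<le> 8 * (r - 1)^2 * c ^ 3" by simp
  have "cmod (Y v) \<le> M * (8 * (r - 1)^2 * c ^ 3 / 1)"
   unfolding Y_def norm_mult norm_divide norm_power using Gb1 g3 M c1 by (intro mult_mono frac_le) auto
  then show "cmod (Y v) \<le> 8 * M * c ^ 3 * (cmod v - 1)^2" by (simp add: r_def mult_ac)
 qed
 moreover have "(if 1 < cmod v then p v else 0) = reflected_differential \<phi> v / (v - z) ^ 4 - \<phi> z * (reflected_differential (\<lambda>_. 1) v / (v - z) ^ 4)" for v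
 proof -
  have e: "\<Theta> u * (u - z) = \<phi> u - \<phi> z" for u by (simp add: \<Theta>_def)
  \<comment> \<open>The algebra behind exactness: the factor u - z from dU and the quotient
    \<open>\<Theta>\<close> multiply to \<phi>(u) - \<phi>(z).\<close>
  have key: "G u * ((x * a)^2 * (a^2 * (u - z))) = (\<phi> u - \<phi> z) * (u^2 * x^2 * a ^ 4)" for u x a
   unfolding e[symmetric] G_def by (simp add: power_mult_distrib eval_nat_numeral mult_ac)
  have "p v = (\<phi> (?s v) - \<phi> z) * ((?s v)^2 * (v - ?s v)^2) / (v - z) ^ 4"
   unfolding p_def U_def key by (simp add: divide_inverse power_inverse)
  then show ?thesis
   by (simp add: reflected_differential_def left_diff_distrib diff_divide_distrib mult.assoc)
 qed
 moreover have "growth 2 1 (\<lambda>_. 1)" by (auto simp: growth_def intro!: power_le_one)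
 note i1 = cauchy_power_integrable(1)[OF reflected_differential_linf_ext[OF this] z]
 have "growth 2 M3 \<phi>" unfolding growth_def
 proof (intro conjI ballI)
  show "\<phi> holomorphic_on ball 0 1" using hol \<rho> by (auto intro: holomorphic_on_subset)
  fix u :: complex assume u: "u \<in> ball 0 1"
  have "cmod (\<phi> u) * (1 - cmod u)^2 \<le> M3 * 1" using M3(2)[of u] M3(1) u by (intro mult_mono power_le_one) auto
  then show "cmod (\<phi> u) * (1 - cmod u)^2 \<le> M3" by simp
 qed
 note i2 = cauchy_power_integrable(1)[OF reflected_differential_linf_ext[OF this] z]
 ultimately have "(LINT v|lborel. reflected_differential \<phi> v / (v - z) ^ 4 - \<phi> z * (reflected_differential (\<lambda>_. 1) v / (v - z) ^ 4)) = 0"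
  by simp
 then have "cauchy_power (reflected_differential \<phi>) z = \<phi> z * cauchy_power (reflected_differential (\<lambda>_. 1)) z"
  unfolding cauchy_power_def using Bochner_Integration.integral_diff[OF i2 integrable_mult_right[OF i1, of "\<phi> z"]]
  by (simp only: integral_mult_right_zero right_minus_eq)
 then show ?thesis using cauchy_power_reflected_1[OF z] by simp
qed

text \<open>At z = 0 the integrand is real and nonnegative, namely (x (1 - x))^2 with x = |v|^(-2);
  the integral is \<pi>/3.\<close>

lemma cauchy_power_reflected_1_nonzero: "cauchy_power (reflected_differential (\<lambda>_. 1)) 0 \<noteq> 0"
proof -
 define x where "x v = 1 / (cmod v)^2" for v
 define h where "h v = indicator (- cball 0 1) v * (x v * (1 - x v))^2" for v :: complex
 have eq: "reflected_differential (\<lambda>_. 1) v / (v - 0) ^ 4 = of_real (h v)" for v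
 proof (cases "1 < cmod v")
  case True
  have ne: "v \<noteq> 0" using True by auto
  have s: "circle_reflection v = v * of_real (x v)" "of_real (x v) = inverse (cnj v) * inverse v"
   using ne by (simp_all add: circle_reflection_def x_def field_simps flip: complex_norm_square)
  have "(circle_reflection v)\<^sup>2 * (v - circle_reflection v)^2 / v ^ 4 = (of_real (x v * (1 - x v)))^2"
   unfolding s(1) using ne by (simp add: field_simps eval_nat_numeral)
  then show ?thesis using True by (simp add: reflected_differential_def h_def)
 qed (simp add: reflected_differential_def h_def)
 \<comment> \<open>On \<open>ball 3 1\<close> the modulus lies between 2 and 4, so x is between 1/16
   and 1/4 and x (1 - x) is at least 3/64.\<close>
 have bnd: "indicator (ball 3 1) v * (3 / 64)^2 \<le> h v" for v
 proof (cases "v \<in> ball 3 1")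
  case True
  then have "cmod (3 - v) < 1" by (simp add: dist_norm)
  then have r: "cmod v \<ge> 2" "cmod v \<le> 4"
   using norm_triangle_ineq2[of 3 v] norm_triangle_ineq3[of 3 v] by auto
  have "2\<^sup>2 \<le> (cmod v)^2" "(cmod v)\<^sup>2 \<le> 4^2" using r by (intro power_mono; simp)+
  then have "x v \<le> 1 / 4" "1 / 16 \<le> x v" using r by (auto simp: x_def divide_le_eq le_divide_eq)
  then have "1 / 16 * (3 / 4) \<le> x v * (1 - x v)" by (intro mult_mono) auto
  then have "(3 / 64)\<^sup>2 \<le> (x v * (1 - x v))^2" by (intro power_mono) auto
  then show ?thesis using True r by (simp add: h_def)
 qed (simp add: h_def)
 have g: "growth 2 1 (\<lambda>_. 1)" by (auto simp: growth_def intro!: power_le_one)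
 have "integrable lborel (\<lambda>v. reflected_differential (\<lambda>_. 1) v / (v - 0) ^ 4)"
  by (rule cauchy_power_integrable(1)[OF reflected_differential_linf_ext[OF g]]) simp
 then have "integrable lborel (\<lambda>v. complex_of_real (h v))" unfolding eq .
 then have hi: "integrable lborel h" by (simp only: complex_of_real_integrable_eq)
 have "0 < measure lborel (ball (3::complex) 1) * (3 / 64)^2" using content_ball_pos[of 1 "3::complex"] by simp
 also have "\<dots> = (LINT v|lborel. indicator (ball (3::complex) 1) v * (3 / 64)^2)" by simp
 also have "\<dots> \<le> integral\<^sup>L lborel h"
 proof (rule integral_mono[OF _ hi bnd])
  show "integrable lborel (\<lambda>v::complex. indicator (ball 3 1) v * (3 / 64)^2 :: real)"
   by (intro integrable_mult_left integrable_real_indicator) (use emeasure_lborel_ball_finite in auto)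
 qed
 finally have "integral\<^sup>L lborel h > 0" .
 moreover have "cauchy_power (reflected_differential (\<lambda>_. 1)) 0 = of_real (integral\<^sup>L lborel h)"
  unfolding cauchy_power_def eq by simp
 ultimately show ?thesis by simp
qed

text \<open>The reproducing formula extends from functions holomorphic across the circle to all of
  order two by dilation: the dilates obey the same growth bound, so their coefficients are uniformly
  bounded and the integrals converge.\<close>

lemma cauchy_power_surjective:
 assumes \<phi>: "growth 2 M \<phi>"
 obtains \<mu> where "\<mu> \<in> linf_ext" "\<And>z. z \<in> ball 0 1 \<Longrightarrow> cauchy_power \<mu> z = \<phi> z"
proof
 define N0 where "N0 = cauchy_power (reflected_differential (\<lambda>_. 1)) 0"
 have N0: "N0 \<noteq> 0" using cauchy_power_reflected_1_nonzero by (simp add: N0_def)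
 have cN: "growth 2 (cmod (1 / N0) * M) (\<lambda>z. 1 / N0 * \<phi> z)" by (rule growth_cmult[OF \<phi>])
 show "reflected_differential (\<lambda>z. 1 / N0 * \<phi> z) \<in> linf_ext" by (rule reflected_differential_linf_ext[OF cN])
 fix z :: complex assume z: "z \<in> ball 0 1"
 \<comment> \<open>Radii tending to 1 from below, all positive.\<close>
 define R where "R = (\<lambda>j::nat. 1 - 1 / (real j + 2))"
 have R: "0 < R j" "R j < 1" for j by (auto simp: R_def)
 define \<psi> where "\<psi> j \<zeta> = \<phi> (of_real (R j) * \<zeta>)" for j \<zeta>
 have hol: "\<phi> holomorphic_on ball 0 1" using \<phi> by (simp add: growth_def)
 have le: "cmod (of_real (R j) * \<zeta>) \<le> cmod \<zeta>" for j \<zeta>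
  using R[of j] mult_right_mono[of "R j" 1 "cmod \<zeta>"] by (simp add: norm_mult)
 have \<psi>: "growth 2 M (\<psi> j)" for j unfolding growth_def
 proof (intro conjI ballI)
  have "(\<phi> \<circ> (\<lambda>\<zeta>. of_real (R j) * \<zeta>)) holomorphic_on ball 0 1"
   by (rule holomorphic_on_compose_gen[OF _ hol]) (auto intro!: holomorphic_intros le_less_trans[OF le])
  then show "\<psi> j holomorphic_on ball 0 1" by (simp add: \<psi>_def[abs_def] o_def)
  fix \<zeta> :: complex assume \<zeta>: "\<zeta> \<in> ball 0 1"
  have in1: "of_real (R j) * \<zeta> \<in> ball 0 1" using le[of j \<zeta>] \<zeta> by auto
  have "cmod (\<psi> j \<zeta>) * (1 - cmod \<zeta>)^2 \<le> cmod (\<psi> j \<zeta>) * (1 - cmod (of_real (R j) * \<zeta>))^2"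
   using le[of j \<zeta>] \<zeta> by (intro mult_left_mono power_mono) auto
  also have "\<dots> \<le> M" using \<phi> in1 by (auto simp: growth_def \<psi>_def)
  finally show "cmod (\<psi> j \<zeta>) * (1 - cmod \<zeta>)^2 \<le> M" .
 qed
 have rep: "cauchy_power (reflected_differential (\<psi> j)) z = \<psi> j z * N0" for j
  unfolding N0_def
 proof (rule cauchy_power_reflected_holomorphic[OF _ _ z])
  show "1 < 1 / R j" using R[of j] by simp
  have "of_real (R j) * \<zeta> \<in> ball 0 1" if "\<zeta> \<in> ball 0 (1 / R j)" for \<zeta> :: complex
   using that R[of j] by (simp add: norm_mult pos_less_divide_eq mult.commute)
  then have "(\<phi> \<circ> (\<lambda>\<zeta>. of_real (R j) * \<zeta>)) holomorphic_on ball 0 (1 / R j)"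
   by (intro holomorphic_on_compose_gen[OF _ hol] holomorphic_intros) auto
  then show "\<psi> j holomorphic_on ball 0 (1 / R j)" by (simp add: \<psi>_def[abs_def] o_def)
 qed
 have lim: "(\<lambda>j. complex_of_real (R j)) \<longlonglongrightarrow> of_real 1"
  unfolding tendsto_of_real_iff R_def by real_asymp
 have pt: "(\<lambda>j. \<psi> j \<zeta>) \<longlonglongrightarrow> \<phi> \<zeta>" if "\<zeta> \<in> ball 0 1" for \<zeta>
 proof -
  have c: "isCont \<phi> \<zeta>" using holomorphic_on_imp_continuous_on[OF hol] that by (simp add: continuous_on_eq_continuous_at)
  have "(\<lambda>j. of_real (R j) * \<zeta>) \<longlonglongrightarrow> \<zeta>" using tendsto_mult_right[OF lim, of \<zeta>] by simp
  from isCont_tendsto_compose[OF c this] show ?thesis by (simp add: \<psi>_def)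
 qed
 have "(\<lambda>j. cauchy_power (reflected_differential (\<psi> j)) z) \<longlonglongrightarrow> cauchy_power (reflected_differential \<phi>) z"
  unfolding cauchy_power_def
 proof (rule integral_dominated_convergence)
  define c where "c = 1 / (1 - cmod z)"
  show "integrable lborel (\<lambda>v. 4 * M * c ^ 4 * (indicator (- cball 0 1) v * (1 / cmod v ^ 4)))"
   by (intro integrable_mult_right integrable_exterior_power4)
  have m: "reflected_differential h \<in> borel_measurable borel" if "growth 2 M h" for h
   by (rule linf_ext_measurable[OF reflected_differential_linf_ext[OF that]])
  note [measurable] = m[OF \<psi>] m[OF \<phi>]
  show "(\<lambda>v. reflected_differential (\<psi> j) v / (v - z) ^ 4) \<in> borel_measurable lborel" for j by measurable
  show "(\<lambda>v. reflected_differential \<phi> v / (v - z) ^ 4) \<in> borel_measurable lborel" by measurable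
  show "AE v in lborel. (\<lambda>j. reflected_differential (\<psi> j) v / (v - z) ^ 4) \<longlonglongrightarrow> reflected_differential \<phi> v / (v - z) ^ 4"
  proof (intro always_eventually allI)
   fix v
   show "(\<lambda>j. reflected_differential (\<psi> j) v / (v - z) ^ 4) \<longlonglongrightarrow> reflected_differential \<phi> v / (v - z) ^ 4"
   proof (cases "1 < cmod v")
    case True
    then have "circle_reflection v \<in> ball 0 1" using True by (simp add: norm_circle_reflection inverse_norm_le_1)
    from tendsto_mult_right[OF pt[OF this], of "(circle_reflection v)\<^sup>2 * (v - circle_reflection v)^2 / (v - z) ^ 4"]
    show ?thesis using True by (simp add: reflected_differential_def mult.assoc)
   qed (simp add: reflected_differential_def)
  qed
  show "AE v in lborel. cmod (reflected_differential (\<psi> j) v / (v - z) ^ 4) \<le> 4 * M * c ^ 4 * (indicator (- cball 0 1) v * (1 / cmod v ^ 4))" for j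
  proof (intro always_eventually allI)
   fix v
   show "cmod (reflected_differential (\<psi> j) v / (v - z) ^ 4) \<le> 4 * M * c ^ 4 * (indicator (- cball 0 1) v * (1 / cmod v ^ 4))"
   proof (cases "1 < cmod v")
    case True
    have "cmod (reflected_differential (\<psi> j) v) * cmod (inverse (v - z)) ^ 4 \<le> 4 * M * (c / cmod v) ^ 4"
     using reflected_differential_bound[OF \<psi>[of j], of v] exterior_kernel_bounds(1)[OF z True c_def] growth_nonneg[OF \<phi>]
     by (intro mult_mono power_mono) auto
    then show ?thesis using True
     by (simp add: norm_mult norm_power norm_inverse divide_inverse power_inverse power_mult_distrib mult.assoc)
   qed (simp add: reflected_differential_def)
  qed
 qed
 then have "(\<lambda>j. \<psi> j z * N0) \<longlonglongrightarrow> cauchy_power (reflected_differential \<phi>) z" unfolding rep .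
 moreover have "(\<lambda>j. \<psi> j z * N0) \<longlonglongrightarrow> \<phi> z * N0" by (intro tendsto_mult_right pt z)
 ultimately have "cauchy_power (reflected_differential \<phi>) z = \<phi> z * N0" by (rule LIMSEQ_unique)
 moreover have "reflected_differential (\<lambda>z. 1 / N0 * \<phi> z) = (\<lambda>v. 1 / N0 * reflected_differential \<phi> v)"
  by (auto simp: reflected_differential_def fun_eq_iff)
 ultimately show "cauchy_power (reflected_differential (\<lambda>z. 1 / N0 * \<phi> z)) z = \<phi> z"
  using N0 cauchy_power_cmult[of "1 / N0" "reflected_differential \<phi>" z] by simp
qed

section \<open>The differential of the Bers maps\<close>

text \<open>As \<open>slope_mass\<close> is \<pi>, this is the classical variational formula with
  the constant -6/\<pi>.\<close>

definition linear_schwarzian :: "(complex \<Rightarrow> complex) \<Rightarrow> complex \<Rightarrow> complex" where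
 "linear_schwarzian \<mu> z = - 6 / of_real slope_mass * cauchy_power \<mu> z"

text \<open>30 = 24 + 6, the error constant of \<open>schwarzian_estimate\<close> plus the bound of
  the linear term; one constant then controls both the Schwarzian and its linearization
  error.\<close>

definition schwarzian_constant :: real where
 "schwarzian_constant = 30 * kernel_mass / slope_mass"

lemma schwarzian_constant_nonneg: "0 \<le> schwarzian_constant"
 using kernel_mass_nonneg slope_mass_pos by (simp add: schwarzian_constant_def)

lemma growth_linear_schwarzian:
 assumes "\<mu> \<in> linf_ext"
 shows "growth 2 (6 * kernel_mass / slope_mass * linf_norm \<mu>) (linear_schwarzian \<mu>)"
proof -
 have "cmod (- 6 / of_real slope_mass) = 6 / slope_mass"
  using slope_mass_pos by (simp add: norm_divide)
 then show ?thesis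
  using growth_cmult[OF growth_cauchy_power[OF assms], of "- 6 / of_real slope_mass"]
  unfolding linear_schwarzian_def[abs_def] by (simp add: mult_ac)
qed

lemma growth_norm_bound:
 "growth q B h \<Longrightarrow> z \<in> ball 0 1 \<Longrightarrow> cmod (h z) \<le> B / (1 - cmod z) ^ q"
 by (auto simp: growth_def pos_le_divide_eq)

context normalized_qc
begin

lemma schwarzian_linearization:
 assumes k4: "k \<le> 1/4" and a: "a \<in> ball 0 1" and c: "w (Some a) \<noteq> None"
 shows "cmod (schwarzian f a - linear_schwarzian \<mu> a) \<le> schwarzian_constant * k^2 / (1 - cmod a)^2"
  "cmod (schwarzian f a) \<le> schwarzian_constant * k / (1 - cmod a)^2"
proof -
 define K where "K = kernel_mass / slope_mass"
 define d where "d = (1 - cmod a)^2"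
 have K: "K \<ge> 0" using kernel_mass_nonneg slope_mass_pos by (simp add: K_def)
 have d: "d > 0" using a by (simp add: d_def)
 have k0: "k \<ge> 0" by (rule linf_norm_AE[OF mu])
 have C: "schwarzian_constant = 30 * K" by (simp add: schwarzian_constant_def K_def)
 have 1: "cmod (schwarzian f a - linear_schwarzian \<mu> a) \<le> 24 * K * k^2 / d"
  using schwarzian_estimate[OF assms] cauchy_power_eq_exterior_kernel[OF mu, of a]
  by (simp add: linear_schwarzian_def K_def d_def)
 also have "24 * K * k^2 / d \<le> 30 * K * k^2 / d" using K d by (intro divide_right_mono mult_right_mono) auto
 finally show "cmod (schwarzian f a - linear_schwarzian \<mu> a) \<le> schwarzian_constant * k^2 / (1 - cmod a)^2"
  by (simp add: C d_def)
 have "cmod (linear_schwarzian \<mu> a) \<le> 6 * K * k / d"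
  using growth_norm_bound[OF growth_linear_schwarzian[OF mu] a] by (simp add: K_def d_def)
 moreover have "24 * K * k^2 / d \<le> 24 * K * k / d"
  using K k0 k4 d mult_left_le[of k k] by (intro divide_right_mono mult_left_mono) (auto simp: power2_eq_square)
 moreover have "24 * K * k / d + 6 * K * k / d = 30 * K * k / d" by (simp flip: add_divide_distrib)
 moreover have "cmod (schwarzian f a) \<le> cmod (schwarzian f a - linear_schwarzian \<mu> a) + cmod (linear_schwarzian \<mu> a)"
  using norm_triangle_ineq[of "schwarzian f a - linear_schwarzian \<mu> a" "linear_schwarzian \<mu> a"] by simp
 ultimately show "cmod (schwarzian f a) \<le> schwarzian_constant * k / (1 - cmod a)^2"
  using 1 unfolding C d_def by linarith
qed

text \<open>Stated for a radius \<rho> \<le> 1 because finiteness on the whole disc is yet to be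
  shown. With A = \<open>schwarzian_constant * k\<close> \<le> 1/8 the threshold 1/4 of the Riccati
  bound is met, and 2A is below the 1/2 that bounds f by 2.\<close>

lemma pre_schwarzian_bound:
 assumes k4: "k \<le> 1/4" "schwarzian_constant * k \<le> 1/8"
  and \<rho>: "0 < \<rho>" "\<rho> \<le> 1" and fin: "\<And>z. z \<in> ball 0 \<rho> \<Longrightarrow> w (Some z) \<noteq> None" and z: "z \<in> ball 0 \<rho>"
 shows "f holomorphic_on ball 0 \<rho>" "deriv f z \<noteq> 0"
  "cmod (deriv (deriv f) z / deriv f z) * (1 - cmod z) \<le> 2 * (schwarzian_constant * k)" "cmod (f z) \<le> 2"
proof -
 let ?p = "\<lambda>z. deriv (deriv f) z / deriv f z"
 have in1: "u \<in> ball 0 1" if "u \<in> ball 0 \<rho>" for u :: complex using that \<rho> by auto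
 show hol: "f holomorphic_on ball 0 \<rho>"
  by (rule holomorphic_on_subset[OF holomorphic_finite]) (use fin in1 in auto)
 have inj: "inj_on f (ball 0 \<rho>)" by (rule inj_on_subset[OF inj_f]) (use fin in auto)
 have nz: "deriv f u \<noteq> 0" if "u \<in> ball 0 \<rho>" for u
  by (rule holomorphic_injective_imp_regular[OF hol open_ball inj that])
 show "deriv f z \<noteq> 0" by (rule nz[OF z])
 have hp: "?p holomorphic_on ball 0 \<rho>"
  using nz by (intro holomorphic_intros holomorphic_deriv hol open_ball) auto
 have p0: "?p 0 = 0" using normalization by simp
 have k0: "k \<ge> 0" by (rule linf_norm_AE[OF mu])
 have eq: "cmod (deriv ?p u - (?p u)\<^sup>2 / 2) \<le> schwarzian_constant * k / (1 - cmod u)^2" if u: "u \<in> ball 0 \<rho>" for u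
  using schwarzian_linearization(2)[OF k4(1) in1[OF u] fin[OF u]] by (simp add: schwarzian_def)
 have "0 \<le> schwarzian_constant * k" using schwarzian_constant_nonneg k0 by simp
 note rb = riccati_bound[OF hp \<rho>(2) p0 eq this]
 show b: "cmod (?p z) * (1 - cmod z) \<le> 2 * (schwarzian_constant * k)"
  by (rule rb[OF _ _ z]) (use k4 in auto)
 show "cmod (f z) \<le> 2"
 proof (rule normalized_bounded[OF hol \<rho>(2,1) f_0 normalization(1) nz _ z])
  fix u :: complex assume u: "u \<in> ball 0 \<rho>"
  show "cmod (deriv (deriv f) u / deriv f u) * (1 - cmod u) \<le> 1 / 2"
   by (rule order_trans[OF rb[OF _ _ u]]) (use k4 in auto)
 qed
qed

text \<open>A pole P would be the only one, so \<open>f\<close> is finite on the open disc of radius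
  |P| and bounded there by 2. Hence |1/w| \<ge> 1/2 on the radius towards P, against 1/w = 0 at
  P.\<close>

lemma finite_on_closed_disc:
 assumes k4: "k \<le> 1/4" "schwarzian_constant * k \<le> 1/8" and P: "P \<in> cball 0 1"
 shows "w (Some P) \<noteq> None"
proof
 assume N: "w (Some P) = None"
 have P0: "P \<noteq> 0" using N w_0 by auto
 have ne: "w (Some z) \<noteq> None" if "z \<noteq> P" for z using that N inj_w[of "Some z" "Some P"] by auto
 \<comment> \<open>The points R j P approach P from inside the disc of radius |P|.\<close>
 define R where "R = (\<lambda>j::nat. 1 - 1 / (real j + 2))"
 have R: "0 < R j" "R j < 1" for j by (auto simp: R_def)
 have "R \<longlonglongrightarrow> 1" unfolding R_def by real_asymp
 from tendsto_mult_right[OF tendsto_of_real[OF this], of P] have lim: "(\<lambda>j. of_real (R j) * P) \<longlonglongrightarrow> P" by simp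
 have c: "isCont f_inv P" using continuous_inverse open_nonzero N by (simp add: continuous_on_eq_continuous_at)
 from isCont_tendsto_compose[OF c lim] have "(\<lambda>j. f_inv (of_real (R j) * P)) \<longlonglongrightarrow> f_inv P" by simp
 then have l: "(\<lambda>j. cmod (f_inv (of_real (R j) * P))) \<longlonglongrightarrow> cmod (f_inv P)" by (rule tendsto_norm)
 have "1 / 2 \<le> cmod (f_inv (of_real (R j) * P))" for j
 proof -
  define u where "u = of_real (R j) * P"
  have u: "u \<in> ball 0 (cmod P)" "u \<noteq> 0" "u \<noteq> P" using R[of j] P0 by (auto simp: u_def norm_mult)
  have fin: "w (Some z) \<noteq> None" if "z \<in> ball 0 (cmod P)" for z by (rule ne) (use that in auto)
  have "cmod (f u) \<le> 2"
   by (rule pre_schwarzian_bound(4)[OF k4 _ _ fin u(1)]) (use P0 P in auto)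
  moreover have w0: "w (Some u) \<noteq> Some 0" using inj_w[of "Some u" "Some 0"] w_0 u by auto
  moreover have "f u \<noteq> 0" using w_eq[OF ne[OF u(3)]] w0 by auto
  ultimately have "inverse 2 \<le> inverse (cmod (f u))" by (intro le_imp_inverse_le) auto
  then show ?thesis using ne[OF u(3)] by (simp add: f_inv_eq[OF w0] norm_inverse flip: u_def)
 qed
 then have "1 / 2 \<le> cmod (f_inv P)" by (intro LIMSEQ_le_const[OF l]) auto
 then show False using f_inv_eq[of P] N by simp
qed

lemma small_coefficient:
 assumes k4: "k \<le> 1/4" "schwarzian_constant * k \<le> 1/8"
 shows "f holomorphic_on ball 0 1" "z \<in> ball 0 1 \<Longrightarrow> deriv f z \<noteq> 0"
  "growth 1 (2 * schwarzian_constant * k) (\<lambda>z. deriv (deriv f) z / deriv f z)"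
  "growth 2 (2 * schwarzian_constant * k^2) (\<lambda>z. schwarzian f z - linear_schwarzian \<mu> z)"
proof -
 have fin: "w (Some z) \<noteq> None" if "z \<in> ball 0 1" for z
  using finite_on_closed_disc[OF k4] that by auto
 note b = pre_schwarzian_bound[OF k4 zero_less_one order_refl fin]
 show hol: "f holomorphic_on ball 0 1" by (rule b(1)[of 0]) auto
 show nz: "deriv f z \<noteq> 0" if "z \<in> ball 0 1" for z by (rule b(2)[OF _ that])
 have hp: "(\<lambda>z. deriv (deriv f) z / deriv f z) holomorphic_on ball 0 1"
  using nz by (intro holomorphic_intros holomorphic_deriv hol open_ball) auto
 show "growth 1 (2 * schwarzian_constant * k) (\<lambda>z. deriv (deriv f) z / deriv f z)"
  unfolding growth_def using hp b(3) by (auto simp: mult.assoc)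
 have "(\<lambda>z. deriv (\<lambda>z. deriv (deriv f) z / deriv f z) z - 1 / 2 * (deriv (deriv f) z / deriv f z)^2) holomorphic_on ball 0 1"
  by (intro holomorphic_intros holomorphic_deriv[OF hp] open_ball hp)
 then have hs: "schwarzian f holomorphic_on ball 0 1" by (simp add: schwarzian_def[abs_def])
 show "growth 2 (2 * schwarzian_constant * k^2) (\<lambda>z. schwarzian f z - linear_schwarzian \<mu> z)"
  unfolding growth_def
 proof (intro conjI ballI)
  show "(\<lambda>z. schwarzian f z - linear_schwarzian \<mu> z) holomorphic_on ball 0 1"
   using growth_linear_schwarzian[OF mu] by (intro holomorphic_intros hs) (simp add: growth_def)
  fix z :: complex assume z: "z \<in> ball 0 1"
  then have "(1 - cmod z)\<^sup>2 > 0" by simp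
  then have "cmod (schwarzian f z - linear_schwarzian \<mu> z) * (1 - cmod z)^2 \<le> schwarzian_constant * k^2"
   using schwarzian_linearization(1)[OF k4(1) z fin[OF z]] by (simp add: pos_le_divide_eq)
  also have "\<dots> \<le> 2 * schwarzian_constant * k^2" using schwarzian_constant_nonneg by (intro mult_right_mono) auto
  finally show "cmod (schwarzian f z - linear_schwarzian \<mu> z) * (1 - cmod z)^2 \<le> 2 * schwarzian_constant * k^2" .
 qed
qed

end

text \<open>The quotient of the two maps minus \<open>1\<close> vanishes on the circle, hence on the disc; it is holomorphic there even where
 the denominator \<open>v\<close> has a pole.\<close>

lemma normalized_qc_boundary_determines:
 assumes "normalized_qc \<mu> w" "normalized_qc \<nu> v"
  and fin: "\<And>z. z \<in> cball 0 1 \<Longrightarrow> w (Some z) \<noteq> None"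
  and bd: "\<And>z. z \<in> sphere 0 1 \<Longrightarrow> w (Some z) = v (Some z)"
  and z: "z \<in> ball 0 1"
 shows "finite_part v z = finite_part w z"
proof -
 interpret W: normalized_qc \<mu> w by fact
 interpret V: normalized_qc \<nu> v by fact
 define h where "h z = (if z = 0 then 0 else V.f_inv z * W.f z - 1)" for z
 have v0: "v (Some z) \<noteq> Some 0" if "z \<noteq> 0" for z using that V.inj_w[of "Some z" "Some 0"] V.w_0 by auto
 have openV: "open (- {0::complex})" by auto
 have nzV: "{z. v (Some z) \<noteq> Some 0} = - {0}" using v0 V.w_0 by auto
 have cW: "continuous_on (cball 0 1) W.f" by (rule continuous_on_subset[OF W.continuous_finite]) (use fin in auto)
 have hW: "W.f holomorphic_on ball 0 1" by (rule holomorphic_on_subset[OF W.holomorphic_finite]) (use fin in auto)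
 have dW: "(W.f has_field_derivative 1) (at 0)"
  using holomorphic_derivI[OF hW open_ball, of 0] W.normalization by simp
 have v0': "0 \<in> ball 0 1 \<inter> {z. v (Some z) \<noteq> None}" using V.w_0 by simp
 have oV: "open (ball 0 1 \<inter> {z. v (Some z) \<noteq> None})" using V.open_finite by auto
 have dV: "(V.f has_field_derivative 1) (at 0)"
  using holomorphic_derivI[OF V.holomorphic_finite oV v0'] V.normalization by simp
 \<comment> \<open>Both maps have derivative 1 at their common zero 0, so their quotient tends to 1
   there and the singularity of h is removable.\<close>
 have tend: "(h \<longlongrightarrow> 0) (at 0)"
 proof -
  have l: "((\<lambda>z. W.f z / z) \<longlongrightarrow> 1) (at 0)" "((\<lambda>z. V.f z / z) \<longlongrightarrow> 1) (at 0)"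
   using dW dV W.f_0 V.f_0 by (auto simp: has_field_derivative_iff)
  have "((\<lambda>z. (W.f z / z) / (V.f z / z) - 1) \<longlongrightarrow> 1 / 1 - 1) (at 0)"
   by (intro tendsto_intros l) simp
  then have "((\<lambda>z. (W.f z / z) / (V.f z / z) - 1) \<longlongrightarrow> 0) (at 0)" by simp
  moreover have "\<forall>\<^sub>F z in at 0. (W.f z / z) / (V.f z / z) - 1 = h z"
  proof -
   have "\<forall>\<^sub>F z in at 0. z \<in> ball 0 1 \<inter> {z. v (Some z) \<noteq> None} - {0}"
    using eventually_at_in_open[OF oV v0'] .
   then show ?thesis
   proof eventually_elim
    case (elim z)
    then have "z \<noteq> 0" and vN: "v (Some z) \<noteq> None" by auto
    moreover from this have "V.f z \<noteq> 0" using V.w_eq[OF vN] v0[of z] by auto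
    moreover have "V.f_inv z = inverse (V.f z)" using V.f_inv_eq[OF v0] vN \<open>z \<noteq> 0\<close> by metis
    ultimately show ?case by (simp add: h_def field_simps)
   qed
  qed
  ultimately show ?thesis by (rule Lim_transform_eventually)
 qed
 have h0: "h 0 = 0" by (simp add: h_def)
 have cont0: "isCont h 0" using tend by (simp add: isCont_def h0)
 have cont: "continuous_on (cball 0 1) h"
  unfolding continuous_on_eq_continuous_within
 proof
  fix x :: complex assume x: "x \<in> cball 0 1"
  show "continuous (at x within cball 0 1) h"
  proof (cases "x = 0")
   case False
   have "continuous_on (cball 0 1 - {0}) (\<lambda>z. V.f_inv z * W.f z - 1)"
    by (intro continuous_intros continuous_on_subset[OF V.continuous_inverse] continuous_on_subset[OF cW]) (use nzV in auto)
   then have "continuous_on (cball 0 1 - {0}) h"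
    by (rule continuous_on_eq) (simp add: h_def)
   then have "continuous (at x within cball 0 1 - {0}) h"
    using x False by (simp add: continuous_on_eq_continuous_within)
   moreover have "at x within cball 0 1 - {0} = at x within cball 0 1"
    by (rule at_within_nhd[of x "- {0}"]) (use False openV in auto)
   ultimately show ?thesis by simp
  qed (use cont0 in \<open>auto intro: continuous_at_imp_continuous_at_within\<close>)
 qed
 have "(\<lambda>z. V.f_inv z * W.f z - 1) holomorphic_on ball 0 1 - {0}"
  by (intro holomorphic_intros holomorphic_on_subset[OF V.holomorphic_inverse] holomorphic_on_subset[OF hW]) (use nzV in auto)
 then have "h holomorphic_on ball 0 1 - {0}" by (rule holomorphic_transform) (simp add: h_def)
 then have hol: "h holomorphic_on ball 0 1"
  by (intro no_isolated_singularity[of "ball 0 1" h "{0}"] continuous_on_subset[OF cont]) auto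
 have "cmod (h u) \<le> 0" if u: "u \<in> ball 0 1" for u
 proof (rule maximum_modulus_frontier[of h "cball 0 1"])
  fix z :: complex assume "z \<in> frontier (cball 0 1)"
  then have z: "z \<in> sphere 0 1" by simp
  then have z0: "z \<noteq> 0" by auto
  have vN: "v (Some z) \<noteq> None" using bd[OF z] fin[of z] z by auto
  have "W.f z = V.f z" using bd[OF z] by (simp add: finite_part_def)
  moreover have "V.f z \<noteq> 0" using V.w_eq[OF vN] v0[OF z0] by auto
  ultimately show "cmod (h z) \<le> 0" using V.f_inv_eq[OF v0[OF z0]] vN z0 by (simp add: h_def)
 qed (use hol cont u in auto)
 \<comment> \<open>From 1/v times w = 1 it follows that 1/v is nonzero, so \<open>v\<close> has no
   pole at z and the values agree.\<close>
 then have hz: "h z = 0" using z by simp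
 show ?thesis
 proof (cases "z = 0")
  case True
  then show ?thesis using V.f_0 W.f_0 by simp
 next
  case False
  then have e: "V.f_inv z * W.f z = 1" using hz by (simp add: h_def)
  have vN: "v (Some z) \<noteq> None"
  proof
   assume "v (Some z) = None"
   then show False using e V.f_inv_eq[OF v0[OF False]] by simp
  qed
  have "V.f_inv z = inverse (V.f z)" using V.f_inv_eq[OF v0[OF False]] vN by metis
  then show ?thesis using inverse_unique[OF e] by simp
 qed
qed

lemma deriv_cong_open:
 assumes "open S" "z \<in> S" "\<And>u. u \<in> S \<Longrightarrow> f u = g u"
 shows "deriv f z = deriv g z"
 by (rule deriv_cong_ev) (use eventually_nhds_in_open[OF assms(1,2)] assms(3) in \<open>auto elim: eventually_mono\<close>)

lemma higher_deriv_cong_open: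
 assumes S: "open S" and fg: "\<And>u. u \<in> S \<Longrightarrow> f u = g u" and z: "z \<in> S"
 shows "(deriv ^^ j) f z = (deriv ^^ j) g z"
 using z
proof (induction j arbitrary: z)
 case (Suc j)
 then show ?case using deriv_cong_open[OF S Suc.prems, of "(deriv ^^ j) f" "(deriv ^^ j) g"] by simp
qed (use fg in simp)

text \<open>All ingredients are derivatives at points of the open disc. This includes the chosen
  root: the choice in \<open>sqrt_deriv\<close> sees f only through f' on the disc, so equal
  derivatives give literally the same root.\<close>

lemma higher_schwarzian_cong:
 assumes fg: "\<And>z. z \<in> ball 0 1 \<Longrightarrow> f z = g z"
 shows "higher_schwarzian \<kappa> n f = higher_schwarzian \<kappa> n g"
proof -
 note c = deriv_cong_open[OF open_ball]
 have d1: "deriv f z = deriv g z" if "z \<in> ball 0 1" for z by (rule c[OF that fg])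
 have d2: "deriv (deriv f) z = deriv (deriv g) z" if "z \<in> ball 0 1" for z by (rule c[OF that d1])
 have s: "schwarzian f z = schwarzian g z" if "z \<in> ball 0 1" for z
 proof -
  have "deriv (\<lambda>u. deriv (deriv f) u / deriv f u) z = deriv (\<lambda>u. deriv (deriv g) u / deriv g u) z"
   by (rule c[OF that]) (simp add: d1 d2)
  then show ?thesis using that by (simp add: schwarzian_def d1 d2)
 qed
 have A: "sigma_A n f z = sigma_A n g z" if "z \<in> ball 0 1" for z
  using that
 proof (induction n arbitrary: z)
  case (Suc n)
  have "deriv (sigma_A n f) z = deriv (sigma_A n g) z" by (rule c[OF Suc.prems Suc.IH])
  then show ?case using Suc s d1 d2 by simp
 qed (simp add: s)
 have "sqrt_deriv f = sqrt_deriv g" unfolding sqrt_deriv_def using d1 by simp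
 then have B: "sigma_B n f z = sigma_B n g z" for z by (simp add: sigma_B_def)
 show ?thesis using A B by (auto simp: higher_schwarzian_def fun_eq_iff split: schwarzian_kind.splits)
qed

lemma zero_in_Belt: "(\<lambda>z. 0) \<in> Belt" "linf_norm (\<lambda>z. 0) = 0"
proof -
 note z = linf_extI[of "\<lambda>z. 0" 0]
 have l: "(\<lambda>z::complex. 0::complex) \<in> linf_ext" by (rule z) auto
 moreover have "linf_norm (\<lambda>z. 0) \<le> 0" by (rule z) auto
 ultimately show "linf_norm (\<lambda>z. 0) = 0" using linf_norm_AE(2)[OF l] by simp
 with l show "(\<lambda>z. 0) \<in> Belt" by (simp add: Belt_def)
qed

lemma linf_ext_add:
 assumes "\<mu> \<in> linf_ext" "\<nu> \<in> linf_ext"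
 shows "(\<lambda>z. \<mu> z + \<nu> z) \<in> linf_ext"
proof (rule linf_extI)
 note [measurable] = assms[THEN linf_ext_measurable]
 show "(\<lambda>z. \<mu> z + \<nu> z) \<in> borel_measurable borel" by measurable
 show "AE z in lborel. cmod (\<mu> z + \<nu> z) \<le> linf_norm \<mu> + linf_norm \<nu>"
  using linf_norm_AE(1)[OF assms(1)] linf_norm_AE(1)[OF assms(2)]
  by eventually_elim (rule norm_triangle_le, simp)
qed (use assms[THEN linf_ext_zero] in simp)

lemma linf_ext_cmult:
 assumes "\<mu> \<in> linf_ext"
 shows "(\<lambda>z. c * \<mu> z) \<in> linf_ext"
proof (rule linf_extI)
 note [measurable] = linf_ext_measurable[OF assms]
 show "(\<lambda>z. c * \<mu> z) \<in> borel_measurable borel" by measurable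
 show "AE z in lborel. cmod (c * \<mu> z) \<le> cmod c * linf_norm \<mu>"
  using linf_norm_AE(1)[OF assms] by eventually_elim (simp add: norm_mult mult_left_mono)
qed (use linf_ext_zero[OF assms] in simp)

text \<open>The factor 2^q comes from 1 - |z|^2 \<le> 2 (1 - |z|).\<close>

lemma bers_spaceI:
 assumes h: "growth q B h" and out: "\<And>z. z \<notin> ball 0 1 \<Longrightarrow> h z = 0"
 shows "h \<in> bers_space q" "bers_norm q h \<le> 2 ^ q * B"
proof -
 have le: "cmod (h z) * (1 - (cmod z)\<^sup>2) ^ q \<le> 2 ^ q * B" if z: "z \<in> ball 0 1" for z
 proof -
  have "1 - (cmod z)\<^sup>2 = (1 + cmod z) * (1 - cmod z)" by (simp add: power2_eq_square algebra_simps)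
  also have "\<dots> \<le> 2 * (1 - cmod z)" using z by (intro mult_right_mono) auto
  finally have "(1 - (cmod z)\<^sup>2) ^ q \<le> (2 * (1 - cmod z)) ^ q"
   using z by (intro power_mono) (auto simp: power_le_one)
  then have "cmod (h z) * (1 - (cmod z)\<^sup>2) ^ q \<le> cmod (h z) * (2 * (1 - cmod z)) ^ q"
   by (rule mult_left_mono) simp
  also have "\<dots> = 2 ^ q * (cmod (h z) * (1 - cmod z) ^ q)" by (simp only: power_mult_distrib mult_ac)
  also have "\<dots> \<le> 2 ^ q * B" using h z by (intro mult_left_mono) (auto simp: growth_def)
  finally show ?thesis .
 qed
 show "h \<in> bers_space q" unfolding bers_space_def
  using h out le by (auto simp: growth_def intro!: bdd_aboveI2[where M="2 ^ q * B"])
 show "bers_norm q h \<le> 2 ^ q * B" unfolding bers_norm_def by (rule cSUP_least) (use le in auto)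
qed

lemma bers_norm_upper:
 assumes "\<phi> \<in> bers_space q" "z \<in> ball 0 1"
 shows "cmod (\<phi> z) * (1 - (cmod z)\<^sup>2) ^ q \<le> bers_norm q \<phi>"
 unfolding bers_norm_def using assms by (intro cSUP_upper) (auto simp: bers_space_def)

lemma bers_space_growth:
 assumes \<phi>: "\<phi> \<in> bers_space q"
 shows "growth q (bers_norm q \<phi>) \<phi>" "z \<notin> ball 0 1 \<Longrightarrow> \<phi> z = 0"
proof -
 show "growth q (bers_norm q \<phi>) \<phi>" unfolding growth_def
 proof (intro conjI ballI)
  show "\<phi> holomorphic_on ball 0 1" using \<phi> by (simp add: bers_space_def)
  fix z :: complex assume z: "z \<in> ball 0 1"
  have "(1 - cmod z) ^ q \<le> (1 - (cmod z)\<^sup>2) ^ q"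
   using z by (intro power_mono) (auto simp: power2_eq_square mult_left_le)
  then have "cmod (\<phi> z) * (1 - cmod z) ^ q \<le> cmod (\<phi> z) * (1 - (cmod z)\<^sup>2) ^ q" by (rule mult_left_mono) simp
  also have "\<dots> \<le> bers_norm q \<phi>" by (rule bers_norm_upper[OF \<phi> z])
  finally show "cmod (\<phi> z) * (1 - cmod z) ^ q \<le> bers_norm q \<phi>" .
 qed
 show "z \<notin> ball 0 1 \<Longrightarrow> \<phi> z = 0" using \<phi> by (simp add: bers_space_def)
qed

lemma bers_space_diff:
 assumes "\<phi> \<in> bers_space q" "\<psi> \<in> bers_space q"
 shows "\<phi> - \<psi> \<in> bers_space q"
proof (rule bers_spaceI)
 show "growth q (bers_norm q \<phi> + cmod (- 1) * bers_norm q \<psi>) (\<phi> - \<psi>)"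
  by (rule growth_cong[OF growth_add[OF bers_space_growth(1)[OF assms(1)] growth_cmult[OF bers_space_growth(1)[OF assms(2)]]]]) simp
qed (use assms[THEN bers_space_growth(2)] in simp)

text \<open>The candidate for the differential, extended by 0 outside the disc like every element of
  the Bers space.\<close>

definition bers_differential :: "schwarzian_kind \<Rightarrow> nat \<Rightarrow> (complex \<Rightarrow> complex) \<Rightarrow> complex \<Rightarrow> complex" where
 "bers_differential \<kappa> n \<mu> z = (if z \<in> ball 0 1 then linear_coefficient \<kappa> n * (deriv ^^ (n - 3)) (linear_schwarzian \<mu>) z else 0)"

lemma linear_schwarzian_holomorphic: "\<mu> \<in> linf_ext \<Longrightarrow> linear_schwarzian \<mu> holomorphic_on ball 0 1"
 using growth_linear_schwarzian by (auto simp: growth_def)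

lemma bers_differential_bound:
 assumes n: "n \<ge> 3"
 shows "\<exists>C\<ge>0. \<forall>\<mu>\<in>linf_ext. growth (n - 1) (C * linf_norm \<mu>) (bers_differential \<kappa> n \<mu>)"
proof -
 define j where "j = n - 3"
 have nj: "n - 1 = 2 + j" "n - 3 = j" using n by (auto simp: j_def)
 define P where "P = (\<Prod>i=1..j. 2 ^ (2 + i) :: real)"
 define C where "C = cmod (linear_coefficient \<kappa> n) * (P * (6 * kernel_mass / slope_mass))"
 have "C \<ge> 0" unfolding C_def P_def using kernel_mass_nonneg slope_mass_pos
  by (intro mult_nonneg_nonneg prod_nonneg divide_nonneg_pos) auto
 moreover have "growth (n - 1) (C * linf_norm \<mu>) (bers_differential \<kappa> n \<mu>)" if "\<mu> \<in> linf_ext" for \<mu>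
 proof -
  have "growth (2 + j) (C * linf_norm \<mu>) (\<lambda>z. linear_coefficient \<kappa> n * (deriv ^^ j) (linear_schwarzian \<mu>) z)"
   using growth_cmult[OF growth_higher_deriv[OF growth_linear_schwarzian[OF that], of j], of "linear_coefficient \<kappa> n"]
   by (simp add: C_def P_def mult_ac)
  then show ?thesis unfolding nj by (rule growth_cong) (simp add: bers_differential_def nj)
 qed
 ultimately show ?thesis by blast
qed

lemma bers_differential_add:
 assumes "\<mu> \<in> linf_ext" "\<nu> \<in> linf_ext"
 shows "bers_differential \<kappa> n (\<lambda>z. \<mu> z + \<nu> z) = bers_differential \<kappa> n \<mu> + bers_differential \<kappa> n \<nu>"
proof
 fix z
 have "(deriv ^^ (n - 3)) (linear_schwarzian (\<lambda>z. \<mu> z + \<nu> z)) z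
   = (deriv ^^ (n - 3)) (linear_schwarzian \<mu>) z + (deriv ^^ (n - 3)) (linear_schwarzian \<nu>) z" if z: "z \<in> ball 0 1"
 proof -
  have "(deriv ^^ (n - 3)) (linear_schwarzian (\<lambda>z. \<mu> z + \<nu> z)) z = (deriv ^^ (n - 3)) (\<lambda>z. linear_schwarzian \<mu> z + linear_schwarzian \<nu> z) z"
   by (rule higher_deriv_cong_open[OF open_ball _ z]) (simp add: linear_schwarzian_def cauchy_power_add[OF assms] distrib_left)
  also have "\<dots> = (deriv ^^ (n - 3)) (linear_schwarzian \<mu>) z + (deriv ^^ (n - 3)) (linear_schwarzian \<nu>) z"
   by (rule higher_deriv_add[OF assms[THEN linear_schwarzian_holomorphic] open_ball z])
  finally show ?thesis .
 qed
 then show "bers_differential \<kappa> n (\<lambda>z. \<mu> z + \<nu> z) z = (bers_differential \<kappa> n \<mu> + bers_differential \<kappa> n \<nu>) z"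
  by (simp add: bers_differential_def distrib_left)
qed

lemma bers_differential_cmult:
 assumes "\<mu> \<in> linf_ext"
 shows "bers_differential \<kappa> n (\<lambda>z. c * \<mu> z) = scale_fun c (bers_differential \<kappa> n \<mu>)"
proof
 fix z
 have "linear_schwarzian (\<lambda>z. c * \<mu> z) = (\<lambda>z. c * linear_schwarzian \<mu> z)"
  by (simp add: fun_eq_iff linear_schwarzian_def cauchy_power_cmult)
 then have "(deriv ^^ (n - 3)) (linear_schwarzian (\<lambda>z. c * \<mu> z)) z = c * (deriv ^^ (n - 3)) (linear_schwarzian \<mu>) z"
  if "z \<in> ball 0 1" using higher_deriv_cmult[OF linear_schwarzian_holomorphic[OF assms] that open_ball] by simp
 then show "bers_differential \<kappa> n (\<lambda>z. c * \<mu> z) z = scale_fun c (bers_differential \<kappa> n \<mu>) z"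
  by (simp add: bers_differential_def scale_fun_def)
qed

text \<open>Each primitive lowers the order by one. The descent stops at order two, so the orders of
  all the primitives stay positive.\<close>

lemma iterated_antiderivative:
 assumes "growth (2 + j) B h"
 shows "\<exists>\<Phi> C. growth 2 C \<Phi> \<and> (\<forall>z\<in>ball 0 1. (deriv ^^ j) \<Phi> z = h z)"
 using assms
proof (induction j arbitrary: B h)
 case (Suc j)
 have "growth (Suc (2 + j)) B h" using Suc.prems by simp
 then obtain H C where H: "growth (2 + j) C H" "\<And>z. z \<in> ball 0 1 \<Longrightarrow> deriv H z = h z"
  by (rule growth_antiderivative) (simp, rule that)
 from Suc.IH[OF H(1)] obtain \<Phi> C' where \<Phi>: "growth 2 C' \<Phi>" "\<forall>z\<in>ball 0 1. (deriv ^^ j) \<Phi> z = H z" by blast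
 have "(deriv ^^ Suc j) \<Phi> z = h z" if z: "z \<in> ball 0 1" for z
  using deriv_cong_open[OF open_ball z, of "(deriv ^^ j) \<Phi>" H] \<Phi>(2) H(2)[OF z] by simp
 then show ?case using \<Phi>(1) by blast
qed auto

lemma bers_differential_surjective:
 assumes n: "n \<ge> 3"
 shows "bers_differential \<kappa> n ` linf_ext = bers_space (n - 1)"
proof
 obtain C where "\<forall>\<mu>\<in>linf_ext. growth (n - 1) (C * linf_norm \<mu>) (bers_differential \<kappa> n \<mu>)"
  using bers_differential_bound[OF n] by blast
 then show "bers_differential \<kappa> n ` linf_ext \<subseteq> bers_space (n - 1)"
  by (auto intro!: bers_spaceI(1) simp: bers_differential_def)
 show "bers_space (n - 1) \<subseteq> bers_differential \<kappa> n ` linf_ext"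
 proof
  fix \<phi> assume \<phi>: "\<phi> \<in> bers_space (n - 1)"
  define c where "c = linear_coefficient \<kappa> n"
  have "(of_nat (n - 2) :: complex) \<noteq> 0" unfolding of_nat_eq_0_iff using n by simp
  then have c: "c \<noteq> 0" by (cases \<kappa>) (simp_all only: c_def linear_coefficient_def schwarzian_kind.case one_neq_zero not_False_eq_True)
  have n1: "n - 1 = 2 + (n - 3)" using n by simp
  obtain \<Phi> C where \<Phi>: "growth 2 C \<Phi>" "\<forall>z\<in>ball 0 1. (deriv ^^ (n - 3)) \<Phi> z = \<phi> z"
   using iterated_antiderivative[of "n - 3"] bers_space_growth(1)[OF \<phi>] n1 by metis
  \<comment> \<open>Cancels the factor -6 / \<open>slope_mass\<close> of the linearized Schwarzian
    and the coefficient c of the family.\<close>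
  define b where "b = - of_real slope_mass / 6 * (1 / c)"
  obtain \<mu> where \<mu>: "\<mu> \<in> linf_ext" "\<And>z. z \<in> ball 0 1 \<Longrightarrow> cauchy_power \<mu> z = b * \<Phi> z"
   using cauchy_power_surjective[OF growth_cmult[OF \<Phi>(1), of b]] by blast
  have ls: "linear_schwarzian \<mu> z = 1 / c * \<Phi> z" if "z \<in> ball 0 1" for z
   using \<mu>(2)[OF that] slope_mass_pos by (simp add: linear_schwarzian_def b_def)
  have "bers_differential \<kappa> n \<mu> z = \<phi> z" for z
  proof (cases "z \<in> ball 0 1")
   case True
   have "(deriv ^^ (n - 3)) (linear_schwarzian \<mu>) z = (deriv ^^ (n - 3)) (\<lambda>z. 1 / c * \<Phi> z) z"
    by (rule higher_deriv_cong_open[OF open_ball ls True])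
   also have "\<dots> = 1 / c * (deriv ^^ (n - 3)) \<Phi> z"
    using \<Phi>(1) by (intro higher_deriv_cmult[OF _ True open_ball]) (simp add: growth_def)
   also have "(deriv ^^ (n - 3)) \<Phi> z = \<phi> z" using \<Phi>(2) True by blast
   finally have "(deriv ^^ (n - 3)) (linear_schwarzian \<mu>) z = 1 / c * \<phi> z" .
   then show ?thesis using c True by (simp add: bers_differential_def flip: c_def)
  qed (simp add: bers_differential_def bers_space_growth(2)[OF \<phi>])
  then have "\<phi> = bers_differential \<kappa> n \<mu>" by auto
  with \<mu>(1) show "\<phi> \<in> bers_differential \<kappa> n ` linf_ext" by blast
 qed
qed

text \<open>\<open>bers_map\<close> is a \<open>the_elem\<close> over a whole class and has the
  intended value only if the higher Schwarzian is constant on it. Only the representative \<mu> is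
  small; other members agree with it on the circle and therefore, by the boundary argument, in the
  disc.\<close>

lemma lifted_bers_map_eq:
 assumes w: "\<And>\<mu>. \<mu> \<in> Belt \<Longrightarrow> normalized_qc_solution \<mu> (w \<mu>)" and \<mu>: "\<mu> \<in> Belt"
  and k: "linf_norm \<mu> \<le> 1/4" "schwarzian_constant * linf_norm \<mu> \<le> 1/8"
 shows "lifted_bers_map w \<kappa> n \<mu> = higher_schwarzian \<kappa> n (finite_part (w \<mu>))"
proof -
 have qc: "normalized_qc \<nu> (w \<nu>)" if "\<nu> \<in> Belt" for \<nu>
  using that w by unfold_locales (auto simp: Belt_def)
 interpret normalized_qc \<mu> "w \<mu>" by (rule qc[OF \<mu>])
 have "higher_schwarzian \<kappa> n (finite_part (w \<nu>)) = higher_schwarzian \<kappa> n (finite_part (w \<mu>))"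
  if \<nu>: "\<nu> \<in> teich_proj w \<mu>" for \<nu>
 proof (rule higher_schwarzian_cong)
  have \<nu>': "\<nu> \<in> Belt" "\<And>z. z \<in> sphere 0 1 \<Longrightarrow> w \<mu> (Some z) = w \<nu> (Some z)"
   using \<nu> by (auto simp: teich_proj_def teich_rel_def)
  fix z :: complex assume z: "z \<in> ball 0 1"
  show "finite_part (w \<nu>) z = finite_part (w \<mu>) z"
   by (rule normalized_qc_boundary_determines[OF qc[OF \<mu>] qc[OF \<nu>'(1)] finite_on_closed_disc[OF k] \<nu>'(2) z])
 qed
 note eq = this
 have "\<mu> \<in> teich_proj w \<mu>" using \<mu> by (simp add: teich_proj_def teich_rel_def)
 note mem = this
 have "(\<lambda>\<nu>. higher_schwarzian \<kappa> n (finite_part (w \<nu>))) ` teich_proj w \<mu> =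
   (\<lambda>_. higher_schwarzian \<kappa> n (finite_part (w \<mu>))) ` teich_proj w \<mu>"
  by (rule image_cong[OF refl eq])
 also have "\<dots> = {higher_schwarzian \<kappa> n (finite_part (w \<mu>))}" by (rule image_constant[OF mem])
 finally have "(\<lambda>\<nu>. higher_schwarzian \<kappa> n (finite_part (w \<nu>))) ` teich_proj w \<mu> = {higher_schwarzian \<kappa> n (finite_part (w \<mu>))}" .
 then show ?thesis by (simp add: lifted_bers_map_def bers_map_def)
qed

text \<open>The remainder is O(k^2) uniformly in \<mu>, so it is o(k).\<close>

lemma lifted_bers_map_differential:
 assumes w: "\<And>\<mu>. \<mu> \<in> Belt \<Longrightarrow> normalized_qc_solution \<mu> (w \<mu>)" and n: "n \<ge> 3"
 shows "has_differential_at_0 scale_fun (bers_space (n - 1)) (bers_norm (n - 1))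
  (lifted_bers_map w \<kappa> n) (bers_differential \<kappa> n)"
proof -
 define q where "q = n - 1"
 define F where "F = lifted_bers_map w \<kappa> n"
 define L where "L = bers_differential \<kappa> n"
 define c where "c = 2 * schwarzian_constant"
 have c: "c \<ge> 0" using schwarzian_constant_nonneg by (simp add: c_def)
 obtain C1 where C1: "C1 \<ge> 0" "\<forall>\<mu>\<in>linf_ext. growth q (C1 * linf_norm \<mu>) (L \<mu>)"
  using bers_differential_bound[OF n] unfolding q_def L_def by blast
 obtain C where C: "C \<ge> 0" and lin: "\<forall>k f \<Lambda>. 0 \<le> k \<longrightarrow> k \<le> 1 \<longrightarrow> f holomorphic_on ball 0 1 \<longrightarrow> (\<forall>z\<in>ball 0 1. deriv f z \<noteq> 0) \<longrightarrow>
   growth 1 (c * k) (\<lambda>z. deriv (deriv f) z / deriv f z) \<longrightarrow> growth 2 (c * k) \<Lambda> \<longrightarrow>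
   growth 2 (c * k^2) (\<lambda>z. schwarzian f z - \<Lambda> z) \<longrightarrow>
   growth q (C * k^2) (\<lambda>z. higher_schwarzian \<kappa> n f z - linear_coefficient \<kappa> n * (deriv ^^ (n - 3)) \<Lambda> z)"
  using higher_schwarzian_linearization[OF c n, of \<kappa>] unfolding q_def by blast
 have Lout: "L \<mu> z = 0" if "z \<notin> ball 0 1" for \<mu> z using that by (simp add: L_def bers_differential_def)
 have Lb: "L \<mu> \<in> bers_space q" "bers_norm q (L \<mu>) \<le> 2 ^ q * (C1 * linf_norm \<mu>)" if "\<mu> \<in> linf_ext" for \<mu>
  using bers_spaceI[OF C1(2)[rule_format, OF that] Lout] by auto
 \<comment> \<open>The range of coefficients in which the map is finite on the closed disc and the
   pre-Schwarzian bound holds.\<close>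
 define small where "small \<mu> \<longleftrightarrow> linf_norm \<mu> \<le> 1/4 \<and> schwarzian_constant * linf_norm \<mu> \<le> 1/8" for \<mu>
 have rem: "growth q (C * (linf_norm \<mu>)^2) (F \<mu> - L \<mu>)" and Fout: "z \<notin> ball 0 1 \<Longrightarrow> F \<mu> z = 0"
  if \<mu>: "\<mu> \<in> Belt" and s: "small \<mu>" for \<mu> z
 proof -
  have k: "linf_norm \<mu> \<le> 1/4" "schwarzian_constant * linf_norm \<mu> \<le> 1/8" using s by (auto simp: small_def)
  interpret normalized_qc \<mu> "w \<mu>" using \<mu> w by unfold_locales (auto simp: Belt_def)
  have FE: "F \<mu> = higher_schwarzian \<kappa> n f" unfolding F_def by (rule lifted_bers_map_eq[OF w \<mu> k])
  then show "F \<mu> z = 0" if "z \<notin> ball 0 1" using that by (simp add: higher_schwarzian_def)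
  have k0: "0 \<le> linf_norm \<mu>" by (rule linf_norm_AE[OF mu])
  have "6 * kernel_mass / slope_mass * linf_norm \<mu> \<le> c * linf_norm \<mu>"
   using kernel_mass_nonneg slope_mass_pos k0
   by (intro mult_right_mono) (auto simp: c_def schwarzian_constant_def divide_right_mono)
  then have gl: "growth 2 (c * linf_norm \<mu>) (linear_schwarzian \<mu>)"
   by (rule growth_mono[OF growth_linear_schwarzian[OF mu]])
  have k1: "linf_norm \<mu> \<le> 1" using k by simp
  note sc = small_coefficient[OF k, folded c_def]
  have "growth q (C * (linf_norm \<mu>)^2) (\<lambda>z. higher_schwarzian \<kappa> n f z - linear_coefficient \<kappa> n * (deriv ^^ (n - 3)) (linear_schwarzian \<mu>) z)"
   using lin[rule_format, OF k0 k1 sc(1) sc(2) sc(3) gl sc(4)] by simp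
  then show "growth q (C * (linf_norm \<mu>)^2) (F \<mu> - L \<mu>)"
   by (rule growth_cong) (simp add: FE L_def bers_differential_def)
 qed
 have L0: "L (\<lambda>z. 0) = 0"
  using bers_differential_cmult[of "\<lambda>z. 0" \<kappa> n 0] zero_in_Belt by (simp add: L_def Belt_def scale_fun_def zero_fun_def)
 have sm0: "small (\<lambda>z. 0)" by (simp add: small_def zero_in_Belt)
 \<comment> \<open>The remainder estimate at \<mu> = 0, where its bound is 0.\<close>
 have F0: "F (\<lambda>z. 0) = 0"
 proof
  fix z
  show "F (\<lambda>z. 0) z = 0 z"
  proof (cases "z \<in> ball 0 1")
   case True
   from rem[OF zero_in_Belt(1) sm0] have "growth q 0 (F (\<lambda>z. 0))" by (simp add: L0 zero_in_Belt)
   then have "cmod (F (\<lambda>z. 0) z) * (1 - cmod z) ^ q \<le> 0" using True unfolding growth_def by blast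
   moreover have "(1 - cmod z) ^ q > 0" using True by simp
   ultimately show ?thesis by (simp add: mult_le_0_iff)
  qed (simp add: Fout[OF zero_in_Belt(1) sm0])
 qed
 have "\<exists>\<delta>>0. \<forall>\<mu>\<in>Belt. linf_norm \<mu> < \<delta> \<longrightarrow> F \<mu> \<in> bers_space q \<and> bers_norm q (F \<mu> - F (\<lambda>z. 0) - L \<mu>) \<le> \<epsilon> * linf_norm \<mu>"
  if \<epsilon>: "\<epsilon> > 0" for \<epsilon>
 proof -
  \<comment> \<open>The summand 1 keeps B positive when C = 0. In \<open>\<delta>\<close> the first
    two entries make \<mu> small, the third turns the quadratic remainder into
    \<open>\<epsilon>\<close> times the norm.\<close>
  define B where "B = 2 ^ q * C + 1"
  define \<delta> where "\<delta> = min (1/4) (min (1 / (8 * (schwarzian_constant + 1))) (\<epsilon> / B))"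
  have B: "B > 0" using C by (simp add: B_def add_nonneg_pos)
  have "\<delta> > 0" using B \<epsilon> schwarzian_constant_nonneg by (simp add: \<delta>_def)
  moreover have "F \<mu> \<in> bers_space q \<and> bers_norm q (F \<mu> - F (\<lambda>z. 0) - L \<mu>) \<le> \<epsilon> * linf_norm \<mu>"
   if \<mu>: "\<mu> \<in> Belt" and less: "linf_norm \<mu> < \<delta>" for \<mu>
  proof -
   have mu: "\<mu> \<in> linf_ext" using \<mu> by (simp add: Belt_def)
   have k0: "0 \<le> linf_norm \<mu>" by (rule linf_norm_AE[OF mu])
   have le: "linf_norm \<mu> \<le> 1/4" "linf_norm \<mu> \<le> 1 / (8 * (schwarzian_constant + 1))" "linf_norm \<mu> \<le> \<epsilon> / B"
    using less by (auto simp: \<delta>_def)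
   have "schwarzian_constant * linf_norm \<mu> \<le> (schwarzian_constant + 1) * (1 / (8 * (schwarzian_constant + 1)))"
    using le(2) k0 schwarzian_constant_nonneg by (intro mult_mono) auto
   also have "\<dots> = 1 / 8" using schwarzian_constant_nonneg by simp
   finally have s: "small \<mu>" using le(1) by (simp add: small_def)
   note bs = bers_spaceI[OF rem[OF \<mu> s]]
   have out: "(F \<mu> - L \<mu>) z = 0" if "z \<notin> ball 0 1" for z using that Fout[OF \<mu> s] Lout by simp
   have "bers_norm q (F \<mu> - L \<mu>) \<le> 2 ^ q * (C * (linf_norm \<mu>)^2)" by (rule bs(2)[OF out])
   also have "\<dots> = 2 ^ q * C * linf_norm \<mu> * linf_norm \<mu>" by (simp add: power2_eq_square)
   also have "\<dots> \<le> B * (\<epsilon> / B) * linf_norm \<mu>"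
    using le(3) k0 C B by (intro mult_right_mono mult_mono) (auto simp: B_def)
   also have "B * (\<epsilon> / B) = \<epsilon>" using B by simp
   finally have b: "bers_norm q (F \<mu> - L \<mu>) \<le> \<epsilon> * linf_norm \<mu>" .
   have "F \<mu> - F (\<lambda>z. 0) - L \<mu> = F \<mu> - L \<mu>" by (simp add: fun_eq_iff F0)
   with b have "bers_norm q (F \<mu> - F (\<lambda>z. 0) - L \<mu>) \<le> \<epsilon> * linf_norm \<mu>" by (simp only:)
   moreover have "F \<mu> \<in> bers_space q"
   proof (rule bers_spaceI(1)[OF _ Fout[OF \<mu> s]])
    show "growth q (C * (linf_norm \<mu>)^2 + C1 * linf_norm \<mu>) (F \<mu>)"
     by (rule growth_cong[OF growth_add[OF rem[OF \<mu> s] C1(2)[rule_format, OF mu]]]) simp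
   qed
   ultimately show ?thesis by blast
  qed
  ultimately show ?thesis by blast
 qed
 moreover have "\<exists>D. \<forall>\<mu>\<in>linf_ext. bers_norm q (L \<mu>) \<le> D * linf_norm \<mu>"
  by (rule exI[of _ "2 ^ q * C1"]) (use Lb(2) in \<open>simp add: mult.assoc\<close>)
 moreover have "\<forall>\<mu>\<in>linf_ext. \<forall>\<nu>\<in>linf_ext. L (\<lambda>z. \<mu> z + \<nu> z) = L \<mu> + L \<nu>"
  by (simp add: L_def bers_differential_add)
 moreover have "\<forall>a. \<forall>\<mu>\<in>linf_ext. L (\<lambda>z. a * \<mu> z) = scale_fun a (L \<mu>)"
  by (simp add: L_def bers_differential_cmult)
 ultimately show ?thesis unfolding has_differential_at_0_def F_def[symmetric] L_def[symmetric] q_def[symmetric]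
  using Lb(1) by blast
qed

text \<open>Evaluation at a point of the disc is a bounded functional on the Bers space. It produces
  the scalar functions on Teichmueller space by which the kernel of the projection is
  tested.\<close>

lemma has_differential_at_0_eval:
 assumes D: "has_differential_at_0 scale_fun (bers_space q) (bers_norm q) F L" and z: "z \<in> ball 0 1"
 shows "has_differential_at_0 (*) UNIV cmod (\<lambda>\<mu>. F \<mu> z) (\<lambda>\<mu>. L \<mu> z)"
proof -
 \<comment> \<open>The weight at z, so that 1/r is the norm bound of the evaluation
   functional.\<close>
 define r where "r = (1 - (cmod z)\<^sup>2) ^ q"
 have "(cmod z)\<^sup>2 < 1" using z by (simp add: power_less_one_iff)
 then have r: "r > 0" by (simp add: r_def)
 have up: "cmod (\<phi> z) \<le> bers_norm q \<phi> / r" if "\<phi> \<in> bers_space q" for \<phi>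
  using bers_norm_upper[OF that z] r by (simp add: pos_le_divide_eq flip: r_def)
 have LY: "\<forall>\<mu>\<in>linf_ext. L \<mu> \<in> bers_space q"
  and Ladd: "\<forall>\<mu>\<in>linf_ext. \<forall>\<nu>\<in>linf_ext. L (\<lambda>z. \<mu> z + \<nu> z) = L \<mu> + L \<nu>"
  and Lmul: "\<forall>c. \<forall>\<mu>\<in>linf_ext. L (\<lambda>z. c * \<mu> z) = scale_fun c (L \<mu>)"
  and Lbd: "\<exists>C. \<forall>\<mu>\<in>linf_ext. bers_norm q (L \<mu>) \<le> C * linf_norm \<mu>"
  and Lrem: "\<forall>\<epsilon>>0. \<exists>\<delta>>0. \<forall>\<mu>\<in>Belt. linf_norm \<mu> < \<delta> \<longrightarrow>
    F \<mu> \<in> bers_space q \<and> bers_norm q (F \<mu> - F (\<lambda>z. 0) - L \<mu>) \<le> \<epsilon> * linf_norm \<mu>"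
  using D unfolding has_differential_at_0_def by blast+
 obtain C where C: "\<forall>\<mu>\<in>linf_ext. bers_norm q (L \<mu>) \<le> C * linf_norm \<mu>" using Lbd by blast
 have bd: "cmod (L \<mu> z) \<le> C / r * linf_norm \<mu>" if "\<mu> \<in> linf_ext" for \<mu>
 proof -
  have "cmod (L \<mu> z) \<le> bers_norm q (L \<mu>) / r" using LY that by (intro up) blast
  also have "\<dots> \<le> C * linf_norm \<mu> / r" using C that r by (intro divide_right_mono) auto
  finally show ?thesis by simp
 qed
 have rem: "\<exists>\<delta>>0. \<forall>\<mu>\<in>Belt. linf_norm \<mu> < \<delta> \<longrightarrow> cmod (F \<mu> z - F (\<lambda>z. 0) z - L \<mu> z) \<le> \<epsilon> * linf_norm \<mu>" if "\<epsilon> > 0" for \<epsilon>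
 proof -
  have "\<epsilon> * r > 0" using that r by simp
  then obtain \<delta> where \<delta>: "\<delta> > 0" "\<forall>\<mu>\<in>Belt. linf_norm \<mu> < \<delta> \<longrightarrow>
    F \<mu> \<in> bers_space q \<and> bers_norm q (F \<mu> - F (\<lambda>z. 0) - L \<mu>) \<le> \<epsilon> * r * linf_norm \<mu>"
   using Lrem by blast
  have F0: "F (\<lambda>z. 0) \<in> bers_space q" using \<delta> zero_in_Belt by simp
  have "cmod (F \<mu> z - F (\<lambda>z. 0) z - L \<mu> z) \<le> \<epsilon> * linf_norm \<mu>" if \<mu>: "\<mu> \<in> Belt" "linf_norm \<mu> < \<delta>" for \<mu>
  proof -
   have "F \<mu> - F (\<lambda>z. 0) - L \<mu> \<in> bers_space q"
    using \<delta>(2) \<mu> F0 LY by (intro bers_space_diff) (auto simp: Belt_def)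
   then have "cmod ((F \<mu> - F (\<lambda>z. 0) - L \<mu>) z) \<le> bers_norm q (F \<mu> - F (\<lambda>z. 0) - L \<mu>) / r" by (rule up)
   also have "\<dots> \<le> \<epsilon> * r * linf_norm \<mu> / r" using \<delta>(2) \<mu> r by (intro divide_right_mono) auto
   finally show ?thesis using r by simp
  qed
  with \<delta>(1) show ?thesis by blast
 qed
 show ?thesis unfolding has_differential_at_0_def
 proof (intro conjI allI ballI impI)
  show "\<exists>C. \<forall>\<mu>\<in>linf_ext. cmod (L \<mu> z) \<le> C * linf_norm \<mu>" using bd by blast
  show "\<exists>\<delta>>0. \<forall>\<mu>\<in>Belt. linf_norm \<mu> < \<delta> \<longrightarrow>
    F \<mu> z \<in> UNIV \<and> cmod (F \<mu> z - F (\<lambda>z. 0) z - L \<mu> z) \<le> \<epsilon> * linf_norm \<mu>" if "\<epsilon> > 0" for \<epsilon>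
   using rem[OF that] by simp
 qed (use Ladd Lmul in \<open>simp_all add: scale_fun_def\<close>)
qed

text \<open>A differential is determined by its values on \<open>linf_ext\<close>; the operator that
  factors through the tangent space is compared with the explicit one only there.\<close>

lemma has_differential_at_0_cong:
 assumes D: "has_differential_at_0 smul Y N F L" and eq: "\<And>\<mu>. \<mu> \<in> linf_ext \<Longrightarrow> L' \<mu> = L \<mu>"
 shows "has_differential_at_0 smul Y N F L'"
proof -
 note P1 = D[unfolded has_differential_at_0_def]
 note P2 = P1[THEN conjunct2] note P3 = P2[THEN conjunct2] note P4 = P3[THEN conjunct2]
 have rem: "\<exists>\<delta>>0. \<forall>\<mu>\<in>Belt. linf_norm \<mu> < \<delta> \<longrightarrow> F \<mu> \<in> Y \<and> N (F \<mu> - F (\<lambda>z. 0) - L' \<mu>) \<le> \<epsilon> * linf_norm \<mu>"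
  if pos: "\<epsilon> > 0" for \<epsilon>
 proof -
  obtain \<delta> where "\<delta> > 0" "\<forall>\<mu>\<in>Belt. linf_norm \<mu> < \<delta> \<longrightarrow> F \<mu> \<in> Y \<and> N (F \<mu> - F (\<lambda>z. 0) - L \<mu>) \<le> \<epsilon> * linf_norm \<mu>"
   using P4[THEN conjunct2, rule_format, OF pos] by blast
  moreover have "L' \<mu> = L \<mu>" if "\<mu> \<in> Belt" for \<mu> using that by (intro eq) (simp add: Belt_def)
  ultimately show ?thesis by (intro exI[of _ \<delta>]) simp
 qed
 show ?thesis unfolding has_differential_at_0_def
 proof (intro conjI ballI allI impI)
  show "\<exists>C. \<forall>\<mu>\<in>linf_ext. N (L' \<mu>) \<le> C * linf_norm \<mu>"
   using P4[THEN conjunct1] by (simp add: eq)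
  show "L' \<mu> \<in> Y" if "\<mu> \<in> linf_ext" for \<mu> using P1[THEN conjunct1] that by (simp add: eq)
  show "L' (\<lambda>z. \<mu> z + \<nu> z) = L' \<mu> + L' \<nu>" if "\<mu> \<in> linf_ext" "\<nu> \<in> linf_ext" for \<mu> \<nu>
   using P2[THEN conjunct1] that by (simp add: eq linf_ext_add)
  show "L' (\<lambda>z. c * \<mu> z) = smul c (L' \<mu>)" if "\<mu> \<in> linf_ext" for c \<mu>
   using P3[THEN conjunct1] that by (simp add: eq linf_ext_cmult)
  show "\<exists>\<delta>>0. \<forall>\<mu>\<in>Belt. linf_norm \<mu> < \<delta> \<longrightarrow> F \<mu> \<in> Y \<and> N (F \<mu> - F (\<lambda>z. 0) - L' \<mu>) \<le> \<epsilon> * linf_norm \<mu>"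
   if pos: "\<epsilon> > 0" for \<epsilon> by (rule rem[OF pos])
 qed
qed

theorem theorem4p14:
  fixes w :: "(complex \<Rightarrow> complex) \<Rightarrow> complex option \<Rightarrow> complex option"
    and n :: nat and \<kappa> :: schwarzian_kind
  assumes w: "\<And>\<mu>. \<mu> \<in> Belt \<Longrightarrow> normalized_qc_solution \<mu> (w \<mu>)"
    and n: "n \<ge> 3"
  shows "(\<exists>D. has_teich_differential w scale_fun (bers_space (n - 1)) (bers_norm (n - 1))
                (bers_map w \<kappa> n) D \<and>
              D ` teich_tangent_space w = bers_space (n - 1)) \<and>
         (\<exists>L. has_differential_at_0 scale_fun (bers_space (n - 1)) (bers_norm (n - 1))
                (lifted_bers_map w \<kappa> n) L \<and>
              L ` linf_ext = bers_space (n - 1))"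
proof -
 let ?L = "bers_differential \<kappa> n"
 note diff = lifted_bers_map_differential[OF w n, of \<kappa>]
 note surj = bers_differential_surjective[OF n, of \<kappa>]
 \<comment> \<open>X -> \<open>bers_map w \<kappa> n X z\<close> is a scalar function differentiable
   at the origin, so by definition of the kernel its derivative vanishes there, for every z in the
   disc.\<close>
 have ker: "?L \<mu> = 0" if "\<mu> \<in> teich_proj_kernel w" for \<mu>
 proof
  fix z
  show "?L \<mu> z = 0 z"
  proof (cases "z \<in> ball 0 1")
   case True
   have "has_differential_at_0 (*) UNIV cmod ((\<lambda>X. bers_map w \<kappa> n X z) \<circ> teich_proj w) (\<lambda>\<mu>. ?L \<mu> z)"
    using has_differential_at_0_eval[OF diff True] by (simp add: lifted_bers_map_def o_def)
   then show ?thesis using that unfolding teich_proj_kernel_def zero_fun_def by blast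
  qed (simp add: bers_differential_def)
 qed
 have zero: "(\<lambda>z. 0) \<in> teich_proj_kernel w"
  unfolding teich_proj_kernel_def
 proof (intro CollectI conjI allI impI)
  show z: "(\<lambda>z. 0) \<in> linf_ext" using zero_in_Belt by (simp add: Belt_def)
  fix G :: "(complex \<Rightarrow> complex) set \<Rightarrow> complex" and l
  assume "has_differential_at_0 (*) UNIV cmod (G \<circ> teich_proj w) l"
  then have "\<forall>c. \<forall>\<mu>\<in>linf_ext. l (\<lambda>z. c * \<mu> z) = c * l \<mu>" unfolding has_differential_at_0_def by blast
  from this[rule_format, OF z, of 0] show "l (\<lambda>z. 0) = 0" by simp
 qed
 \<comment> \<open>On a tangent class the operator is constant by \<open>ker\<close> and additivity,
   so the image is a singleton and \<open>the_elem\<close> is its value.\<close>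
 define D where "D X = the_elem (?L ` X)" for X
 have DL: "D (teich_proj_differential w \<mu>) = ?L \<mu>" if \<mu>: "\<mu> \<in> linf_ext" for \<mu>
 proof -
  have "?L \<nu> = ?L \<mu>" if "(\<mu>, \<nu>) \<in> teich_tangent_rel w" for \<nu>
  proof -
   have d: "(\<lambda>z. \<nu> z - \<mu> z) \<in> teich_proj_kernel w" using that by (simp add: teich_tangent_rel_def)
   then have "(\<lambda>z. \<nu> z - \<mu> z) \<in> linf_ext" by (simp add: teich_proj_kernel_def)
   note add = bers_differential_add[OF \<mu> this, of \<kappa> n]
   have e: "(\<lambda>z. \<mu> z + (\<nu> z - \<mu> z)) = \<nu>" by (rule ext) simp
   show ?thesis using add unfolding e ker[OF d] by simp
  qed
  moreover have "(\<mu>, \<mu>) \<in> teich_tangent_rel w" using \<mu> zero by (simp add: teich_tangent_rel_def)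
  ultimately have mem: "\<mu> \<in> teich_proj_differential w \<mu>" "\<And>\<nu>. \<nu> \<in> teich_proj_differential w \<mu> \<Longrightarrow> ?L \<nu> = ?L \<mu>"
   unfolding teich_proj_differential_def by blast+
  have "?L ` teich_proj_differential w \<mu> = (\<lambda>_. ?L \<mu>) ` teich_proj_differential w \<mu>"
   by (rule image_cong[OF refl mem(2)])
  also have "\<dots> = {?L \<mu>}" by (rule image_constant[OF mem(1)])
  finally have "?L ` teich_proj_differential w \<mu> = {?L \<mu>}" .
  then show ?thesis unfolding D_def by (simp only: the_elem_eq)
 qed
 have "has_differential_at_0 scale_fun (bers_space (n - 1)) (bers_norm (n - 1))
   (lifted_bers_map w \<kappa> n) (D \<circ> teich_proj_differential w)"
 proof (rule has_differential_at_0_cong[OF diff])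
  fix \<mu> assume "\<mu> \<in> linf_ext"
  from DL[OF this] show "(D \<circ> teich_proj_differential w) \<mu> = ?L \<mu>" unfolding comp_apply .
 qed
 then have teich: "has_teich_differential w scale_fun (bers_space (n - 1)) (bers_norm (n - 1)) (bers_map w \<kappa> n) D"
  unfolding has_teich_differential_def lifted_bers_map_def .
 have "teich_tangent_space w = (\<Union>\<mu>\<in>linf_ext. {teich_proj_differential w \<mu>})"
  unfolding teich_tangent_space_def quotient_def teich_proj_differential_def ..
 then have "D ` teich_tangent_space w = (\<lambda>\<mu>. D (teich_proj_differential w \<mu>)) ` linf_ext"
  by (simp only: UNION_singleton_eq_range image_image)
 also have "\<dots> = ?L ` linf_ext" by (rule image_cong[OF refl DL])
 also have "\<dots> = bers_space (n - 1)" by (rule surj)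
 finally have im: "D ` teich_tangent_space w = bers_space (n - 1)" .
 show ?thesis
  by (rule conjI, rule exI[of _ D], rule conjI[OF teich im], rule exI[of _ ?L], rule conjI[OF diff surj])
qed

end
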